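(* Let $\Omega\subset\mathbb{R}^3$ be an open bounded convex domain with $C^2$ boundary of positive Gaussian curvature. Suppose $0 \leq \alpha < 1/2$ and the cross section is $B(|\zeta-\zeta_*|,\theta) = B_0|\zeta-\zeta_*|^\gamma \sin\theta\cos\theta$ with $B_0>0$ and $0\le\gamma\le 1$. Then there is a positive constant $C$ such that for all $h_1, h_2 \in \tilde{\mathcal{W}}_\alpha$ we have $$|\Gamma(h_1, h_2)(x, \zeta)| \leq C \| h_1 \|_{L^\infty_\alpha(\Omega \times \mathbb{R}^3)} \| h_2 \|_{L^\infty_\alpha(\Omega \times \mathbb{R}^3)} e^{-\alpha |\zeta|^2} (1 + |\zeta|)^\gamma,$$ $$|\nabla_x \Gamma(h_1, h_2)(x, \zeta)| \leq C \left(d_x^{-\frac{1}{2}} + w(x, \zeta)^{-1} \right) \| h_1 \|_{\tilde{\mathcal{W}}_\alpha} \| h_2 \|_{\tilde{\mathcal{W}}_\alpha } e^{-\alpha |\zeta|^2} (1 + |\zeta|)^\gamma,$$ $$|\nabla_\zeta \Gamma(h_1, h_2)(x, \zeta)| \leq C \left( d_{x}^{-\frac{1}{2}} + w(x, \zeta)^{-1} \right) \| h_1 \|_{\tilde{\mathcal{W}}_\alpha} \| h_2 \|_{\tilde{\mathcal{W}}_\alpha} e^{-\alpha |\zeta|^2} (1 + |\zeta|)^\gamma$$ for a.e. $(x, \zeta) \in \Omega \times \mathbb{R}^3$.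
   Context: $n(x)$ is the outward unit normal at $x\in\partial\Omega$; $d_x:=\mathrm{dist}(x,\partial\Omega)$. For $(x,\zeta)\in\Omega\times(\mathbb{R}^3\setminus\{0\})$: $\tau_-(x,\zeta):=\inf\{s>0 : x-s\zeta\notin\Omega\}$, $q(x,\zeta):=x-\tau_-(x,\zeta)\zeta$, $N(x,\zeta):=|n(q(x,\zeta))\cdot\zeta|/|\zeta|$, $w(x,\zeta):=\frac{|\zeta|}{1+|\zeta|}N(x,\zeta)$. $$Q(F,G)(\zeta):=\int_{\mathbb{R}^3}\int_0^{2\pi}\int_0^{\pi/2}[F(\zeta')G(\zeta_*')-F(\zeta)G(\zeta_* )]\,B(|\zeta-\zeta_*|,\theta)\,d\theta\,d\phi\,d\zeta_*,$$ where $\zeta':=\zeta+((\zeta_*-\zeta)\cdot\omega)\omega$, $\zeta_*':=\zeta_*-((\zeta_*-\zeta)\cdot\omega)\omega$, $\omega:=\cos\theta\frac{\zeta_*-\zeta}{|\zeta_*-\zeta|}+(\sin\theta\cos\phi)e_2+(\sin\theta\sin\phi)e_3$, and $\{(\zeta_*-\zeta)/|\zeta_*-\zeta|,e_2,e_3\}$ is an orthonormal basis of $\mathbb{R}^3$. With $M(\zeta):=\pi^{-3/2}e^{-|\zeta|^2}$, $\Gamma(h_1,h_2):=M^{-1/2}Q(M^{1/2}h_1,M^{1/2}h_2)$, acting in $\zeta$ with $x$ as a parameter. Norms (suprema over $\Omega\times\mathbb{R}^3$, essential suprema; gradients are weak): $\|f\|_{L^\infty_\alpha(\Omega\times\mathbb{R}^3)}:=\sup|f|e^{\alpha|\zeta|^2}$;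 $\|f\|_{\tilde{\mathcal{W}}_\alpha}:=\|f\|_{L^\infty_\alpha(\Omega\times\mathbb{R}^3)}+\sup|\nabla_xf|\,w\,e^{\alpha|\zeta|^2}+\sup|\nabla_\zeta f|\,w\,e^{\alpha|\zeta|^2}$; $\tilde{\mathcal{W}}_\alpha$ is the space of functions for which this is finite. *)

theory Defs
  imports "HOL-Analysis.Analysis" "HOL-Probability.Essential_Supremum"
begin

section \<open>Functions of class C^k and weak derivatives\<close>

text \<open>
  Class C^k on a whole space: f is differentiable everywhere and all its directional derivatives
  are of class C^(k-1). On finite-dimensional spaces this is the usual notion.
\<close>

primrec Ck :: "nat \<Rightarrow> ('a::real_normed_vector \<Rightarrow> 'b::real_normed_vector) \<Rightarrow> bool" where
  "Ck 0 f \<longleftrightarrow> continuous_on UNIV f"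
| "Ck (Suc k) f \<longleftrightarrow>
     (\<exists>f'. (\<forall>x. (f has_derivative f' x) (at x)) \<and> (\<forall>v. Ck k (\<lambda>x. f' x v)))"

definition test_function :: "'a::euclidean_space set \<Rightarrow> ('a \<Rightarrow> real) \<Rightarrow> bool" where
  "test_function U \<phi> \<longleftrightarrow>
     (\<forall>k. Ck k \<phi>) \<and> compact (closure {p. \<phi> p \<noteq> 0}) \<and> closure {p. \<phi> p \<noteq> 0} \<subseteq> U"

definition locally_integrable_on :: "('a::euclidean_space \<Rightarrow> real) \<Rightarrow> 'a set \<Rightarrow> bool" where
  "locally_integrable_on u U \<longleftrightarrow> (\<forall>K. compact K \<and> K \<subseteq> U \<longrightarrow> u absolutely_integrable_on K)"

text \<open>v is the weak derivative of u on the open set U in the direction e.\<close>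

definition has_weak_derivative_in ::
    "('a::euclidean_space \<Rightarrow> real) \<Rightarrow> ('a \<Rightarrow> real) \<Rightarrow> 'a \<Rightarrow> 'a set \<Rightarrow> bool" where
  "has_weak_derivative_in u v e U \<longleftrightarrow>
     locally_integrable_on u U \<and> locally_integrable_on v U \<and>
     (\<forall>\<phi>. test_function U \<phi> \<longrightarrow>
        (LINT p|lebesgue_on U. u p * frechet_derivative \<phi> (at p) e) =
        - (LINT p|lebesgue_on U. v p * \<phi> p))"

type_synonym phase = "(real^3) \<times> (real^3)"

definition has_weak_grad_x :: "(real^3) set \<Rightarrow> (phase \<Rightarrow> real) \<Rightarrow> (phase \<Rightarrow> real^3) \<Rightarrow> bool" where
  "has_weak_grad_x \<Omega> f g \<longleftrightarrow>
     (\<forall>i. has_weak_derivative_in f (\<lambda>p. g p $ i) (axis i 1, 0) (\<Omega> \<times> UNIV))"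

definition has_weak_grad_\<zeta> :: "(real^3) set \<Rightarrow> (phase \<Rightarrow> real) \<Rightarrow> (phase \<Rightarrow> real^3) \<Rightarrow> bool" where
  "has_weak_grad_\<zeta> \<Omega> f g \<longleftrightarrow>
     (\<forall>i. has_weak_derivative_in f (\<lambda>p. g p $ i) (0, axis i 1) (\<Omega> \<times> UNIV))"

definition weakly_differentiable :: "(real^3) set \<Rightarrow> (phase \<Rightarrow> real) \<Rightarrow> bool" where
  "weakly_differentiable \<Omega> f \<longleftrightarrow> (\<exists>g. has_weak_grad_x \<Omega> f g) \<and> (\<exists>g. has_weak_grad_\<zeta> \<Omega> f g)"

text \<open>
  A weak gradient is unique up to null sets, so the choice below is immaterial. It is meaningful
  for weakly differentiable functions only.
\<close>

definition weak_grad_x :: "(real^3) set \<Rightarrow> (phase \<Rightarrow> real) \<Rightarrow> phase \<Rightarrow> real^3" where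
  "weak_grad_x \<Omega> f = (SOME g. has_weak_grad_x \<Omega> f g)"

definition weak_grad_\<zeta> :: "(real^3) set \<Rightarrow> (phase \<Rightarrow> real) \<Rightarrow> phase \<Rightarrow> real^3" where
  "weak_grad_\<zeta> \<Omega> f = (SOME g. has_weak_grad_\<zeta> \<Omega> f g)"


section \<open>Domains with C^2 boundary; Gaussian curvature; the outward normal\<close>

definition orthonormal3 :: "real^3 \<Rightarrow> real^3 \<Rightarrow> real^3 \<Rightarrow> bool" where
  "orthonormal3 a b c \<longleftrightarrow> norm a = 1 \<and> norm b = 1 \<and> norm c = 1 \<and>
     orthogonal a b \<and> orthogonal a c \<and> orthogonal b c"

text \<open>
  In the orthonormal coordinates given by a, b, c, the set is the strict epigraph of the C^2
  function g inside the ball of radius r around p.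
\<close>

definition C2_boundary_chart ::
    "(real^3) set \<Rightarrow> real^3 \<Rightarrow> real \<Rightarrow> real^3 \<Rightarrow> real^3 \<Rightarrow> real^3 \<Rightarrow> (real \<times> real \<Rightarrow> real) \<Rightarrow> bool" where
  "C2_boundary_chart \<Omega> p r a b c g \<longleftrightarrow> 0 < r \<and> orthonormal3 a b c \<and> Ck 2 g \<and>
     (\<forall>x\<in>ball p r. x \<in> \<Omega> \<longleftrightarrow> g (x \<bullet> a, x \<bullet> b) < x \<bullet> c)"

definition C2_boundary :: "(real^3) set \<Rightarrow> bool" where
  "C2_boundary \<Omega> \<longleftrightarrow> (\<forall>p\<in>frontier \<Omega>. \<exists>r a b c g. C2_boundary_chart \<Omega> p r a b c g)"

definition partial_1 :: "(real \<times> real \<Rightarrow> real^3) \<Rightarrow> real \<times> real \<Rightarrow> real^3" where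
  "partial_1 X = (\<lambda>(u, v). vector_derivative (\<lambda>s. X (s, v)) (at u))"

definition partial_2 :: "(real \<times> real \<Rightarrow> real^3) \<Rightarrow> real \<times> real \<Rightarrow> real^3" where
  "partial_2 X = (\<lambda>(u, v). vector_derivative (\<lambda>s. X (u, s)) (at v))"

text \<open>
  Gaussian curvature of a parametrized surface X at the parameter s: determinant of the second
  fundamental form (L, M, N) over the determinant of the first one (E, F, G).
\<close>

definition gaussian_curvature :: "(real \<times> real \<Rightarrow> real^3) \<Rightarrow> real \<times> real \<Rightarrow> real" where
  "gaussian_curvature X s =
     (let Xu = partial_1 X s; Xv = partial_2 X s;
          \<nu> = cross3 Xu Xv /\<^sub>R norm (cross3 Xu Xv);
          E = Xu \<bullet> Xu; F = Xu \<bullet> Xv; G = Xv \<bullet> Xv;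
          L = partial_1 (partial_1 X) s \<bullet> \<nu>;
          M = partial_2 (partial_1 X) s \<bullet> \<nu>;
          N = partial_2 (partial_2 X) s \<bullet> \<nu>
      in (L * N - M\<^sup>2) / (E * G - F\<^sup>2))"

text \<open>
  The curvature of the boundary at p is computed in the graph parametrization of a chart at p.
  It does not depend on the chart, so quantifying over all of them is the same as picking one.
\<close>

definition positive_boundary_curvature :: "(real^3) set \<Rightarrow> bool" where
  "positive_boundary_curvature \<Omega> \<longleftrightarrow>
     (\<forall>p\<in>frontier \<Omega>. \<forall>r a b c g. C2_boundary_chart \<Omega> p r a b c g \<longrightarrow>
        0 < gaussian_curvature (\<lambda>(u, v). u *\<^sub>R a + v *\<^sub>R b + g (u, v) *\<^sub>R c) (p \<bullet> a, p \<bullet> b))"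

text \<open>
  Tangent vectors of the boundary at p are velocities of curves in the boundary; the unit normal
  is orthogonal to all of them and points out of the set.
\<close>

definition boundary_tangent :: "(real^3) set \<Rightarrow> real^3 \<Rightarrow> real^3 \<Rightarrow> bool" where
  "boundary_tangent \<Omega> p v \<longleftrightarrow>
     (\<exists>c::real \<Rightarrow> real^3. c 0 = p \<and> (\<forall>\<^sub>F t in nhds 0. c t \<in> frontier \<Omega>) \<and>
        (c has_vector_derivative v) (at 0))"

definition outward_normal :: "(real^3) set \<Rightarrow> real^3 \<Rightarrow> real^3" where
  "outward_normal \<Omega> p =
     (THE n. norm n = 1 \<and> (\<forall>v. boundary_tangent \<Omega> p v \<longrightarrow> n \<bullet> v = 0) \<and>
        (\<forall>\<^sub>F t in at_right 0. p + t *\<^sub>R n \<notin> closure \<Omega>))"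


section \<open>Backward exit time and the kinetic weight\<close>

definition tau_minus :: "(real^3) set \<Rightarrow> real^3 \<Rightarrow> real^3 \<Rightarrow> real" where
  "tau_minus \<Omega> x \<zeta> = Inf {s. s > 0 \<and> x - s *\<^sub>R \<zeta> \<notin> \<Omega>}"

definition q_exit :: "(real^3) set \<Rightarrow> real^3 \<Rightarrow> real^3 \<Rightarrow> real^3" where
  "q_exit \<Omega> x \<zeta> = x - tau_minus \<Omega> x \<zeta> *\<^sub>R \<zeta>"

definition N_exit :: "(real^3) set \<Rightarrow> real^3 \<Rightarrow> real^3 \<Rightarrow> real" where
  "N_exit \<Omega> x \<zeta> = \<bar>outward_normal \<Omega> (q_exit \<Omega> x \<zeta>) \<bullet> \<zeta>\<bar> / norm \<zeta>"

definition weight :: "(real^3) set \<Rightarrow> real^3 \<Rightarrow> real^3 \<Rightarrow> real" where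
  "weight \<Omega> x \<zeta> = norm \<zeta> / (1 + norm \<zeta>) * N_exit \<Omega> x \<zeta>"


section \<open>The collision operator\<close>

text \<open>
  The two vectors completing u to an orthonormal basis are an arbitrary choice. Rotating or
  reflecting them only shifts or reflects the angle \<phi>, so the collision integral does not
  depend on it.
\<close>

definition basis_completion :: "real^3 \<Rightarrow> (real^3) \<times> (real^3)" where
  "basis_completion u = (SOME (e2, e3). orthonormal3 u e2 e3)"

definition omega :: "real^3 \<Rightarrow> real^3 \<Rightarrow> real \<Rightarrow> real \<Rightarrow> real^3" where
  "omega \<zeta> \<zeta>s \<theta> \<phi> =
     (let u = (\<zeta>s - \<zeta>) /\<^sub>R norm (\<zeta>s - \<zeta>); (e2, e3) = basis_completion u
      in cos \<theta> *\<^sub>R u + (sin \<theta> * cos \<phi>) *\<^sub>R e2 + (sin \<theta> * sin \<phi>) *\<^sub>R e3)"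

definition post_1 :: "real^3 \<Rightarrow> real^3 \<Rightarrow> real \<Rightarrow> real \<Rightarrow> real^3" where
  "post_1 \<zeta> \<zeta>s \<theta> \<phi> = \<zeta> + ((\<zeta>s - \<zeta>) \<bullet> omega \<zeta> \<zeta>s \<theta> \<phi>) *\<^sub>R omega \<zeta> \<zeta>s \<theta> \<phi>"

definition post_2 :: "real^3 \<Rightarrow> real^3 \<Rightarrow> real \<Rightarrow> real \<Rightarrow> real^3" where
  "post_2 \<zeta> \<zeta>s \<theta> \<phi> = \<zeta>s - ((\<zeta>s - \<zeta>) \<bullet> omega \<zeta> \<zeta>s \<theta> \<phi>) *\<^sub>R omega \<zeta> \<zeta>s \<theta> \<phi>"

definition collision ::
    "(real \<Rightarrow> real \<Rightarrow> real) \<Rightarrow> (real^3 \<Rightarrow> real) \<Rightarrow> (real^3 \<Rightarrow> real) \<Rightarrow> real^3 \<Rightarrow> real" where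
  "collision B F G \<zeta> =
     (LINT \<zeta>s|lebesgue. (LINT \<phi>:{0..2 * pi}|lebesgue. (LINT \<theta>:{0..pi / 2}|lebesgue.
        (F (post_1 \<zeta> \<zeta>s \<theta> \<phi>) * G (post_2 \<zeta> \<zeta>s \<theta> \<phi>) - F \<zeta> * G \<zeta>s) * B (norm (\<zeta> - \<zeta>s)) \<theta>)))"

definition maxwellian :: "real^3 \<Rightarrow> real" where
  "maxwellian \<zeta> = pi powr (-3/2) * exp (- (norm \<zeta>)\<^sup>2)"

definition Gamma_op ::
    "(real \<Rightarrow> real \<Rightarrow> real) \<Rightarrow> (phase \<Rightarrow> real) \<Rightarrow> (phase \<Rightarrow> real) \<Rightarrow> phase \<Rightarrow> real" where
  "Gamma_op B h1 h2 = (\<lambda>(x, \<zeta>).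
     maxwellian \<zeta> powr (-1/2) *
     collision B (\<lambda>\<eta>. maxwellian \<eta> powr (1/2) * h1 (x, \<eta>))
                 (\<lambda>\<eta>. maxwellian \<eta> powr (1/2) * h2 (x, \<eta>)) \<zeta>)"


section \<open>Weighted norms\<close>

definition Linf_norm :: "real \<Rightarrow> (real^3) set \<Rightarrow> (phase \<Rightarrow> real) \<Rightarrow> ennreal" where
  "Linf_norm \<alpha> \<Omega> f =
     esssup (lebesgue_on (\<Omega> \<times> UNIV)) (\<lambda>(x, \<zeta>). ennreal (\<bar>f (x, \<zeta>)\<bar> * exp (\<alpha> * (norm \<zeta>)\<^sup>2)))"

definition Wt_norm :: "real \<Rightarrow> (real^3) set \<Rightarrow> (phase \<Rightarrow> real) \<Rightarrow> ennreal" where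
  "Wt_norm \<alpha> \<Omega> f = Linf_norm \<alpha> \<Omega> f
     + esssup (lebesgue_on (\<Omega> \<times> UNIV))
         (\<lambda>(x, \<zeta>). ennreal (norm (weak_grad_x \<Omega> f (x, \<zeta>)) * weight \<Omega> x \<zeta> * exp (\<alpha> * (norm \<zeta>)\<^sup>2)))
     + esssup (lebesgue_on (\<Omega> \<times> UNIV))
         (\<lambda>(x, \<zeta>). ennreal (norm (weak_grad_\<zeta> \<Omega> f (x, \<zeta>)) * weight \<Omega> x \<zeta> * exp (\<alpha> * (norm \<zeta>)\<^sup>2)))"

definition Wt_space :: "real \<Rightarrow> (real^3) set \<Rightarrow> (phase \<Rightarrow> real) set" where
  "Wt_space \<alpha> \<Omega> = {f. weakly_differentiable \<Omega> f \<and> Wt_norm \<alpha> \<Omega> f < \<infinity>}"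

end

theory Submission
  imports Defs "HOL-Probability.Distributions" "HOL-Computational_Algebra.Polynomial"
begin

text \<open>
  Positive curvature makes the boundary uniformly strictly convex, $n(q) \cdot (q - y) \ge \kappa |q - y|^2$. With
  \<open>q\<close> the exit point this bounds the inverse weight by $C d_x^{-1/2} (1 + 1/|\zeta|)$, so a function of finite norm
  has a gradient of size $d_x^{-1/2} (1 + 1/|\zeta|) e^{-\alpha |\zeta|^2}$.

  After the substitution $\zeta_* = \zeta + V$ the post-collisional velocities are shifts of \<open>\<zeta>\<close> by vectors
  depending on the collision parameters only. The derivative therefore falls on the two functions and on the
  Maxwellian, and conservation of energy, $|\zeta'|^2 + |\zeta_*'|^2 = |\zeta|^2 + |\zeta_*|^2$, gives the factor
  $e^{-\alpha |\zeta|^2}$. What remains is to integrate $1/|\zeta'|$ and $1/|\zeta_*'|$ over the scattering angles and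
  the relative velocity: the angular integral is bounded by a multiple of $1/|V|$ uniformly in \<open>\<zeta>\<close>, and this
  is integrable against $|V|^\gamma$ and a Gaussian. Only the loss term with the derivative on the first function keeps
  the weight at \<open>\<zeta>\<close>.
\<close>

section \<open>Smooth functions and test functions\<close>

text \<open>The gradients exist only weakly and are unbounded, so neither the product rule for the
  integrand nor differentiation under the collision integral is available pointwise. Both become
  integral statements: the product rule is integration by parts on almost every line, and the
  collision parameters are integrated out by Fubini in the weak formulation. The functions are
  replaced by Borel representatives whose bounds hold at every point. For fixed relative velocity
  the scattered velocities fill a sphere, a null set; Fubini in the shifted variables shows that for
  almost every (x, \<zeta>) the replacement changes nothing. The uniform angular bound uses two
  coordinates of a scattered velocity. Along V/|V| and along one orthogonal direction they are, up
  to sign, |V| times c1 + (sin \<theta>)^2 and |V| times c2 + sin \<theta> cos \<theta> cos \<phi>,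
  where \<zeta> enters only through c1 and c2. The pole of order 1 is shared between them with
  exponents 2/3 and 1/3: the second has to stay below 1/2, because passing from \<phi> to cos \<phi>
  adds an inverse square root.\<close>

lemma Ck_Suc_imp_Ck: "Ck (Suc k) f \<Longrightarrow> Ck k f"
proof (induction k arbitrary: f)
  case 0
  then show ?case
    by (auto intro!: continuous_at_imp_continuous_on) (blast intro: has_derivative_continuous)
next
  case (Suc k)
  then obtain f' where "\<forall>x. (f has_derivative f' x) (at x)" "\<forall>v. Ck (Suc k) (\<lambda>x. f' x v)"
    by (auto simp only: Ck.simps(2)[of "Suc k"])
  with Suc.IH show ?case
    unfolding Ck.simps(2)[of k f] by blast
qed

lemma Ck_const: "Ck k (\<lambda>x. c)"
  by (induction k arbitrary: c) (auto intro!: exI[of _ "\<lambda>_ _. 0"])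

lemma Ck_add: "Ck k f \<Longrightarrow> Ck k g \<Longrightarrow> Ck k (\<lambda>x. f x + g x)"
proof (induction k arbitrary: f g)
  case 0
  then show ?case by (simp add: continuous_on_add)
next
  case (Suc k)
  from Suc.prems obtain f' g' where
    d: "\<forall>x. (f has_derivative f' x) (at x)" "\<forall>v. Ck k (\<lambda>x. f' x v)"
    "\<forall>x. (g has_derivative g' x) (at x)" "\<forall>v. Ck k (\<lambda>x. g' x v)" by auto
  have "\<forall>x. ((\<lambda>x. f x + g x) has_derivative (\<lambda>v. f' x v + g' x v)) (at x)"
    using d by (auto intro!: has_derivative_add)
  moreover have "\<forall>v. Ck k (\<lambda>x. f' x v + g' x v)"
    using d Suc.IH by blast
  ultimately show ?case unfolding Ck.simps by (intro exI conjI)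
qed

lemma Ck_mult:
  fixes f g :: "'a::real_normed_vector \<Rightarrow> real"
  shows "Ck k f \<Longrightarrow> Ck k g \<Longrightarrow> Ck k (\<lambda>x. f x * g x)"
proof (induction k arbitrary: f g)
  case 0
  then show ?case by (simp add: continuous_on_mult)
next
  case (Suc k)
  from Suc.prems have fg: "Ck k f" "Ck k g" by (blast intro: Ck_Suc_imp_Ck)+
  from Suc.prems obtain f' g' where
    d: "\<forall>x. (f has_derivative f' x) (at x)" "\<forall>v. Ck k (\<lambda>x. f' x v)"
    "\<forall>x. (g has_derivative g' x) (at x)" "\<forall>v. Ck k (\<lambda>x. g' x v)" by auto
  have "\<forall>x. ((\<lambda>x. f x * g x) has_derivative (\<lambda>v. f x * g' x v + f' x v * g x)) (at x)"
    using d by (auto intro!: has_derivative_mult)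
  moreover have "\<forall>v. Ck k (\<lambda>x. f x * g' x v + f' x v * g x)"
    using d fg Suc.IH by (auto intro!: Ck_add)
  ultimately show ?case unfolding Ck.simps by (intro exI conjI)
qed

lemma Ck_prod:
  fixes f :: "'i \<Rightarrow> 'a::real_normed_vector \<Rightarrow> real"
  assumes "finite I" "\<And>i. i \<in> I \<Longrightarrow> Ck k (f i)"
  shows "Ck k (\<lambda>x. \<Prod>i\<in>I. f i x)"
  using assms by (induction I rule: finite_induct) (auto intro: Ck_const Ck_mult)

lemma Ck_translate: "Ck k f \<Longrightarrow> Ck k (\<lambda>x. f (x + c))"
proof (induction k arbitrary: f)
  case 0
  then have "continuous_on UNIV f" by simp
  then have "continuous_on UNIV (\<lambda>x. f (x + c))"
    by (rule continuous_on_compose2) (auto intro!: continuous_intros)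
  then show ?case by simp
next
  case (Suc k)
  then obtain f' where d: "\<And>x. (f has_derivative f' x) (at x)" "\<And>v. Ck k (\<lambda>x. f' x v)"
    by auto
  have "((\<lambda>x. f (x + c)) has_derivative f' (x + c)) (at x)" for x
  proof -
    have "((\<lambda>x. x + c) has_derivative (\<lambda>h. h)) (at x)" by (auto intro!: derivative_eq_intros)
    from has_derivative_compose[OF this d(1)] show ?thesis .
  qed
  then show ?case unfolding Ck.simps using Suc.IH[OF d(2)]
    by (intro exI[of _ "\<lambda>x. f' (x + c)"]) blast
qed

section \<open>Smooth cutoffs and box bumps\<close>

text \<open>The flat function exp (-1/t), extended by 0, is the case P = 1. The polynomial in 1/t is
  carried along because the whole family is closed under differentiation, so smoothness of every
  order is one induction with P generalized.\<close>

definition smooth_cutoff :: "real poly \<Rightarrow> real \<Rightarrow> real" where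
  "smooth_cutoff P t = (if t > 0 then poly P (1 / t) * exp (- 1 / t) else 0)"

lemma poly_times_exp_tendsto_0: "((\<lambda>x::real. poly P x * exp (- x)) \<longlongrightarrow> 0) at_top"
proof -
  have "((\<lambda>x::real. \<Sum>i\<le>degree P. coeff P i * (x ^ i / exp x)) \<longlongrightarrow> (\<Sum>i\<le>degree P. coeff P i * 0)) at_top"
    by (intro tendsto_intros tendsto_power_div_exp_0)
  moreover have "(\<Sum>i\<le>degree P. coeff P i * (x ^ i / exp x)) = poly P x * exp (- x)" for x :: real
    by (simp add: poly_altdef sum_distrib_right exp_minus divide_inverse mult.assoc)
  ultimately show ?thesis by simp
qed

text \<open>The factor \<open>[:0, 0, 1:]\<close> is X^2 and comes from the inner derivative of 1/t:
  for t > 0 the derivative of P(1/t) exp (-1/t) is (P - P')(1/t) exp (-1/t) / t^2.\<close>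

lemma smooth_cutoff_has_derivative:
  "(smooth_cutoff P has_field_derivative smooth_cutoff ([:0, 0, 1:] * (P - pderiv P)) t) (at t)"
proof -
  consider "t > 0" | "t < 0" | "t = 0" by linarith
  then show ?thesis
  proof cases
    case 1
    have "((\<lambda>t. poly P (1 / t) * exp (- 1 / t)) has_field_derivative
        smooth_cutoff ([:0, 0, 1:] * (P - pderiv P)) t) (at t)"
      using 1 unfolding smooth_cutoff_def
      by (auto intro!: derivative_eq_intros DERIV_chain2[of "poly P"] poly_DERIV
          simp: field_simps power2_eq_square)
    then show ?thesis
      by (rule has_field_derivative_transform_within_open[of _ _ _ "{0<..}"])
        (use 1 in \<open>auto simp: smooth_cutoff_def\<close>)
  next
    case 2
    have "((\<lambda>t. 0) has_field_derivative smooth_cutoff ([:0, 0, 1:] * (P - pderiv P)) t) (at t)"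
      using 2 by (simp add: smooth_cutoff_def)
    then show ?thesis
      by (rule has_field_derivative_transform_within_open[of _ _ _ "{..<0}"])
        (use 2 in \<open>auto simp: smooth_cutoff_def\<close>)
  next
    case 3
    \<comment> \<open>The difference quotient at 0 is P(1/h) exp (-1/h) / h. It belongs to the same
      family with polynomial \<open>pCons 0 P\<close>, so it tends to 0 by the growth of
      exp.\<close>
    have r: "((\<lambda>h. smooth_cutoff P h / h) \<longlongrightarrow> 0) (at_right 0)"
    proof -
      have "((\<lambda>h. poly (pCons 0 P) (inverse h) * exp (- inverse h)) \<longlongrightarrow> 0) (at_right 0)"
        by (rule filterlim_compose[OF poly_times_exp_tendsto_0 filterlim_inverse_at_top_right])
      then show ?thesis
        by (rule Lim_transform_eventually)
          (auto simp: smooth_cutoff_def eventually_at_right_less field_simps eventually_at_topological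
           intro!: exI[of _ UNIV])
    qed
    have l: "((\<lambda>h. smooth_cutoff P h / h) \<longlongrightarrow> 0) (at_left 0)"
      by (rule Lim_transform_eventually[of "\<lambda>_. 0"])
          (auto simp: smooth_cutoff_def eventually_at_topological
           intro!: exI[of _ UNIV])
    from filterlim_split_at_real[OF l r] show ?thesis
      using 3 by (simp add: has_field_derivative_iff smooth_cutoff_def)
  qed
qed

lemma Ck_smooth_cutoff_inner:
  "Ck k (\<lambda>p::'a::real_inner. smooth_cutoff P (c * (p \<bullet> b) + d))"
proof (induction k arbitrary: P)
  case 0
  have "continuous_on UNIV (smooth_cutoff P)"
    by (meson continuous_at_imp_continuous_on DERIV_isCont smooth_cutoff_has_derivative)
  then have "continuous_on UNIV (\<lambda>p::'a. smooth_cutoff P (c * (p \<bullet> b) + d))"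
    by (rule continuous_on_compose2) (auto intro!: continuous_intros)
  then show ?case by simp
next
  case (Suc k)
  let ?Q = "[:0, 0, 1:] * (P - pderiv P)"
  have "((\<lambda>p::'a. smooth_cutoff P (c * (p \<bullet> b) + d)) has_derivative
      (\<lambda>v. smooth_cutoff ?Q (c * (p \<bullet> b) + d) * (c * (v \<bullet> b)))) (at p)" for p
    by (rule has_derivative_compose[OF _ smooth_cutoff_has_derivative[unfolded has_field_derivative_def],
        of "\<lambda>p. c * (p \<bullet> b) + d"])
      (auto intro!: derivative_eq_intros)
  moreover have "Ck k (\<lambda>p::'a. smooth_cutoff ?Q (c * (p \<bullet> b) + d) * (c * (v \<bullet> b)))" for v
    by (intro Ck_mult Suc.IH Ck_const)
  ultimately show ?case unfolding Ck.simps
    by (intro exI[of _ "\<lambda>p v. smooth_cutoff ?Q (c * (p \<bullet> b) + d) * (c * (v \<bullet> b))"]) auto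
qed

text \<open>Each coordinate contributes one flat function for either face of the box. The parameter
  n sharpens them, since exp (-1/(n t)) tends to 1 for every t > 0: the bumps approximate the
  indicator of the open box while their supports stay in the same closed box.\<close>

definition box_bump :: "real \<Rightarrow> 'a::euclidean_space \<Rightarrow> 'a \<Rightarrow> 'a \<Rightarrow> real" where
  "box_bump n a b p = (\<Prod>i\<in>Basis. smooth_cutoff 1 (n * (p \<bullet> i) + (- n * (a \<bullet> i))) *
     smooth_cutoff 1 (- n * (p \<bullet> i) + n * (b \<bullet> i)))"

lemma Ck_box_bump: "Ck k (box_bump n a b)"
  unfolding box_bump_def by (intro Ck_prod Ck_mult Ck_smooth_cutoff_inner) auto

lemma box_bump_eq_0: "n > 0 \<Longrightarrow> p \<notin> box a b \<Longrightarrow> box_bump n a b p = 0"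
proof -
  assume n: "n > 0" and "p \<notin> box a b"
  then obtain i where i: "i \<in> Basis" "p \<bullet> i \<le> a \<bullet> i \<or> b \<bullet> i \<le> p \<bullet> i"
    by (auto simp: box_def not_less)
  then have "n * (p \<bullet> i) \<le> n * (a \<bullet> i) \<or> n * (b \<bullet> i) \<le> n * (p \<bullet> i)"
    using n by (auto simp: mult_left_mono)
  then show ?thesis
    unfolding box_bump_def prod_zero_iff[OF finite_Basis]
    by (intro bexI[OF _ i(1)]) (auto simp: smooth_cutoff_def)
qed

lemma box_bump_bounds: "0 \<le> box_bump n a b p" "box_bump n a b p \<le> 1"
  unfolding box_bump_def
  by (auto intro!: prod_nonneg prod_le_1 mult_nonneg_nonneg mult_le_one simp: smooth_cutoff_def)

lemma test_function_box_bump: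
  assumes "n > 0" "cbox a b \<subseteq> U"
  shows "test_function U (box_bump n a b)"
proof -
  have "{p. box_bump n a b p \<noteq> 0} \<subseteq> cbox a b"
    using box_bump_eq_0[OF assms(1), of _ a b] box_subset_cbox by blast
  then have *: "closure {p. box_bump n a b p \<noteq> 0} \<subseteq> cbox a b"
    by (simp add: closure_minimal closed_cbox)
  then have "compact (closure {p. box_bump n a b p \<noteq> 0})"
    by (meson bounded_closure bounded_subset bounded_cbox closed_closure compact_eq_bounded_closed)
  with * show ?thesis using assms(2) unfolding test_function_def
    by (auto simp: Ck_box_bump)
qed

lemma box_bump_tendsto_indicator:
  "(\<lambda>n. box_bump (real (Suc n)) a b p) \<longlonglongrightarrow> indicator (box a b) p"
proof (cases "p \<in> box a b")
  case False
  then show ?thesis by (simp add: box_bump_eq_0)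
next
  case True
  have 1: "(\<lambda>n. smooth_cutoff 1 (real (Suc n) * t)) \<longlonglongrightarrow> 1" if "t > 0" for t
  proof -
    have "(\<lambda>n. exp (- ((1 / t) * inverse (real (Suc n))))) \<longlonglongrightarrow> exp (- ((1 / t) * 0))"
      by (intro tendsto_intros LIMSEQ_inverse_real_of_nat)
    moreover have "exp (- ((1 / t) * inverse (real (Suc n)))) = smooth_cutoff 1 (real (Suc n) * t)" for n
      using that by (simp add: smooth_cutoff_def divide_inverse)
    ultimately show ?thesis by simp
  qed
  have "(\<lambda>n. box_bump (real (Suc n)) a b p) \<longlonglongrightarrow> (\<Prod>i\<in>(Basis::'a set). 1 * 1)"
    unfolding box_bump_def
  proof (intro tendsto_intros)
    fix i :: 'a assume i: "i \<in> Basis"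
    show "(\<lambda>n. smooth_cutoff 1 (real (Suc n) * (p \<bullet> i) + - real (Suc n) * (a \<bullet> i))) \<longlonglongrightarrow> 1"
      using 1[of "p \<bullet> i - a \<bullet> i"] True i by (simp add: box_def algebra_simps)
    show "(\<lambda>n. smooth_cutoff 1 (- real (Suc n) * (p \<bullet> i) + real (Suc n) * (b \<bullet> i))) \<longlonglongrightarrow> 1"
      using 1[of "b \<bullet> i - p \<bullet> i"] True i by (simp add: box_def algebra_simps)
  qed
  then show ?thesis using True by simp
qed

section \<open>The fundamental lemma of the calculus of variations\<close>

text \<open>\<open>ennreal (f p)\<close> and \<open>ennreal (- f p)\<close> are the positive and the
  negative part of f. The measures with these densities agree on the intersection-stable generator
  of open boxes, hence everywhere, and uniqueness of densities makes the two parts equal almost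
  everywhere. They can agree only where f vanishes.\<close>

lemma AE_eq_0_if_box_integrals_eq_0:
  fixes f :: "'a::euclidean_space \<Rightarrow> real"
  assumes f: "integrable lborel f"
    and z: "\<And>a b. (\<integral>p. f p * indicator (box a b) p \<partial>lborel) = 0"
  shows "AE p in lborel. f p = 0"
proof -
  have [measurable]: "f \<in> borel_measurable borel" using f by (simp add: borel_measurable_integrable)
  let ?P = "density lborel (\<lambda>p. ennreal (f p))" and ?N = "density lborel (\<lambda>p. ennreal (- f p))"
  let ?E = "range (\<lambda>(a, b). box a b :: 'a set)"
  have fin: "(\<integral>\<^sup>+p. ennreal (f p) \<partial>lborel) < \<infinity>" "(\<integral>\<^sup>+p. ennreal (- f p) \<partial>lborel) < \<infinity>"
    using f by (auto simp: real_integrable_def less_top)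
  have eq: "emeasure ?P (box a b) = emeasure ?N (box a b)" for a b
  proof -
    have i: "integrable lborel (\<lambda>p. f p * indicator (box a b) p)"
      using f by (rule integrable_mult_indicator[of "box a b" lborel f, simplified, THEN Bochner_Integration.integrable_cong[THEN iffD1, rotated 2]])
        (auto simp: mult.commute)
    have e: "ennreal (f p * indicator (box a b) p) = ennreal (f p) * indicator (box a b) p"
       "ennreal (- (f p * indicator (box a b) p)) = ennreal (- f p) * indicator (box a b) p" for p
      by (auto simp: indicator_def)
    have l: "(\<integral>\<^sup>+p. ennreal (f p) * indicator (box a b) p \<partial>lborel) < \<infinity>"
       "(\<integral>\<^sup>+p. ennreal (- f p) * indicator (box a b) p \<partial>lborel) < \<infinity>"
      by (rule le_less_trans[OF nn_integral_mono fin(1)], simp add: indicator_def)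
         (rule le_less_trans[OF nn_integral_mono fin(2)], simp add: indicator_def)
    have "enn2real (\<integral>\<^sup>+p. ennreal (f p) * indicator (box a b) p \<partial>lborel)
        = enn2real (\<integral>\<^sup>+p. ennreal (- f p) * indicator (box a b) p \<partial>lborel)"
      using real_lebesgue_integral_def[OF i] z[of a b] by (simp add: e)
    with l have "(\<integral>\<^sup>+p. ennreal (f p) * indicator (box a b) p \<partial>lborel)
        = (\<integral>\<^sup>+p. ennreal (- f p) * indicator (box a b) p \<partial>lborel)"
      by (metis ennreal_enn2real less_top infinity_ennreal_def)
    then show ?thesis by (simp add: emeasure_density)
  qed
  have "?P = ?N"
  proof (rule measure_eqI_generator_eq[of ?E UNIV _ _ "\<lambda>n. box (- (real n *\<^sub>R One)) (real n *\<^sub>R One)"])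
    show "Int_stable ?E"
      by (auto simp: Int_stable_def box_Int_box)
    show "sets ?P = sigma_sets UNIV ?E" "sets ?N = sigma_sets UNIV ?E"
      by (auto simp: borel_eq_box[where 'a='a, THEN arg_cong, of sets])
    show "(\<Union>i. box (- (real i *\<^sub>R One)) (real i *\<^sub>R One)) = (UNIV::'a set)"
      by (rule UN_box_eq_UNIV)
    show "emeasure ?P (box (- (real i *\<^sub>R One)) (real i *\<^sub>R One)) \<noteq> \<infinity>" for i
    proof -
      have "emeasure ?P (box (- (real i *\<^sub>R One)) (real i *\<^sub>R One)) \<le> (\<integral>\<^sup>+p. ennreal (f p) \<partial>lborel)"
        by (auto simp: emeasure_density intro!: nn_integral_mono) (simp add: indicator_def)
      then show ?thesis using fin(1) by (auto simp: top_unique)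
    qed
  qed (auto simp: eq)
  then have "AE p in lborel. ennreal (f p) = ennreal (- f p)"
    by (subst (asm) sigma_finite_measure.density_unique_iff[OF sigma_finite_lborel]) auto
  then show ?thesis
    by eventually_elim (metis ennreal_eq_0_iff ennreal_inj linorder_le_cases neg_le_0_iff_le neg_0_le_iff_le order_antisym)
qed

lemma AE_lborel_cbox_imp_box: "AE p in lborel. p \<in> cbox a b \<longrightarrow> p \<in> box a (b::'a::euclidean_space)"
proof -
  have "cbox a b - box a b \<in> null_sets lebesgue"
    using negligible_frontier_interval[of a b] by (simp add: negligible_iff_null_sets)
  then have "cbox a b - box a b \<in> null_sets lborel"
    by (subst (asm) null_sets_completion_iff) auto
  from AE_not_in[OF this] show ?thesis by eventually_elim auto
qed

text \<open>An open set is a countable union of closed boxes, so countably many null sets are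
  collected.\<close>

lemma AE_open_if_AE_cbox:
  fixes U :: "'a::euclidean_space set"
  assumes U: "open U" and P: "\<And>a b. cbox a b \<subseteq> U \<Longrightarrow> AE p in lborel. p \<in> cbox a b \<longrightarrow> P p"
  shows "AE p in lborel. p \<in> U \<longrightarrow> P p"
proof -
  have "\<exists>D. countable D \<and> D \<subseteq> Pow U \<and> (\<forall>X\<in>D. \<exists>a b. X = cbox a b) \<and> \<Union>D = U"
  proof (rule open_countable_Union_open_cbox[OF U], rule exI, intro conjI ballI)
    fix D X assume "\<And>X. X \<in> D \<Longrightarrow> \<exists>a b. X = cbox a b" "X \<in> D"
    then show "\<exists>a b. X = cbox a b" .
  qed assumption+
  then obtain D where D: "countable D" "D \<subseteq> Pow U" "\<forall>X\<in>D. \<exists>a b. X = cbox a b" "\<Union>D = U"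
    by blast
  have "AE p in lborel. \<forall>X\<in>D. p \<in> X \<longrightarrow> P p"
    unfolding AE_ball_countable[OF D(1)]
  proof
    fix X assume X: "X \<in> D"
    from bspec[OF D(3) X] obtain a b where ab: "X = cbox a b" by (elim exE)
    from X D(2) have "X \<subseteq> U" by (auto simp only: Pow_iff)
    then show "AE p in lborel. p \<in> X \<longrightarrow> P p" unfolding ab by (rule P)
  qed
  then show ?thesis
  proof eventually_elim
    case (elim p)
    show ?case using elim unfolding D(4)[symmetric] by (auto simp only: Union_iff)
  qed
qed

text \<open>Borel measurability is demanded on the whole space because it survives composition with
  shifts and the passage to product measures, where Lebesgue measurability may get lost.\<close>

definition locally_integrable_borel :: "('a::euclidean_space \<Rightarrow> real) \<Rightarrow> 'a set \<Rightarrow> bool" where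
  "locally_integrable_borel u U \<longleftrightarrow>
     u \<in> borel_measurable borel \<and> (\<forall>K. compact K \<and> K \<subseteq> U \<longrightarrow> set_integrable lborel K u)"

text \<open>Box bumps supported in a closed box inside U converge to the indicator of the open box,
  so dominated convergence turns vanishing test integrals into vanishing box integrals. The
  criterion for box integrals is then applied to f cut off to one box at a time.\<close>

lemma AE_eq_0_if_test_integrals_eq_0:
  fixes f :: "'a::euclidean_space \<Rightarrow> real"
  assumes U: "open U" and f: "locally_integrable_borel f U"
    and z: "\<And>\<phi>. test_function U \<phi> \<Longrightarrow> (\<integral>p. f p * \<phi> p \<partial>lborel) = 0"
  shows "AE p in lborel. p \<in> U \<longrightarrow> f p = 0"
proof -
  have [measurable]: "f \<in> borel_measurable borel" using f by (simp add: locally_integrable_borel_def)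
  have box0: "(\<integral>p. f p * indicator (box c d) p \<partial>lborel) = 0" if cd: "cbox c d \<subseteq> U" for c d
  proof -
    have i: "integrable lborel (\<lambda>p. \<bar>f p\<bar> * indicator (cbox c d) p)"
    proof -
      have "set_integrable lborel (cbox c d) f"
        using f cd by (auto simp: locally_integrable_borel_def)
      then have "set_integrable lborel (cbox c d) (\<lambda>p. \<bar>f p\<bar>)" by (rule set_integrable_abs)
      then show ?thesis by (simp add: set_integrable_def mult.commute)
    qed
    have "(\<lambda>n. \<integral>p. f p * box_bump (real (Suc n)) c d p \<partial>lborel) \<longlonglongrightarrow>
        (\<integral>p. f p * indicator (box c d) p \<partial>lborel)"
    proof (rule integral_dominated_convergence[OF _ _ i])
      show "AE p in lborel. (\<lambda>n. f p * box_bump (real (Suc n)) c d p) \<longlonglongrightarrow> f p * indicator (box c d) p"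
        by (intro AE_I2 tendsto_intros box_bump_tendsto_indicator)
      have [measurable]: "box_bump n c d \<in> borel_measurable borel" for n
        using Ck_box_bump[of 0 n c d] by (simp add: borel_measurable_continuous_onI)
      show "(\<lambda>p. f p * box_bump (real (Suc n)) c d p) \<in> borel_measurable lborel" for n
        by measurable
      show "AE p in lborel. norm (f p * box_bump (real (Suc n)) c d p) \<le> \<bar>f p\<bar> * indicator (cbox c d) p" for n
      proof (rule AE_I2)
        fix p
        have "\<bar>box_bump (real (Suc n)) c d p\<bar> \<le> indicator (cbox c d) p"
          using box_bump_bounds[of "real (Suc n)" c d p] box_bump_eq_0[of "real (Suc n)" p c d] box_subset_cbox[of c d]
          by (cases "p \<in> cbox c d") auto
        then show "norm (f p * box_bump (real (Suc n)) c d p) \<le> \<bar>f p\<bar> * indicator (cbox c d) p"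
          by (simp add: abs_mult mult_left_mono)
      qed
    qed measurable
    moreover have "(\<integral>p. f p * box_bump (real (Suc n)) c d p \<partial>lborel) = 0" for n
      by (intro z test_function_box_bump cd) auto
    ultimately show ?thesis by (simp add: LIMSEQ_const_iff)
  qed
  have on_cbox: "AE p in lborel. p \<in> cbox a b \<longrightarrow> f p = 0" if ab: "cbox a b \<subseteq> U" for a b
  proof -
    have i: "integrable lborel (\<lambda>p. f p * indicator (box a b) p)"
    proof -
      have "set_integrable lborel (cbox a b) f"
        using f ab by (auto simp: locally_integrable_borel_def)
      then have "set_integrable lborel (box a b) f"
        by (rule set_integrable_subset) (auto simp: box_subset_cbox)
      then show ?thesis by (simp add: set_integrable_def mult.commute)
    qed
    \<comment> \<open>The criterion asks for all boxes of the space, also those that leave U. Their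
      intersection with \<open>box a b\<close> is again a box, with closure inside U.\<close>
    have "(\<integral>p. f p * indicator (box a b) p * indicator (box c d) p \<partial>lborel) = 0" for c d
    proof -
      obtain c' d' where cd: "box a b \<inter> box c d = box c' d'" using box_Int_box by blast
      have "(\<integral>p. f p * indicator (box c' d') p \<partial>lborel) = 0"
      proof (cases "box c' d' = {}")
        case False
        then have "cbox c' d' = closure (box c' d')" by (simp add: closure_box)
        also have "\<dots> \<subseteq> closure (box a b)" using cd by (intro closure_mono) auto
        also have "\<dots> \<subseteq> cbox a b" by (simp add: closure_minimal box_subset_cbox closed_cbox)
        finally show ?thesis using ab box0 by auto
      qed simp
      then show ?thesis by (simp add: cd[symmetric] indicator_inter_arith mult.assoc)
    qed
    from AE_eq_0_if_box_integrals_eq_0[OF i this] AE_lborel_cbox_imp_box[of a b]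
    show ?thesis by eventually_elim (auto simp: indicator_def split: if_splits)
  qed
  show ?thesis by (rule AE_open_if_AE_cbox[OF U on_cbox])
qed

section \<open>Test functions: supports, bounds and translates\<close>

lemma test_function_facts:
  assumes "test_function U \<phi>"
  defines "K \<equiv> closure {p. \<phi> p \<noteq> 0}"
  shows "compact K" "K \<subseteq> U" "\<And>p. p \<notin> K \<Longrightarrow> \<phi> p = 0"
    "continuous_on UNIV \<phi>"
    "\<And>p. (\<phi> has_derivative frechet_derivative \<phi> (at p)) (at p)"
    "continuous_on UNIV (\<lambda>p. frechet_derivative \<phi> (at p) e)"
    "\<And>p. p \<notin> K \<Longrightarrow> frechet_derivative \<phi> (at p) e = 0"
proof -
  show "compact K" "K \<subseteq> U" using assms by (auto simp: test_function_def)
  show z: "\<phi> p = 0" if "p \<notin> K" for p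
    using that closure_subset[of "{p. \<phi> p \<noteq> 0}"] by (auto simp: K_def)
  have Ck: "Ck k \<phi>" for k using assms by (simp add: test_function_def)
  from Ck[of 0] show "continuous_on UNIV \<phi>" by simp
  from Ck[of "Suc 0"] obtain f' where f': "\<And>p. (\<phi> has_derivative f' p) (at p)"
    "\<And>v. continuous_on UNIV (\<lambda>x. f' x v)" by auto
  have eq: "frechet_derivative \<phi> (at p) = f' p" for p
    using frechet_derivative_at[OF f'(1)] by simp
  show "\<And>p. (\<phi> has_derivative frechet_derivative \<phi> (at p)) (at p)"
    "continuous_on UNIV (\<lambda>p. frechet_derivative \<phi> (at p) e)" by (simp_all add: eq f')
  show "frechet_derivative \<phi> (at p) e = 0" if "p \<notin> K" for p
  proof -
    have "open (- K)" unfolding K_def by (intro open_Compl closed_closure)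
    then have "(\<phi> has_derivative (\<lambda>_. 0)) (at p)"
      using that by (intro has_derivative_transform_within_open[of "\<lambda>_. 0" "\<lambda>_. 0" p UNIV "- K" \<phi>])
        (auto simp: z)
    from has_derivative_unique[OF this f'(1)] show ?thesis by (simp add: eq fun_eq_iff)
  qed
qed

lemma closure_support_translate:
  fixes \<phi> :: "'a::real_normed_vector \<Rightarrow> real"
  shows "closure {p. \<phi> (p - c) \<noteq> 0} = (+) c ` closure {p. \<phi> p \<noteq> 0}"
proof -
  have "{p. \<phi> (p - c) \<noteq> 0} = (+) c ` {p. \<phi> p \<noteq> 0}"
  proof safe
    fix x assume "\<phi> (x - c) \<noteq> 0"
    then show "x \<in> (+) c ` {p. \<phi> p \<noteq> 0}" by (intro image_eqI[of _ _ "x - c"]) auto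
  qed simp
  then show ?thesis by (simp add: closure_translation)
qed

lemma test_function_translate:
  assumes "test_function V \<phi>" "(+) c ` closure {p. \<phi> p \<noteq> 0} \<subseteq> U"
  shows "test_function U (\<lambda>p. \<phi> (p - c))"
  using assms Ck_translate[of _ \<phi> "- c"]
  by (auto simp: test_function_def closure_support_translate compact_translation)

section \<open>Weak derivatives and integrals along lines\<close>

lemma distr_lborel_add: "distr lborel borel (\<lambda>x::'a::euclidean_space. x + c) = lborel"
  using lborel_distr_plus[of c] by (simp add: add.commute[of _ c])

lemma nn_integral_lborel_add:
  fixes f :: "'a::euclidean_space \<Rightarrow> ennreal"
  assumes [measurable]: "f \<in> borel_measurable borel"
  shows "(\<integral>\<^sup>+p. f (p + c) \<partial>lborel) = (\<integral>\<^sup>+p. f p \<partial>lborel)"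
  by (subst distr_lborel_add[of c, symmetric], subst nn_integral_distr) auto

lemma integral_lborel_add:
  fixes f :: "'a::euclidean_space \<Rightarrow> real"
  assumes [measurable]: "f \<in> borel_measurable borel"
  shows "(\<integral>p. f (p + c) \<partial>lborel) = (\<integral>p. f p \<partial>lborel)"
  by (subst distr_lborel_add[of c, symmetric], subst integral_distr) auto

lemma integrable_lborel_add:
  fixes f :: "'a::euclidean_space \<Rightarrow> real"
  assumes [measurable]: "f \<in> borel_measurable borel"
  shows "integrable lborel (\<lambda>p. f (p + c)) \<longleftrightarrow> integrable lborel f"
  by (subst (2) distr_lborel_add[of c, symmetric], subst integrable_distr_eq) auto

lemma AE_lborel_add:
  assumes "AE p in lborel. P (p::'a::euclidean_space)"
  shows "AE p in lborel. P (p + c)"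
proof -
  from assms obtain N where N: "N \<in> null_sets lborel" "{p. \<not> P p} \<subseteq> N"
    by (auto simp: eventually_ae_filter)
  then have [measurable]: "N \<in> sets borel" by auto
  have "AE p in distr lborel borel (\<lambda>x. x + c). p \<notin> N"
    unfolding distr_lborel_add by (rule AE_not_in[OF N(1)])
  then have "AE p in lborel. p + c \<notin> N"
    by (subst (asm) AE_distr_iff) auto
  then show ?thesis by eventually_elim (use N in auto)
qed

text \<open>Integrability on this one compact set controls all translates, by s e with s between 0
  and t, of a function supported in K.\<close>

definition sweep :: "'a::euclidean_space \<Rightarrow> 'a set \<Rightarrow> real \<Rightarrow> 'a set" where
  "sweep e K t = (\<lambda>(p, s). p + s *\<^sub>R e) ` (K \<times> {0..t})"

lemma compact_sweep: "compact K \<Longrightarrow> compact (sweep e K t)"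
  unfolding sweep_def
  by (intro compact_continuous_image compact_Times)
    (auto intro!: continuous_intros simp: case_prod_beta)

lemma sweepI: "p \<in> K \<Longrightarrow> 0 \<le> s \<Longrightarrow> s \<le> t \<Longrightarrow> p + s *\<^sub>R e \<in> sweep e K t"
  by (force simp: sweep_def)

lemma sweep_subset_convex:
  assumes "convex U" "K \<subseteq> U" "\<And>p. p \<in> K \<Longrightarrow> p + t *\<^sub>R e \<in> U" "0 < t"
  shows "sweep e K t \<subseteq> U"
proof
  fix x assume "x \<in> sweep e K t"
  then obtain p s where p: "p \<in> K" "s \<in> {0..t}" and x: "x = p + s *\<^sub>R e" by (auto simp: sweep_def)
  have "(1 - s / t) *\<^sub>R p + (s / t) *\<^sub>R (p + t *\<^sub>R e) \<in> U"
    using assms p by (intro convexD[OF assms(1)]) auto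
  moreover have "(1 - s / t) *\<^sub>R p + (s / t) *\<^sub>R (p + t *\<^sub>R e) = p + s *\<^sub>R e"
    using assms(4) by (simp add: algebra_simps)
  ultimately show "x \<in> U" by (simp add: x)
qed

text \<open>Prepares Fubini for line integrals. For every s the first product is supported in the
  sweep, so its p-integral is at most M times the integral of |f| there, and s ranges over a bounded
  interval. For fixed s the two integrands differ by the translation p -> p + s e, which preserves
  the measure.\<close>

lemma integrable_translates:
  fixes f \<psi> :: "'a::euclidean_space \<Rightarrow> real"
  assumes [measurable]: "f \<in> borel_measurable borel" "\<psi> \<in> borel_measurable borel"
    and K: "compact K" "\<And>p. p \<notin> K \<Longrightarrow> \<psi> p = 0" and M: "\<And>p. \<bar>\<psi> p\<bar> \<le> M"
    and f: "set_integrable lborel (sweep e K t) f"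
  shows "integrable (lborel \<Otimes>\<^sub>M lborel) (\<lambda>(p, s). f p * \<psi> (p - s *\<^sub>R e) * indicator {0..t} s)"
    and "integrable (lborel \<Otimes>\<^sub>M lborel) (\<lambda>(p, s). f (p + s *\<^sub>R e) * \<psi> p * indicator {0..t} s)"
proof -
  have [measurable]: "sweep e K t \<in> sets borel"
    using compact_sweep[OF K(1)] by (simp add: borel_compact)
  have M0: "0 \<le> M" using M[of 0] by linarith
  have ineq: "norm (f p * \<psi> (p - s *\<^sub>R e)) \<le> M * norm (indicator (sweep e K t) p *\<^sub>R f p)"
    if "s \<in> {0..t}" for p s
  proof (cases "p - s *\<^sub>R e \<in> K")
    case True
    from sweepI[OF True, of s t e] that have "p \<in> sweep e K t" by auto
    then show ?thesis using M[of "p - s *\<^sub>R e"]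
      by (simp add: abs_mult mult.commute[of _ "\<bar>f p\<bar>"] mult_left_mono)
  qed (simp add: K M0)
  define I where "I = (\<integral>\<^sup>+p. norm (indicator (sweep e K t) p *\<^sub>R f p) \<partial>lborel)"
  have I: "I < \<infinity>" using f by (simp add: set_integrable_def integrable_iff_bounded I_def)
  have bound: "(\<integral>\<^sup>+p. norm (f p * \<psi> (p - s *\<^sub>R e) * indicator {0..t} s) \<partial>lborel) \<le> M * I * indicator {0..t} s" for s
  proof (cases "s \<in> {0..t}")
    case True
    have "(\<integral>\<^sup>+p. norm (f p * \<psi> (p - s *\<^sub>R e)) \<partial>lborel) \<le> (\<integral>\<^sup>+p. ennreal M * norm (indicator (sweep e K t) p *\<^sub>R f p) \<partial>lborel)"
      using ineq[OF True] by (intro nn_integral_mono) (simp add: M0 flip: ennreal_mult)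
    also have "\<dots> = M * I" by (simp add: nn_integral_cmult I_def)
    finally show ?thesis using True by simp
  qed simp
  have fin: "(\<integral>\<^sup>+s. ennreal M * I * indicator {0..t} s \<partial>lborel) < \<infinity>"
    using I by (simp add: nn_integral_cmult_indicator ennreal_mult_less_top emeasure_lborel_Icc_eq)
  show "integrable (lborel \<Otimes>\<^sub>M lborel) (\<lambda>(p, s). f p * \<psi> (p - s *\<^sub>R e) * indicator {0..t} s)"
  proof (rule integrableI_bounded)
    have "(\<integral>\<^sup>+z. norm (case z of (p, s) \<Rightarrow> f p * \<psi> (p - s *\<^sub>R e) * indicator {0..t} s) \<partial>(lborel \<Otimes>\<^sub>M lborel))
       = (\<integral>\<^sup>+s. \<integral>\<^sup>+p. norm (f p * \<psi> (p - s *\<^sub>R e) * indicator {0..t} s) \<partial>lborel \<partial>lborel)"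
      by (subst lborel_pair.nn_integral_snd[symmetric]) auto
    also have "\<dots> \<le> (\<integral>\<^sup>+s. ennreal M * I * indicator {0..t} s \<partial>lborel)"
      by (intro nn_integral_mono bound)
    finally show "(\<integral>\<^sup>+z. norm (case z of (p, s) \<Rightarrow> f p * \<psi> (p - s *\<^sub>R e) * indicator {0..t} s) \<partial>(lborel \<Otimes>\<^sub>M lborel)) < \<infinity>"
      using fin by simp
  qed measurable
  show "integrable (lborel \<Otimes>\<^sub>M lborel) (\<lambda>(p, s). f (p + s *\<^sub>R e) * \<psi> p * indicator {0..t} s)"
  proof (rule integrableI_bounded)
    have "(\<integral>\<^sup>+z. norm (case z of (p, s) \<Rightarrow> f (p + s *\<^sub>R e) * \<psi> p * indicator {0..t} s) \<partial>(lborel \<Otimes>\<^sub>M lborel))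
       = (\<integral>\<^sup>+s. \<integral>\<^sup>+p. norm (f (p + s *\<^sub>R e) * \<psi> p * indicator {0..t} s) \<partial>lborel \<partial>lborel)"
      by (subst lborel_pair.nn_integral_snd[symmetric]) auto
    also have "\<dots> = (\<integral>\<^sup>+s. \<integral>\<^sup>+p. norm (f p * \<psi> (p - s *\<^sub>R e) * indicator {0..t} s) \<partial>lborel \<partial>lborel)"
    proof (rule nn_integral_cong)
      fix s :: real
      show "(\<integral>\<^sup>+p. norm (f (p + s *\<^sub>R e) * \<psi> p * indicator {0..t} s) \<partial>lborel)
        = (\<integral>\<^sup>+p. norm (f p * \<psi> (p - s *\<^sub>R e) * indicator {0..t} s) \<partial>lborel)"
        using nn_integral_lborel_add[of "\<lambda>p. norm (f p * \<psi> (p - s *\<^sub>R e) * indicator {0..t} s)" "s *\<^sub>R e"]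
        by simp
    qed
    also have "\<dots> \<le> (\<integral>\<^sup>+s. ennreal M * I * indicator {0..t} s \<partial>lborel)"
      by (intro nn_integral_mono bound)
    finally show "(\<integral>\<^sup>+z. norm (case z of (p, s) \<Rightarrow> f (p + s *\<^sub>R e) * \<psi> p * indicator {0..t} s) \<partial>(lborel \<Otimes>\<^sub>M lborel)) < \<infinity>"
      using fin by simp
  qed measurable
qed

text \<open>Fubini and translation invariance move the average along the segment from f to
  \<open>\<psi>\<close>: a shift of the argument of f is traded for the opposite shift of the
  argument of \<open>\<psi>\<close>.\<close>

lemma integral_line_integral:
  fixes f \<psi> :: "'a::euclidean_space \<Rightarrow> real"
  assumes [measurable]: "f \<in> borel_measurable borel" "\<psi> \<in> borel_measurable borel"
    and K: "compact K" "\<And>p. p \<notin> K \<Longrightarrow> \<psi> p = 0" and M: "\<And>p. \<bar>\<psi> p\<bar> \<le> M"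
    and f: "set_integrable lborel (sweep e K t) f"
  shows "(\<integral>p. (LINT s:{0..t}|lborel. f (p + s *\<^sub>R e)) * \<psi> p \<partial>lborel)
     = (LINT s:{0..t}|lborel. (\<integral>p. f p * \<psi> (p - s *\<^sub>R e) \<partial>lborel))"
    and "(\<integral>p. f p * (LINT s:{0..t}|lborel. \<psi> (p - s *\<^sub>R e)) \<partial>lborel)
     = (LINT s:{0..t}|lborel. (\<integral>p. f p * \<psi> (p - s *\<^sub>R e) \<partial>lborel))"
    and "integrable lborel (\<lambda>p. (LINT s:{0..t}|lborel. f (p + s *\<^sub>R e)) * \<psi> p)"
proof -
  note i = integrable_translates[OF assms]
  have e1: "(\<integral>s. f (p + s *\<^sub>R e) * \<psi> p * indicator {0..t} s \<partial>lborel) = (LINT s:{0..t}|lborel. f (p + s *\<^sub>R e)) * \<psi> p" for p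
    unfolding set_lebesgue_integral_def
    by (subst integral_mult_left_zero[symmetric], rule Bochner_Integration.integral_cong) (auto simp: indicator_def)
  have e2: "(\<integral>s. f p * \<psi> (p - s *\<^sub>R e) * indicator {0..t} s \<partial>lborel) = f p * (LINT s:{0..t}|lborel. \<psi> (p - s *\<^sub>R e))" for p
    unfolding set_lebesgue_integral_def
    by (subst integral_mult_right_zero[symmetric], rule Bochner_Integration.integral_cong) (auto simp: indicator_def)
  have e3: "(\<integral>p. f p * \<psi> (p - s *\<^sub>R e) * indicator {0..t} s \<partial>lborel) = indicator {0..t} s *\<^sub>R (\<integral>p. f p * \<psi> (p - s *\<^sub>R e) \<partial>lborel)" for s
    by (auto simp: indicator_def)
  have e4: "(\<integral>p. f (p + s *\<^sub>R e) * \<psi> p * indicator {0..t} s \<partial>lborel) = indicator {0..t} s *\<^sub>R (\<integral>p. f p * \<psi> (p - s *\<^sub>R e) \<partial>lborel)" for s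
    using integral_lborel_add[of "\<lambda>p. f p * \<psi> (p - s *\<^sub>R e)" "s *\<^sub>R e"] by (auto simp: indicator_def)
  show "(\<integral>p. (LINT s:{0..t}|lborel. f (p + s *\<^sub>R e)) * \<psi> p \<partial>lborel)
     = (LINT s:{0..t}|lborel. (\<integral>p. f p * \<psi> (p - s *\<^sub>R e) \<partial>lborel))"
    using lborel_pair.Fubini_integral[OF i(2)] unfolding e1 e4 by (simp add: set_lebesgue_integral_def)
  show "(\<integral>p. f p * (LINT s:{0..t}|lborel. \<psi> (p - s *\<^sub>R e)) \<partial>lborel)
     = (LINT s:{0..t}|lborel. (\<integral>p. f p * \<psi> (p - s *\<^sub>R e) \<partial>lborel))"
    using lborel_pair.Fubini_integral[OF i(1)] unfolding e2 e3 by (simp add: set_lebesgue_integral_def)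
  show "integrable lborel (\<lambda>p. (LINT s:{0..t}|lborel. f (p + s *\<^sub>R e)) * \<psi> p)"
    using lborel_pair.integrable_fst[OF i(2)] unfolding e1 by simp
qed

lemma test_function_bounds:
  assumes "test_function U \<phi>"
  obtains M where "\<And>p. \<bar>\<phi> p\<bar> \<le> M" "\<And>p. \<bar>frechet_derivative \<phi> (at p) e\<bar> \<le> M"
proof -
  let ?K = "closure {p. \<phi> p \<noteq> 0}"
  note F = test_function_facts[OF assms]
  have b: "\<exists>M. \<forall>p. \<bar>g p\<bar> \<le> M" if g: "continuous_on UNIV g" "\<And>p. p \<notin> ?K \<Longrightarrow> g p = 0" for g :: "'a \<Rightarrow> real"
  proof -
    have "compact (g ` ?K)"
      using F(1) g(1) by (intro compact_continuous_image continuous_on_subset[OF g(1)]) auto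
    then obtain M where M: "\<And>p. p \<in> ?K \<Longrightarrow> \<bar>g p\<bar> \<le> M" "0 < M"
      using compact_imp_bounded[THEN bounded_pos[THEN iffD1]] by fastforce
    show ?thesis
    proof (intro exI allI)
      fix p show "\<bar>g p\<bar> \<le> M" using M g(2) by (cases "p \<in> ?K") auto
    qed
  qed
  obtain M1 where M1: "\<And>p. \<bar>\<phi> p\<bar> \<le> M1" using b[OF F(4) F(3)] by blast
  obtain M2 where M2: "\<And>p. \<bar>frechet_derivative \<phi> (at p) e\<bar> \<le> M2" using b[OF F(6) F(7)] by blast
  show thesis by (rule that[of "max M1 M2"]) (use M1 M2 in \<open>auto simp: max.coboundedI1 max.coboundedI2\<close>)
qed

lemma test_function_increment:
  assumes "test_function U \<phi>" "0 \<le> t"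
  shows "(LINT s:{0..t}|lborel. frechet_derivative \<phi> (at (p - s *\<^sub>R e)) e) = \<phi> p - \<phi> (p - t *\<^sub>R e)"
proof -
  note F = test_function_facts[OF assms(1)]
  have "((\<lambda>s. - \<phi> (p - s *\<^sub>R e)) has_vector_derivative frechet_derivative \<phi> (at (p - s *\<^sub>R e)) e) (at s within {0..t})" for s
  proof -
    interpret L: bounded_linear "frechet_derivative \<phi> (at (p - s *\<^sub>R e))"
      by (rule has_derivative_bounded_linear[OF F(5)])
    have "((\<lambda>s. p - s *\<^sub>R e) has_derivative (\<lambda>h. - (h *\<^sub>R e))) (at s within {0..t})"
      by (auto intro!: derivative_eq_intros)
    from has_derivative_compose[OF this F(5)]
    have "((\<lambda>s. - \<phi> (p - s *\<^sub>R e)) has_derivative (\<lambda>h. - frechet_derivative \<phi> (at (p - s *\<^sub>R e)) (- (h *\<^sub>R e)))) (at s within {0..t})"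
      by (rule has_derivative_minus)
    then show ?thesis
      by (simp add: has_vector_derivative_def linear_neg[OF L.linear] linear_scale[OF L.linear])
  qed
  moreover have "continuous_on {0..t} (\<lambda>s. frechet_derivative \<phi> (at (p - s *\<^sub>R e)) e)"
    by (rule continuous_on_compose2[OF F(6)]) (auto intro!: continuous_intros)
  ultimately show ?thesis
    using integral_FTC_atLeastAtMost[of 0 t "\<lambda>s. - \<phi> (p - s *\<^sub>R e)" "\<lambda>s. frechet_derivative \<phi> (at (p - s *\<^sub>R e)) e"] assms(2)
    by (simp add: set_lebesgue_integral_def)
qed

section \<open>Equivalence of weak derivatives and increments along lines\<close>

definition weak_deriv_borel :: "('a::euclidean_space \<Rightarrow> real) \<Rightarrow> ('a \<Rightarrow> real) \<Rightarrow> 'a \<Rightarrow> 'a set \<Rightarrow> bool" where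
  "weak_deriv_borel u v e U \<longleftrightarrow> locally_integrable_borel u U \<and> locally_integrable_borel v U \<and>
     (\<forall>\<phi>. test_function U \<phi> \<longrightarrow>
       (\<integral>p. u p * frechet_derivative \<phi> (at p) e \<partial>lborel) = - (\<integral>p. v p * \<phi> p \<partial>lborel))"

text \<open>
  The increment of \<open>u\<close> along almost every segment is the integral of \<open>v\<close>. For locally integrable functions
  on an open set this is equivalent to the weak formulation, but it is visibly stable under products and under shifts.
\<close>

definition line_deriv :: "('a::euclidean_space \<Rightarrow> real) \<Rightarrow> ('a \<Rightarrow> real) \<Rightarrow> 'a \<Rightarrow> 'a set \<Rightarrow> bool" where
  "line_deriv u v e U \<longleftrightarrow> (\<forall>t>0. AE p in lborel. p \<in> U \<and> p + t *\<^sub>R e \<in> U \<longrightarrow>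
     set_integrable lborel {0..t} (\<lambda>s. v (p + s *\<^sub>R e)) \<and>
     u (p + t *\<^sub>R e) - u p = (LINT s:{0..t}|lborel. v (p + s *\<^sub>R e)))"

lemma integrable_mult_test:
  fixes f \<psi> :: "'a::euclidean_space \<Rightarrow> real"
  assumes [measurable]: "f \<in> borel_measurable borel" "\<psi> \<in> borel_measurable borel"
    and K: "set_integrable lborel K f" "\<And>p. p \<notin> K \<Longrightarrow> \<psi> p = 0" and M: "\<And>p. \<bar>\<psi> p\<bar> \<le> M"
  shows "integrable lborel (\<lambda>p. f p * \<psi> p)"
proof (rule Bochner_Integration.integrable_bound[of _ "\<lambda>p. M * norm (indicator K p *\<^sub>R f p)"])
  show "integrable lborel (\<lambda>p. M * norm (indicator K p *\<^sub>R f p))"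
    using K(1) by (simp add: set_integrable_def)
  have "0 \<le> M" using M[of 0] by linarith
  then show "AE p in lborel. norm (f p * \<psi> p) \<le> norm (M * norm (indicator K p *\<^sub>R f p))"
    using M by (intro AE_I2) (auto simp: indicator_def abs_mult mult.commute[of "\<bar>f _\<bar>"] K(2) intro: mult_right_mono)
qed measurable

lemma test_function_measurable:
  assumes "test_function U \<phi>"
  shows "\<phi> \<in> borel_measurable borel" "(\<lambda>p. frechet_derivative \<phi> (at p) e) \<in> borel_measurable borel"
  using test_function_facts(4,6)[OF assms] by (auto intro: borel_measurable_continuous_onI)

lemma integral_mult_test_increment:
  fixes f :: "'a::euclidean_space \<Rightarrow> real"
  assumes m[measurable]: "f \<in> borel_measurable borel" and \<phi>: "test_function U \<phi>"
    and f: "set_integrable lborel (sweep e (closure {p. \<phi> p \<noteq> 0}) t) f" and t: "0 \<le> t"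
  shows "(\<integral>p. f p * (\<phi> p - \<phi> (p - t *\<^sub>R e)) \<partial>lborel) =
    (LINT s:{0..t}|lborel. (\<integral>p. f p * frechet_derivative \<phi> (at (p - s *\<^sub>R e)) e \<partial>lborel))"
proof -
  note F = test_function_facts[OF \<phi>]
  note M[measurable] = test_function_measurable[OF \<phi>]
  obtain M where M: "\<And>p. \<bar>frechet_derivative \<phi> (at p) e\<bar> \<le> M"
    using test_function_bounds[OF \<phi>] by metis
  from integral_line_integral(2)[OF m test_function_measurable(2)[OF \<phi>] F(1) F(7) M f]
  show ?thesis by (simp add: test_function_increment[OF \<phi> t])
qed

lemma frechet_derivative_translate:
  assumes "\<And>p. (\<phi> has_derivative frechet_derivative \<phi> (at p)) (at p)"
  shows "frechet_derivative (\<lambda>p. \<phi> (p - c)) (at p) = frechet_derivative \<phi> (at (p - c))"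
proof -
  have "((\<lambda>p. p - c) has_derivative (\<lambda>h. h)) (at p)" by (auto intro!: derivative_eq_intros)
  from has_derivative_compose[OF this assms] show ?thesis
    by (rule frechet_derivative_at[symmetric])
qed

text \<open>The translates \<open>\<phi> (p - s *\<^sub>R e)\<close> are again test functions, so
  the weak identity may be used for each s. Integrated over \<open>{0..t}\<close>, its left side
  turns into an increment of \<open>\<phi>\<close>, which after translation is an increment of u,
  and its right side into the line integral of v. The fundamental lemma then removes the test
  function.\<close>

lemma weak_deriv_imp_line_deriv:
  fixes u v :: "'a::euclidean_space \<Rightarrow> real"
  assumes U: "open U" "convex U" and w: "weak_deriv_borel u v e U"
  shows "line_deriv u v e U"
  unfolding line_deriv_def
proof (intro allI impI)
  fix t :: real assume t: "0 < t"
  \<comment> \<open>The starting points whose end point is still in U. By convexity the segments in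
    between, and hence the sweeps of subsets of W, stay in U.\<close>
  define W where "W = U \<inter> {p. p + t *\<^sub>R e \<in> U}"
  have oW: "open W"
  proof -
    have "open ((\<lambda>p. p + t *\<^sub>R e) -` U)"
      by (intro open_vimage U) (intro continuous_intros)
    then show ?thesis unfolding W_def using U by (auto simp: vimage_def)
  qed
  have loc: "locally_integrable_borel u U" "locally_integrable_borel v U"
    using w by (auto simp: weak_deriv_borel_def)
  then have [measurable]: "u \<in> borel_measurable borel" "v \<in> borel_measurable borel"
    by (auto simp: locally_integrable_borel_def)
  have sw: "sweep e K t \<subseteq> U" if "K \<subseteq> W" for K
    using that by (intro sweep_subset_convex[OF U(2) _ _ t]) (auto simp: W_def)
  have int: "set_integrable lborel (sweep e K t) u" "set_integrable lborel (sweep e K t) v"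
    if "compact K" "K \<subseteq> W" for K
    using loc sw[OF that(2)] compact_sweep[OF that(1)] by (auto simp: locally_integrable_borel_def)
  define J where "J p = (LINT s:{0..t}|lborel. v (p + s *\<^sub>R e))" for p
  have [measurable]: "J \<in> borel_measurable borel"
    unfolding J_def set_lebesgue_integral_def by measurable
  have ind: "(indicator K :: 'a \<Rightarrow> real) \<in> borel_measurable borel" if "compact K" for K :: "'a set"
    using that by (auto intro!: borel_measurable_indicator borel_compact)
  have J: "set_integrable lborel K J" "AE p in lborel. p \<in> K \<longrightarrow> set_integrable lborel {0..t} (\<lambda>s. v (p + s *\<^sub>R e))"
    if K: "compact K" "K \<subseteq> W" for K
  proof -
    have 0: "\<And>p. p \<notin> K \<Longrightarrow> indicator K p = (0::real)" and 1: "\<And>p. \<bar>indicator K p :: real\<bar> \<le> 1"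
      by (auto simp: indicator_def)
    have v: "v \<in> borel_measurable borel" by measurable
    note lem = v ind[OF K(1)] K(1) 0 1 int(2)[OF K]
    from integral_line_integral(3)[OF lem]
    show "set_integrable lborel K J" by (simp add: set_integrable_def J_def mult.commute)
    have "AE p in lborel. integrable lborel (\<lambda>s. v (p + s *\<^sub>R e) * indicator K p * indicator {0..t} s)"
      by (rule lborel_pair.AE_integrable_fst[OF integrable_translates(2)[OF lem]])
    then show "AE p in lborel. p \<in> K \<longrightarrow> set_integrable lborel {0..t} (\<lambda>s. v (p + s *\<^sub>R e))"
      by eventually_elim (auto simp: set_integrable_def mult.commute)
  qed
  have u_shift: "set_integrable lborel K (\<lambda>p. u (p + t *\<^sub>R e))" if K: "compact K" "K \<subseteq> W" for K
  proof -
    have [measurable]: "K \<in> sets borel" using K by (simp add: borel_compact)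
    have "compact ((+) (t *\<^sub>R e) ` K)" using K by (simp add: compact_translation)
    moreover have "(+) (t *\<^sub>R e) ` K \<subseteq> U" using K by (auto simp: W_def add.commute)
    ultimately have "set_integrable lborel ((+) (t *\<^sub>R e) ` K) u"
      using loc by (auto simp: locally_integrable_borel_def)
    moreover have "indicator ((+) (t *\<^sub>R e) ` K) p = (indicator K (p - t *\<^sub>R e) :: real)" for p
      by (auto simp: indicator_def intro: image_eqI[of _ _ "p - t *\<^sub>R e"])
    ultimately have "integrable lborel (\<lambda>p. indicator K (p - t *\<^sub>R e) *\<^sub>R u p)"
      by (simp add: set_integrable_def)
    then show ?thesis
      using integrable_lborel_add[of "\<lambda>p. indicator K (p - t *\<^sub>R e) *\<^sub>R u p" "t *\<^sub>R e"]
      by (simp add: set_integrable_def)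
  qed
  have "AE p in lborel. p \<in> W \<longrightarrow> u (p + t *\<^sub>R e) - u p - J p = 0"
  proof (rule AE_eq_0_if_test_integrals_eq_0[OF oW])
    show "locally_integrable_borel (\<lambda>p. u (p + t *\<^sub>R e) - u p - J p) W"
      unfolding locally_integrable_borel_def
    proof (intro conjI allI impI)
      fix K assume K: "compact K \<and> K \<subseteq> W"
      then have "set_integrable lborel K u" using loc by (auto simp: locally_integrable_borel_def W_def)
      then show "set_integrable lborel K (\<lambda>p. u (p + t *\<^sub>R e) - u p - J p)"
        using K J u_shift by (intro set_integral_diff) auto
    qed measurable
    fix \<phi> assume \<phi>: "test_function W \<phi>"
    define K where "K = closure {p. \<phi> p \<noteq> 0}"
    note F = test_function_facts[OF \<phi>, folded K_def]
    note [measurable] = test_function_measurable(1)[OF \<phi>]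
    obtain M where M: "\<And>p. \<bar>\<phi> p\<bar> \<le> M"
      using test_function_bounds[OF \<phi>] by metis
    note K = F(1,2)
    have u: "set_integrable lborel K u"
      using loc K by (auto simp: locally_integrable_borel_def W_def)
    have i: "integrable lborel (\<lambda>p. u (p + t *\<^sub>R e) * \<phi> p)" "integrable lborel (\<lambda>p. u p * \<phi> p)"
      "integrable lborel (\<lambda>p. J p * \<phi> p)"
      using u u_shift[OF K] J(1)[OF K] by (auto intro!: integrable_mult_test[OF _ _ _ F(3) M])
    have i': "integrable lborel (\<lambda>p. u p * \<phi> (p - t *\<^sub>R e))"
      and e': "(\<integral>p. u (p + t *\<^sub>R e) * \<phi> p \<partial>lborel) = (\<integral>p. u p * \<phi> (p - t *\<^sub>R e) \<partial>lborel)"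
      using i(1) integrable_lborel_add[of "\<lambda>p. u p * \<phi> (p - t *\<^sub>R e)" "t *\<^sub>R e"]
        integral_lborel_add[of "\<lambda>p. u p * \<phi> (p - t *\<^sub>R e)" "t *\<^sub>R e"] by auto
    have test: "test_function U (\<lambda>p. \<phi> (p - s *\<^sub>R e))" if s: "s \<in> {0..t}" for s
    proof (rule test_function_translate[OF \<phi>], fold K_def)
      have "(+) (s *\<^sub>R e) ` K \<subseteq> sweep e K t"
        using s sweepI[of _ K s t e] by (auto simp: add.commute)
      then show "(+) (s *\<^sub>R e) ` K \<subseteq> U" using sw[OF K(2)] by auto
    qed
    have "(\<integral>p. u p * (\<phi> p - \<phi> (p - t *\<^sub>R e)) \<partial>lborel) =
      (LINT s:{0..t}|lborel. (\<integral>p. u p * frechet_derivative \<phi> (at (p - s *\<^sub>R e)) e \<partial>lborel))"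
      using int(1)[OF K] t by (intro integral_mult_test_increment[OF _ \<phi>]) (auto simp: K_def)
    also have "\<dots> = (LINT s:{0..t}|lborel. - (\<integral>p. v p * \<phi> (p - s *\<^sub>R e) \<partial>lborel))"
    proof (rule set_lebesgue_integral_cong)
      show "\<forall>s. s \<in> {0..t} \<longrightarrow> (\<integral>p. u p * frechet_derivative \<phi> (at (p - s *\<^sub>R e)) e \<partial>lborel)
          = - (\<integral>p. v p * \<phi> (p - s *\<^sub>R e) \<partial>lborel)"
      proof (intro allI impI)
        fix s assume "s \<in> {0..t}"
        from w test[OF this] have "(\<integral>p. u p * frechet_derivative (\<lambda>p. \<phi> (p - s *\<^sub>R e)) (at p) e \<partial>lborel)
          = - (\<integral>p. v p * \<phi> (p - s *\<^sub>R e) \<partial>lborel)"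
          by (simp add: weak_deriv_borel_def)
        then show "(\<integral>p. u p * frechet_derivative \<phi> (at (p - s *\<^sub>R e)) e \<partial>lborel)
          = - (\<integral>p. v p * \<phi> (p - s *\<^sub>R e) \<partial>lborel)"
          unfolding frechet_derivative_translate[OF F(5)] .
      qed
    qed simp
    also have "\<dots> = - (\<integral>p. J p * \<phi> p \<partial>lborel)"
      unfolding J_def
      by (subst integral_line_integral(1)[OF _ _ F(1) F(3) M int(2)[OF K]]) (auto simp: set_lebesgue_integral_def)
    finally have "(\<integral>p. u p * \<phi> p \<partial>lborel) - (\<integral>p. u p * \<phi> (p - t *\<^sub>R e) \<partial>lborel) = - (\<integral>p. J p * \<phi> p \<partial>lborel)"
      using i i' by (simp add: right_diff_distrib)
    then show "(\<integral>p. (u (p + t *\<^sub>R e) - u p - J p) * \<phi> p \<partial>lborel) = 0"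
      using i e' by (simp add: left_diff_distrib)
  qed
  moreover have "AE p in lborel. p \<in> W \<longrightarrow> set_integrable lborel {0..t} (\<lambda>s. v (p + s *\<^sub>R e))"
    by (rule AE_open_if_AE_cbox[OF oW]) (rule J(2)[OF compact_cbox])
  ultimately show "AE p in lborel. p \<in> U \<and> p + t *\<^sub>R e \<in> U \<longrightarrow>
     set_integrable lborel {0..t} (\<lambda>s. v (p + s *\<^sub>R e)) \<and>
     u (p + t *\<^sub>R e) - u p = (LINT s:{0..t}|lborel. v (p + s *\<^sub>R e))"
    by eventually_elim (auto simp: W_def J_def)
qed

text \<open>Needed to return from integrals over short intervals of shifts to the shift 0. The
  majorant lives on the sweep and does not depend on s.\<close>

lemma continuous_on_integral_translate:
  fixes f \<psi> :: "'a::euclidean_space \<Rightarrow> real"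
  assumes [measurable]: "f \<in> borel_measurable borel" and \<psi>: "continuous_on UNIV \<psi>"
    and K: "compact K" "\<And>p. p \<notin> K \<Longrightarrow> \<psi> p = 0" and M: "\<And>p. \<bar>\<psi> p\<bar> \<le> M"
    and f: "set_integrable lborel (sweep e K t) f"
  shows "continuous_on {0..t} (\<lambda>s. \<integral>p. f p * \<psi> (p - s *\<^sub>R e) \<partial>lborel)"
  unfolding continuous_on_sequentially comp_def
proof (intro allI ballI impI)
  fix x :: "nat \<Rightarrow> real" and a assume a: "a \<in> {0..t}" and "(\<forall>n. x n \<in> {0..t}) \<and> x \<longlonglongrightarrow> a"
  then have x: "\<And>n. x n \<in> {0..t}" "x \<longlonglongrightarrow> a" by blast+
  have [measurable]: "\<psi> \<in> borel_measurable borel" using \<psi> by (rule borel_measurable_continuous_onI)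
  have M0: "0 \<le> M" using M[of 0] by linarith
  show "(\<lambda>n. \<integral>p. f p * \<psi> (p - x n *\<^sub>R e) \<partial>lborel) \<longlonglongrightarrow> (\<integral>p. f p * \<psi> (p - a *\<^sub>R e) \<partial>lborel)"
  proof (rule integral_dominated_convergence[where w="\<lambda>p. M * norm (indicator (sweep e K t) p *\<^sub>R f p)"])
    show "integrable lborel (\<lambda>p. M * norm (indicator (sweep e K t) p *\<^sub>R f p))"
      using f by (simp add: set_integrable_def)
    have "(\<lambda>n. \<psi> (p - x n *\<^sub>R e)) \<longlonglongrightarrow> \<psi> (p - a *\<^sub>R e)" for p
    proof -
      have "isCont \<psi> (p - a *\<^sub>R e)" using \<psi> by (simp add: continuous_on_eq_continuous_at)
      moreover have "(\<lambda>n. p - x n *\<^sub>R e) \<longlonglongrightarrow> p - a *\<^sub>R e" by (intro tendsto_intros x)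
      ultimately show ?thesis by (rule isCont_tendsto_compose)
    qed
    then show "AE p in lborel. (\<lambda>n. f p * \<psi> (p - x n *\<^sub>R e)) \<longlonglongrightarrow> f p * \<psi> (p - a *\<^sub>R e)"
      by (intro AE_I2 tendsto_mult tendsto_const)
    show "AE p in lborel. norm (f p * \<psi> (p - x n *\<^sub>R e)) \<le> M * norm (indicator (sweep e K t) p *\<^sub>R f p)" for n
    proof (rule AE_I2)
      fix p
      show "norm (f p * \<psi> (p - x n *\<^sub>R e)) \<le> M * norm (indicator (sweep e K t) p *\<^sub>R f p)"
      proof (cases "p - x n *\<^sub>R e \<in> K")
        case True
        from sweepI[OF True, of "x n" t e] x(1)[of n] have "p \<in> sweep e K t" by auto
        then show ?thesis using M[of "p - x n *\<^sub>R e"]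
          by (simp add: abs_mult mult.commute[of _ "\<bar>f p\<bar>"] mult_left_mono)
      qed (simp add: K M0)
    qed
  qed measurable
qed

lemma eq_0_if_integrals_eq_0:
  fixes g :: "real \<Rightarrow> real"
  assumes T: "0 < T" and g: "continuous_on {0..T} g"
    and z: "\<And>t. 0 < t \<Longrightarrow> t \<le> T \<Longrightarrow> (LINT s:{0..t}|lborel. g s) = 0"
  shows "g 0 = 0"
proof -
  have z': "integral {0..t} g = 0" if "t \<in> {0..T}" for t
  proof (cases "t = 0")
    case False
    then have t: "0 < t" "t \<le> T" using that by auto
    have "continuous_on {0..t} g" using g by (rule continuous_on_subset) (use t in auto)
    then have "set_integrable lborel {0..t} g" by (rule borel_integrable_atLeastAtMost')
    from set_borel_integral_eq_integral(2)[OF this] show ?thesis using z[OF t] by simp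
  qed simp
  have "((\<lambda>t. integral {0..t} g) has_vector_derivative g 0) (at 0 within {0..T})"
    using T by (intro integral_has_vector_derivative[OF g]) auto
  then have d: "((\<lambda>t. 0) has_vector_derivative g 0) (at 0 within {0..T})"
    by (rule has_vector_derivative_transform[rotated 2]) (use T z' in auto)
  have "((\<lambda>t. 0::real) has_vector_derivative 0) (at 0 within {0..T})" by simp
  from vector_derivative_unique_within_closed_interval[where a=0 and b=T, unfolded cbox_interval, OF _ _ d this] T
  show ?thesis by auto
qed

lemma sweep_inside_open:
  fixes e :: "'a::euclidean_space"
  assumes "compact K" "open U" "K \<subseteq> U"
  obtains T where "0 < T" "sweep e K T \<subseteq> U"
proof -
  obtain \<delta> where \<delta>: "0 < \<delta>" "(\<Union>x\<in>K. ball x \<delta>) \<subseteq> U"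
    using compact_subset_open_imp_ball_epsilon_subset[OF assms] by blast
  have "sweep e K (\<delta> / (2 * (norm e + 1))) \<subseteq> U"
  proof
    fix x assume "x \<in> sweep e K (\<delta> / (2 * (norm e + 1)))"
    then obtain p s where p: "p \<in> K" "0 \<le> s" "s \<le> \<delta> / (2 * (norm e + 1))" "x = p + s *\<^sub>R e"
      by (auto simp: sweep_def)
    have "s * norm e \<le> \<delta> / (2 * (norm e + 1)) * (norm e + 1)"
      using p \<delta> by (intro mult_mono) auto
    also have "\<dots> = \<delta> / 2" by (simp add: field_simps add_nonneg_eq_0_iff)
    also have "\<dots> < \<delta>" using \<delta> by simp
    finally have "x \<in> ball p \<delta>" using p by (simp add: dist_norm)
    then show "x \<in> U" using \<delta> p by blast
  qed
  then show thesis using \<delta> by (intro that) (auto simp: add_nonneg_pos)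
qed

text \<open>\<open>G s\<close> is the defect of the weak identity for the test function shifted by s
  e. The increment formula makes its integral over \<open>{0..t}\<close> vanish for all small t, and
  continuity then forces \<open>G 0 = 0\<close>. Only short sweeps of the support occur, and these
  stay inside the open set U.\<close>

lemma line_deriv_imp_weak_deriv:
  fixes u v :: "'a::euclidean_space \<Rightarrow> real"
  assumes U: "open U" and l: "line_deriv u v e U"
    and loc: "locally_integrable_borel u U" "locally_integrable_borel v U"
  shows "weak_deriv_borel u v e U"
  unfolding weak_deriv_borel_def
proof (intro conjI loc allI impI)
  fix \<phi> assume \<phi>: "test_function U \<phi>"
  have [measurable]: "u \<in> borel_measurable borel" "v \<in> borel_measurable borel"
    using loc by (auto simp: locally_integrable_borel_def)
  define K where "K = closure {p. \<phi> p \<noteq> 0}"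
  note F = test_function_facts[OF \<phi>, folded K_def]
  note [measurable] = test_function_measurable[OF \<phi>]
  obtain M where M: "\<And>p. \<bar>\<phi> p\<bar> \<le> M" "\<And>p. \<bar>frechet_derivative \<phi> (at p) e\<bar> \<le> M"
    using test_function_bounds[OF \<phi>] by metis
  obtain T where T: "0 < T" "sweep e K T \<subseteq> U"
    using sweep_inside_open[OF F(1) U F(2)] by metis
  have sub: "sweep e K t \<subseteq> sweep e K T" if "t \<le> T" for t
    using that by (fastforce simp: sweep_def)
  have int: "set_integrable lborel (sweep e K t) u" "set_integrable lborel (sweep e K t) v"
    if "t \<le> T" for t
    using loc sub[OF that] T(2) compact_sweep[OF F(1), of e t]
    by (auto simp: locally_integrable_borel_def)
  have intK: "set_integrable lborel K u"
    using loc F by (auto simp: locally_integrable_borel_def)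
  define G where "G s = (\<integral>p. u p * frechet_derivative \<phi> (at (p - s *\<^sub>R e)) e \<partial>lborel)
    + (\<integral>p. v p * \<phi> (p - s *\<^sub>R e) \<partial>lborel)" for s
  have cont: "continuous_on {0..T} (\<lambda>s. \<integral>p. u p * frechet_derivative \<phi> (at (p - s *\<^sub>R e)) e \<partial>lborel)"
    "continuous_on {0..T} (\<lambda>s. \<integral>p. v p * \<phi> (p - s *\<^sub>R e) \<partial>lborel)"
    using int[of T] by (auto intro!: continuous_on_integral_translate[OF _ F(6) F(1) F(7) M(2)]
       continuous_on_integral_translate[OF _ F(4) F(1) F(3) M(1)])
  have "G 0 = 0"
  proof (rule eq_0_if_integrals_eq_0[OF T(1)])
    show "continuous_on {0..T} G" unfolding G_def by (intro continuous_on_add cont)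
    fix t assume t: "0 < t" "t \<le> T"
    have K_t: "p + t *\<^sub>R e \<in> U" if "p \<in> K" for p
      using sweepI[OF that, of t T e] t T by auto
    have si: "set_integrable lborel {0..t} (\<lambda>s. \<integral>p. u p * frechet_derivative \<phi> (at (p - s *\<^sub>R e)) e \<partial>lborel)"
      "set_integrable lborel {0..t} (\<lambda>s. \<integral>p. v p * \<phi> (p - s *\<^sub>R e) \<partial>lborel)"
      using t by (auto intro!: borel_integrable_atLeastAtMost' continuous_on_subset[OF cont(1)] continuous_on_subset[OF cont(2)])
    have "set_integrable lborel ((+) (t *\<^sub>R e) ` K) u"
    proof (rule loc(1)[unfolded locally_integrable_borel_def, THEN conjunct2, rule_format, OF conjI])
      show "compact ((+) (t *\<^sub>R e) ` K)" using F(1) by (rule compact_translation)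
      show "(+) (t *\<^sub>R e) ` K \<subseteq> U" using K_t by (auto simp: add.commute)
    qed
    then have ii: "integrable lborel (\<lambda>p. u p * \<phi> (p - t *\<^sub>R e))"
    proof (rule integrable_mult_test[rotated 2])
      show "p \<notin> (+) (t *\<^sub>R e) ` K \<Longrightarrow> \<phi> (p - t *\<^sub>R e) = 0" for p
        by (rule F(3)) (auto simp: image_iff algebra_simps)
    qed (auto intro: M)
    have i0: "integrable lborel (\<lambda>p. u p * \<phi> p)"
      using intK by (intro integrable_mult_test[OF _ _ _ F(3) M(1)]) auto
    have i1: "integrable lborel (\<lambda>p. u (p + t *\<^sub>R e) * \<phi> p)"
      and e1: "(\<integral>p. u (p + t *\<^sub>R e) * \<phi> p \<partial>lborel) = (\<integral>p. u p * \<phi> (p - t *\<^sub>R e) \<partial>lborel)"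
      using ii integrable_lborel_add[of "\<lambda>p. u p * \<phi> (p - t *\<^sub>R e)" "t *\<^sub>R e"]
        integral_lborel_add[of "\<lambda>p. u p * \<phi> (p - t *\<^sub>R e)" "t *\<^sub>R e"] by auto
    have "(LINT s:{0..t}|lborel. (\<integral>p. u p * frechet_derivative \<phi> (at (p - s *\<^sub>R e)) e \<partial>lborel))
      = (\<integral>p. u p * (\<phi> p - \<phi> (p - t *\<^sub>R e)) \<partial>lborel)"
      using int(1)[OF t(2)] t
      by (intro integral_mult_test_increment[OF _ \<phi>, symmetric]) (auto simp: K_def)
    also have "\<dots> = - (\<integral>p. (u (p + t *\<^sub>R e) - u p) * \<phi> p \<partial>lborel)"
      using ii i0 i1 e1 by (simp add: left_diff_distrib right_diff_distrib)
    also have "(\<integral>p. (u (p + t *\<^sub>R e) - u p) * \<phi> p \<partial>lborel)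
       = (\<integral>p. (LINT s:{0..t}|lborel. v (p + s *\<^sub>R e)) * \<phi> p \<partial>lborel)"
    proof (rule integral_cong_AE)
      have "AE p in lborel. p \<in> U \<and> p + t *\<^sub>R e \<in> U \<longrightarrow>
         u (p + t *\<^sub>R e) - u p = (LINT s:{0..t}|lborel. v (p + s *\<^sub>R e))"
        using l t by (auto simp: line_deriv_def elim!: allE[of _ t] eventually_mono)
      then show "AE p in lborel. (u (p + t *\<^sub>R e) - u p) * \<phi> p = (LINT s:{0..t}|lborel. v (p + s *\<^sub>R e)) * \<phi> p"
      proof eventually_elim
        case (elim p)
        show ?case
        proof (cases "p \<in> K")
          case True
          then show ?thesis using elim K_t F(2) by auto
        qed (simp add: F(3))
      qed
    qed (unfold set_lebesgue_integral_def, measurable)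
    also have "\<dots> = (LINT s:{0..t}|lborel. (\<integral>p. v p * \<phi> (p - s *\<^sub>R e) \<partial>lborel))"
      by (rule integral_line_integral(1)[OF _ _ F(1) F(3) M(1) int(2)[OF t(2)]]) auto
    finally show "(LINT s:{0..t}|lborel. G s) = 0"
      unfolding G_def using si by (simp add: set_integral_add)
  qed
  then show "(\<integral>p. u p * frechet_derivative \<phi> (at p) e \<partial>lborel) = - (\<integral>p. v p * \<phi> p \<partial>lborel)"
    by (simp add: G_def)
qed

section \<open>The product rule on almost every line\<close>

text \<open>The product of the two integrals is an integral over a square of side t. The triangles r
  <= s and s <= r cover the square, and Fubini on each of them gives one term of the sum. The
  primitives are never differentiated.\<close>

lemma integral_product_by_parts:
  fixes v1 v2 :: "real \<Rightarrow> real"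
  assumes [measurable]: "v1 \<in> borel_measurable borel" "v2 \<in> borel_measurable borel"
    and v: "set_integrable lborel {0..t} v1" "set_integrable lborel {0..t} v2"
  shows "set_integrable lborel {0..t} (\<lambda>s. v1 s * (LINT r:{0..s}|lborel. v2 r))"
    and "(LINT s:{0..t}|lborel. v1 s * (LINT r:{0..s}|lborel. v2 r)) + (LINT s:{0..t}|lborel. v2 s * (LINT r:{0..s}|lborel. v1 r))
       = (LINT s:{0..t}|lborel. v1 s) * (LINT s:{0..t}|lborel. v2 s)"
proof -
  define a where "a s = indicator {0..t} s * v1 s" for s
  define b where "b s = indicator {0..t} s * v2 s" for s
  have [measurable]: "a \<in> borel_measurable borel" "b \<in> borel_measurable borel"
    unfolding a_def b_def by measurable
  have ab: "integrable lborel a" "integrable lborel b"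
    using v by (auto simp: set_integrable_def a_def[abs_def] b_def[abs_def])
  have prod: "integrable (lborel \<Otimes>\<^sub>M lborel) (\<lambda>(s, r). a s * b r)"
    using ab by (intro lborel_pair.Fubini_integrable) (auto simp: abs_mult)
  have i1: "integrable (lborel \<Otimes>\<^sub>M lborel) (\<lambda>(s, r). a s * b r * indicator {z. snd z \<le> fst z} (s, r))"
    by (rule Bochner_Integration.integrable_bound[OF prod]) (auto simp: indicator_def)
  have i2: "integrable (lborel \<Otimes>\<^sub>M lborel) (\<lambda>(s, r). a s * b r * indicator {z. fst z \<le> snd z} (s, r))"
    by (rule Bochner_Integration.integrable_bound[OF prod]) (auto simp: indicator_def)
  have e1: "(\<integral>r. a s * b r * indicator {z. snd z \<le> fst z} (s, r) \<partial>lborel) = indicator {0..t} s *\<^sub>R (v1 s * (LINT r:{0..s}|lborel. v2 r))" for s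
  proof -
    have "(\<integral>r. a s * b r * indicator {z. snd z \<le> fst z} (s, r) \<partial>lborel) = (\<integral>r. a s * (b r * indicator {..s} r) \<partial>lborel)"
      by (intro Bochner_Integration.integral_cong) (auto simp: indicator_def)
    also have "\<dots> = a s * (\<integral>r. b r * indicator {..s} r \<partial>lborel)"
      by (rule integral_mult_right_zero)
    also have "\<dots> = indicator {0..t} s *\<^sub>R (v1 s * (LINT r:{0..s}|lborel. v2 r))"
    proof (cases "s \<in> {0..t}")
      case True
      then have "(\<integral>r. b r * indicator {..s} r \<partial>lborel) = (LINT r:{0..s}|lborel. v2 r)"
        unfolding set_lebesgue_integral_def
        by (intro Bochner_Integration.integral_cong) (auto simp: b_def indicator_def)
      then show ?thesis using True by (simp add: a_def)
    qed (simp add: a_def)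
    finally show ?thesis .
  qed
  have e2: "(\<integral>s. a s * b r * indicator {z. fst z \<le> snd z} (s, r) \<partial>lborel) = indicator {0..t} r *\<^sub>R (v2 r * (LINT s:{0..r}|lborel. v1 s))" for r
  proof -
    have "(\<integral>s. a s * b r * indicator {z. fst z \<le> snd z} (s, r) \<partial>lborel) = (\<integral>s. b r * (a s * indicator {..r} s) \<partial>lborel)"
      by (intro Bochner_Integration.integral_cong) (auto simp: indicator_def)
    also have "\<dots> = b r * (\<integral>s. a s * indicator {..r} s \<partial>lborel)"
      by (rule integral_mult_right_zero)
    also have "\<dots> = indicator {0..t} r *\<^sub>R (v2 r * (LINT s:{0..r}|lborel. v1 s))"
    proof (cases "r \<in> {0..t}")
      case True
      then have "(\<integral>s. a s * indicator {..r} s \<partial>lborel) = (LINT s:{0..r}|lborel. v1 s)"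
        unfolding set_lebesgue_integral_def
        by (intro Bochner_Integration.integral_cong) (auto simp: a_def indicator_def)
      then show ?thesis using True by (simp add: b_def)
    qed (simp add: b_def)
    finally show ?thesis .
  qed
  show "set_integrable lborel {0..t} (\<lambda>s. v1 s * (LINT r:{0..s}|lborel. v2 r))"
    using lborel_pair.integrable_fst[OF i1] unfolding e1 by (simp add: set_integrable_def)
  have "(LINT s:{0..t}|lborel. v1 s * (LINT r:{0..s}|lborel. v2 r)) + (LINT s:{0..t}|lborel. v2 s * (LINT r:{0..s}|lborel. v1 r))
     = (\<integral>z. (case z of (s, r) \<Rightarrow> a s * b r * indicator {z. snd z \<le> fst z} (s, r)) \<partial>(lborel \<Otimes>\<^sub>M lborel))
     + (\<integral>z. (case z of (s, r) \<Rightarrow> a s * b r * indicator {z. fst z \<le> snd z} (s, r)) \<partial>(lborel \<Otimes>\<^sub>M lborel))"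
    using lborel_pair.integral_fst[OF i1] lborel_pair.integral_snd[OF i2] unfolding e1 e2
    by (simp add: set_lebesgue_integral_def)
  also have "\<dots> = (\<integral>z. (case z of (s, r) \<Rightarrow> a s * b r * indicator {z. snd z \<le> fst z} (s, r))
     + (case z of (s, r) \<Rightarrow> a s * b r * indicator {z. fst z \<le> snd z} (s, r)) \<partial>(lborel \<Otimes>\<^sub>M lborel))"
    by (rule Bochner_Integration.integral_add[OF i1 i2, symmetric])
  also have "\<dots> = (\<integral>z. (case z of (s, r) \<Rightarrow> a s * b r) \<partial>(lborel \<Otimes>\<^sub>M lborel))"
  proof (rule integral_cong_AE)
    \<comment> \<open>The diagonal belongs to both triangles, so their indicators add up to 1 only
      off this null set.\<close>
    have "AE r in lborel. s \<noteq> r" for s :: real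
      using AE_lborel_singleton[of s] by eventually_elim auto
    then have "AE s in lborel. AE r in lborel. s \<noteq> (r::real)" by simp
    then have "AE z in lborel \<Otimes>\<^sub>M lborel. fst z \<noteq> (snd z::real)"
    proof (intro lborel_pair.AE_pair_measure)
      show "{z \<in> space (lborel \<Otimes>\<^sub>M lborel). fst z \<noteq> (snd z::real)} \<in> sets (lborel \<Otimes>\<^sub>M lborel)"
        by measurable
    qed auto
    then show "AE z in lborel \<Otimes>\<^sub>M lborel. (case z of (s, r) \<Rightarrow> a s * b r * indicator {z. snd z \<le> fst z} (s, r))
     + (case z of (s, r) \<Rightarrow> a s * b r * indicator {z. fst z \<le> snd z} (s, r)) = (case z of (s, r) \<Rightarrow> a s * b r)"
      by eventually_elim (auto simp: indicator_def)
  qed measurable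
  also have "\<dots> = (\<integral>s. (\<integral>r. a s * b r \<partial>lborel) \<partial>lborel)"
    using lborel_pair.integral_fst[OF prod] by simp
  also have "\<dots> = (LINT s:{0..t}|lborel. v1 s) * (LINT s:{0..t}|lborel. v2 s)"
    by (simp add: set_lebesgue_integral_def a_def b_def)
  finally show "(LINT s:{0..t}|lborel. v1 s * (LINT r:{0..s}|lborel. v2 r)) + (LINT s:{0..t}|lborel. v2 s * (LINT r:{0..s}|lborel. v1 r))
       = (LINT s:{0..t}|lborel. v1 s) * (LINT s:{0..t}|lborel. v2 s)" .
qed

text \<open>\<open>line_deriv\<close> fixes the length first and then discards a null set of
  starting points, which depends on the length. Fubini exchanges the two: almost every starting
  point is good for almost every length, so along its segment u agrees almost everywhere with a
  primitive of v.\<close>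

lemma line_deriv_AE_initial:
  fixes u v :: "'a::euclidean_space \<Rightarrow> real"
  assumes [measurable]: "u \<in> borel_measurable borel" "v \<in> borel_measurable borel"
    and U: "open U" "convex U" and l: "line_deriv u v e U" and t: "0 < t"
  shows "AE p in lborel. p \<in> U \<and> p + t *\<^sub>R e \<in> U \<longrightarrow>
     (AE s in lborel. s \<in> {0..t} \<longrightarrow> u (p + s *\<^sub>R e) = u p + (LINT r:{0..s}|lborel. v (p + r *\<^sub>R e)))"
proof -
  have [measurable]: "U \<in> sets borel" using U by auto
  let ?P = "\<lambda>p s. s > 0 \<and> p \<in> U \<and> p + s *\<^sub>R e \<in> U \<longrightarrow> u (p + s *\<^sub>R e) = u p + (LINT r:{0..s}|lborel. v (p + r *\<^sub>R e))"
  have [measurable]: "(\<lambda>(p, s). LINT r:{0..s}|lborel. v (p + r *\<^sub>R e)) \<in> borel_measurable (lborel \<Otimes>\<^sub>M lborel)"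
  proof -
    have "(\<lambda>(p, s). \<integral>r. (if 0 \<le> r \<and> r \<le> s then 1 else 0) *\<^sub>R v (p + r *\<^sub>R e) \<partial>lborel) \<in> borel_measurable (lborel \<Otimes>\<^sub>M lborel)"
      by measurable
    also have "(\<lambda>(p, s). \<integral>r. (if 0 \<le> r \<and> r \<le> s then 1 else 0) *\<^sub>R v (p + r *\<^sub>R e) \<partial>lborel)
       = (\<lambda>(p, s). LINT r:{0..s}|lborel. v (p + r *\<^sub>R e))"
      unfolding set_lebesgue_integral_def
      by (auto simp: fun_eq_iff indicator_def intro!: Bochner_Integration.integral_cong)
    finally show ?thesis .
  qed
  have "AE p in lborel. ?P p s" for s
  proof (cases "s > 0")
    case True
    with l have "AE p in lborel. p \<in> U \<and> p + s *\<^sub>R e \<in> U \<longrightarrow>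
     set_integrable lborel {0..s} (\<lambda>s. v (p + s *\<^sub>R e)) \<and>
     u (p + s *\<^sub>R e) - u p = (LINT r:{0..s}|lborel. v (p + r *\<^sub>R e))"
      by (simp add: line_deriv_def)
    then show ?thesis by eventually_elim auto
  qed simp
  then have "AE s in lborel. AE p in lborel. ?P p s" by simp
  then have "AE p in lborel. AE s in lborel. ?P p s"
  proof (subst lborel_pair.AE_commute)
    show "{x \<in> space (lborel \<Otimes>\<^sub>M lborel). ?P (fst x) (snd x)} \<in> sets (lborel \<Otimes>\<^sub>M lborel)"
      by measurable
  qed
  then show ?thesis
  proof eventually_elim
    case (elim p)
    show ?case
    proof
      assume p: "p \<in> U \<and> p + t *\<^sub>R e \<in> U"
      from elim AE_lborel_singleton[of 0]
      show "AE s in lborel. s \<in> {0..t} \<longrightarrow> u (p + s *\<^sub>R e) = u p + (LINT r:{0..s}|lborel. v (p + r *\<^sub>R e))"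
      proof eventually_elim
        case (elim s)
        show ?case
        proof
          assume s: "s \<in> {0..t}"
          have "sweep e {p} t \<subseteq> U" using p t by (intro sweep_subset_convex U) auto
          then have "p + s *\<^sub>R e \<in> U" using sweepI[of p "{p}" s t e] s by auto
          then show "u (p + s *\<^sub>R e) = u p + (LINT r:{0..s}|lborel. v (p + r *\<^sub>R e))"
            using elim p s by auto
        qed
      qed
    qed
  qed
qed

text \<open>Along almost every segment u1 and u2 agree almost everywhere with primitives of v1 and
  v2, so the product rule is the integration by parts above. In particular v1 and v2 may be
  unbounded, and the integrability of the new derivative along the segment comes out as part of the
  argument.\<close>

lemma line_deriv_mult:
  fixes u1 v1 u2 v2 :: "'a::euclidean_space \<Rightarrow> real"
  assumes m[measurable]: "u1 \<in> borel_measurable borel" "v1 \<in> borel_measurable borel"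
      "u2 \<in> borel_measurable borel" "v2 \<in> borel_measurable borel"
    and U: "open U" "convex U" and l1: "line_deriv u1 v1 e U" and l2: "line_deriv u2 v2 e U"
  shows "line_deriv (\<lambda>p. u1 p * u2 p) (\<lambda>p. v1 p * u2 p + u1 p * v2 p) e U"
  unfolding line_deriv_def
proof (intro allI impI)
  fix t :: real assume t: "0 < t"
  from l1 l2 t have
    "AE p in lborel. p \<in> U \<and> p + t *\<^sub>R e \<in> U \<longrightarrow> set_integrable lborel {0..t} (\<lambda>s. v1 (p + s *\<^sub>R e)) \<and>
     u1 (p + t *\<^sub>R e) - u1 p = (LINT s:{0..t}|lborel. v1 (p + s *\<^sub>R e))"
    "AE p in lborel. p \<in> U \<and> p + t *\<^sub>R e \<in> U \<longrightarrow> set_integrable lborel {0..t} (\<lambda>s. v2 (p + s *\<^sub>R e)) \<and>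
     u2 (p + t *\<^sub>R e) - u2 p = (LINT s:{0..t}|lborel. v2 (p + s *\<^sub>R e))"
    by (simp_all add: line_deriv_def)
  with line_deriv_AE_initial[OF m(1,2) U l1 t] line_deriv_AE_initial[OF m(3,4) U l2 t]
  show "AE p in lborel. p \<in> U \<and> p + t *\<^sub>R e \<in> U \<longrightarrow>
     set_integrable lborel {0..t} (\<lambda>s. v1 (p + s *\<^sub>R e) * u2 (p + s *\<^sub>R e) + u1 (p + s *\<^sub>R e) * v2 (p + s *\<^sub>R e)) \<and>
     u1 (p + t *\<^sub>R e) * u2 (p + t *\<^sub>R e) - u1 p * u2 p =
       (LINT s:{0..t}|lborel. v1 (p + s *\<^sub>R e) * u2 (p + s *\<^sub>R e) + u1 (p + s *\<^sub>R e) * v2 (p + s *\<^sub>R e))"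
  proof eventually_elim
    case (elim p)
    show ?case
    proof
      assume p: "p \<in> U \<and> p + t *\<^sub>R e \<in> U"
      define a where "a s = v1 (p + s *\<^sub>R e)" for s
      define b where "b s = v2 (p + s *\<^sub>R e)" for s
      have [measurable]: "a \<in> borel_measurable borel" "b \<in> borel_measurable borel"
        unfolding a_def b_def by measurable
      have ab: "set_integrable lborel {0..t} a" "set_integrable lborel {0..t} b"
        and t12: "u1 (p + t *\<^sub>R e) = u1 p + (LINT s:{0..t}|lborel. a s)" "u2 (p + t *\<^sub>R e) = u2 p + (LINT s:{0..t}|lborel. b s)"
        and s1: "AE s in lborel. s \<in> {0..t} \<longrightarrow> u1 (p + s *\<^sub>R e) = u1 p + (LINT r:{0..s}|lborel. a r)"
        and s2: "AE s in lborel. s \<in> {0..t} \<longrightarrow> u2 (p + s *\<^sub>R e) = u2 p + (LINT r:{0..s}|lborel. b r)"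
        using elim p by (auto simp: a_def[abs_def] b_def[abs_def] algebra_simps)
      note P = integral_product_by_parts[OF _ _ ab] integral_product_by_parts(1)[OF _ _ ab(2,1)]
      \<comment> \<open>The product rule with u1 and u2 replaced by their primitives: first the
        terms with the initial values, then those with the running integrals.\<close>
      let ?F = "\<lambda>s. (a s * u2 p + u1 p * b s) + (a s * (LINT r:{0..s}|lborel. b r) + b s * (LINT r:{0..s}|lborel. a r))"
      have i1: "set_integrable lborel {0..t} (\<lambda>s. a s * u2 p + u1 p * b s)"
        using ab by (intro set_integral_add) auto
      have i2: "set_integrable lborel {0..t} (\<lambda>s. a s * (LINT r:{0..s}|lborel. b r) + b s * (LINT r:{0..s}|lborel. a r))"
        using P by (intro set_integral_add) auto
      have iF: "set_integrable lborel {0..t} ?F" by (rule set_integral_add(1)[OF i1 i2])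
      have "(LINT s:{0..t}|lborel. ?F s) = (LINT s:{0..t}|lborel. a s * u2 p + u1 p * b s)
         + (LINT s:{0..t}|lborel. a s * (LINT r:{0..s}|lborel. b r) + b s * (LINT r:{0..s}|lborel. a r))"
        by (rule set_integral_add(2)[OF i1 i2])
      also have "\<dots> = (LINT s:{0..t}|lborel. a s) * u2 p + u1 p * (LINT s:{0..t}|lborel. b s) + (LINT s:{0..t}|lborel. a s) * (LINT s:{0..t}|lborel. b s)"
        using P ab by (simp add: set_integral_add)
      finally have F: "(LINT s:{0..t}|lborel. ?F s) = u1 (p + t *\<^sub>R e) * u2 (p + t *\<^sub>R e) - u1 p * u2 p"
        by (simp add: t12 algebra_simps)
      have eq: "AE s in lborel. indicator {0..t} s *\<^sub>R ?F s = indicator {0..t} s *\<^sub>R (v1 (p + s *\<^sub>R e) * u2 (p + s *\<^sub>R e) + u1 (p + s *\<^sub>R e) * v2 (p + s *\<^sub>R e))"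
        using s1 s2 by eventually_elim (auto simp: indicator_def a_def[symmetric] b_def[symmetric] algebra_simps)
      have mF: "(\<lambda>s. indicator {0..t} s *\<^sub>R ?F s) \<in> borel_measurable lborel"
        using iF by (simp add: set_integrable_def borel_measurable_integrable)
      have "set_integrable lborel {0..t} (\<lambda>s. v1 (p + s *\<^sub>R e) * u2 (p + s *\<^sub>R e) + u1 (p + s *\<^sub>R e) * v2 (p + s *\<^sub>R e))"
        unfolding set_integrable_def
        by (rule Bochner_Integration.integrable_cong_AE_imp[OF iF[unfolded set_integrable_def] _ eq]) measurable
      moreover have "(LINT s:{0..t}|lborel. ?F s) = (LINT s:{0..t}|lborel. v1 (p + s *\<^sub>R e) * u2 (p + s *\<^sub>R e) + u1 (p + s *\<^sub>R e) * v2 (p + s *\<^sub>R e))"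
        unfolding set_lebesgue_integral_def[of lborel "{0..t}"] by (rule integral_cong_AE[OF mF _ eq]) measurable
      ultimately show "set_integrable lborel {0..t} (\<lambda>s. v1 (p + s *\<^sub>R e) * u2 (p + s *\<^sub>R e) + u1 (p + s *\<^sub>R e) * v2 (p + s *\<^sub>R e)) \<and>
        u1 (p + t *\<^sub>R e) * u2 (p + t *\<^sub>R e) - u1 p * u2 p =
         (LINT s:{0..t}|lborel. v1 (p + s *\<^sub>R e) * u2 (p + s *\<^sub>R e) + u1 (p + s *\<^sub>R e) * v2 (p + s *\<^sub>R e))"
        using F by simp
    qed
  qed
qed

section \<open>Translations, classical derivatives and superpositions\<close>

lemma line_deriv_translate:
  assumes "line_deriv u v e U" "\<And>p. p \<in> U \<Longrightarrow> p + c \<in> U"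
  shows "line_deriv (\<lambda>p. u (p + c)) (\<lambda>p. v (p + c)) e U"
  unfolding line_deriv_def
proof (intro allI impI)
  fix t :: real assume "0 < t"
  with assms(1) have "AE p in lborel. p \<in> U \<and> p + t *\<^sub>R e \<in> U \<longrightarrow>
     set_integrable lborel {0..t} (\<lambda>s. v (p + s *\<^sub>R e)) \<and>
     u (p + t *\<^sub>R e) - u p = (LINT s:{0..t}|lborel. v (p + s *\<^sub>R e))"
    by (simp add: line_deriv_def)
  from AE_lborel_add[OF this, of c]
  show "AE p in lborel. p \<in> U \<and> p + t *\<^sub>R e \<in> U \<longrightarrow>
     set_integrable lborel {0..t} (\<lambda>s. v (p + s *\<^sub>R e + c)) \<and>
     u (p + t *\<^sub>R e + c) - u (p + c) = (LINT s:{0..t}|lborel. v (p + s *\<^sub>R e + c))"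
    by eventually_elim (use assms(2)[of "_ + t *\<^sub>R e"] assms(2) in \<open>auto simp: ac_simps\<close>)
qed

lemma line_deriv_classical:
  fixes u v :: "'a::euclidean_space \<Rightarrow> real"
  assumes "\<And>p. (u has_derivative u' p) (at p)" "\<And>p. v p = u' p e" "continuous_on UNIV v"
  shows "line_deriv u v e U"
  unfolding line_deriv_def
proof (intro allI impI AE_I2)
  fix t :: real and p assume t: "0 < t"
  have c: "continuous_on {0..t} (\<lambda>s. v (p + s *\<^sub>R e))"
    by (rule continuous_on_compose2[OF assms(3)]) (auto intro!: continuous_intros)
  have "((\<lambda>s. u (p + s *\<^sub>R e)) has_vector_derivative v (p + s *\<^sub>R e)) (at s within {0..t})" for s
  proof -
    interpret L: bounded_linear "u' (p + s *\<^sub>R e)"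
      by (rule has_derivative_bounded_linear[OF assms(1)])
    have "((\<lambda>s. p + s *\<^sub>R e) has_derivative (\<lambda>h. h *\<^sub>R e)) (at s within {0..t})"
      by (auto intro!: derivative_eq_intros)
    from has_derivative_compose[OF this assms(1)] show ?thesis
      by (simp add: has_vector_derivative_def linear_scale[OF L.linear] assms(2))
  qed
  from integral_FTC_atLeastAtMost[OF _ this c] t borel_integrable_atLeastAtMost'[OF c]
  show "set_integrable lborel {0..t} (\<lambda>s. v (p + s *\<^sub>R e)) \<and>
     u (p + t *\<^sub>R e) - u p = (LINT s:{0..t}|lborel. v (p + s *\<^sub>R e))"
    by (simp add: set_lebesgue_integral_def)
qed

text \<open>The weak identity is linear in the pair (u, v), so it can be integrated over a parameter
  as soon as Fubini applies to both sides. The two finiteness conditions guarantee this for every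
  test function, since such a function is bounded and supported in a compact subset of U.\<close>

lemma weak_deriv_superposition:
  fixes u v :: "'a::euclidean_space \<times> 'b \<Rightarrow> real" and \<nu> :: "'b measure"
  assumes \<nu>: "sigma_finite_measure \<nu>"
    and m[measurable]: "u \<in> borel_measurable (borel \<Otimes>\<^sub>M \<nu>)" "v \<in> borel_measurable (borel \<Otimes>\<^sub>M \<nu>)"
    and w: "AE y in \<nu>. weak_deriv_borel (\<lambda>p. u (p, y)) (\<lambda>p. v (p, y)) e U"
    and fin: "\<And>K. compact K \<Longrightarrow> K \<subseteq> U \<Longrightarrow>
       (\<integral>\<^sup>+p. (\<integral>\<^sup>+y. ennreal \<bar>u (p, y)\<bar> \<partial>\<nu>) * indicator K p \<partial>lborel) < \<infinity>"
       "\<And>K. compact K \<Longrightarrow> K \<subseteq> U \<Longrightarrow>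
       (\<integral>\<^sup>+p. (\<integral>\<^sup>+y. ennreal \<bar>v (p, y)\<bar> \<partial>\<nu>) * indicator K p \<partial>lborel) < \<infinity>"
  shows "weak_deriv_borel (\<lambda>p. \<integral>y. u (p, y) \<partial>\<nu>) (\<lambda>p. \<integral>y. v (p, y) \<partial>\<nu>) e U"
proof -
  interpret \<nu>: sigma_finite_measure \<nu> by fact
  interpret P: pair_sigma_finite "lborel :: 'a measure" \<nu>
    by (simp add: pair_sigma_finite_def sigma_finite_lborel \<nu>)
  have [measurable]: "u \<in> borel_measurable (lborel \<Otimes>\<^sub>M \<nu>)" "v \<in> borel_measurable (lborel \<Otimes>\<^sub>M \<nu>)"
    using m by (auto cong: measurable_cong_sets sets_pair_measure_cong)
  have prod: "integrable (lborel \<Otimes>\<^sub>M \<nu>) (\<lambda>(p, y). f (p, y) * \<psi> p)"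
    if [measurable]: "f \<in> borel_measurable (lborel \<Otimes>\<^sub>M \<nu>)" "\<psi> \<in> borel_measurable borel"
    and \<psi>: "\<And>p. p \<notin> K \<Longrightarrow> \<psi> p = 0" "\<And>p. \<bar>\<psi> p\<bar> \<le> M" and K: "compact K"
    and f: "(\<integral>\<^sup>+p. (\<integral>\<^sup>+y. ennreal \<bar>f (p, y)\<bar> \<partial>\<nu>) * indicator K p \<partial>lborel) < \<infinity>"
    for f and \<psi> :: "'a \<Rightarrow> real" and K M
  proof (rule integrableI_bounded)
    have [measurable]: "K \<in> sets borel" using K by (simp add: borel_compact)
    have M0: "0 \<le> M" using \<psi>(2)[of 0] by linarith
    have "(\<integral>\<^sup>+z. ennreal (norm (case z of (p, y) \<Rightarrow> f (p, y) * \<psi> p)) \<partial>(lborel \<Otimes>\<^sub>M \<nu>))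
      = (\<integral>\<^sup>+p. \<integral>\<^sup>+y. ennreal \<bar>f (p, y)\<bar> * ennreal \<bar>\<psi> p\<bar> \<partial>\<nu> \<partial>lborel)"
      by (subst \<nu>.nn_integral_fst[symmetric]) (auto simp: abs_mult ennreal_mult)
    also have "\<dots> \<le> (\<integral>\<^sup>+p. ennreal M * ((\<integral>\<^sup>+y. ennreal \<bar>f (p, y)\<bar> \<partial>\<nu>) * indicator K p) \<partial>lborel)"
    proof (rule nn_integral_mono)
      fix p :: 'a
      have "(\<integral>\<^sup>+y. ennreal \<bar>f (p, y)\<bar> * ennreal \<bar>\<psi> p\<bar> \<partial>\<nu>) = (\<integral>\<^sup>+y. ennreal \<bar>f (p, y)\<bar> \<partial>\<nu>) * ennreal \<bar>\<psi> p\<bar>"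
        by (rule nn_integral_multc) measurable
      also have "\<dots> \<le> (\<integral>\<^sup>+y. ennreal \<bar>f (p, y)\<bar> \<partial>\<nu>) * (ennreal M * indicator K p)"
        using \<psi> by (intro mult_left_mono) (auto simp: indicator_def intro: ennreal_leI)
      finally show "(\<integral>\<^sup>+y. ennreal \<bar>f (p, y)\<bar> * ennreal \<bar>\<psi> p\<bar> \<partial>\<nu>) \<le> ennreal M * ((\<integral>\<^sup>+y. ennreal \<bar>f (p, y)\<bar> \<partial>\<nu>) * indicator K p)"
        by (simp add: ac_simps)
    qed
    also have "\<dots> < \<infinity>" using f by (simp add: nn_integral_cmult ennreal_mult_less_top)
    finally show "(\<integral>\<^sup>+z. ennreal (norm (case z of (p, y) \<Rightarrow> f (p, y) * \<psi> p)) \<partial>(lborel \<Otimes>\<^sub>M \<nu>)) < \<infinity>" .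
  qed measurable
  have loc: "locally_integrable_borel (\<lambda>p. \<integral>y. f (p, y) \<partial>\<nu>) U"
    if [measurable]: "f \<in> borel_measurable (lborel \<Otimes>\<^sub>M \<nu>)"
    and f: "\<And>K. compact K \<Longrightarrow> K \<subseteq> U \<Longrightarrow> (\<integral>\<^sup>+p. (\<integral>\<^sup>+y. ennreal \<bar>f (p, y)\<bar> \<partial>\<nu>) * indicator K p \<partial>lborel) < \<infinity>" for f
    unfolding locally_integrable_borel_def
  proof (intro conjI allI impI)
    have "(\<lambda>p. \<integral>y. f (p, y) \<partial>\<nu>) \<in> borel_measurable lborel" by measurable
    then show "(\<lambda>p. \<integral>y. f (p, y) \<partial>\<nu>) \<in> borel_measurable borel" by simp
    fix K assume K: "compact K \<and> K \<subseteq> U"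
    have "integrable (lborel \<Otimes>\<^sub>M \<nu>) (\<lambda>(p, y). f (p, y) * indicator K p)"
      using K f by (intro prod[where K=K and M=1]) (auto intro!: borel_measurable_indicator simp: borel_compact split: split_indicator)
    from P.integrable_fst[OF this] show "set_integrable lborel K (\<lambda>p. \<integral>y. f (p, y) \<partial>\<nu>)"
      by (simp add: set_integrable_def mult.commute)
  qed
  show ?thesis unfolding weak_deriv_borel_def
  proof (intro conjI allI impI)
    show "locally_integrable_borel (\<lambda>p. \<integral>y. u (p, y) \<partial>\<nu>) U" "locally_integrable_borel (\<lambda>p. \<integral>y. v (p, y) \<partial>\<nu>) U"
      using fin by (auto intro!: loc)
    fix \<phi> assume \<phi>: "test_function U \<phi>"
    note F = test_function_facts[OF \<phi>]
    note [measurable] = test_function_measurable[OF \<phi>]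
    obtain M where M: "\<And>p. \<bar>\<phi> p\<bar> \<le> M" "\<And>p. \<bar>frechet_derivative \<phi> (at p) e\<bar> \<le> M"
      using test_function_bounds[OF \<phi>] by metis
    have i: "integrable (lborel \<Otimes>\<^sub>M \<nu>) (\<lambda>(p, y). u (p, y) * frechet_derivative \<phi> (at p) e)"
      by (rule prod[OF _ _ F(7) M(2) F(1) fin(1)[OF F(1,2)]]) measurable
    have j: "integrable (lborel \<Otimes>\<^sub>M \<nu>) (\<lambda>(p, y). v (p, y) * \<phi> p)"
      by (rule prod[OF _ _ F(3) M(1) F(1) fin(2)[OF F(1,2)]]) measurable
    have "(\<integral>p. (\<integral>y. u (p, y) \<partial>\<nu>) * frechet_derivative \<phi> (at p) e \<partial>lborel)
       = (\<integral>p. (\<integral>y. u (p, y) * frechet_derivative \<phi> (at p) e \<partial>\<nu>) \<partial>lborel)" by simp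
    also have "\<dots> = (\<integral>y. (\<integral>p. u (p, y) * frechet_derivative \<phi> (at p) e \<partial>lborel) \<partial>\<nu>)"
      by (rule P.Fubini_integral[OF i, symmetric])
    also have "\<dots> = (\<integral>y. - (\<integral>p. v (p, y) * \<phi> p \<partial>lborel) \<partial>\<nu>)"
    proof (rule integral_cong_AE)
      show "AE y in \<nu>. (\<integral>p. u (p, y) * frechet_derivative \<phi> (at p) e \<partial>lborel) = - (\<integral>p. v (p, y) * \<phi> p \<partial>lborel)"
        using w by eventually_elim (use \<phi> in \<open>simp add: weak_deriv_borel_def\<close>)
      show "(\<lambda>y. \<integral>p. u (p, y) * frechet_derivative \<phi> (at p) e \<partial>lborel) \<in> borel_measurable \<nu>"
        using P.integrable_snd[OF i] by (simp add: borel_measurable_integrable)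
      show "(\<lambda>y. - (\<integral>p. v (p, y) * \<phi> p \<partial>lborel)) \<in> borel_measurable \<nu>"
        using P.integrable_snd[OF j] by (simp add: borel_measurable_integrable)
    qed
    also have "\<dots> = - (\<integral>p. (\<integral>y. v (p, y) * \<phi> p \<partial>\<nu>) \<partial>lborel)"
      using P.Fubini_integral[OF j] by simp
    finally show "(\<integral>p. (\<integral>y. u (p, y) \<partial>\<nu>) * frechet_derivative \<phi> (at p) e \<partial>lborel) = - (\<integral>p. (\<integral>y. v (p, y) \<partial>\<nu>) * \<phi> p \<partial>lborel)"
      by simp
  qed
qed

section \<open>Strict convexity and the kinetic weight\<close>

lemma orthonormal3_expand:
  assumes "orthonormal3 a b c"
  shows "x = (x \<bullet> a) *\<^sub>R a + (x \<bullet> b) *\<^sub>R b + (x \<bullet> c) *\<^sub>R c"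
proof -
  have n: "norm a = 1" "norm b = 1" "norm c = 1" and o: "a \<bullet> b = 0" "a \<bullet> c = 0" "b \<bullet> c = 0"
    using assms by (auto simp: orthonormal3_def orthogonal_def)
  have sq: "a \<bullet> a = 1" "b \<bullet> b = 1" "c \<bullet> c = 1" using n by (auto simp: dot_square_norm)
  have d: "a \<noteq> b" "a \<noteq> c" "b \<noteq> c" using sq o by auto
  let ?B = "{a, b, c}"
  have po: "pairwise orthogonal ?B"
    using o by (auto simp: pairwise_def orthogonal_def inner_commute)
  have "independent ?B"
    using n by (intro pairwise_orthogonal_independent[OF po]) auto
  then have "span ?B = UNIV"
    using d card_eq_dim[of ?B "UNIV :: (real^3) set"] by (auto simp: dim_UNIV)
  then have "x \<in> span ?B" by simp
  then have "(\<Sum>i\<in>?B. (x \<bullet> i) *\<^sub>R i) = x"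
    by (intro orthonormal_basis_expand[OF po]) (use n in auto)
  then show ?thesis using d by (simp add: inner_commute algebra_simps)
qed

lemma orthonormal3_inner:
  assumes "orthonormal3 a b c"
  shows "a \<bullet> a = 1" "b \<bullet> b = 1" "c \<bullet> c = 1" "a \<bullet> b = 0" "a \<bullet> c = 0" "b \<bullet> c = 0"
    "b \<bullet> a = 0" "c \<bullet> a = 0" "c \<bullet> b = 0"
  using assms by (auto simp: orthonormal3_def orthogonal_def dot_square_norm inner_commute)

lemma orthonormal3_inner_expand:
  assumes "orthonormal3 a b c"
  shows "x \<bullet> y = (x \<bullet> a) * (y \<bullet> a) + (x \<bullet> b) * (y \<bullet> b) + (x \<bullet> c) * (y \<bullet> c)"
  by (subst orthonormal3_expand[OF assms, of x]) (simp add: inner_add_left inner_add_right inner_commute[of _ y])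

lemma isCont_tendsto_nhds: "isCont f x \<Longrightarrow> (f \<longlongrightarrow> f x) (nhds x)"
  using tendsto_at_iff_tendsto_nhds[of f x] by (simp add: isCont_def)

section \<open>Second derivatives of a C^2 graph\<close>

text \<open>\<open>g'' v z w\<close> is the derivative of \<open>\<lambda>z. g' z v\<close> at z in
  the direction w. It is linear in w by construction; linearity in v follows from uniqueness of
  derivatives and symmetry from the mean value theorem.\<close>

locale C2_graph =
  fixes g :: "real \<times> real \<Rightarrow> real" and g' g''
  assumes g1: "\<And>z. (g has_derivative g' z) (at z)"
    and g2: "\<And>z v. ((\<lambda>z. g' z v) has_derivative g'' v z) (at z)"
    and g3: "\<And>v w. continuous_on UNIV (\<lambda>z. g'' v z w)"
begin

lemma linear_g': "linear (g' z)" using has_derivative_linear[OF g1] .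
lemma linear_g'': "linear (g'' v z)" using has_derivative_linear[OF g2] .

lemma isCont_g'': "isCont (\<lambda>z. g'' v z w) z"
  using g3 unfolding continuous_on_eq_continuous_at[OF open_UNIV] by blast

lemma isCont_g: "isCont g z"
  using g1 by (rule has_derivative_continuous)

lemma g''_add: "g'' (v + w) z = (\<lambda>x. g'' v z x + g'' w z x)"
proof -
  have "((\<lambda>z. g' z v + g' z w) has_derivative (\<lambda>x. g'' v z x + g'' w z x)) (at z)"
    by (intro has_derivative_add g2)
  then have "((\<lambda>z. g' z (v + w)) has_derivative (\<lambda>x. g'' v z x + g'' w z x)) (at z)"
    by (simp add: linear_add[OF linear_g'])
  from has_derivative_unique[OF g2 this] show ?thesis .
qed

lemma g''_scale: "g'' (c *\<^sub>R v) z = (\<lambda>x. c * g'' v z x)"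
proof -
  have "((\<lambda>z. c * g' z v) has_derivative (\<lambda>x. c * g'' v z x)) (at z)"
    by (intro has_derivative_mult_right g2)
  then have "((\<lambda>z. g' z (c *\<^sub>R v)) has_derivative (\<lambda>x. c * g'' v z x)) (at z)"
    by (simp add: linear_scale[OF linear_g'])
  from has_derivative_unique[OF g2 this] show ?thesis .
qed

lemma deriv_line: "((\<lambda>s. g (z + s *\<^sub>R v)) has_real_derivative g' (z + s *\<^sub>R v) v) (at s within S)"
proof -
  have "((\<lambda>s. z + s *\<^sub>R v) has_derivative (\<lambda>h. h *\<^sub>R v)) (at s within S)"
    by (auto intro!: derivative_eq_intros)
  from has_derivative_compose[OF this g1] show ?thesis
    by (simp add: has_field_derivative_def linear_scale[OF linear_g'] mult_commute_abs)
qed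

lemma deriv_line2: "((\<lambda>s. g' (z + s *\<^sub>R v) w) has_real_derivative g'' w (z + s *\<^sub>R v) v) (at s within S)"
proof -
  have "((\<lambda>s. z + s *\<^sub>R v) has_derivative (\<lambda>h. h *\<^sub>R v)) (at s within S)"
    by (auto intro!: derivative_eq_intros)
  from has_derivative_compose[OF this g2] show ?thesis
    by (simp add: has_field_derivative_def linear_scale[OF linear_g''] mult_commute_abs)
qed

text \<open>The mean value theorem is applied twice, first along v to the difference of g and its
  shift by h w, then along w. The left side is symmetric in v and w while the right side is not, so
  letting h tend to 0 yields the symmetry of the second derivative.\<close>

lemma second_difference:
  assumes h: "0 < h"
  shows "\<exists>\<xi> \<eta>. 0 < \<xi> \<and> \<xi> < h \<and> 0 < \<eta> \<and> \<eta> < h \<and>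
    g (z + h *\<^sub>R v + h *\<^sub>R w) - g (z + h *\<^sub>R v) - g (z + h *\<^sub>R w) + g z = h * h * g'' v (z + \<xi> *\<^sub>R v + \<eta> *\<^sub>R w) w"
proof -
  have "((\<lambda>s. g ((z + h *\<^sub>R w) + s *\<^sub>R v) - g (z + s *\<^sub>R v)) has_real_derivative
     g' ((z + h *\<^sub>R w) + s *\<^sub>R v) v - g' (z + s *\<^sub>R v) v) (at s)" for s
    by (intro DERIV_diff deriv_line)
  from MVT2[OF h this] obtain \<xi> where \<xi>: "0 < \<xi>" "\<xi> < h"
    "g ((z + h *\<^sub>R w) + h *\<^sub>R v) - g (z + h *\<^sub>R v) - (g ((z + h *\<^sub>R w) + 0 *\<^sub>R v) - g (z + 0 *\<^sub>R v)) =
     (h - 0) * (g' ((z + h *\<^sub>R w) + \<xi> *\<^sub>R v) v - g' (z + \<xi> *\<^sub>R v) v)" by blast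
  have "((\<lambda>s. g' ((z + \<xi> *\<^sub>R v) + s *\<^sub>R w) v) has_real_derivative g'' v ((z + \<xi> *\<^sub>R v) + s *\<^sub>R w) w) (at s)" for s
    by (rule deriv_line2)
  from MVT2[OF h this] obtain \<eta> where \<eta>: "0 < \<eta>" "\<eta> < h"
    "g' ((z + \<xi> *\<^sub>R v) + h *\<^sub>R w) v - g' ((z + \<xi> *\<^sub>R v) + 0 *\<^sub>R w) v = (h - 0) * g'' v ((z + \<xi> *\<^sub>R v) + \<eta> *\<^sub>R w) w"
    by blast
  show ?thesis using \<xi> \<eta> by (intro exI[of _ \<xi>] exI[of _ \<eta>]) (simp add: ac_simps)
qed

lemma g''_symmetric: "g'' v z w = g'' w z v"
proof -
  define h where "h n = inverse (real (Suc n))" for n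
  have h: "0 < h n" for n by (simp add: h_def)
  have h0: "h \<longlonglongrightarrow> 0" unfolding h_def by (rule LIMSEQ_inverse_real_of_nat)
  have "\<exists>\<xi> \<eta> \<xi>' \<eta>'. 0 < \<xi> \<and> \<xi> < h n \<and> 0 < \<eta> \<and> \<eta> < h n \<and> 0 < \<xi>' \<and> \<xi>' < h n \<and> 0 < \<eta>' \<and> \<eta>' < h n \<and>
     g'' v (z + \<xi> *\<^sub>R v + \<eta> *\<^sub>R w) w = g'' w (z + \<xi>' *\<^sub>R w + \<eta>' *\<^sub>R v) v" for n
  proof -
    from second_difference[OF h, of n z v w] obtain \<xi> \<eta> where 1: "0 < \<xi>" "\<xi> < h n" "0 < \<eta>" "\<eta> < h n"
      "g (z + h n *\<^sub>R v + h n *\<^sub>R w) - g (z + h n *\<^sub>R v) - g (z + h n *\<^sub>R w) + g z = h n * h n * g'' v (z + \<xi> *\<^sub>R v + \<eta> *\<^sub>R w) w" by blast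
    from second_difference[OF h, of n z w v] obtain \<xi>' \<eta>' where 2: "0 < \<xi>'" "\<xi>' < h n" "0 < \<eta>'" "\<eta>' < h n"
      "g (z + h n *\<^sub>R w + h n *\<^sub>R v) - g (z + h n *\<^sub>R w) - g (z + h n *\<^sub>R v) + g z = h n * h n * g'' w (z + \<xi>' *\<^sub>R w + \<eta>' *\<^sub>R v) v" by blast
    have "h n * h n * g'' v (z + \<xi> *\<^sub>R v + \<eta> *\<^sub>R w) w = h n * h n * g'' w (z + \<xi>' *\<^sub>R w + \<eta>' *\<^sub>R v) v"
      using 1(5) 2(5) by (simp only: add.commute[of "h n *\<^sub>R v"] add.assoc)
    then have "g'' v (z + \<xi> *\<^sub>R v + \<eta> *\<^sub>R w) w = g'' w (z + \<xi>' *\<^sub>R w + \<eta>' *\<^sub>R v) v"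
      using h[of n] by simp
    then show ?thesis using 1(1-4) 2(1-4) by blast
  qed
  then obtain \<xi> \<eta> \<xi>' \<eta>' where x: "\<And>n. 0 < \<xi> n" "\<And>n. \<xi> n < h n" "\<And>n. 0 < \<eta> n" "\<And>n. \<eta> n < h n"
    "\<And>n. 0 < \<xi>' n" "\<And>n. \<xi>' n < h n" "\<And>n. 0 < \<eta>' n" "\<And>n. \<eta>' n < h n"
    "\<And>n. g'' v (z + \<xi> n *\<^sub>R v + \<eta> n *\<^sub>R w) w = g'' w (z + \<xi>' n *\<^sub>R w + \<eta>' n *\<^sub>R v) v" by metis
  have lim0: "f \<longlonglongrightarrow> 0" if "\<And>n. 0 < f n" "\<And>n. f n < h n" for f
    by (rule tendsto_sandwich[OF _ _ tendsto_const h0]) (use that in \<open>auto intro!: always_eventually less_imp_le\<close>)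
  have "(\<lambda>n. z + \<xi> n *\<^sub>R v + \<eta> n *\<^sub>R w) \<longlonglongrightarrow> z + 0 *\<^sub>R v + 0 *\<^sub>R w"
    by (intro tendsto_intros lim0 x)
  moreover note isCont_g''[where v=v and w=w and z=z]
  ultimately have "(\<lambda>n. g'' v (z + \<xi> n *\<^sub>R v + \<eta> n *\<^sub>R w) w) \<longlonglongrightarrow> g'' v z w"
    by (intro isCont_tendsto_compose[where g="\<lambda>z. g'' v z w"]) auto
  moreover have "(\<lambda>n. z + \<xi>' n *\<^sub>R w + \<eta>' n *\<^sub>R v) \<longlonglongrightarrow> z + 0 *\<^sub>R w + 0 *\<^sub>R v"
    by (intro tendsto_intros lim0 x)
  moreover note isCont_g''[where v=w and w=v and z=z]
  ultimately have "(\<lambda>n. g'' w (z + \<xi>' n *\<^sub>R w + \<eta>' n *\<^sub>R v) v) \<longlonglongrightarrow> g'' w z v"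
    by (intro isCont_tendsto_compose[where g="\<lambda>z. g'' w z v"]) auto
  with \<open>(\<lambda>n. g'' v (z + \<xi> n *\<^sub>R v + \<eta> n *\<^sub>R w) w) \<longlonglongrightarrow> g'' v z w\<close> show ?thesis
    unfolding x(9) using LIMSEQ_unique by blast
qed

abbreviation "guu z \<equiv> g'' (1, 0) z (1, 0)"
abbreviation "guv z \<equiv> g'' (1, 0) z (0, 1)"
abbreviation "gvv z \<equiv> g'' (0, 1) z (0, 1)"

lemma g''_coords: "g'' (x, y) z (x, y) = guu z * x\<^sup>2 + 2 * guv z * x * y + gvv z * y\<^sup>2"
proof -
  have e: "(x, y) = x *\<^sub>R (1, 0) + y *\<^sub>R (0, 1)" by simp
  have s: "g'' (0, 1) z (1, 0) = guv z" by (rule g''_symmetric)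
  show ?thesis
    by (subst (1 2) e) (simp add: g''_add g''_scale linear_add[OF linear_g''] linear_scale[OF linear_g''] s
        power2_eq_square algebra_simps del: scaleR_Pair)
qed

lemma g'_coords: "g' z (x, y) = g' z (1, 0) * x + g' z (0, 1) * y"
proof -
  have e: "(x, y) = x *\<^sub>R (1, 0) + y *\<^sub>R (0, 1)" by simp
  show ?thesis
    by (subst e) (simp add: linear_add[OF linear_g'] linear_scale[OF linear_g'] del: scaleR_Pair)
qed

lemma continuous_g': "continuous_on UNIV (\<lambda>z. g' z v)"
  using has_derivative_continuous[OF g2] by (simp add: continuous_at_imp_continuous_on)

text \<open>The smaller eigenvalue of a positive definite 2x2 form is at least determinant over
  trace. This bounds the form from below at z0, and by continuity half of the bound persists
  nearby.\<close>

lemma Hessian_positive_nearby: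
  assumes A: "guu z0 > 0" and d: "guu z0 * gvv z0 - (guv z0)\<^sup>2 > 0"
  obtains m \<rho> where "0 < m" "0 < \<rho>" "\<And>z x y. dist z z0 < \<rho> \<Longrightarrow> m * (x\<^sup>2 + y\<^sup>2) \<le> g'' (x, y) z (x, y)"
proof -
  define A B C where "A = guu z0" "B = guv z0" "C = gvv z0"
  define D where "D = A * C - B\<^sup>2"
  have A0: "A > 0" and D0: "D > 0" using A d by (auto simp: A_B_C_def D_def)
  have "A * C > 0" using D0 D_def by (smt (verit) zero_le_power2)
  with A0 have C0: "C > 0" by (simp add: zero_less_mult_iff)
  \<comment> \<open>Half of determinant over trace. Changing each entry by at most m/2 costs at most
    m times the squared length: one half comes from the diagonal, one half from the mixed
    term.\<close>
  define m where "m = D / (A + C) / 2"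
  have m: "0 < m" using A0 C0 D0 by (simp add: m_def)
  have q0: "2 * m * (x\<^sup>2 + y\<^sup>2) \<le> A * x\<^sup>2 + 2 * B * x * y + C * y\<^sup>2" for x y
  proof -
    define T where "T = A + C"
    define a where "a = A - D / T"
    have T0: "T > 0" using A0 C0 by (simp add: T_def)
    have a: "a = (A\<^sup>2 + B\<^sup>2) / T" using T0 by (simp add: a_def D_def T_def field_simps power2_eq_square)
    then have a0: "a > 0" using A0 T0 by (simp add: add_pos_nonneg)
    define c where "c = C - D / T"
    have c: "c = (C\<^sup>2 + B\<^sup>2) / T" using T0 by (simp add: c_def D_def T_def field_simps power2_eq_square)
    \<comment> \<open>After D/T is subtracted from both diagonal entries the determinant is (D/T)^2,
      so the remaining form is still semidefinite; completing the square shows this.\<close>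
    have "a * c = A * C - (D / T) * T + (D / T)\<^sup>2"
      unfolding a_def c_def using T0 by (simp add: T_def algebra_simps power2_eq_square add_divide_distrib)
    then have "a * c = A * C - D + (D / T)\<^sup>2" using T0 by simp
    then have ac: "a * c \<ge> B\<^sup>2" by (simp add: D_def)
    have "a * (a * x\<^sup>2 + 2 * B * x * y + c * y\<^sup>2) = (a * x + B * y)\<^sup>2 + (a * c - B\<^sup>2) * y\<^sup>2"
      by (simp add: power2_eq_square algebra_simps)
    also have "\<dots> \<ge> 0" using ac by simp
    finally have "a * x\<^sup>2 + 2 * B * x * y + c * y\<^sup>2 \<ge> 0" using a0 by (simp add: zero_le_mult_iff)
    moreover have "2 * m = D / T" using T0 by (simp add: m_def T_def field_simps)
    ultimately show ?thesis by (simp add: a_def c_def algebra_simps)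
  qed
  have ev: "\<forall>\<^sub>F z in nhds z0. \<bar>f z - f z0\<bar> < m / 2" if "continuous_on UNIV f" for f :: "real \<times> real \<Rightarrow> real"
  proof -
    have "isCont f z0" using that unfolding continuous_on_eq_continuous_at[OF open_UNIV] by blast
    then have "(f \<longlongrightarrow> f z0) (nhds z0)" by (rule isCont_tendsto_nhds)
    from tendstoD[OF this, of "m / 2"] m show ?thesis by (simp add: dist_real_def)
  qed
  from eventually_conj[OF ev[OF g3, of "(1,0)" "(1,0)"] eventually_conj[OF ev[OF g3, of "(1,0)" "(0,1)"] ev[OF g3, of "(0,1)" "(0,1)"]]]
  obtain \<rho> where \<rho>: "0 < \<rho>" "\<And>z. dist z z0 < \<rho> \<Longrightarrow> \<bar>guu z - A\<bar> < m / 2 \<and> \<bar>guv z - B\<bar> < m / 2 \<and> \<bar>gvv z - C\<bar> < m / 2"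
    unfolding eventually_nhds_metric A_B_C_def by blast
  have "m * (x\<^sup>2 + y\<^sup>2) \<le> g'' (x, y) z (x, y)" if "dist z z0 < \<rho>" for z x y
  proof -
    have b: "A - m/2 \<le> guu z" "C - m/2 \<le> gvv z" "2 * \<bar>guv z - B\<bar> \<le> m"
    proof -
      have *: "\<bar>guu z - A\<bar> < m / 2" "\<bar>guv z - B\<bar> < m / 2" "\<bar>gvv z - C\<bar> < m / 2"
        using \<rho>(2)[OF that] by blast+
      show "A - m/2 \<le> guu z" using *(1) by linarith
      show "C - m/2 \<le> gvv z" using *(3) by linarith
      show "2 * \<bar>guv z - B\<bar> \<le> m" using *(2) by simp
    qed
    have 1: "guu z * x\<^sup>2 \<ge> (A - m/2) * x\<^sup>2" using b(1) by (rule mult_right_mono) simp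
    have 2: "gvv z * y\<^sup>2 \<ge> (C - m/2) * y\<^sup>2" using b(2) by (rule mult_right_mono) simp
    have "\<bar>2 * e * (x * y)\<bar> = (2 * \<bar>e\<bar>) * \<bar>x * y\<bar>" for e by (simp add: abs_mult)
    then have "\<bar>2 * (guv z - B) * (x * y)\<bar> = (2 * \<bar>guv z - B\<bar>) * \<bar>x * y\<bar>" .
    also have "\<dots> \<le> m * \<bar>x * y\<bar>" using b(3) by (rule mult_right_mono) simp
    also have "\<dots> \<le> m * ((x\<^sup>2 + y\<^sup>2) / 2)"
    proof -
      have "\<bar>x * y\<bar> \<le> (x\<^sup>2 + y\<^sup>2) / 2"
        using sum_squares_bound[of "\<bar>x\<bar>" "\<bar>y\<bar>"] by (simp add: abs_mult)
      then show ?thesis using m by (simp add: mult_left_mono)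
    qed
    finally have "- (2 * (guv z - B) * (x * y)) \<le> m * ((x\<^sup>2 + y\<^sup>2) / 2)" by (rule abs_le_D2)
    moreover have "2 * guv z * x * y - 2 * B * x * y = 2 * (guv z - B) * (x * y)" by (simp add: algebra_simps)
    ultimately have 3: "2 * guv z * x * y \<ge> 2 * B * x * y - m * ((x\<^sup>2 + y\<^sup>2) / 2)" by linarith
    have "g'' (x, y) z (x, y) \<ge> (A - m/2) * x\<^sup>2 + (2 * B * x * y - m * ((x\<^sup>2 + y\<^sup>2) / 2)) + (C - m/2) * y\<^sup>2"
      by (subst g''_coords) (use 1 2 3 in linarith)
    also have "(A - m/2) * x\<^sup>2 + (2 * B * x * y - m * ((x\<^sup>2 + y\<^sup>2) / 2)) + (C - m/2) * y\<^sup>2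
       = A * x\<^sup>2 + 2 * B * x * y + C * y\<^sup>2 - m * (x\<^sup>2 + y\<^sup>2)" by (simp add: algebra_simps)
    finally show ?thesis using q0[of x y] by (simp add: algebra_simps)
  qed
  with m \<rho>(1) show thesis by (rule that)
qed

text \<open>\<open>?\<chi>\<close> is g along the segment minus the linear and the quadratic term.
  Its derivative is non-negative by the mean value theorem for \<open>g'\<close>, hence its value at
  1 is at least its value at 0.\<close>

lemma strong_convexity:
  assumes m: "\<And>z x y. dist z z0 < \<rho> \<Longrightarrow> m * (x\<^sup>2 + y\<^sup>2) \<le> g'' (x, y) z (x, y)"
    and z: "dist z1 z0 < \<rho>" "dist z2 z0 < \<rho>"
  shows "g z1 + g' z1 (z2 - z1) + m / 2 * (norm (z2 - z1))\<^sup>2 \<le> g z2"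
proof -
  define \<delta> where "\<delta> = z2 - z1"
  have nd: "(norm \<delta>)\<^sup>2 = (fst \<delta>)\<^sup>2 + (snd \<delta>)\<^sup>2" by (cases \<delta>) (simp add: norm_Pair)
  have in_ball: "dist (z1 + s *\<^sub>R \<delta>) z0 < \<rho>" if "0 \<le> s" "s \<le> 1" for s
  proof -
    have "(1 - s) *\<^sub>R z1 + s *\<^sub>R z2 \<in> ball z0 \<rho>"
      using z that by (intro convexD[OF convex_ball]) (auto simp: dist_commute)
    then show ?thesis by (simp add: \<delta>_def algebra_simps dist_commute)
  qed
  have d1: "g' (z1 + s *\<^sub>R \<delta>) \<delta> - g' z1 \<delta> \<ge> m * (norm \<delta>)\<^sup>2 * s" if s: "0 \<le> s" "s \<le> 1" for s
  proof (cases "s = 0")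
    case False
    then have s0: "0 < s" using s by simp
    from MVT2[OF s0 deriv_line2[where S=UNIV, of z1 \<delta> \<delta>]] obtain \<xi> where \<xi>: "0 < \<xi>" "\<xi> < s"
      "g' (z1 + s *\<^sub>R \<delta>) \<delta> - g' (z1 + 0 *\<^sub>R \<delta>) \<delta> = (s - 0) * g'' \<delta> (z1 + \<xi> *\<^sub>R \<delta>) \<delta>" by blast
    have "m * (norm \<delta>)\<^sup>2 \<le> g'' \<delta> (z1 + \<xi> *\<^sub>R \<delta>) \<delta>"
      using m[OF in_ball[of \<xi>], of "fst \<delta>" "snd \<delta>"] \<xi> s by (simp add: nd)
    then have "s * (m * (norm \<delta>)\<^sup>2) \<le> s * g'' \<delta> (z1 + \<xi> *\<^sub>R \<delta>) \<delta>" using s0 by (intro mult_left_mono) auto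
    then show ?thesis using \<xi> by (simp add: algebra_simps)
  qed simp
  let ?\<chi> = "\<lambda>s. g (z1 + s *\<^sub>R \<delta>) - g' z1 \<delta> * s - m / 2 * (norm \<delta>)\<^sup>2 * s\<^sup>2"
  have "?\<chi> 0 \<le> ?\<chi> 1"
  proof (rule DERIV_nonneg_imp_nondecreasing[of 0 1 ?\<chi>])
    fix s :: real assume s: "0 \<le> s" "s \<le> 1"
    have "(?\<chi> has_real_derivative g' (z1 + s *\<^sub>R \<delta>) \<delta> - g' z1 \<delta> - m * (norm \<delta>)\<^sup>2 * s) (at s)"
      by (auto intro!: derivative_eq_intros deriv_line[where S=UNIV])
    moreover have "0 \<le> g' (z1 + s *\<^sub>R \<delta>) \<delta> - g' z1 \<delta> - m * (norm \<delta>)\<^sup>2 * s" using d1[OF s] by simp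
    ultimately show "\<exists>y. (?\<chi> has_real_derivative y) (at s) \<and> 0 \<le> y" by blast
  qed simp
  then show ?thesis by (simp add: \<delta>_def)
qed

text \<open>Positive curvature determines only the sign of the determinant of the Hessian; the sign
  of a diagonal entry has to come from convexity. A negative second derivative would stay negative
  nearby and, by two applications of the mean value theorem, make the symmetric second difference
  negative.\<close>

lemma guu_nonneg_if_midpoint_convex:
  assumes t0: "t0 > 0" and mid: "\<And>t. 0 < t \<Longrightarrow> t < t0 \<Longrightarrow> 2 * g z \<le> g (z + t *\<^sub>R v) + g (z + (- t) *\<^sub>R v)"
  shows "g'' v z v \<ge> 0"
proof (rule ccontr)
  assume neg: "\<not> g'' v z v \<ge> 0"
  have "((\<lambda>s. g'' v (z + s *\<^sub>R v) v) \<longlongrightarrow> g'' v (z + 0 *\<^sub>R v) v) (nhds 0)"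
  proof -
    have "isCont (\<lambda>s. g'' v (z + s *\<^sub>R v) v) 0"
    proof (rule isCont_o2[where g="\<lambda>z. g'' v z v"])
      show "isCont (\<lambda>z. g'' v z v) (z + 0 *\<^sub>R v)"
        by (rule isCont_g'')
    qed (intro continuous_intros)
    then show ?thesis
      using tendsto_at_iff_tendsto_nhds[of "\<lambda>s. g'' v (z + s *\<^sub>R v) v" 0] by (simp add: isCont_def)
  qed
  then have "\<forall>\<^sub>F s in nhds 0. g'' v (z + s *\<^sub>R v) v < 0"
    using neg by (intro order_tendstoD) auto
  then obtain e where e: "e > 0" "\<And>s. \<bar>s\<bar> < e \<Longrightarrow> g'' v (z + s *\<^sub>R v) v < 0"
    unfolding eventually_nhds_metric by (auto simp: dist_real_def)
  define t where "t = min e t0 / 2"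
  have t: "0 < t" "t < e" "t < t0" using e t0 by (auto simp: t_def)
  have d: "((\<lambda>s. g (z + s *\<^sub>R v) + g (z + s *\<^sub>R (- v))) has_real_derivative g' (z + s *\<^sub>R v) v + g' (z + s *\<^sub>R (- v)) (- v)) (at s)" for s
    by (intro DERIV_add deriv_line)
  from MVT2[OF t(1) d] obtain \<xi> where \<xi>: "0 < \<xi>" "\<xi> < t"
    "g (z + t *\<^sub>R v) + g (z + t *\<^sub>R (- v)) - (g (z + 0 *\<^sub>R v) + g (z + 0 *\<^sub>R (- v))) =
      (t - 0) * (g' (z + \<xi> *\<^sub>R v) v + g' (z + \<xi> *\<^sub>R (- v)) (- v))" by blast
  from \<xi> have "- \<xi> < \<xi>" by simp
  from MVT2[OF this deriv_line2[where S=UNIV, of z v v]] obtain \<eta> where \<eta>: "- \<xi> < \<eta>" "\<eta> < \<xi>"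
    "g' (z + \<xi> *\<^sub>R v) v - g' (z + (- \<xi>) *\<^sub>R v) v = (\<xi> - (- \<xi>)) * g'' v (z + \<eta> *\<^sub>R v) v" by blast
  have "g'' v (z + \<eta> *\<^sub>R v) v < 0" using e(2)[of \<eta>] \<xi> \<eta> t by auto
  then have "g' (z + \<xi> *\<^sub>R v) v - g' (z + (- \<xi>) *\<^sub>R v) v < 0"
    using \<xi> \<eta>(3) by (simp add: mult_pos_neg)
  then have "g' (z + \<xi> *\<^sub>R v) v + g' (z + \<xi> *\<^sub>R (- v)) (- v) < 0"
    by (simp add: linear_neg[OF linear_g'])
  then have "t * (g' (z + \<xi> *\<^sub>R v) v + g' (z + \<xi> *\<^sub>R (- v)) (- v)) < 0" using t by (simp add: mult_pos_neg)
  then show False using mid[OF t(1,3)] \<xi>(3) by simp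
qed

end

lemma Ck2_C2_graph:
  assumes "Ck 2 g" obtains g' g'' where "C2_graph g g' g''"
proof -
  have "Ck (Suc (Suc 0)) g" using assms by (simp add: numeral_2_eq_2)
  then obtain g' where 1: "\<And>z. (g has_derivative g' z) (at z)" and "\<And>v. Ck (Suc 0) (\<lambda>z. g' z v)"
    unfolding Ck.simps(2)[of "Suc 0"] by blast
  then have "\<forall>v. \<exists>h. (\<forall>z. ((\<lambda>z. g' z v) has_derivative h z) (at z)) \<and> (\<forall>w. continuous_on UNIV (\<lambda>z. h z w))"
    by simp
  then obtain g'' where "\<And>v z. ((\<lambda>z. g' z v) has_derivative g'' v z) (at z)" "\<And>v w. continuous_on UNIV (\<lambda>z. g'' v z w)"
    by metis
  with 1 show thesis by (intro that[of g' g'']) (simp add: C2_graph_def)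
qed

text \<open>The second derivatives of the graph parametrization are multiples of c, so the second
  fundamental form is \<open>c \<bullet> \<nu>\<close> times the Hessian of g. The denominator of
  the curvature is a Gram determinant, non-negative by Cauchy-Schwarz, so positivity of the quotient
  passes to the numerator.\<close>

lemma graph_curvature_positive:
  assumes "C2_graph g g' g''" and o: "orthonormal3 a b c"
    and pos: "0 < gaussian_curvature (\<lambda>(u, v). u *\<^sub>R a + v *\<^sub>R b + g (u, v) *\<^sub>R c) z"
  shows "0 < g'' (1, 0) z (1, 0) * g'' (0, 1) z (0, 1) - (g'' (1, 0) z (0, 1))\<^sup>2"
proof -
  interpret C2_graph g g' g'' by fact
  let ?X = "\<lambda>(u, v). u *\<^sub>R a + v *\<^sub>R b + g (u, v) *\<^sub>R c"
  have d1: "((\<lambda>s. f (s, v)) has_real_derivative f' (u, v) (1, 0)) (at u)"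
    if "\<And>z. (f has_derivative f' z) (at z)" for f :: "real \<times> real \<Rightarrow> real" and f' u v
  proof -
    have "((\<lambda>s. (s, v)) has_derivative (\<lambda>h. (h, 0))) (at u)"
      by (auto intro!: derivative_eq_intros)
    from has_derivative_compose[OF this that]
    have "((\<lambda>s. f (s, v)) has_derivative (\<lambda>h. f' (u, v) (h, 0))) (at u)" .
    moreover have "(\<lambda>h. f' (u, v) (h, 0)) = (*) (f' (u, v) (1, 0))"
    proof
      fix h
      have "f' (u, v) (h *\<^sub>R (1, 0)) = h *\<^sub>R f' (u, v) (1, 0)"
        by (rule linear_scale[OF has_derivative_linear[OF that]])
      then show "f' (u, v) (h, 0) = f' (u, v) (1, 0) * h" by (simp add: mult.commute)
    qed
    ultimately show ?thesis by (simp only: has_field_derivative_def)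
  qed
  have d2: "((\<lambda>s. f (u, s)) has_real_derivative f' (u, v) (0, 1)) (at v)"
    if "\<And>z. (f has_derivative f' z) (at z)" for f :: "real \<times> real \<Rightarrow> real" and f' u v
  proof -
    have "((\<lambda>s. (u, s)) has_derivative (\<lambda>h. (0, h))) (at v)"
      by (auto intro!: derivative_eq_intros)
    from has_derivative_compose[OF this that]
    have "((\<lambda>s. f (u, s)) has_derivative (\<lambda>h. f' (u, v) (0, h))) (at v)" .
    moreover have "(\<lambda>h. f' (u, v) (0, h)) = (*) (f' (u, v) (0, 1))"
    proof
      fix h
      have "f' (u, v) (h *\<^sub>R (0, 1)) = h *\<^sub>R f' (u, v) (0, 1)"
        by (rule linear_scale[OF has_derivative_linear[OF that]])
      then show "f' (u, v) (0, h) = f' (u, v) (0, 1) * h" by (simp add: mult.commute)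
    qed
    ultimately show ?thesis by (simp only: has_field_derivative_def)
  qed
  have v: "((\<lambda>s. A + f s *\<^sub>R C) has_vector_derivative D *\<^sub>R C) (at x)"
    if "(f has_real_derivative D) (at x)" for f D x and A C :: "real^3"
    using that by (auto intro!: derivative_eq_intros simp: has_real_derivative_iff_has_vector_derivative)
  have v': "((\<lambda>s. s *\<^sub>R B + A + f s *\<^sub>R C) has_vector_derivative B + D *\<^sub>R C) (at x)"
    if "(f has_real_derivative D) (at x)" for f D x and A B C :: "real^3"
    using that by (auto intro!: derivative_eq_intros simp: has_real_derivative_iff_has_vector_derivative)
  have p1: "partial_1 ?X = (\<lambda>z. a + g' z (1, 0) *\<^sub>R c)"
    unfolding partial_1_def using v'[OF d1[OF g1]]
    by (auto simp: fun_eq_iff intro!: vector_derivative_at)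
  have p2: "partial_2 ?X = (\<lambda>z. b + g' z (0, 1) *\<^sub>R c)"
  proof -
    have "((\<lambda>s. u *\<^sub>R a + s *\<^sub>R b + g (u, s) *\<^sub>R c) has_vector_derivative b + g' (u, w) (0, 1) *\<^sub>R c) (at w)" for u w
      using v'[OF d2[OF g1, where u=u and v=w], where B=b and A="u *\<^sub>R a" and C=c] by (simp add: add.commute)
    then show ?thesis unfolding partial_2_def
      by (auto simp: fun_eq_iff intro!: vector_derivative_at)
  qed
  have p11: "partial_1 (partial_1 ?X) z = guu z *\<^sub>R c"
    unfolding p1 unfolding partial_1_def using v[OF d1[OF g2]]
    by (cases z) (auto simp: fun_eq_iff intro!: vector_derivative_at)
  have p12: "partial_2 (partial_1 ?X) z = guv z *\<^sub>R c"
    unfolding p1 unfolding partial_2_def using v[OF d2[OF g2]]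
    by (cases z) (auto simp: fun_eq_iff intro!: vector_derivative_at)
  have p22: "partial_2 (partial_2 ?X) z = gvv z *\<^sub>R c"
    unfolding p2 unfolding partial_2_def using v[OF d2[OF g2]]
    by (cases z) (auto simp: fun_eq_iff intro!: vector_derivative_at)
  define Xu Xv where "Xu = partial_1 ?X z" and "Xv = partial_2 ?X z"
  define \<nu> where "\<nu> = cross3 Xu Xv /\<^sub>R norm (cross3 Xu Xv)"
  define S where "S = (Xu \<bullet> Xu) * (Xv \<bullet> Xv) - (Xu \<bullet> Xv)\<^sup>2"
  have S: "S \<ge> 0" using Cauchy_Schwarz_ineq[of Xu Xv] by (simp add: S_def)
  have "0 < (guu z * (c \<bullet> \<nu>) * (gvv z * (c \<bullet> \<nu>)) - (guv z * (c \<bullet> \<nu>))\<^sup>2) / S"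
    using pos unfolding gaussian_curvature_def Let_def p11 p12 p22 Xu_def[symmetric] Xv_def[symmetric] \<nu>_def[symmetric] S_def[symmetric]
    by simp
  then have "0 < guu z * (c \<bullet> \<nu>) * (gvv z * (c \<bullet> \<nu>)) - (guv z * (c \<bullet> \<nu>))\<^sup>2"
    using S by (simp add: zero_less_divide_iff)
  also have "\<dots> = (c \<bullet> \<nu>)\<^sup>2 * (guu z * gvv z - (guv z)\<^sup>2)" by (simp add: power2_eq_square algebra_simps)
  finally show ?thesis by (simp add: zero_less_mult_iff)
qed

section \<open>Charts of the boundary and the outward normal\<close>

locale chart = C2_graph g g' g'' for g :: "real \<times> real \<Rightarrow> real" and g' g'' +
  fixes \<Omega> :: "(real^3) set" and p :: "real^3" and r :: real and a b c
  assumes op: "open \<Omega>" and r: "0 < r" and on: "orthonormal3 a b c"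
    and chart: "\<And>x. x \<in> ball p r \<Longrightarrow> x \<in> \<Omega> \<longleftrightarrow> g (x \<bullet> a, x \<bullet> b) < x \<bullet> c"
begin

abbreviation "xy x \<equiv> (x \<bullet> a, x \<bullet> b)"

lemmas oi = orthonormal3_inner[OF on]
lemmas expand = orthonormal3_expand[OF on]

lemma norm_sq: "(norm x)\<^sup>2 = (x \<bullet> a)\<^sup>2 + (x \<bullet> b)\<^sup>2 + (x \<bullet> c)\<^sup>2"
  unfolding power2_norm_eq_inner orthonormal3_inner_expand[OF on, of x x] by (simp only: power2_eq_square)

lemma continuous_height: "continuous_on S (\<lambda>x. x \<bullet> c - g (xy x))"
proof -
  have "continuous_on UNIV g" by (simp add: continuous_at_imp_continuous_on isCont_g)
  then have "continuous_on S (\<lambda>x. g (xy x))"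
    by (rule continuous_on_compose2) (auto intro!: continuous_intros)
  then show ?thesis by (intro continuous_intros)
qed

text \<open>The region strictly below the graph is open and misses the set, so it contains no
  boundary points; from a point of the graph, small steps along c enter the set.\<close>

lemma frontier_chart:
  assumes x: "x \<in> ball p r"
  shows "x \<in> frontier \<Omega> \<longleftrightarrow> x \<bullet> c = g (xy x)"
proof
  assume f: "x \<in> frontier \<Omega>"
  then have nx: "x \<notin> \<Omega>" "x \<in> closure \<Omega>" using op by (auto simp: frontier_def interior_open)
  show "x \<bullet> c = g (xy x)"
  proof (rule ccontr)
    assume "x \<bullet> c \<noteq> g (xy x)"
    with nx(1) chart[OF x] have lt: "x \<bullet> c - g (xy x) < 0" by auto
    define V where "V = ball p r \<inter> {y. y \<bullet> c - g (xy y) < 0}"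
    have "open V" unfolding V_def
      by (intro open_Int open_ball open_Collect_less continuous_height continuous_intros)
    moreover have "x \<in> V" using x lt by (simp add: V_def)
    moreover have "V \<inter> \<Omega> = {}" using chart by (auto simp: V_def)
    ultimately show False using nx(2) by (metis closure_iff_nhds_not_empty Int_commute open_subset_interior interior_open subset_refl)
  qed
next
  assume e: "x \<bullet> c = g (xy x)"
  then have nx: "x \<notin> \<Omega>" using chart[OF x] by simp
  have "x \<in> closure \<Omega>"
    unfolding closure_approachable
  proof (intro allI impI)
    fix \<epsilon> :: real assume \<epsilon>: "0 < \<epsilon>"
    define t where "t = min \<epsilon> (r - dist p x) / 2"
    have t: "0 < t" "t < \<epsilon>" "t < r - dist p x" using \<epsilon> x by (auto simp: t_def)
    have d: "dist (x + t *\<^sub>R c) x = t" using t oi by (simp add: dist_norm norm_eq_sqrt_inner)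
    have "dist p (x + t *\<^sub>R c) \<le> dist p x + dist x (x + t *\<^sub>R c)" by (rule dist_triangle)
    then have "x + t *\<^sub>R c \<in> ball p r" using t d by (simp add: dist_commute)
    then have "x + t *\<^sub>R c \<in> \<Omega>" using chart[of "x + t *\<^sub>R c"] e t by (simp add: inner_add_left oi)
    then show "\<exists>y\<in>\<Omega>. dist y x < \<epsilon>" using d t by (intro bexI) auto
  qed
  with nx show "x \<in> frontier \<Omega>" using op by (simp add: frontier_def interior_open)
qed

text \<open>The gradient of g(x.a, x.b) - x.c, a function that is negative exactly at the points of
  the set inside the ball. It therefore points outwards; it is not normalized, but its component
  along c is -1, so its norm is at least 1.\<close>

definition normal_vec :: "real^3 \<Rightarrow> real^3" where
  "normal_vec q = g' (xy q) (1, 0) *\<^sub>R a + g' (xy q) (0, 1) *\<^sub>R b - c"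

lemma normal_vec_inner: "normal_vec q \<bullet> y = g' (xy q) (xy y) - y \<bullet> c"
  unfolding normal_vec_def
  by (subst (3) g'_coords) (simp add: inner_add_left inner_diff_left inner_add_right inner_diff_right inner_commute)

lemma normal_vec_norm: "(norm (normal_vec q))\<^sup>2 = (g' (xy q) (1, 0))\<^sup>2 + (g' (xy q) (0, 1))\<^sup>2 + 1"
  unfolding norm_sq by (simp add: normal_vec_def inner_add_left inner_diff_left oi)

lemma normal_vec_ge_1: "1 \<le> norm (normal_vec q)"
  using normal_vec_norm[of q] by (metis norm_ge_zero one_power2 power2_le_imp_le le_add_same_cancel2 sum_power2_ge_zero)

text \<open>The height above the graph vanishes along a curve in the boundary, and so does its
  derivative at 0.\<close>

lemma tangent_orthogonal:
  assumes q: "q \<in> ball p r" and v: "boundary_tangent \<Omega> q v"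
  shows "normal_vec q \<bullet> v = 0"
proof -
  from v obtain \<kappa> where \<kappa>: "\<kappa> 0 = q" "\<forall>\<^sub>F t in nhds 0. \<kappa> t \<in> frontier \<Omega>" "(\<kappa> has_vector_derivative v) (at 0)"
    by (auto simp: boundary_tangent_def)
  have c0: "isCont \<kappa> 0" using \<kappa>(3) by (rule has_vector_derivative_continuous)
  have "\<forall>\<^sub>F t in nhds 0. \<kappa> t \<in> ball p r"
    using topological_tendstoD[OF isCont_tendsto_nhds[OF c0], of "ball p r"] q \<kappa>(1) by simp
  with \<kappa>(2) have ev: "\<forall>\<^sub>F t in nhds 0. \<kappa> t \<bullet> c - g (xy (\<kappa> t)) = 0"
    by eventually_elim (simp add: frontier_chart)
  have k: "(\<kappa> has_derivative (\<lambda>h. h *\<^sub>R v)) (at 0)" using \<kappa>(3) by (simp add: has_vector_derivative_def)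
  have "((\<lambda>t. xy (\<kappa> t)) has_derivative (\<lambda>h. xy (h *\<^sub>R v))) (at 0)"
    by (intro has_derivative_Pair has_derivative_inner_left k)
  from has_derivative_compose[OF this g1]
  have "((\<lambda>t. g (xy (\<kappa> t))) has_derivative (\<lambda>h. g' (xy q) (xy (h *\<^sub>R v)))) (at 0)" by (simp add: \<kappa>(1))
  then have "((\<lambda>t. \<kappa> t \<bullet> c - g (xy (\<kappa> t))) has_derivative (\<lambda>h. (h *\<^sub>R v) \<bullet> c - g' (xy q) (xy (h *\<^sub>R v)))) (at 0)"
    using k by (intro has_derivative_diff has_derivative_inner_left)
  moreover have "((\<lambda>t. \<kappa> t \<bullet> c - g (xy (\<kappa> t))) has_derivative (\<lambda>h. 0)) (at 0)"
    by (rule has_derivative_transform_eventually[OF has_derivative_const, of _ _ 0])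
      (use ev eventually_nhds_x_imp_x[OF ev] in \<open>auto simp: eventually_at_filter elim: eventually_mono\<close>)
  ultimately have "(\<lambda>h. (h *\<^sub>R v) \<bullet> c - g' (xy q) (xy (h *\<^sub>R v))) = (\<lambda>h. 0)"
    by (rule has_derivative_unique)
  from fun_cong[OF this, of 1] show ?thesis by (simp add: normal_vec_inner)
qed

text \<open>The curve is a straight line of the coordinate plane lifted to the graph.\<close>

lemma tangent_graph:
  assumes q: "q \<in> ball p r" "q \<in> frontier \<Omega>"
  shows "boundary_tangent \<Omega> q (x *\<^sub>R a + y *\<^sub>R b + g' (xy q) (x, y) *\<^sub>R c)"
proof -
  define \<kappa> where "\<kappa> t = q + t *\<^sub>R (x *\<^sub>R a + y *\<^sub>R b) + (g (xy q + t *\<^sub>R (x, y)) - g (xy q)) *\<^sub>R c" for t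
  have xy\<kappa>: "xy (\<kappa> t) = xy q + t *\<^sub>R (x, y)" for t
    by (simp add: \<kappa>_def inner_add_left oi)
  have c\<kappa>: "\<kappa> t \<bullet> c = g (xy q + t *\<^sub>R (x, y))" for t
    using frontier_chart[OF q(1)] q(2) by (simp add: \<kappa>_def inner_add_left oi)
  have d: "(\<kappa> has_vector_derivative (x *\<^sub>R a + y *\<^sub>R b + g' (xy q) (x, y) *\<^sub>R c)) (at 0)"
  proof -
    have "((\<lambda>t. g (xy q + t *\<^sub>R (x, y)) - g (xy q)) has_real_derivative g' (xy q) (x, y)) (at 0)"
      using DERIV_diff[OF deriv_line[of "xy q" "(x, y)" 0 UNIV] DERIV_const[of "g (xy q)"]] by simp
    moreover have "((\<lambda>t. q + t *\<^sub>R w + f t *\<^sub>R c) has_vector_derivative w + D *\<^sub>R c) (at 0)"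
      if "(f has_real_derivative D) (at 0)" for f D w
      using that by (auto intro!: derivative_eq_intros simp: has_real_derivative_iff_has_vector_derivative)
    ultimately show ?thesis unfolding \<kappa>_def[abs_def] by blast
  qed
  have c0: "isCont \<kappa> 0" using d by (rule has_vector_derivative_continuous)
  have "\<kappa> 0 = q" by (simp add: \<kappa>_def)
  then have "\<forall>\<^sub>F t in nhds 0. \<kappa> t \<in> ball p r"
    using topological_tendstoD[OF isCont_tendsto_nhds[OF c0], of "ball p r"] q by simp
  then have "\<forall>\<^sub>F t in nhds 0. \<kappa> t \<in> frontier \<Omega>"
    by eventually_elim (simp add: frontier_chart xy\<kappa> c\<kappa> del: scaleR_Pair plus_prod_def add_Pair)
  then show ?thesis using d \<open>\<kappa> 0 = q\<close> unfolding boundary_tangent_def by blast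
qed

text \<open>Serves to exclude the opposite unit vector in the uniqueness part of
  \<open>outward_normal_chart\<close>.\<close>

lemma inward_in_\<Omega>:
  assumes q: "q \<in> ball p r" "q \<in> frontier \<Omega>"
  shows "\<forall>\<^sub>F t in at_right 0. q - t *\<^sub>R normal_vec q \<in> \<Omega>"
proof -
  let ?z = "(g' (xy q) (1, 0), g' (xy q) (0, 1))"
  have xy: "xy (q - t *\<^sub>R normal_vec q) = xy q + t *\<^sub>R (- ?z)" for t
    by (simp add: normal_vec_def inner_diff_left inner_add_left oi)
  have c: "(q - t *\<^sub>R normal_vec q) \<bullet> c = q \<bullet> c + t" for t
    by (simp add: normal_vec_def inner_diff_left inner_add_left oi)
  let ?f = "\<lambda>t. q \<bullet> c + t - g (xy q + t *\<^sub>R (- ?z))"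
  have "(?f has_real_derivative 1 - g' (xy q + 0 *\<^sub>R (- ?z)) (- ?z)) (at 0)"
    using deriv_line[of "xy q" "- ?z" 0 UNIV] by (auto intro!: derivative_eq_intros)
  moreover have "0 < 1 - g' (xy q + 0 *\<^sub>R (- ?z)) (- ?z)"
  proof -
    have "g' (xy q + 0 *\<^sub>R (- ?z)) (- ?z) = - ((g' (xy q) (1, 0))\<^sup>2 + (g' (xy q) (0, 1))\<^sup>2)"
      by (subst linear_neg[OF linear_g'], subst g'_coords) (simp add: power2_eq_square)
    then show ?thesis by (smt (verit) sum_power2_ge_zero)
  qed
  ultimately obtain d where d: "d > 0" "\<And>h. 0 < h \<Longrightarrow> h < d \<Longrightarrow> ?f 0 < ?f (0 + h)"
    using DERIV_pos_inc_right by blast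
  have f0: "?f 0 = 0" using frontier_chart[OF q(1)] q(2) by simp
  have "((\<lambda>t. q - t *\<^sub>R normal_vec q) \<longlongrightarrow> q - 0 *\<^sub>R normal_vec q) (at_right 0)"
    by (intro tendsto_intros)
  then have "\<forall>\<^sub>F t in at_right 0. q - t *\<^sub>R normal_vec q \<in> ball p r"
    using q(1) by (intro topological_tendstoD) auto
  moreover have "\<forall>\<^sub>F t in at_right (0::real). 0 < t \<and> t < d"
    using d(1) by (auto simp: eventually_at_right_field)
  ultimately show ?thesis
  proof eventually_elim
    case (elim t)
    then have "0 < ?f t" using d(2)[of t] f0 by simp
    then show ?case unfolding chart[OF elim(1)] xy c by simp
  qed
qed

text \<open>Existence and uniqueness behind a definite description. The supporting half-space keeps
  outward steps out of the closure. Conversely, orthogonality to the two coordinate tangents of the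
  graph leaves only the two unit multiples of \<open>normal_vec q\<close>, and small steps along the
  inward one enter the set.\<close>

lemma outward_normal_chart:
  assumes q: "q \<in> ball p r" "q \<in> frontier \<Omega>"
    and supp: "\<And>y. y \<in> \<Omega> \<Longrightarrow> normal_vec q \<bullet> (y - q) \<le> 0"
  shows "outward_normal \<Omega> q = normal_vec q /\<^sub>R norm (normal_vec q)"
  unfolding outward_normal_def
proof (rule the_equality)
  let ?\<nu> = "normal_vec q"
  have n0: "norm ?\<nu> > 0" using normal_vec_ge_1[of q] by linarith
  have "\<Omega> \<subseteq> {y. ?\<nu> \<bullet> y \<le> ?\<nu> \<bullet> q}" using supp by (auto simp: inner_diff_right)
  then have cl: "closure \<Omega> \<subseteq> {y. ?\<nu> \<bullet> y \<le> ?\<nu> \<bullet> q}"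
    by (simp add: closure_minimal closed_halfspace_le)
  show "norm (?\<nu> /\<^sub>R norm ?\<nu>) = 1 \<and> (\<forall>v. boundary_tangent \<Omega> q v \<longrightarrow> (?\<nu> /\<^sub>R norm ?\<nu>) \<bullet> v = 0) \<and>
    (\<forall>\<^sub>F t in at_right 0. q + t *\<^sub>R (?\<nu> /\<^sub>R norm ?\<nu>) \<notin> closure \<Omega>)"
  proof (intro conjI allI impI)
    show "norm (?\<nu> /\<^sub>R norm ?\<nu>) = 1" using n0 by simp
    show "(?\<nu> /\<^sub>R norm ?\<nu>) \<bullet> v = 0" if "boundary_tangent \<Omega> q v" for v
      using tangent_orthogonal[OF q(1) that] by simp
    have "q + t *\<^sub>R (?\<nu> /\<^sub>R norm ?\<nu>) \<notin> closure \<Omega>" if "0 < t" for t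
    proof
      assume "q + t *\<^sub>R (?\<nu> /\<^sub>R norm ?\<nu>) \<in> closure \<Omega>"
      with cl have "?\<nu> \<bullet> (q + t *\<^sub>R (?\<nu> /\<^sub>R norm ?\<nu>)) \<le> ?\<nu> \<bullet> q" by blast
      then have "t * (?\<nu> \<bullet> ?\<nu> / norm ?\<nu>) \<le> 0" by (simp add: inner_add_right divide_inverse mult.commute)
      moreover have "t * (?\<nu> \<bullet> ?\<nu> / norm ?\<nu>) > 0" using that n0 by (auto intro!: mult_pos_pos divide_pos_pos)
      ultimately show False by simp
    qed
    then show "\<forall>\<^sub>F t in at_right 0. q + t *\<^sub>R (?\<nu> /\<^sub>R norm ?\<nu>) \<notin> closure \<Omega>"
      by (auto simp: eventually_at_filter)
  qed
  fix n assume n: "norm n = 1 \<and> (\<forall>v. boundary_tangent \<Omega> q v \<longrightarrow> n \<bullet> v = 0) \<and>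
    (\<forall>\<^sub>F t in at_right 0. q + t *\<^sub>R n \<notin> closure \<Omega>)"
  have "n \<bullet> (1 *\<^sub>R a + 0 *\<^sub>R b + g' (xy q) (1, 0) *\<^sub>R c) = 0"
    "n \<bullet> (0 *\<^sub>R a + 1 *\<^sub>R b + g' (xy q) (0, 1) *\<^sub>R c) = 0"
    using n tangent_graph[OF q] by blast+
  then have "n \<bullet> a = - (n \<bullet> c) * g' (xy q) (1, 0)" "n \<bullet> b = - (n \<bullet> c) * g' (xy q) (0, 1)"
    by (simp_all add: inner_add_right eq_neg_iff_add_eq_0 mult.commute)
  then have nn: "n = (- (n \<bullet> c)) *\<^sub>R ?\<nu>"
    using expand[of n] by (simp add: normal_vec_def algebra_simps)
  then have "\<bar>n \<bullet> c\<bar> * norm ?\<nu> = 1" using n by (metis abs_minus norm_scaleR)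
  then have k: "\<bar>n \<bullet> c\<bar> = inverse (norm ?\<nu>)" using n0 by (simp add: field_simps)
  show "n = ?\<nu> /\<^sub>R norm ?\<nu>"
  proof (cases "n \<bullet> c < 0")
    case True
    then have "- (n \<bullet> c) = inverse (norm ?\<nu>)" using k by simp
    then show ?thesis by (subst nn) simp
  next
    case False
    then have kk: "n \<bullet> c = inverse (norm ?\<nu>)" using k by simp
    have "\<forall>\<^sub>F t in at_right 0. q - t *\<^sub>R ?\<nu> \<in> \<Omega>" by (rule inward_in_\<Omega>[OF q])
    then obtain e where e: "e > 0" "\<And>t. 0 < t \<Longrightarrow> t < e \<Longrightarrow> q - t *\<^sub>R ?\<nu> \<in> \<Omega>"
      by (auto simp: eventually_at_right_field)
    from n obtain e' where e': "e' > 0" "\<And>t. 0 < t \<Longrightarrow> t < e' \<Longrightarrow> q + t *\<^sub>R n \<notin> closure \<Omega>"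
      by (auto simp: eventually_at_right_field)
    define t where "t = min e e' / 2"
    have t: "0 < t" "t < e" "t < e'" using e e' by (auto simp: t_def)
    have "t * inverse (norm ?\<nu>) \<le> t * 1"
      using t normal_vec_ge_1[of q] by (intro mult_left_mono) (auto simp: inverse_le_1_iff)
    then have "t * inverse (norm ?\<nu>) < e" using t by linarith
    moreover have "0 < t * inverse (norm ?\<nu>)" using t n0 by (intro mult_pos_pos positive_imp_inverse_positive)
    ultimately have "q - (t * inverse (norm ?\<nu>)) *\<^sub>R ?\<nu> \<in> \<Omega>" by (intro e(2))
    moreover have "q - (t * inverse (norm ?\<nu>)) *\<^sub>R ?\<nu> = q + t *\<^sub>R n"
      by (subst nn) (simp add: kk)
    ultimately have "q + t *\<^sub>R n \<in> closure \<Omega>" using closure_subset by auto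
    then show ?thesis using e'(2) t by blast
  qed
qed

text \<open>\<open>P t \<epsilon>\<close> lies at height \<open>\<epsilon>\<close> above the graph,
  over the point displaced by t in the first coordinate, hence in the set. By convexity the midpoint
  of the points for t and -t is in the set as well, which is the midpoint inequality for g up to
  \<open>\<epsilon>\<close>.\<close>

lemma guu_nonneg:
  assumes p: "p \<in> frontier \<Omega>" and cv: "convex \<Omega>"
  shows "0 \<le> guu (xy p)"
proof -
  have pc: "p \<bullet> c = g (xy p)" using frontier_chart[of p] r p by simp
  define P where "P t \<epsilon> = p + t *\<^sub>R a + (g (xy p + t *\<^sub>R (1, 0)) - g (xy p) + \<epsilon>) *\<^sub>R c" for t \<epsilon>
  have xyP: "xy (P t \<epsilon>) = xy p + t *\<^sub>R (1, 0)" for t \<epsilon> by (simp add: P_def inner_add_left oi)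
  have cP: "P t \<epsilon> \<bullet> c = g (xy p + t *\<^sub>R (1, 0)) + \<epsilon>" for t \<epsilon>
    by (simp add: P_def inner_add_left oi pc)
  have "isCont (\<lambda>t. g (xy p + t *\<^sub>R (1, 0))) 0"
    by (rule isCont_o2[where g=g]) (intro continuous_intros isCont_g)+
  then have "((\<lambda>t. g (xy p + t *\<^sub>R (1, 0))) \<longlongrightarrow> g (xy p + 0 *\<^sub>R (1, 0))) (nhds 0)"
    by (rule isCont_tendsto_nhds)
  then have "((\<lambda>t. P t 0) \<longlongrightarrow> P 0 0) (nhds 0)"
    unfolding P_def by (intro tendsto_intros) (auto simp: filterlim_def)
  then have "\<forall>\<^sub>F t in nhds 0. dist (P t 0) (P 0 0) < r / 2"
    using r by (intro tendstoD) auto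
  then obtain t0 where t0: "t0 > 0" "\<And>t. \<bar>t\<bar> < t0 \<Longrightarrow> dist (P t 0) p < r / 2"
    unfolding eventually_nhds_metric by (auto simp: dist_real_def P_def)
  have inP: "P t \<epsilon> \<in> \<Omega>" if "\<bar>t\<bar> < t0" "0 < \<epsilon>" "\<epsilon> < r / 2" for t \<epsilon>
  proof -
    have "P t \<epsilon> = P t 0 + \<epsilon> *\<^sub>R c" by (simp add: P_def algebra_simps)
    moreover have "norm c = 1" using on by (simp add: orthonormal3_def)
    ultimately have "dist (P t \<epsilon>) (P t 0) < r / 2" using that by (simp add: dist_norm)
    then have "dist (P t \<epsilon>) p < r"
      using t0(2)[OF that(1)] dist_triangle[of "P t \<epsilon>" p "P t 0"] by linarith
    then have "P t \<epsilon> \<in> ball p r" by (simp add: dist_commute)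
    then show ?thesis using chart[of "P t \<epsilon>"] that unfolding xyP cP by simp
  qed
  show ?thesis
  proof (rule guu_nonneg_if_midpoint_convex[OF t0(1)])
  fix t assume t: "0 < t" "t < t0"
  show "2 * g (xy p) \<le> g (xy p + t *\<^sub>R (1, 0)) + g (xy p + (- t) *\<^sub>R (1, 0))"
  proof (rule field_le_epsilon)
    fix e :: real assume e: "0 < e"
    define \<epsilon> where "\<epsilon> = min (e / 2) (r / 4)"
    have \<epsilon>: "0 < \<epsilon>" "\<epsilon> < r / 2" "2 * \<epsilon> \<le> e" using e r by (auto simp: \<epsilon>_def)
    let ?m = "(1/2) *\<^sub>R P t \<epsilon> + (1/2) *\<^sub>R P (- t) \<epsilon>"
    have m: "?m \<in> \<Omega>"
      using inP[of t \<epsilon>] inP[of "- t" \<epsilon>] t \<epsilon> by (intro convexD[OF cv]) auto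
    have "?m \<in> ball p r"
    proof (rule convexD[OF convex_ball])
      have "dist (P s \<epsilon>) p < r" if "\<bar>s\<bar> < t0" for s
      proof -
        have "P s \<epsilon> = P s 0 + \<epsilon> *\<^sub>R c" by (simp add: P_def algebra_simps)
        moreover have "norm c = 1" using on by (simp add: orthonormal3_def)
        ultimately have "dist (P s \<epsilon>) (P s 0) < r / 2" using \<epsilon> by (simp add: dist_norm)
        then show ?thesis using t0(2)[OF that] dist_triangle[of "P s \<epsilon>" p "P s 0"] by linarith
      qed
      then show "P t \<epsilon> \<in> ball p r" "P (- t) \<epsilon> \<in> ball p r" using t by (auto simp: dist_commute)
    qed auto
    from chart[OF this] m have "g (xy ?m) < ?m \<bullet> c" by blast
    moreover have "xy ?m = xy p"
      using xyP[of t \<epsilon>] xyP[of "- t" \<epsilon>] by (simp add: inner_add_left) (simp add: field_simps)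
    moreover have "?m \<bullet> c = (g (xy p + t *\<^sub>R (1, 0)) + g (xy p + (- t) *\<^sub>R (1, 0))) / 2 + \<epsilon>"
      unfolding inner_add_left inner_scaleR_left cP by (simp add: field_simps)
    ultimately have "g (xy p) < (g (xy p + t *\<^sub>R (1, 0)) + g (xy p + (- t) *\<^sub>R (1, 0))) / 2 + \<epsilon>" by (simp only:)
    moreover have "x < (A + B) / 2 + e \<Longrightarrow> 2 * x < A + B + 2 * e" for x A B e :: real by (simp add: field_simps)
    ultimately have "2 * g (xy p) < g (xy p + t *\<^sub>R (1, 0)) + g (xy p + (- t) *\<^sub>R (1, 0)) + 2 * \<epsilon>" by blast
    then show "2 * g (xy p) \<le> g (xy p + t *\<^sub>R (1, 0)) + g (xy p + (- t) *\<^sub>R (1, 0)) + e" using \<epsilon>(3) by linarith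
  qed
  qed
qed

text \<open>Let s be the pairing of q - y with \<open>normal_vec q\<close>. Strong convexity of g
  bounds the squared horizontal displacement by a multiple of s. The vertical displacement is s plus
  the slope term, so its square is controlled by s^2 and the squared horizontal
  displacement.\<close>

lemma local_strict_convexity:
  assumes p: "p \<in> frontier \<Omega>" and cv: "convex \<Omega>"
    and d: "guu (xy p) * gvv (xy p) - (guv (xy p))\<^sup>2 > 0"
  obtains \<kappa> \<rho> where "0 < \<kappa>" "0 < \<rho>" "\<rho> \<le> r"
    "\<And>q y. q \<in> frontier \<Omega> \<Longrightarrow> q \<in> ball p \<rho> \<Longrightarrow> y \<in> \<Omega> \<Longrightarrow> y \<in> ball p \<rho> \<Longrightarrow>
       \<kappa> * (norm (q - y))\<^sup>2 \<le> (normal_vec q /\<^sub>R norm (normal_vec q)) \<bullet> (q - y)"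
proof -
  have A: "guu (xy p) > 0"
  proof -
    have "guu (xy p) \<noteq> 0"
    proof
      assume "guu (xy p) = 0"
      then show False using d zero_le_power2[of "guv (xy p)"] by simp
    qed
    then show ?thesis using guu_nonneg[OF p cv] by linarith
  qed
  obtain m \<rho>1 where m: "0 < m" "0 < \<rho>1" "\<And>z x y. dist z (xy p) < \<rho>1 \<Longrightarrow> m * (x\<^sup>2 + y\<^sup>2) \<le> g'' (x, y) z (x, y)"
    using Hessian_positive_nearby[OF A d] by blast
  have cn: "continuous_on UNIV normal_vec"
  proof -
    have "continuous_on UNIV (\<lambda>q. g' (xy q) v)" for v
      by (rule continuous_on_compose2[OF continuous_g']) (auto intro!: continuous_intros)
    then show ?thesis unfolding normal_vec_def[abs_def] by (intro continuous_intros)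
  qed
  have "compact (normal_vec ` cball p r)"
    by (intro compact_continuous_image continuous_on_subset[OF cn]) auto
  from compact_imp_bounded[OF this]
  obtain \<Lambda> where \<Lambda>: "\<And>q. q \<in> cball p r \<Longrightarrow> norm (normal_vec q) \<le> \<Lambda>"
    unfolding bounded_iff by blast
  have \<Lambda>1: "1 \<le> \<Lambda>" using \<Lambda>[of p] normal_vec_ge_1[of p] r by simp
  define \<rho> where "\<rho> = min \<rho>1 r"
  have \<rho>: "0 < \<rho>" "\<rho> \<le> r" "\<rho> \<le> \<rho>1" using m r by (auto simp: \<rho>_def)
  have xyd: "dist (xy x) (xy p) < \<rho>1" if "x \<in> ball p \<rho>" for x
  proof -
    have "(dist (xy x) (xy p))\<^sup>2 = ((x - p) \<bullet> a)\<^sup>2 + ((x - p) \<bullet> b)\<^sup>2"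
      by (simp add: dist_Pair_Pair dist_real_def inner_diff_left)
    also have "\<dots> \<le> (norm (x - p))\<^sup>2" unfolding norm_sq[of "x - p"] by simp
    finally have "dist (xy x) (xy p) \<le> norm (x - p)" by (rule power2_le_imp_le) simp
    then show ?thesis using that \<rho> by (simp add: dist_norm norm_minus_commute)
  qed
  \<comment> \<open>Read off from the final estimate of \<open>(norm (q - y))\<^sup>2\<close>: 2/m
    comes from strong convexity, \<open>\<Lambda>\<close> bounds the normal vector, and
    \<open>2 * \<Lambda> * \<rho>\<close> bounds s.\<close>
  define K where "K = (1 + 2 * \<Lambda>\<^sup>2) * (2 / m) + 4 * \<Lambda> * \<rho>"
  have K: "K > 0" using \<Lambda>1 m(1) \<rho>(1) unfolding K_def
    by (intro add_pos_pos mult_pos_pos divide_pos_pos) (auto intro: add_pos_nonneg)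
  show thesis
  proof (rule that[of "1 / (K * \<Lambda>)" \<rho>])
    show "0 < 1 / (K * \<Lambda>)" using K \<Lambda>1 by simp
    fix q y assume q: "q \<in> frontier \<Omega>" "q \<in> ball p \<rho>" and y: "y \<in> \<Omega>" "y \<in> ball p \<rho>"
    have qr: "q \<in> ball p r" "y \<in> ball p r" using q y \<rho> by auto
    define \<delta> where "\<delta> = xy y - xy q"
    define s where "s = normal_vec q \<bullet> (q - y)"
    have \<delta>: "\<delta> = xy (y - q)" by (simp add: \<delta>_def inner_diff_left)
    have s1: "s = (y - q) \<bullet> c - g' (xy q) \<delta>"
      unfolding s_def \<delta> using normal_vec_inner[of q "y - q"] by (simp add: inner_diff_right algebra_simps inner_diff_left)
    have conv: "g (xy q) + g' (xy q) \<delta> + m / 2 * (norm \<delta>)\<^sup>2 \<le> g (xy y)"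
      unfolding \<delta>_def by (rule strong_convexity[OF m(3) xyd[OF q(2)] xyd[OF y(2)]])
    have "m / 2 * (norm \<delta>)\<^sup>2 \<le> s"
      using conv chart[OF qr(2)] y(1) frontier_chart[OF qr(1)] q(1) by (simp add: s1 inner_diff_left)
    then have n\<delta>: "(norm \<delta>)\<^sup>2 \<le> 2 / m * s" using m(1) by (simp add: field_simps)
    have s0: "0 \<le> s" using \<open>m / 2 * (norm \<delta>)\<^sup>2 \<le> s\<close> m(1) by (smt (verit) divide_pos_pos mult_nonneg_nonneg zero_le_power2)
    have N: "norm (normal_vec q) \<le> \<Lambda>" using \<Lambda>[of q] qr by simp
    have "s \<le> norm (normal_vec q) * norm (q - y)" unfolding s_def by (rule norm_cauchy_schwarz)
    also have "\<dots> \<le> \<Lambda> * (2 * \<rho>)"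
    proof (intro mult_mono N)
      have "norm (q - y) \<le> dist p q + dist p y" using dist_triangle3[of q y p] by (simp add: dist_norm)
      then show "norm (q - y) \<le> 2 * \<rho>" using q y by simp
    qed (use \<Lambda>1 in auto)
    finally have sle: "s \<le> 2 * \<Lambda> * \<rho>" by simp
    have g'b: "\<bar>g' (xy q) \<delta>\<bar> \<le> \<Lambda> * norm \<delta>"
    proof -
      let ?w = "(y - q) - ((y - q) \<bullet> c) *\<^sub>R c"
      have "normal_vec q \<bullet> ?w = g' (xy q) \<delta>"
        unfolding normal_vec_inner \<delta> by (simp add: inner_diff_left oi)
      moreover have "(norm ?w)\<^sup>2 = (norm \<delta>)\<^sup>2"
        unfolding norm_sq[of ?w] by (simp add: inner_diff_left oi \<delta> norm_Pair)
      then have "norm ?w = norm \<delta>" by simp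
      ultimately have "\<bar>g' (xy q) \<delta>\<bar> \<le> norm (normal_vec q) * norm \<delta>"
        using Cauchy_Schwarz_ineq2[of "normal_vec q" ?w] by simp
      also have "\<dots> \<le> \<Lambda> * norm \<delta>" using N by (simp add: mult_right_mono)
      finally show ?thesis .
    qed
    \<comment> \<open>The quadratic term in s is made linear by the bound \<open>sle\<close>, so
      that everything can be compared with s.\<close>
    have "((y - q) \<bullet> c)\<^sup>2 = (s + g' (xy q) \<delta>)\<^sup>2" by (simp add: s1)
    also have "\<dots> \<le> 2 * s\<^sup>2 + 2 * (g' (xy q) \<delta>)\<^sup>2"
      using sum_squares_bound[of s "g' (xy q) \<delta>"] by (simp add: power2_sum)
    also have "\<dots> \<le> 2 * s * (2 * \<Lambda> * \<rho>) + 2 * (\<Lambda> * norm \<delta>)\<^sup>2"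
    proof (intro add_mono mult_left_mono)
      show "2 * s\<^sup>2 \<le> 2 * s * (2 * \<Lambda> * \<rho>)"
        using mult_left_mono[OF sle s0] by (simp add: power2_eq_square algebra_simps)
      show "(g' (xy q) \<delta>)\<^sup>2 \<le> (\<Lambda> * norm \<delta>)\<^sup>2"
        using g'b by (metis abs_ge_zero power2_abs power_mono)
    qed auto
    finally have c2: "((y - q) \<bullet> c)\<^sup>2 \<le> 4 * \<Lambda> * \<rho> * s + 2 * \<Lambda>\<^sup>2 * (norm \<delta>)\<^sup>2"
      by (simp add: power_mult_distrib algebra_simps)
    have "(norm (q - y))\<^sup>2 = (norm \<delta>)\<^sup>2 + ((y - q) \<bullet> c)\<^sup>2"
      unfolding norm_minus_commute[of q y] norm_sq[of "y - q"] by (simp add: \<delta> norm_Pair)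
    also have "\<dots> \<le> (1 + 2 * \<Lambda>\<^sup>2) * (norm \<delta>)\<^sup>2 + 4 * \<Lambda> * \<rho> * s" using c2 by (simp add: algebra_simps)
    also have "\<dots> \<le> (1 + 2 * \<Lambda>\<^sup>2) * (2 / m * s) + 4 * \<Lambda> * \<rho> * s"
      by (intro add_right_mono mult_left_mono n\<delta>) simp
    also have "\<dots> = K * s" by (simp add: K_def algebra_simps)
    finally have Ks: "(norm (q - y))\<^sup>2 \<le> K * s" .
    have n1: "norm (normal_vec q) > 0" using normal_vec_ge_1[of q] by linarith
    have "1 / (K * \<Lambda>) * (norm (q - y))\<^sup>2 \<le> 1 / (K * \<Lambda>) * (K * s)"
      using Ks K \<Lambda>1 by (intro mult_left_mono) auto
    also have "\<dots> = s / \<Lambda>" using K by simp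
    also have "\<dots> \<le> s / norm (normal_vec q)" using N n1 s0 \<Lambda>1 by (intro divide_left_mono mult_pos_pos) auto
    also have "\<dots> = (normal_vec q /\<^sub>R norm (normal_vec q)) \<bullet> (q - y)" by (simp add: s_def divide_inverse mult.commute)
    finally show "1 / (K * \<Lambda>) * (norm (q - y))\<^sup>2 \<le> (normal_vec q /\<^sub>R norm (normal_vec q)) \<bullet> (q - y)" .
  qed (use \<rho> in auto)
qed

end

section \<open>Strict convexity of the whole boundary\<close>

text \<open>The chart controls only points y close to p. For a distant y, a point z on the segment
  from q to y and close to q is used. It lies in the set by convexity, and since the pairing scales
  linearly with \<open>\<tau>\<close> but the square quadratically, the estimate survives with the
  constant \<open>\<kappa> * \<tau>\<close>.\<close>

lemma strict_convexity_near:
  assumes op: "open \<Omega>" and bd: "bounded \<Omega>" and cv: "convex \<Omega>"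
    and C2: "C2_boundary \<Omega>" and pos: "positive_boundary_curvature \<Omega>" and p: "p \<in> frontier \<Omega>"
  shows "\<exists>\<kappa> \<rho>. 0 < \<kappa> \<and> 0 < \<rho> \<and> (\<forall>q\<in>frontier \<Omega> \<inter> ball p \<rho>.
     norm (outward_normal \<Omega> q) = 1 \<and> (\<forall>y\<in>\<Omega>. \<kappa> * (norm (q - y))\<^sup>2 \<le> outward_normal \<Omega> q \<bullet> (q - y)))"
proof -
  from C2 p obtain r a b c g where ch: "C2_boundary_chart \<Omega> p r a b c g"
    by (auto simp: C2_boundary_def)
  then have chart': "0 < r" "orthonormal3 a b c" "Ck 2 g"
    "\<And>x. x \<in> ball p r \<Longrightarrow> x \<in> \<Omega> \<longleftrightarrow> g (x \<bullet> a, x \<bullet> b) < x \<bullet> c"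
    unfolding C2_boundary_chart_def by blast+
  obtain g' g'' where G: "C2_graph g g' g''" using Ck2_C2_graph[OF chart'(3)] .
  interpret chart g g' g'' \<Omega> p r a b c
    using G chart' op by (intro chart.intro chart_axioms.intro)
  have "0 < gaussian_curvature (\<lambda>(u, v). u *\<^sub>R a + v *\<^sub>R b + g (u, v) *\<^sub>R c) (p \<bullet> a, p \<bullet> b)"
    using pos p ch unfolding positive_boundary_curvature_def by blast
  from graph_curvature_positive[OF G chart'(2) this] obtain \<kappa> \<rho> where
    k: "0 < \<kappa>" "0 < \<rho>" "\<rho> \<le> r"
    "\<And>q y. q \<in> frontier \<Omega> \<Longrightarrow> q \<in> ball p \<rho> \<Longrightarrow> y \<in> \<Omega> \<Longrightarrow> y \<in> ball p \<rho> \<Longrightarrow>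
       \<kappa> * (norm (q - y))\<^sup>2 \<le> (normal_vec q /\<^sub>R norm (normal_vec q)) \<bullet> (q - y)"
    using local_strict_convexity[OF p cv] by blast
  from bd obtain D0 where D0: "\<And>x. x \<in> closure \<Omega> \<Longrightarrow> norm x \<le> D0"
    using bounded_closure[OF bd] by (auto simp: bounded_iff)
  define D where "D = 2 * \<bar>D0\<bar> + 1"
  have D: "D > 0" by (simp add: D_def)
  have diam: "norm (q - y) \<le> D" if "q \<in> closure \<Omega>" "y \<in> closure \<Omega>" for q y
    using D0[OF that(1)] D0[OF that(2)] norm_triangle_ineq4[of q y] by (simp add: D_def)
  \<comment> \<open>The diameter bound D turns the factor \<open>\<rho> / (4 * L)\<close> of the
    distant case into a constant.\<close>
  define \<kappa>' where "\<kappa>' = min \<kappa> (\<kappa> * \<rho> / (4 * D))"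
  have k': "0 < \<kappa>'" "\<kappa>' \<le> \<kappa>" "\<kappa>' \<le> \<kappa> * \<rho> / (4 * D)" using k D by (auto simp: \<kappa>'_def)
  have main: "\<kappa>' * (norm (q - y))\<^sup>2 \<le> (normal_vec q /\<^sub>R norm (normal_vec q)) \<bullet> (q - y)"
    if q: "q \<in> frontier \<Omega>" "q \<in> ball p (\<rho> / 2)" and y: "y \<in> \<Omega>" for q y
  proof -
    let ?n = "normal_vec q /\<^sub>R norm (normal_vec q)"
    have q\<rho>: "q \<in> ball p \<rho>" using q k by auto
    have qc: "q \<in> closure \<Omega>" using q(1) by (simp add: frontier_def)
    have yc: "y \<in> closure \<Omega>" using y closure_subset by auto
    show ?thesis
    proof (cases "dist q y < \<rho> / 2")
      case True
      have "dist p y \<le> dist p q + dist q y" by (rule dist_triangle)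
      then have "y \<in> ball p \<rho>" using True q(2) by simp
      then have "\<kappa> * (norm (q - y))\<^sup>2 \<le> ?n \<bullet> (q - y)" using k(4) q(1) q\<rho> y by blast
      moreover have "\<kappa>' * (norm (q - y))\<^sup>2 \<le> \<kappa> * (norm (q - y))\<^sup>2" using k' by (intro mult_right_mono) auto
      ultimately show ?thesis by linarith
    next
      case False
      define L where "L = norm (q - y)"
      have L: "L \<ge> \<rho> / 2" "L > 0" "L \<le> D" using False k diam[OF qc yc] by (auto simp: L_def dist_norm)
      \<comment> \<open>This places z at distance \<open>\<rho> / 4\<close> from q, and q is within
        \<open>\<rho> / 2\<close> of p, so z is still in the ball of the local estimate.\<close>
      define \<tau> where "\<tau> = \<rho> / (4 * L)"
      have \<tau>: "0 < \<tau>" "\<tau> \<le> 1" "\<tau> * L = \<rho> / 4" using L k by (auto simp: \<tau>_def field_simps)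
      define z where "z = q - \<tau> *\<^sub>R (q - y)"
      have z\<Omega>: "z \<in> \<Omega>"
        using mem_interior_closure_convex_shrink[OF cv _ qc \<tau>(1,2), of y] y op
        by (simp add: z_def interior_open)
      have qz: "q - z = \<tau> *\<^sub>R (q - y)" by (simp add: z_def)
      have "dist q z = \<rho> / 4" using \<tau> by (simp add: dist_norm qz L_def)
      moreover have "dist p z \<le> dist p q + dist q z" by (rule dist_triangle)
      ultimately have "z \<in> ball p \<rho>" using q(2) k by simp
      then have "\<kappa> * (norm (q - z))\<^sup>2 \<le> ?n \<bullet> (q - z)" using k(4) q(1) q\<rho> z\<Omega> by blast
      then have "\<tau> * (\<kappa> * \<tau> * L\<^sup>2) \<le> \<tau> * (?n \<bullet> (q - y))"
        using \<tau> unfolding qz by (simp add: L_def power_mult_distrib power2_eq_square ac_simps)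
      then have 1: "\<kappa> * \<tau> * L\<^sup>2 \<le> ?n \<bullet> (q - y)" using \<tau> by simp
      have "\<kappa>' * L\<^sup>2 \<le> \<kappa> * \<rho> / (4 * D) * L\<^sup>2" using k' by (intro mult_right_mono) auto
      also have "\<dots> \<le> \<kappa> * \<rho> / (4 * L) * L\<^sup>2"
        using L k D by (intro mult_right_mono divide_left_mono) auto
      also have "\<dots> = \<kappa> * \<tau> * L\<^sup>2" by (simp add: \<tau>_def)
      finally show ?thesis using 1 by (simp add: L_def)
    qed
  qed
  \<comment> \<open>The supporting half-space required by \<open>outward_normal_chart\<close>
    concerns the whole set, so the normal can be identified only after the estimate has been
    extended to distant points.\<close>
  have n: "outward_normal \<Omega> q = normal_vec q /\<^sub>R norm (normal_vec q)"
    if q: "q \<in> frontier \<Omega>" "q \<in> ball p (\<rho> / 2)" for q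
  proof (rule outward_normal_chart)
    show "q \<in> ball p r" using q k by auto
    fix y assume y: "y \<in> \<Omega>"
    have "0 \<le> \<kappa>' * (norm (q - y))\<^sup>2" using k' by simp
    also have "\<dots> \<le> (normal_vec q /\<^sub>R norm (normal_vec q)) \<bullet> (q - y)" by (rule main[OF q y])
    finally have "0 \<le> inverse (norm (normal_vec q)) * (normal_vec q \<bullet> (q - y))" by simp
    moreover have "0 < inverse (norm (normal_vec q))"
      by (rule positive_imp_inverse_positive[OF less_le_trans[OF zero_less_one normal_vec_ge_1]])
    ultimately have "0 \<le> normal_vec q \<bullet> (q - y)" by (simp add: zero_le_mult_iff)
    then show "normal_vec q \<bullet> (y - q) \<le> 0" by (simp add: inner_diff_right)
  qed fact
  have "norm (outward_normal \<Omega> q) = 1" if "q \<in> frontier \<Omega>" "q \<in> ball p (\<rho> / 2)" for q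
  proof -
    have "normal_vec q \<noteq> 0" using normal_vec_ge_1[of q] by (metis norm_zero not_one_le_zero)
    then show ?thesis using n[OF that] by simp
  qed
  then show ?thesis using k' k main n
    by (intro exI[of _ \<kappa>'] exI[of _ "\<rho> / 2"]) auto
qed

lemma strict_convexity:
  assumes op: "open \<Omega>" and bd: "bounded \<Omega>" and cv: "convex \<Omega>"
    and C2: "C2_boundary \<Omega>" and pos: "positive_boundary_curvature \<Omega>"
  obtains \<kappa> where "0 < \<kappa>" "\<And>q. q \<in> frontier \<Omega> \<Longrightarrow> norm (outward_normal \<Omega> q) = 1"
    "\<And>q y. q \<in> frontier \<Omega> \<Longrightarrow> y \<in> \<Omega> \<Longrightarrow> \<kappa> * (norm (q - y))\<^sup>2 \<le> outward_normal \<Omega> q \<bullet> (q - y)"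
proof -
  obtain K R where KR: "\<And>p. p \<in> frontier \<Omega> \<Longrightarrow> 0 < K p" "\<And>p. p \<in> frontier \<Omega> \<Longrightarrow> 0 < R p"
    "\<And>p q. p \<in> frontier \<Omega> \<Longrightarrow> q \<in> frontier \<Omega> \<inter> ball p (R p) \<Longrightarrow> norm (outward_normal \<Omega> q) = 1"
    "\<And>p q y. p \<in> frontier \<Omega> \<Longrightarrow> q \<in> frontier \<Omega> \<inter> ball p (R p) \<Longrightarrow> y \<in> \<Omega> \<Longrightarrow>
      K p * (norm (q - y))\<^sup>2 \<le> outward_normal \<Omega> q \<bullet> (q - y)"
    using strict_convexity_near[OF assms] by metis
  have "compact (frontier \<Omega>)" using bd by (rule compact_frontier_bounded)
  then obtain F where F: "F \<subseteq> frontier \<Omega>" "finite F" "frontier \<Omega> \<subseteq> (\<Union>p\<in>F. ball p (R p))"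
    using KR(2) by (elim compactE_image[where C="frontier \<Omega>" and f="\<lambda>p. ball p (R p)"]) force+
  \<comment> \<open>Finitely many charts cover the compact boundary. Inserting 1 makes the minimum
    well defined for every F.\<close>
  define \<kappa> where "\<kappa> = Min (insert 1 (K ` F))"
  have "0 < \<kappa>" unfolding \<kappa>_def using F KR(1) by (subst Min_gr_iff) auto
  moreover have "norm (outward_normal \<Omega> q) = 1 \<and> (\<forall>y\<in>\<Omega>. \<kappa> * (norm (q - y))\<^sup>2 \<le> outward_normal \<Omega> q \<bullet> (q - y))"
    if "q \<in> frontier \<Omega>" for q
  proof -
    from F(3) that have "q \<in> (\<Union>p\<in>F. ball p (R p))" by (rule subsetD)
    then obtain p where p: "p \<in> F" "q \<in> ball p (R p)" by (rule UN_E)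
    then have pf: "p \<in> frontier \<Omega>" using F by auto
    have "\<kappa> \<le> K p" unfolding \<kappa>_def using F p by (intro Min_le) auto
    then have "\<kappa> * (norm (q - y))\<^sup>2 \<le> K p * (norm (q - y))\<^sup>2" for y by (intro mult_right_mono) auto
    then show ?thesis using KR(3)[OF pf, of q] KR(4)[OF pf, of q] that p by (meson IntI order_trans)
  qed
  ultimately show thesis by (intro that) auto
qed

section \<open>Exit points and the inverse weight\<close>

text \<open>Boundedness makes the set of exit times non-empty and openness makes its infimum
  positive. Openness also shows that the exit point is no longer inside, while earlier points of the
  ray approximate it from inside.\<close>

lemma exit_point:
  assumes op: "open \<Omega>" and bd: "bounded \<Omega>" and x: "x \<in> \<Omega>" and \<zeta>: "\<zeta> \<noteq> 0"
  shows "0 < tau_minus \<Omega> x \<zeta>" "q_exit \<Omega> x \<zeta> \<in> frontier \<Omega>"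
proof -
  define S where "S = {s. s > 0 \<and> x - s *\<^sub>R \<zeta> \<notin> \<Omega>}"
  define \<tau> where "\<tau> = Inf S"
  have \<tau>: "tau_minus \<Omega> x \<zeta> = \<tau>" by (simp add: tau_minus_def \<tau>_def S_def)
  obtain M where M: "\<And>y. y \<in> \<Omega> \<Longrightarrow> norm y \<le> M" using bd by (auto simp: bounded_iff)
  have "0 \<le> M" using M[OF x] norm_ge_zero order_trans by blast
  define s1 where "s1 = (2 * M + 1) / norm \<zeta>"
  have "s1 > 0" using \<zeta> \<open>0 \<le> M\<close> by (simp add: s1_def)
  moreover have "x - s1 *\<^sub>R \<zeta> \<notin> \<Omega>"
  proof
    assume "x - s1 *\<^sub>R \<zeta> \<in> \<Omega>"
    from M[OF this] M[OF x] have "norm (s1 *\<^sub>R \<zeta>) \<le> 2 * M"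
      using norm_triangle_ineq4[of x "x - s1 *\<^sub>R \<zeta>"] by simp
    moreover have "norm (s1 *\<^sub>R \<zeta>) = 2 * M + 1" using \<zeta> \<open>0 \<le> M\<close> by (simp add: s1_def)
    ultimately show False by simp
  qed
  ultimately have ne: "S \<noteq> {}" by (auto simp: S_def)
  obtain e where e: "e > 0" "ball x e \<subseteq> \<Omega>" using op x by (auto simp: open_contains_ball)
  have lb: "e / norm \<zeta> \<le> s" if "s \<in> S" for s
  proof (rule ccontr)
    assume "\<not> e / norm \<zeta> \<le> s"
    then have "norm (s *\<^sub>R \<zeta>) < e" using that \<zeta> by (simp add: S_def field_simps)
    then have "x - s *\<^sub>R \<zeta> \<in> ball x e" by (simp add: dist_norm)
    from subsetD[OF e(2) this] show False using that by (simp add: S_def)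
  qed
  have bb: "bdd_below S" using lb by (intro bdd_belowI)
  have "e / norm \<zeta> \<le> \<tau>" unfolding \<tau>_def using ne lb by (intro cInf_greatest)
  then have t0: "0 < \<tau>" using e \<zeta> by (smt (verit) divide_pos_pos zero_less_norm_iff)
  then show "0 < tau_minus \<Omega> x \<zeta>" by (simp add: \<tau>)
  have inside: "x - s *\<^sub>R \<zeta> \<in> \<Omega>" if "0 < s" "s < \<tau>" for s
    using that cInf_lower[OF _ bb, of s] by (force simp: \<tau>_def S_def)
  have notin: "x - \<tau> *\<^sub>R \<zeta> \<notin> \<Omega>"
  proof
    assume "x - \<tau> *\<^sub>R \<zeta> \<in> \<Omega>"
    then obtain e where e: "e > 0" "ball (x - \<tau> *\<^sub>R \<zeta>) e \<subseteq> \<Omega>" using op by (auto simp: open_contains_ball)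
    have "\<tau> < \<tau> + e / norm \<zeta>" using e \<zeta> by simp
    then obtain s where s: "s \<in> S" "s < \<tau> + e / norm \<zeta>"
      unfolding \<tau>_def using cInf_lessD[OF ne] by metis
    have "\<tau> \<le> s" unfolding \<tau>_def using s bb by (intro cInf_lower)
    then have "(s - \<tau>) * norm \<zeta> < e" using s \<zeta> by (simp add: field_simps)
    then have "norm ((s - \<tau>) *\<^sub>R \<zeta>) < e" using \<open>\<tau> \<le> s\<close> unfolding norm_scaleR by simp
    then have "dist (x - \<tau> *\<^sub>R \<zeta>) (x - s *\<^sub>R \<zeta>) < e" by (simp add: dist_norm algebra_simps)
    then show False using e s by (auto simp: S_def)
  qed
  have "x - \<tau> *\<^sub>R \<zeta> \<in> closure \<Omega>"
    unfolding closure_approachable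
  proof (intro allI impI)
    fix e :: real assume e: "0 < e"
    define s where "s = max (\<tau> / 2) (\<tau> - e / (2 * norm \<zeta>))"
    have s: "0 < s" "s < \<tau>" "\<tau> - s \<le> e / (2 * norm \<zeta>)" using e t0 \<zeta> by (auto simp: s_def)
    have "dist (x - s *\<^sub>R \<zeta>) (x - \<tau> *\<^sub>R \<zeta>) = (\<tau> - s) * norm \<zeta>"
      using s by (simp add: dist_norm flip: scaleR_diff_left)
    also have "\<dots> \<le> e / (2 * norm \<zeta>) * norm \<zeta>" using s by (intro mult_right_mono) auto
    also have "\<dots> < e" using e \<zeta> by simp
    finally show "\<exists>y\<in>\<Omega>. dist y (x - \<tau> *\<^sub>R \<zeta>) < e" using inside[OF s(1,2)] by blast
  qed
  then show "q_exit \<Omega> x \<zeta> \<in> frontier \<Omega>"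
    using notin op by (simp add: q_exit_def \<tau> frontier_def interior_open)
qed

text \<open>Two estimates at the exit point q are multiplied. Strict convexity with y = x gives
  \<open>\<kappa> * \<tau> * norm \<zeta> \<le> N\<close>. The distance from x to the tangent plane
  at q is \<open>\<tau> * norm \<zeta> * N\<close>, and the set lies on one side of this plane, so d
  is at most that distance. Together \<kappa> d <= N^2, which explains the exponent -1/2.\<close>

theorem inverse_weight_bound:
  assumes op: "open \<Omega>" and ne: "\<Omega> \<noteq> {}" and bd: "bounded \<Omega>" and cv: "convex \<Omega>"
    and C2: "C2_boundary \<Omega>" and pos: "positive_boundary_curvature \<Omega>"
  obtains C where "0 < C" "\<And>x \<zeta>. x \<in> \<Omega> \<Longrightarrow> \<zeta> \<noteq> 0 \<Longrightarrow> 0 < weight \<Omega> x \<zeta>"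
    "\<And>x \<zeta>. x \<in> \<Omega> \<Longrightarrow> \<zeta> \<noteq> 0 \<Longrightarrow>
       inverse (weight \<Omega> x \<zeta>) \<le> C * infdist x (frontier \<Omega>) powr (-1/2) * (1 + inverse (norm \<zeta>))"
proof -
  obtain \<kappa> where \<kappa>: "0 < \<kappa>" "\<And>q. q \<in> frontier \<Omega> \<Longrightarrow> norm (outward_normal \<Omega> q) = 1"
    "\<And>q y. q \<in> frontier \<Omega> \<Longrightarrow> y \<in> \<Omega> \<Longrightarrow> \<kappa> * (norm (q - y))\<^sup>2 \<le> outward_normal \<Omega> q \<bullet> (q - y)"
    using strict_convexity[OF op bd cv C2 pos] by blast
  have *: "0 < weight \<Omega> x \<zeta> \<and> inverse (weight \<Omega> x \<zeta>) \<le> \<kappa> powr (-1/2) * infdist x (frontier \<Omega>) powr (-1/2) * (1 + inverse (norm \<zeta>))"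
    if x: "x \<in> \<Omega>" and \<zeta>: "\<zeta> \<noteq> 0" for x \<zeta>
  proof -
    define \<tau> q n where "\<tau> = tau_minus \<Omega> x \<zeta>" and "q = q_exit \<Omega> x \<zeta>" and "n = outward_normal \<Omega> q"
    define N where "N = N_exit \<Omega> x \<zeta>"
    have \<tau>: "0 < \<tau>" and q: "q \<in> frontier \<Omega>" using exit_point[OF op bd x \<zeta>] by (auto simp: \<tau>_def q_def)
    have qx: "q - x = - (\<tau> *\<^sub>R \<zeta>)" by (simp add: q_def q_exit_def \<tau>_def)
    have n1: "norm n = 1" unfolding n_def by (rule \<kappa>(2)[OF q])
    have z0: "norm \<zeta> > 0" using \<zeta> by simp
    have "\<kappa> * (norm (q - x))\<^sup>2 \<le> n \<bullet> (q - x)" unfolding n_def by (rule \<kappa>(3)[OF q x])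
    then have "\<tau> * (\<kappa> * \<tau> * (norm \<zeta>)\<^sup>2) \<le> \<tau> * (- (n \<bullet> \<zeta>))"
      unfolding qx by (simp add: power_mult_distrib power2_eq_square ac_simps)
    then have lz: "\<kappa> * \<tau> * (norm \<zeta>)\<^sup>2 \<le> - (n \<bullet> \<zeta>)" using \<tau> by (rule mult_left_le_imp_le)
    have "0 < \<kappa> * \<tau> * (norm \<zeta>)\<^sup>2" using \<kappa> \<tau> z0 by simp
    with lz have neg: "0 < - (n \<bullet> \<zeta>)" by linarith
    have N: "N = - (n \<bullet> \<zeta>) / norm \<zeta>" using neg by (simp add: N_def N_exit_def n_def q_def)
    have N0: "0 < N" unfolding N by (rule divide_pos_pos[OF neg z0])
    have N1: "\<kappa> * \<tau> * norm \<zeta> \<le> N" using lz z0 by (simp add: N field_simps power2_eq_square)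
    define d where "d = infdist x (frontier \<Omega>)"
    define l where "l = n \<bullet> (q - x)"
    have "l = \<tau> * norm \<zeta> * N" using z0 by (simp add: l_def qx N)
    moreover have "0 < \<tau> * norm \<zeta> * N" using \<tau> z0 N0 by (intro mult_pos_pos)
    ultimately have l: "l = \<tau> * norm \<zeta> * N" "0 < l" by auto
    \<comment> \<open>\<open>x + l *\<^sub>R n\<close> is the orthogonal projection of x to the
      tangent plane. By strict convexity a point of the set in that plane could only be q, which is
      a boundary point.\<close>
    have out: "x + l *\<^sub>R n \<notin> \<Omega>"
    proof
      assume i: "x + l *\<^sub>R n \<in> \<Omega>"
      have "n \<bullet> (q - (x + l *\<^sub>R n)) = 0"
        using n1 by (simp add: l_def inner_diff_right inner_add_right norm_eq_1)
      with \<kappa>(3)[OF q i] \<kappa>(1) have "norm (q - (x + l *\<^sub>R n)) = 0"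
        unfolding n_def by (simp add: mult_le_0_iff)
      then have "q \<in> \<Omega>" using i by simp
      then show False using q op by (simp add: frontier_def interior_open)
    qed
    have "closed_segment x (x + l *\<^sub>R n) \<inter> frontier \<Omega> \<noteq> {}"
      by (rule connected_Int_frontier) (use x out in auto)
    then obtain z where z: "z \<in> closed_segment x (x + l *\<^sub>R n)" "z \<in> frontier \<Omega>" by auto
    have "d \<le> dist x z" unfolding d_def by (rule infdist_le[OF z(2)])
    also have "\<dots> \<le> norm (x + l *\<^sub>R n - x)" using segment_bound1[OF z(1)] by (simp add: dist_norm norm_minus_commute)
    also have "\<dots> = l" using n1 l by simp
    finally have dl: "d \<le> \<tau> * norm \<zeta> * N" by (simp add: l)
    have d0: "0 < d"
    proof -
      have "x \<notin> frontier \<Omega>" using x op by (simp add: frontier_def interior_open)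
      then show ?thesis unfolding d_def using q
        by (intro infdist_pos_not_in_closed) auto
    qed
    have "\<kappa> * d \<le> \<kappa> * (\<tau> * norm \<zeta> * N)" using dl \<kappa> by (intro mult_left_mono) auto
    also have "\<dots> = (\<kappa> * \<tau> * norm \<zeta>) * N" by (simp add: ac_simps)
    also have "\<dots> \<le> N * N" using N1 N0 by (intro mult_right_mono) auto
    finally have "\<kappa> * d \<le> N\<^sup>2" by (simp add: power2_eq_square)
    then have sN: "sqrt (\<kappa> * d) \<le> N" using N0 by (intro real_le_lsqrt) auto
    have w: "weight \<Omega> x \<zeta> = norm \<zeta> / (1 + norm \<zeta>) * N" by (simp add: weight_def N_def)
    have z1: "0 < 1 + norm \<zeta>" using z0 by linarith
    have w0: "0 < weight \<Omega> x \<zeta>" unfolding w by (intro mult_pos_pos divide_pos_pos z0 z1 N0)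
    have "inverse (weight \<Omega> x \<zeta>) = (1 + inverse (norm \<zeta>)) * inverse N"
      unfolding w using z0 N0 by (simp add: field_simps)
    also have "\<dots> \<le> (1 + inverse (norm \<zeta>)) * inverse (sqrt (\<kappa> * d))"
      using sN \<kappa> d0 z0 by (intro mult_left_mono le_imp_inverse_le) auto
    also have "inverse (sqrt (\<kappa> * d)) = \<kappa> powr (-1/2) * d powr (-1/2)"
      using \<kappa> d0 by (simp add: powr_minus powr_half_sqrt real_sqrt_mult powr_mult flip: powr_minus_divide)
    finally show ?thesis using w0 by (simp add: d_def ac_simps)
  qed
  show thesis by (rule that[of "\<kappa> powr (-1/2)"]) (use * \<kappa> in auto)
qed

section \<open>Singular integrals over angles and velocities\<close>

text \<open>The power |x|^(-a) with the value infinity at 0. The real power is 0 there, which would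
  break antimonotonicity; with infinity the comparisons hold without excluding the pole.\<close>

definition inv_pow :: "real \<Rightarrow> real \<Rightarrow> ennreal" where
  "inv_pow a x = inverse (ennreal (\<bar>x\<bar> powr a))"

lemma measurable_inv_pow [measurable]: "inv_pow a \<in> borel_measurable borel"
  unfolding inv_pow_def by measurable

lemma inv_pow_0 [simp]: "inv_pow a 0 = top"
  by (simp add: inv_pow_def)

lemma inv_pow_pos: "x \<noteq> 0 \<Longrightarrow> inv_pow a x = ennreal (\<bar>x\<bar> powr (- a))"
  by (simp add: inv_pow_def inverse_ennreal powr_minus)

lemma inv_pow_abs [simp]: "inv_pow a \<bar>x\<bar> = inv_pow a x" and inv_pow_minus [simp]: "inv_pow a (- x) = inv_pow a x"
  by (simp_all add: inv_pow_def)

lemma inv_pow_antimono: "0 \<le> a \<Longrightarrow> \<bar>x\<bar> \<le> \<bar>y\<bar> \<Longrightarrow> inv_pow a y \<le> inv_pow a x"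
  by (cases "x = 0") (auto simp: inv_pow_pos intro!: ennreal_leI powr_mono2')

lemma inv_pow_mult: "inv_pow a (x * y) = inv_pow a x * inv_pow a y"
  by (simp add: inv_pow_def abs_mult powr_mult ennreal_mult ennreal_inverse_mult)

lemma inv_pow_add: "inv_pow (a + b) x = inv_pow a x * inv_pow b x"
  by (simp add: inv_pow_def powr_add ennreal_mult ennreal_inverse_mult)

text \<open>The smaller of the two arguments carries the whole exponent. A product of two poles at
  different places is thus traded for a sum of single poles.\<close>

lemma inv_pow_mult_le_add:
  assumes "0 \<le> a" "0 \<le> b"
  shows "inv_pow a x * inv_pow b y \<le> inv_pow (a + b) x + inv_pow (a + b) y"
proof (cases "\<bar>x\<bar> \<le> \<bar>y\<bar>")
  case True
  then have "inv_pow a x * inv_pow b y \<le> inv_pow a x * inv_pow b x"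
    using assms by (intro mult_left_mono inv_pow_antimono) auto
  then show ?thesis by (simp add: inv_pow_add[symmetric] add_increasing2)
next
  case False
  then have "inv_pow a x * inv_pow b y \<le> inv_pow a y * inv_pow b y"
    using assms by (intro mult_right_mono inv_pow_antimono) auto
  then show ?thesis by (simp add: inv_pow_add[symmetric] add_increasing)
qed

lemma inv_pow_le_1: "0 \<le> a \<Longrightarrow> 1 \<le> \<bar>x\<bar> \<Longrightarrow> inv_pow a x \<le> 1"
  using inv_pow_antimono[of a 1 x] by (simp add: inv_pow_def)

text \<open>The pole of a maximum can be shared between its two arguments with a free choice of
  exponents; this separates the two angular integrations.\<close>

lemma inv_pow_max_le:
  assumes "0 \<le> a" "0 \<le> b" "\<bar>x\<bar> \<le> z" "\<bar>y\<bar> \<le> z"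
  shows "inv_pow (a + b) z \<le> inv_pow a x * inv_pow b y"
  unfolding inv_pow_add using assms by (intro mult_mono inv_pow_antimono) auto

section \<open>One-dimensional integrals with a moving pole\<close>

lemma nn_integral_inv_pow_unit:
  assumes "0 \<le> a" "a < 1"
  shows "(\<integral>\<^sup>+t. inv_pow a t * indicator {-1..1} t \<partial>lborel) < \<infinity>"
proof -
  have pos: "(\<integral>\<^sup>+t. inv_pow a t * indicator {0..1} t \<partial>lborel) < \<infinity>"
  proof -
    have "((\<lambda>x. x powr (- a)) has_integral (1 powr (- a + 1) / (- a + 1))) {0..1}"
      using assms by (intro has_integral_powr_from_0) auto
    then have "(\<integral>\<^sup>+x. ennreal (x powr (- a)) * indicator {0..1} x \<partial>lborel) < \<infinity>"
      by (subst nn_integral_has_integral_lebesgue') auto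
    moreover have "(\<integral>\<^sup>+x. ennreal (x powr (- a)) * indicator {0..1} x \<partial>lborel) = (\<integral>\<^sup>+t. inv_pow a t * indicator {0..1} t \<partial>lborel)"
    proof (rule nn_integral_cong_AE)
      show "AE x in lborel. ennreal (x powr (- a)) * indicator {0..1} x = inv_pow a x * indicator {0..1} x"
        using AE_lborel_singleton[of 0] by eventually_elim (auto simp: inv_pow_pos indicator_def)
    qed
    ultimately show ?thesis by simp
  qed
  have neg: "(\<integral>\<^sup>+t. inv_pow a t * indicator {-1..0} t \<partial>lborel) = (\<integral>\<^sup>+t. inv_pow a t * indicator {0..1} t \<partial>lborel)"
    by (subst nn_integral_real_affine[of _ "-1" 0]) (auto intro!: nn_integral_cong simp: indicator_def)
  have "(\<integral>\<^sup>+t. inv_pow a t * indicator {-1..1} t \<partial>lborel) \<le> (\<integral>\<^sup>+t. inv_pow a t * indicator {-1..0} t + inv_pow a t * indicator {0..1} t \<partial>lborel)"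
    by (intro nn_integral_mono) (auto simp: indicator_def)
  also have "\<dots> < \<infinity>" using pos by (simp add: nn_integral_add neg)
  finally show ?thesis .
qed

text \<open>Within distance 1 of the pole the integral is the one around 0, and elsewhere the
  integrand is at most 1. Neither part depends on c.\<close>

lemma nn_integral_inv_pow_bounded:
  assumes a: "0 \<le> a" "a < 1"
  shows "\<exists>K<\<infinity>. \<forall>c. (\<integral>\<^sup>+t. inv_pow a (c + t) * indicator {l..u} t \<partial>lborel) \<le> K"
proof (intro exI conjI allI)
  let ?U = "\<integral>\<^sup>+t. inv_pow a t * indicator {-1..1} t \<partial>lborel"
  show "?U + emeasure lborel {l..u} < \<infinity>"
    using nn_integral_inv_pow_unit[OF a] by (simp add: emeasure_lborel_Icc_eq)
  fix c
  have p: "inv_pow a t \<le> inv_pow a t * indicator {-1..1} t + 1" for t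
    using inv_pow_le_1[OF a(1), of t] by (auto simp: indicator_def)
  have "(\<integral>\<^sup>+t. inv_pow a (c + t) * indicator {l..u} t \<partial>lborel)
     \<le> (\<integral>\<^sup>+t. inv_pow a (c + t) * indicator {-1..1} (c + t) + indicator {l..u} t \<partial>lborel)"
    using p[of "c + _"] by (intro nn_integral_mono) (auto simp: indicator_def)
  also have "\<dots> = (\<integral>\<^sup>+t. inv_pow a (c + t) * indicator {-1..1} (c + t) \<partial>lborel) + emeasure lborel {l..u}"
    by (subst nn_integral_add) auto
  also have "(\<integral>\<^sup>+t. inv_pow a (c + t) * indicator {-1..1} (c + t) \<partial>lborel) = ?U"
    by (subst (2) nn_integral_real_affine[of _ 1 c]) auto
  finally show "(\<integral>\<^sup>+t. inv_pow a (c + t) * indicator {l..u} t \<partial>lborel) \<le> ?U + emeasure lborel {l..u}" .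
qed

text \<open>Substitution $s = -\cos\varphi$; the Jacobian contributes the factor $(1 - s^2)^{-1/2}$.\<close>
lemma nn_integral_inv_pow_cos_half:
  shows "\<exists>K<\<infinity>. \<forall>c. (\<integral>\<^sup>+\<phi>. inv_pow (1/3) (c + cos \<phi>) * indicator {0..pi} \<phi> \<partial>lborel) \<le> K"
proof -
  \<comment> \<open>The exponent 5/6 is 1/3 + 1/2, the given pole merged with those of the Jacobian;
    it is still below 1.\<close>
  obtain A where A: "A < \<infinity>" "\<And>c. (\<integral>\<^sup>+t. inv_pow (5/6) (c + t) * indicator {-1..1} t \<partial>lborel) \<le> A"
    using nn_integral_inv_pow_bounded[of "5/6" "-1" 1] by auto
  show ?thesis
  proof (intro exI conjI allI)
    show "A + (A + A) < \<infinity>" using A by simp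
    fix c :: real
    let ?f = "\<lambda>s::real. inv_pow (1/3) (c - s) * inv_pow (1/2) (1 - s\<^sup>2)"
    have "(\<integral>\<^sup>+\<phi>. inv_pow (1/3) (c + cos \<phi>) * indicator {0..pi} \<phi> \<partial>lborel)
      = (\<integral>\<^sup>+\<phi>. ?f (- cos \<phi>) * ennreal (sin \<phi>) * indicator {0..pi} \<phi> \<partial>lborel)"
    proof (rule nn_integral_cong_AE)
      show "AE \<phi> in lborel. inv_pow (1/3) (c + cos \<phi>) * indicator {0..pi} \<phi> = ?f (- cos \<phi>) * ennreal (sin \<phi>) * indicator {0..pi} \<phi>"
        using AE_lborel_singleton[of 0] AE_lborel_singleton[of pi]
      proof eventually_elim
        case (elim \<phi>)
        show ?case
        proof (cases "\<phi> \<in> {0..pi}")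
          case True
          then have s: "0 < sin \<phi>" using elim by (intro sin_gt_zero) auto
          have "inv_pow (1/2) (1 - (cos \<phi>)\<^sup>2) = inv_pow (1/2) ((sin \<phi>)\<^sup>2)"
            by (simp add: sin_squared_eq)
          also have "\<dots> = ennreal (inverse (sin \<phi>))"
            using s by (simp add: inv_pow_pos powr_minus powr_half_sqrt)
          finally have "inv_pow (1/2) (1 - (cos \<phi>)\<^sup>2) * ennreal (sin \<phi>) = 1"
            using s by (simp flip: ennreal_mult)
          then show ?thesis by (simp add: mult.assoc)
        qed simp
      qed
    qed
    also have "\<dots> = (\<integral>\<^sup>+s. ?f s * indicator {- cos 0..- cos pi} s \<partial>lborel)"
      by (rule nn_integral_substitution_aux[symmetric])
        (auto intro!: derivative_eq_intros continuous_intros sin_ge_zero)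
    also have "\<dots> \<le> (\<integral>\<^sup>+s. inv_pow (5/6) (- c + s) * indicator {-1..1} s
        + (inv_pow (5/6) (1 + s) * indicator {-1..1} s + inv_pow (5/6) (- 1 + s) * indicator {-1..1} s) \<partial>lborel)"
    proof (intro nn_integral_mono)
      fix s :: real
      show "?f s * indicator {- cos 0..- cos pi} s \<le> inv_pow (5/6) (- c + s) * indicator {-1..1} s
        + (inv_pow (5/6) (1 + s) * indicator {-1..1} s + inv_pow (5/6) (- 1 + s) * indicator {-1..1} s)"
      proof (cases "s \<in> {-1..1}")
        case True
        have f1: "?f s \<le> inv_pow (5/6) (c - s) + inv_pow (5/6) (1 - s\<^sup>2)"
          using inv_pow_mult_le_add[of "1/3" "1/2" "c - s" "1 - s\<^sup>2"] by simp
        have f2: "inv_pow (5/6) (c - s) = inv_pow (5/6) (- c + s)"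
          using inv_pow_minus[of "5/6" "c - s"] by simp
        have f3: "inv_pow (5/6) (- 1 + s) = inv_pow (5/6) (1 - s)"
          using inv_pow_minus[of "5/6" "1 - s"] by simp
        \<comment> \<open>On [-1, 1] one of the factors 1 + s and 1 - s is at least 1, so the
          product dominates the other factor.\<close>
        have f4: "inv_pow (5/6) (1 - s\<^sup>2) \<le> inv_pow (5/6) (1 + s) + inv_pow (5/6) (1 - s)"
        proof -
          have f: "1 - s\<^sup>2 = (1 + s) * (1 - s)" by (simp add: power2_eq_square algebra_simps)
          have "\<bar>1 + s\<bar> \<le> \<bar>1 - s\<^sup>2\<bar> \<or> \<bar>1 - s\<bar> \<le> \<bar>1 - s\<^sup>2\<bar>"
          proof (cases "s \<ge> 0")
            case True
            have "1 * (1 - s) \<le> (1 + s) * (1 - s)" using True \<open>s \<in> {-1..1}\<close> by (intro mult_right_mono) auto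
            then show ?thesis using \<open>s \<in> {-1..1}\<close> f by auto
          next
            case False
            have "(1 + s) * 1 \<le> (1 + s) * (1 - s)" using False \<open>s \<in> {-1..1}\<close> by (intro mult_left_mono) auto
            then show ?thesis using \<open>s \<in> {-1..1}\<close> f by auto
          qed
          then show ?thesis
          proof
            assume "\<bar>1 + s\<bar> \<le> \<bar>1 - s\<^sup>2\<bar>"
            then have "inv_pow (5/6) (1 - s\<^sup>2) \<le> inv_pow (5/6) (1 + s)" by (intro inv_pow_antimono) auto
            then show ?thesis by (rule add_increasing2[rotated]) simp
          next
            assume "\<bar>1 - s\<bar> \<le> \<bar>1 - s\<^sup>2\<bar>"
            then have "inv_pow (5/6) (1 - s\<^sup>2) \<le> inv_pow (5/6) (1 - s)" by (intro inv_pow_antimono) auto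
            then show ?thesis by (rule add_increasing[rotated]) simp
          qed
        qed
        from order_trans[OF f1 add_left_mono[OF f4]]
        have "?f s \<le> inv_pow (5/6) (- c + s) + (inv_pow (5/6) (1 + s) + inv_pow (5/6) (- 1 + s))"
          unfolding f2 f3 .
        then show ?thesis using True by simp
      qed simp
    qed
    also have "\<dots> = (\<integral>\<^sup>+s. inv_pow (5/6) (- c + s) * indicator {-1..1} s \<partial>lborel)
        + ((\<integral>\<^sup>+s. inv_pow (5/6) (1 + s) * indicator {-1..1} s \<partial>lborel) + (\<integral>\<^sup>+s. inv_pow (5/6) (- 1 + s) * indicator {-1..1} s \<partial>lborel))"
      by (subst nn_integral_add, measurable, subst nn_integral_add) measurable
    also have "\<dots> \<le> A + (A + A)"
      using A(2) by (intro add_mono) blast+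
    finally show "(\<integral>\<^sup>+\<phi>. inv_pow (1/3) (c + cos \<phi>) * indicator {0..pi} \<phi> \<partial>lborel) \<le> A + (A + A)" .
  qed
qed

lemma nn_integral_inv_pow_cos:
  shows "\<exists>K<\<infinity>. \<forall>c. (\<integral>\<^sup>+\<phi>. inv_pow (1/3) (c + cos \<phi>) * indicator {0..2*pi} \<phi> \<partial>lborel) \<le> K"
proof -
  obtain K where K: "K < \<infinity>" "\<And>c. (\<integral>\<^sup>+\<phi>. inv_pow (1/3) (c + cos \<phi>) * indicator {0..pi} \<phi> \<partial>lborel) \<le> K"
    using nn_integral_inv_pow_cos_half by blast
  show ?thesis
  proof (intro exI conjI allI)
    show "K + K < \<infinity>" using K by simp
    fix c :: real
    have r: "(\<integral>\<^sup>+\<phi>. inv_pow (1/3) (c + cos \<phi>) * indicator {pi..2*pi} \<phi> \<partial>lborel)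
       = (\<integral>\<^sup>+\<phi>. inv_pow (1/3) (c + cos \<phi>) * indicator {0..pi} \<phi> \<partial>lborel)"
      by (subst nn_integral_real_affine[of _ "-1" "2 * pi"])
        (auto intro!: nn_integral_cong simp: indicator_def)
    have "(\<integral>\<^sup>+\<phi>. inv_pow (1/3) (c + cos \<phi>) * indicator {0..2*pi} \<phi> \<partial>lborel)
       \<le> (\<integral>\<^sup>+\<phi>. inv_pow (1/3) (c + cos \<phi>) * indicator {0..pi} \<phi> + inv_pow (1/3) (c + cos \<phi>) * indicator {pi..2*pi} \<phi> \<partial>lborel)"
      by (intro nn_integral_mono) (auto simp: indicator_def)
    also have "\<dots> \<le> K + K" using K(2)[of c] by (simp add: nn_integral_add r add_mono)
    finally show "(\<integral>\<^sup>+\<phi>. inv_pow (1/3) (c + cos \<phi>) * indicator {0..2*pi} \<phi> \<partial>lborel) \<le> K + K" .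
  qed
qed

text \<open>With t = (sin \<theta>)^2 the measure sin \<theta> cos \<theta> d\<theta> becomes dt up
  to a factor, and the power -1/3 of sin \<theta> cos \<theta> becomes the power -1/6 of t (1 - t).
  Merged with the pole of order 2/3 this gives the exponent 5/6, below 1.\<close>

lemma nn_integral_inv_pow_sin2:
  shows "\<exists>K<\<infinity>. \<forall>c. (\<integral>\<^sup>+\<theta>. inv_pow (2/3) (c + (sin \<theta>)\<^sup>2) * inv_pow (1/3) (sin \<theta> * cos \<theta>)
     * ennreal (sin \<theta> * cos \<theta>) * indicator {0..pi/2} \<theta> \<partial>lborel) \<le> K"
proof -
  obtain A where A: "A < \<infinity>" "\<And>c. (\<integral>\<^sup>+t. inv_pow (5/6) (c + t) * indicator {0..1} t \<partial>lborel) \<le> A"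
    using nn_integral_inv_pow_bounded[of "5/6" 0 1] by auto
  \<comment> \<open>On the unit interval one of t and 1 - t is at least 1/2; d is the price for
    removing it from the product.\<close>
  define d where "d = inv_pow (5/6) (1/2)"
  have d: "d < \<infinity>" by (simp add: d_def inv_pow_pos)
  show ?thesis
  proof (intro exI conjI allI)
    show "A + d * (A + A) < \<infinity>" using A d by (simp add: ennreal_mult_less_top)
    fix c :: real
    let ?f = "\<lambda>t::real. inv_pow (2/3) (c + t) * inv_pow (1/6) (t * (1 - t))"
    have e: "inv_pow (1/3) (sin \<theta> * cos \<theta>) = inv_pow (1/6) ((sin \<theta>)\<^sup>2 * (1 - (sin \<theta>)\<^sup>2))" for \<theta> :: real
    proof -
      have "(sin \<theta>)\<^sup>2 * (1 - (sin \<theta>)\<^sup>2) = (sin \<theta> * cos \<theta>) * (sin \<theta> * cos \<theta>)"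
        using cos_squared_eq[of \<theta>] by (simp add: power2_eq_square)
      then have "inv_pow (1/6) ((sin \<theta>)\<^sup>2 * (1 - (sin \<theta>)\<^sup>2)) = inv_pow (1/6 + 1/6) (sin \<theta> * cos \<theta>)"
        by (simp only: inv_pow_mult[of _ "sin \<theta> * cos \<theta>" "sin \<theta> * cos \<theta>"] inv_pow_add)
      then show ?thesis by simp
    qed
    have "(\<integral>\<^sup>+\<theta>. inv_pow (2/3) (c + (sin \<theta>)\<^sup>2) * inv_pow (1/3) (sin \<theta> * cos \<theta>)
        * ennreal (sin \<theta> * cos \<theta>) * indicator {0..pi/2} \<theta> \<partial>lborel)
      \<le> (\<integral>\<^sup>+\<theta>. ?f ((sin \<theta>)\<^sup>2) * ennreal (2 * sin \<theta> * cos \<theta>) * indicator {0..pi/2} \<theta> \<partial>lborel)"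
    proof (intro nn_integral_mono)
      fix \<theta> :: real
      show "inv_pow (2/3) (c + (sin \<theta>)\<^sup>2) * inv_pow (1/3) (sin \<theta> * cos \<theta>) * ennreal (sin \<theta> * cos \<theta>) * indicator {0..pi/2} \<theta>
         \<le> ?f ((sin \<theta>)\<^sup>2) * ennreal (2 * sin \<theta> * cos \<theta>) * indicator {0..pi/2} \<theta>"
      proof (cases "\<theta> \<in> {0..pi/2}")
        case True
        then have "0 \<le> sin \<theta>" "0 \<le> cos \<theta>" by (auto intro: sin_ge_zero cos_ge_zero)
        then show ?thesis unfolding e by (intro mult_right_mono mult_left_mono ennreal_leI) auto
      qed simp
    qed
    also have "\<dots> = (\<integral>\<^sup>+t. ?f t * indicator {(sin 0)\<^sup>2..(sin (pi/2))\<^sup>2} t \<partial>lborel)"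
      by (rule nn_integral_substitution_aux[where g="\<lambda>\<theta>. (sin \<theta>)\<^sup>2", symmetric])
        (auto intro!: derivative_eq_intros continuous_intros mult_nonneg_nonneg sin_ge_zero cos_ge_zero)
    also have "\<dots> \<le> (\<integral>\<^sup>+t. inv_pow (5/6) (c + t) * indicator {0..1} t
        + d * (inv_pow (5/6) (0 + t) * indicator {0..1} t + inv_pow (5/6) (- 1 + t) * indicator {0..1} t) \<partial>lborel)"
    proof (intro nn_integral_mono)
      fix t :: real
      show "?f t * indicator {(sin 0)\<^sup>2..(sin (pi/2))\<^sup>2} t \<le> inv_pow (5/6) (c + t) * indicator {0..1} t
        + d * (inv_pow (5/6) (0 + t) * indicator {0..1} t + inv_pow (5/6) (- 1 + t) * indicator {0..1} t)"
      proof (cases "t \<in> {0..1}")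
        case True
        have f1: "?f t \<le> inv_pow (5/6) (c + t) + inv_pow (5/6) (t * (1 - t))"
          using inv_pow_mult_le_add[of "2/3" "1/6" "c + t" "t * (1 - t)"] by simp
        have f3: "inv_pow (5/6) (- 1 + t) = inv_pow (5/6) (1 - t)"
          using inv_pow_minus[of "5/6" "1 - t"] by simp
        have f4: "inv_pow (5/6) (t * (1 - t)) \<le> d * (inv_pow (5/6) t + inv_pow (5/6) (1 - t))"
        proof (cases "t \<le> 1/2")
          case t: True
          have "inv_pow (5/6) (t * (1 - t)) \<le> inv_pow (5/6) ((1/2) * t)"
            using True t mult_left_mono[of "1/2" "1 - t" t] by (intro inv_pow_antimono) (auto simp: abs_mult)
          also have "\<dots> = d * inv_pow (5/6) t" by (simp only: inv_pow_mult d_def)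
          also have "\<dots> \<le> d * (inv_pow (5/6) t + inv_pow (5/6) (1 - t))" by (intro mult_left_mono) auto
          finally show ?thesis .
        next
          case t: False
          have "inv_pow (5/6) (t * (1 - t)) \<le> inv_pow (5/6) ((1/2) * (1 - t))"
            using True t mult_right_mono[of "1/2" t "1 - t"] by (intro inv_pow_antimono) (auto simp: abs_mult)
          also have "\<dots> = d * inv_pow (5/6) (1 - t)" by (simp only: inv_pow_mult d_def)
          also have "\<dots> \<le> d * (inv_pow (5/6) t + inv_pow (5/6) (1 - t))" by (intro mult_left_mono) auto
          finally show ?thesis .
        qed
        from order_trans[OF f1 add_left_mono[OF f4]]
        have "?f t \<le> inv_pow (5/6) (c + t) + d * (inv_pow (5/6) (0 + t) + inv_pow (5/6) (- 1 + t))"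
          unfolding f3 add_0 .
        then show ?thesis using True by simp
      qed simp
    qed
    also have "\<dots> = (\<integral>\<^sup>+t. inv_pow (5/6) (c + t) * indicator {0..1} t \<partial>lborel)
        + d * ((\<integral>\<^sup>+t. inv_pow (5/6) (0 + t) * indicator {0..1} t \<partial>lborel) + (\<integral>\<^sup>+t. inv_pow (5/6) (- 1 + t) * indicator {0..1} t \<partial>lborel))"
      by (subst nn_integral_add, measurable, subst nn_integral_cmult, measurable, subst nn_integral_add) measurable
    also have "\<dots> \<le> A + d * (A + A)"
      using A(2) by (intro add_mono mult_left_mono) (blast+, simp)
    finally show "(\<integral>\<^sup>+\<theta>. inv_pow (2/3) (c + (sin \<theta>)\<^sup>2) * inv_pow (1/3) (sin \<theta> * cos \<theta>)
        * ennreal (sin \<theta> * cos \<theta>) * indicator {0..pi/2} \<theta> \<partial>lborel) \<le> A + d * (A + A)" .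
  qed
qed

section \<open>Integrals over the scattering angles\<close>

definition angle_weight :: "real \<times> real \<Rightarrow> ennreal" where
  "angle_weight = (\<lambda>(\<phi>, \<theta>). ennreal (sin \<theta> * cos \<theta>) * indicator {0..2*pi} \<phi> * indicator {0..pi/2} \<theta>)"

lemma measurable_angle_weight [measurable]: "angle_weight \<in> borel_measurable (borel \<Otimes>\<^sub>M borel)"
  unfolding angle_weight_def by measurable

text \<open>The first argument of the maximum takes the exponent 2/3, the second 1/3. For the
  \<phi>-integral the factor sin \<theta> cos \<theta> is divided out of the second argument, which
  leaves its power -1/3 to the \<theta>-integral, where the angular weight compensates it.\<close>

lemma sphere_singularity:
  shows "\<exists>K<\<infinity>. \<forall>c1 c2. (\<integral>\<^sup>+y. angle_weight y * inv_pow 1 (max \<bar>c1 + (sin (snd y))\<^sup>2\<bar> \<bar>c2 + sin (snd y) * cos (snd y) * cos (fst y)\<bar>) \<partial>lborel) \<le> K"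
proof -
  obtain K1 where K1: "K1 < \<infinity>" "\<And>c. (\<integral>\<^sup>+\<phi>. inv_pow (1/3) (c + cos \<phi>) * indicator {0..2*pi} \<phi> \<partial>lborel) \<le> K1"
    using nn_integral_inv_pow_cos by blast
  obtain K2 where K2: "K2 < \<infinity>" "\<And>c. (\<integral>\<^sup>+\<theta>. inv_pow (2/3) (c + (sin \<theta>)\<^sup>2) * inv_pow (1/3) (sin \<theta> * cos \<theta>)
     * ennreal (sin \<theta> * cos \<theta>) * indicator {0..pi/2} \<theta> \<partial>lborel) \<le> K2"
    using nn_integral_inv_pow_sin2 by blast
  show ?thesis
  proof (intro exI conjI allI)
    show "K1 * K2 < \<infinity>" using K1 K2 by (simp add: ennreal_mult_less_top)
    fix c1 c2 :: real
    let ?m = "\<lambda>\<phi> \<theta>. max \<bar>c1 + (sin \<theta>)\<^sup>2\<bar> \<bar>c2 + sin \<theta> * cos \<theta> * cos \<phi>\<bar>"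
    have "(\<integral>\<^sup>+y. angle_weight y * inv_pow 1 (?m (fst y) (snd y)) \<partial>lborel)
       = (\<integral>\<^sup>+\<theta>. \<integral>\<^sup>+\<phi>. angle_weight (\<phi>, \<theta>) * inv_pow 1 (?m \<phi> \<theta>) \<partial>lborel \<partial>lborel)"
      unfolding lborel_prod[symmetric] by (subst lborel_pair.nn_integral_snd[symmetric]) simp_all
    also have "\<dots> \<le> (\<integral>\<^sup>+\<theta>. K1 * (inv_pow (2/3) (c1 + (sin \<theta>)\<^sup>2) * inv_pow (1/3) (sin \<theta> * cos \<theta>)
       * ennreal (sin \<theta> * cos \<theta>) * indicator {0..pi/2} \<theta>) \<partial>lborel)"
    proof (rule nn_integral_mono_AE)
      show "AE \<theta> in lborel. (\<integral>\<^sup>+\<phi>. angle_weight (\<phi>, \<theta>) * inv_pow 1 (?m \<phi> \<theta>) \<partial>lborel)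
         \<le> K1 * (inv_pow (2/3) (c1 + (sin \<theta>)\<^sup>2) * inv_pow (1/3) (sin \<theta> * cos \<theta>) * ennreal (sin \<theta> * cos \<theta>) * indicator {0..pi/2} \<theta>)"
        using AE_lborel_singleton[of 0] AE_lborel_singleton[of "pi/2"]
      proof eventually_elim
        case (elim \<theta>)
        show ?case
        proof (cases "\<theta> \<in> {0..pi/2}")
          case True
          with elim have \<theta>: "0 < \<theta>" "\<theta> < pi/2" by auto
          then have sc: "0 < sin \<theta> * cos \<theta>" by (intro mult_pos_pos sin_gt_zero cos_gt_zero_pi) auto
          let ?r = "sin \<theta> * cos \<theta>"
          have "inv_pow 1 (?m \<phi> \<theta>) \<le> inv_pow (2/3) (c1 + (sin \<theta>)\<^sup>2) * (inv_pow (1/3) ?r * inv_pow (1/3) (c2 / ?r + cos \<phi>))" for \<phi>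
          proof -
            have "inv_pow 1 (?m \<phi> \<theta>) \<le> inv_pow (2/3) (c1 + (sin \<theta>)\<^sup>2) * inv_pow (1/3) (c2 + ?r * cos \<phi>)"
              using inv_pow_max_le[of "2/3" "1/3" "c1 + (sin \<theta>)\<^sup>2" "?m \<phi> \<theta>" "c2 + ?r * cos \<phi>"] by simp
            moreover have "c2 + ?r * cos \<phi> = ?r * (c2 / ?r + cos \<phi>)"
            proof -
              have "c2 + r * x = r * (c2 / r + x)" if "0 < r" for r x using that by (simp add: distrib_left)
              from this[OF sc] show ?thesis .
            qed
            then have "inv_pow (1/3) (c2 + ?r * cos \<phi>) = inv_pow (1/3) ?r * inv_pow (1/3) (c2 / ?r + cos \<phi>)"
              by (simp only: inv_pow_mult[of _ ?r])
            ultimately show ?thesis by (simp only:)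
          qed
          then have "(\<integral>\<^sup>+\<phi>. angle_weight (\<phi>, \<theta>) * inv_pow 1 (?m \<phi> \<theta>) \<partial>lborel)
            \<le> (\<integral>\<^sup>+\<phi>. (inv_pow (2/3) (c1 + (sin \<theta>)\<^sup>2) * inv_pow (1/3) ?r * ennreal ?r) * (inv_pow (1/3) (c2 / ?r + cos \<phi>) * indicator {0..2*pi} \<phi>) \<partial>lborel)"
            using True by (intro nn_integral_mono) (auto simp: angle_weight_def indicator_def ac_simps intro!: mult_left_mono)
          also have "\<dots> = (inv_pow (2/3) (c1 + (sin \<theta>)\<^sup>2) * inv_pow (1/3) ?r * ennreal ?r) * (\<integral>\<^sup>+\<phi>. inv_pow (1/3) (c2 / ?r + cos \<phi>) * indicator {0..2*pi} \<phi> \<partial>lborel)"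
            by (rule nn_integral_cmult) measurable
          also have "\<dots> \<le> (inv_pow (2/3) (c1 + (sin \<theta>)\<^sup>2) * inv_pow (1/3) ?r * ennreal ?r) * K1"
            by (intro mult_left_mono K1) auto
          finally show ?thesis using True by (simp add: ac_simps)
        qed (simp add: angle_weight_def)
      qed
    qed
    also have "\<dots> = K1 * (\<integral>\<^sup>+\<theta>. inv_pow (2/3) (c1 + (sin \<theta>)\<^sup>2) * inv_pow (1/3) (sin \<theta> * cos \<theta>)
       * ennreal (sin \<theta> * cos \<theta>) * indicator {0..pi/2} \<theta> \<partial>lborel)"
      by (rule nn_integral_cmult) measurable
    also have "\<dots> \<le> K1 * K2" by (intro mult_left_mono K2) auto
    finally show "(\<integral>\<^sup>+y. angle_weight y * inv_pow 1 (max \<bar>c1 + (sin (snd y))\<^sup>2\<bar> \<bar>c2 + sin (snd y) * cos (snd y) * cos (fst y)\<bar>) \<partial>lborel) \<le> K1 * K2" .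
  qed
qed

text \<open>The two vectors are the velocities after a collision with relative velocity \<rho> u.
  Their norm dominates the components along u and e2, which have the shape required by
  \<open>sphere_singularity\<close>. The vector \<zeta> enters only through the shifts c1 and c2, so
  K is independent of it, and the common factor \<rho> gives the pole on the right.\<close>

lemma sphere_singularity_vec:
  "\<exists>K<\<infinity>. \<forall>u e2 e3 \<zeta> \<rho>. orthonormal3 u e2 e3 \<longrightarrow> \<rho> > 0 \<longrightarrow>
     (\<integral>\<^sup>+y. angle_weight y * inv_pow 1 (norm (\<zeta> + (\<rho> * cos (snd y)) *\<^sub>R
        (cos (snd y) *\<^sub>R u + (sin (snd y) * cos (fst y)) *\<^sub>R e2 + (sin (snd y) * sin (fst y)) *\<^sub>R e3))) \<partial>lborel)
       \<le> K * inv_pow 1 \<rho> \<and>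
     (\<integral>\<^sup>+y. angle_weight y * inv_pow 1 (norm (\<zeta> + \<rho> *\<^sub>R u - (\<rho> * cos (snd y)) *\<^sub>R
        (cos (snd y) *\<^sub>R u + (sin (snd y) * cos (fst y)) *\<^sub>R e2 + (sin (snd y) * sin (fst y)) *\<^sub>R e3))) \<partial>lborel)
       \<le> K * inv_pow 1 \<rho>"
proof -
  obtain K where K: "K < \<infinity>" "\<And>c1 c2. (\<integral>\<^sup>+y. angle_weight y * inv_pow 1 (max \<bar>c1 + (sin (snd y))\<^sup>2\<bar> \<bar>c2 + sin (snd y) * cos (snd y) * cos (fst y)\<bar>) \<partial>lborel) \<le> K"
    using sphere_singularity by blast
  have main: "(\<integral>\<^sup>+y. angle_weight y * inv_pow 1 (norm (z y)) \<partial>lborel) \<le> K * inv_pow 1 \<rho>"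
    if \<rho>: "\<rho> > 0" and u: "norm u = 1" and e: "norm e = 1"
    and c: "\<And>y. \<bar>z y \<bullet> u\<bar> = \<rho> * \<bar>c1 + (sin (snd y))\<^sup>2\<bar>" "\<And>y. \<bar>z y \<bullet> e\<bar> = \<rho> * \<bar>c2 + sin (snd y) * cos (snd y) * cos (fst y)\<bar>"
    for z :: "real \<times> real \<Rightarrow> real^3" and u e \<rho> c1 c2
  proof -
    let ?m = "\<lambda>y. max \<bar>c1 + (sin (snd y))\<^sup>2\<bar> \<bar>c2 + sin (snd y) * cos (snd y) * cos (fst y)\<bar>"
    have "inv_pow 1 (norm (z y)) \<le> inv_pow 1 \<rho> * inv_pow 1 (?m y)" for y
    proof -
      have "\<rho> * ?m y = max (\<bar>z y \<bullet> u\<bar>) (\<bar>z y \<bullet> e\<bar>)" unfolding c using \<rho> by (simp add: max_mult_distrib_left)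
      also have "\<dots> \<le> norm (z y)"
        using Cauchy_Schwarz_ineq2[of "z y" u] Cauchy_Schwarz_ineq2[of "z y" e] u e by simp
      finally have "inv_pow 1 (norm (z y)) \<le> inv_pow 1 (\<rho> * ?m y)"
        using \<rho> by (intro inv_pow_antimono) (auto simp: abs_mult)
      then show ?thesis by (simp only: inv_pow_mult)
    qed
    then have "(\<integral>\<^sup>+y. angle_weight y * inv_pow 1 (norm (z y)) \<partial>lborel) \<le> (\<integral>\<^sup>+y. inv_pow 1 \<rho> * (angle_weight y * inv_pow 1 (?m y)) \<partial>lborel)"
      by (intro nn_integral_mono) (simp add: mult_left_mono mult.left_commute)
    also have "\<dots> = inv_pow 1 \<rho> * (\<integral>\<^sup>+y. angle_weight y * inv_pow 1 (?m y) \<partial>lborel)"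
      unfolding lborel_prod[symmetric] by (rule nn_integral_cmult) measurable
    also have "\<dots> \<le> inv_pow 1 \<rho> * K" by (intro mult_left_mono K) auto
    finally show ?thesis by (simp add: mult.commute)
  qed
  show ?thesis
  proof (intro exI[of _ K] conjI allI impI K(1))
    fix u e2 e3 \<zeta> :: "real^3" and \<rho> :: real
    assume o: "orthonormal3 u e2 e3" and \<rho>: "0 < \<rho>"
    then have n: "norm u = 1" "norm e2 = 1" by (auto simp: orthonormal3_def)
    have i: "u \<bullet> u = 1" "u \<bullet> e2 = 0" "e2 \<bullet> u = 0" "e2 \<bullet> e2 = 1" "e3 \<bullet> u = 0" "e3 \<bullet> e2 = 0"
      using o by (auto simp: orthonormal3_def orthogonal_def inner_commute dot_square_norm)
    define c1 where "c1 = \<zeta> \<bullet> u / \<rho>"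
    define c2 where "c2 = \<zeta> \<bullet> e2 / \<rho>"
    have c: "\<zeta> \<bullet> u = \<rho> * c1" "\<zeta> \<bullet> e2 = \<rho> * c2" using \<rho> by (auto simp: c1_def c2_def)
    have ab: "\<bar>\<rho> * x\<bar> = \<rho> * \<bar>y\<bar>" if "x = y \<or> x = - y" for x y using that \<rho> by (auto simp: abs_mult)
    show "(\<integral>\<^sup>+y. angle_weight y * inv_pow 1 (norm (\<zeta> + (\<rho> * cos (snd y)) *\<^sub>R
        (cos (snd y) *\<^sub>R u + (sin (snd y) * cos (fst y)) *\<^sub>R e2 + (sin (snd y) * sin (fst y)) *\<^sub>R e3))) \<partial>lborel)
       \<le> K * inv_pow 1 \<rho>"
    \<comment> \<open>Since (cos \<theta>)^2 = 1 - (sin \<theta>)^2, the component along u is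
      -\<rho> times -c1 - 1 + (sin \<theta>)^2.\<close>
    proof (rule main[OF \<rho> n, where ?c1.0="- c1 - 1" and ?c2.0=c2])
      fix y :: "real \<times> real"
      have "(\<zeta> + (\<rho> * cos (snd y)) *\<^sub>R (cos (snd y) *\<^sub>R u + (sin (snd y) * cos (fst y)) *\<^sub>R e2 + (sin (snd y) * sin (fst y)) *\<^sub>R e3)) \<bullet> u
         = \<rho> * (c1 + (cos (snd y))\<^sup>2)"
        by (simp add: inner_add_left i c algebra_simps power2_eq_square)
      then show "\<bar>(\<zeta> + (\<rho> * cos (snd y)) *\<^sub>R (cos (snd y) *\<^sub>R u + (sin (snd y) * cos (fst y)) *\<^sub>R e2 + (sin (snd y) * sin (fst y)) *\<^sub>R e3)) \<bullet> u\<bar>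
        = \<rho> * \<bar>- c1 - 1 + (sin (snd y))\<^sup>2\<bar>"
        by (simp only:) (rule ab, simp add: sin_squared_eq)
      have "(\<zeta> + (\<rho> * cos (snd y)) *\<^sub>R (cos (snd y) *\<^sub>R u + (sin (snd y) * cos (fst y)) *\<^sub>R e2 + (sin (snd y) * sin (fst y)) *\<^sub>R e3)) \<bullet> e2
         = \<rho> * (c2 + sin (snd y) * cos (snd y) * cos (fst y))"
        by (simp add: inner_add_left i c algebra_simps power2_eq_square)
      then show "\<bar>(\<zeta> + (\<rho> * cos (snd y)) *\<^sub>R (cos (snd y) *\<^sub>R u + (sin (snd y) * cos (fst y)) *\<^sub>R e2 + (sin (snd y) * sin (fst y)) *\<^sub>R e3)) \<bullet> e2\<bar>
        = \<rho> * \<bar>c2 + sin (snd y) * cos (snd y) * cos (fst y)\<bar>"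
        by (simp only:) (rule ab, simp)
    qed
    show "(\<integral>\<^sup>+y. angle_weight y * inv_pow 1 (norm (\<zeta> + \<rho> *\<^sub>R u - (\<rho> * cos (snd y)) *\<^sub>R
        (cos (snd y) *\<^sub>R u + (sin (snd y) * cos (fst y)) *\<^sub>R e2 + (sin (snd y) * sin (fst y)) *\<^sub>R e3))) \<partial>lborel)
       \<le> K * inv_pow 1 \<rho>"
    proof (rule main[OF \<rho> n, where ?c1.0=c1 and ?c2.0="- c2"])
      fix y :: "real \<times> real"
      have "(\<zeta> + \<rho> *\<^sub>R u - (\<rho> * cos (snd y)) *\<^sub>R (cos (snd y) *\<^sub>R u + (sin (snd y) * cos (fst y)) *\<^sub>R e2 + (sin (snd y) * sin (fst y)) *\<^sub>R e3)) \<bullet> u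
         = \<rho> * (c1 + (1 - (cos (snd y))\<^sup>2))"
        by (simp add: inner_add_left inner_diff_left i c algebra_simps power2_eq_square)
      then show "\<bar>(\<zeta> + \<rho> *\<^sub>R u - (\<rho> * cos (snd y)) *\<^sub>R (cos (snd y) *\<^sub>R u + (sin (snd y) * cos (fst y)) *\<^sub>R e2 + (sin (snd y) * sin (fst y)) *\<^sub>R e3)) \<bullet> u\<bar>
        = \<rho> * \<bar>c1 + (sin (snd y))\<^sup>2\<bar>"
        by (simp only:) (rule ab, simp add: sin_squared_eq)
      have "(\<zeta> + \<rho> *\<^sub>R u - (\<rho> * cos (snd y)) *\<^sub>R (cos (snd y) *\<^sub>R u + (sin (snd y) * cos (fst y)) *\<^sub>R e2 + (sin (snd y) * sin (fst y)) *\<^sub>R e3)) \<bullet> e2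
         = \<rho> * (c2 - sin (snd y) * cos (snd y) * cos (fst y))"
        by (simp add: inner_add_left inner_diff_left i c algebra_simps power2_eq_square)
      then show "\<bar>(\<zeta> + \<rho> *\<^sub>R u - (\<rho> * cos (snd y)) *\<^sub>R (cos (snd y) *\<^sub>R u + (sin (snd y) * cos (fst y)) *\<^sub>R e2 + (sin (snd y) * sin (fst y)) *\<^sub>R e3)) \<bullet> e2\<bar>
        = \<rho> * \<bar>- c2 + sin (snd y) * cos (snd y) * cos (fst y)\<bar>"
        by (simp only:) (rule ab, simp)
    qed
  qed
qed

lemma nn_integral_angle_weight_finite: "(\<integral>\<^sup>+y. angle_weight y \<partial>lborel) < \<infinity>"
proof -
  have "angle_weight y \<le> indicator ({0..2*pi} \<times> {0..pi/2}) y" for y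
  proof (cases y)
    case (Pair \<phi> \<theta>)
    have "sin \<theta> * cos \<theta> \<le> \<bar>sin \<theta>\<bar> * \<bar>cos \<theta>\<bar>" by (simp flip: abs_mult)
    also have "\<dots> \<le> 1" by (intro mult_le_one) auto
    finally show ?thesis by (auto simp: Pair angle_weight_def indicator_def ennreal_le_1)
  qed
  then have "(\<integral>\<^sup>+y. angle_weight y \<partial>lborel) \<le> (\<integral>\<^sup>+y. indicator ({0..2*pi} \<times> {0..pi/2}) y \<partial>lborel)"
    by (intro nn_integral_mono)
  also have "\<dots> = emeasure lborel (cbox (0, 0) (2*pi, pi/2))"
    unfolding cbox_Pair_eq[symmetric] cbox_interval[symmetric] by (rule nn_integral_indicator) simp
  also have "\<dots> < \<infinity>" by (rule emeasure_lborel_cbox_finite)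
  finally show ?thesis .
qed

section \<open>Integrals over the relative velocity\<close>

lemma nn_integral_gaussian_finite: "(\<integral>\<^sup>+x. ennreal (exp (- (norm (x::real^3))\<^sup>2 / 8)) \<partial>lborel) < \<infinity>"
proof -
  have 1: "(\<integral>\<^sup>+t. ennreal (exp (- t\<^sup>2 / 8)) \<partial>lborel) < \<infinity>"
  proof -
    have "integrable lborel (\<lambda>t. sqrt (8 * pi) * normal_density 0 2 t)" by simp
    also have "(\<lambda>t. sqrt (8 * pi) * normal_density 0 2 t) = (\<lambda>t. exp (- t\<^sup>2 / 8))"
      by (simp add: normal_density_def fun_eq_iff)
    finally show ?thesis by (simp add: integrable_iff_bounded)
  qed
  have "exp (- (norm x)\<^sup>2 / 8) = (\<Prod>b\<in>Basis. exp (- (x \<bullet> b)\<^sup>2 / 8))" for x :: "real^3"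
  proof -
    have "(norm x)\<^sup>2 = (\<Sum>b\<in>Basis. (x \<bullet> b)\<^sup>2)"
      unfolding power2_norm_eq_inner euclidean_inner[of x x] by (simp add: power2_eq_square)
    then show ?thesis by (simp add: exp_sum[symmetric] sum_negf sum_divide_distrib)
  qed
  then have "(\<integral>\<^sup>+x. ennreal (exp (- (norm (x::real^3))\<^sup>2 / 8)) \<partial>lborel)
      = (\<integral>\<^sup>+x. ennreal (\<Prod>b\<in>Basis. exp (- ((x::real^3) \<bullet> b)\<^sup>2 / 8)) \<partial>lborel)"
    by (simp only:)
  also have "\<dots> = (\<Prod>b\<in>(Basis::(real^3) set). (\<integral>\<^sup>+t. ennreal (exp (- t\<^sup>2 / 8)) \<partial>lborel))"
    using nn_integral_lborel_prod[of "\<lambda>(b::real^3) t. exp (- t\<^sup>2 / 8)"] by (simp add: prod_ennreal)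
  also have "\<dots> < \<infinity>" using 1 by (simp add: power_less_top_ennreal)
  finally show ?thesis .
qed

text \<open>The norm is at least every |x_i|, so off the coordinate planes 1/|x| is at most the
  product of the three powers |x_i|^(-1/3). The integral of this product factors into convergent
  one-dimensional integrals.\<close>

lemma nn_integral_inv_norm_ball_finite: "(\<integral>\<^sup>+x. inv_pow 1 (norm (x::real^3)) * indicator (cball 0 1) x \<partial>lborel) < \<infinity>"
proof -
  let ?g = "\<lambda>t::real. \<bar>t\<bar> powr (-1/3) * indicator {-1..1} t"
  have 1: "(\<integral>\<^sup>+t. ennreal (?g t) \<partial>lborel) < \<infinity>"
  proof -
    have "(\<integral>\<^sup>+t. ennreal (?g t) \<partial>lborel) \<le> (\<integral>\<^sup>+t. inv_pow (1/3) t * indicator {-1..1} t \<partial>lborel)"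
    proof (intro nn_integral_mono)
      fix t :: real
      show "ennreal (?g t) \<le> inv_pow (1/3) t * indicator {-1..1} t"
        by (cases "t = 0") (auto simp: inv_pow_pos indicator_def)
    qed
    also have "\<dots> < \<infinity>" by (rule nn_integral_inv_pow_unit) auto
    finally show ?thesis .
  qed
  have nz: "AE x :: real^3 in lborel. \<forall>b\<in>Basis. x \<bullet> b \<noteq> 0"
  proof -
    have "AE x :: real^3 in lborel. x \<bullet> b \<noteq> 0" if b: "b \<in> Basis" for b
    proof -
      have "{x. x \<bullet> b = 0} \<in> null_sets lebesgue"
        using negligible_standard_hyperplane[OF b, of 0] by (simp add: negligible_iff_null_sets)
      then have "{x. x \<bullet> b = 0} \<in> null_sets lborel"
        by (subst (asm) null_sets_completion_iff) (auto intro!: borel_closed closed_hyperplane simp: inner_commute)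
      from AE_not_in[OF this] show ?thesis by simp
    qed
    then show ?thesis by (intro AE_finite_allI) auto
  qed
  have "(\<integral>\<^sup>+x. inv_pow 1 (norm (x::real^3)) * indicator (cball 0 1) x \<partial>lborel) \<le> (\<integral>\<^sup>+x. ennreal (\<Prod>b\<in>Basis. ?g ((x::real^3) \<bullet> b)) \<partial>lborel)"
  proof (rule nn_integral_mono_AE)
    show "AE x :: real^3 in lborel. inv_pow 1 (norm x) * indicator (cball 0 1) x \<le> ennreal (\<Prod>b\<in>Basis. ?g (x \<bullet> b))"
      using nz
    proof eventually_elim
      case (elim x)
      show ?case
      proof (cases "norm x \<le> 1")
        case True
        have xb: "\<bar>x \<bullet> b\<bar> \<le> norm x" if "b \<in> Basis" for b using that by (rule Basis_le_norm)
        obtain b0 :: "real^3" where b0: "b0 \<in> Basis" using nonempty_Basis by blast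
        have x0: "0 < norm x" using elim b0 by auto
        have "norm x powr (-1) = (\<Prod>b\<in>(Basis::(real^3) set). norm x powr (-1/3))"
          using x0 by (simp add: powr_powr flip: powr_realpow)
        also have "\<dots> \<le> (\<Prod>b\<in>Basis. ?g (x \<bullet> b))"
        proof (rule prod_mono, intro conjI)
          fix b :: "real^3" assume b: "b \<in> Basis"
          have "norm x powr (-1/3) \<le> \<bar>x \<bullet> b\<bar> powr (-1/3)"
            using elim b xb[OF b] by (intro powr_mono2') auto
          moreover have "x \<bullet> b \<in> {-1..1}" using xb[OF b] True by auto
          ultimately show "norm x powr (-1/3) \<le> ?g (x \<bullet> b)" by simp
        qed simp
        finally show ?thesis using True x0 by (simp add: inv_pow_pos ennreal_leI)
      qed simp
    qed
  qed
  also have "\<dots> = (\<Prod>b\<in>(Basis::(real^3) set). (\<integral>\<^sup>+t. ennreal (?g t) \<partial>lborel))"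
    using nn_integral_lborel_prod[of "\<lambda>(b::real^3). ?g"] by (simp add: prod_ennreal)
  also have "\<dots> < \<infinity>" using 1 by (simp add: power_less_top_ennreal)
  finally show ?thesis .
qed

text \<open>A Gaussian with half of the exponent of the square root of the Maxwellian. The other
  half absorbs the linear factor produced by differentiating that root.\<close>

definition decay :: "real^3 \<Rightarrow> ennreal" where
  "decay \<eta> = ennreal (exp (- (norm \<eta>)\<^sup>2 / 4))"

lemma measurable_decay [measurable]: "decay \<in> borel_measurable borel"
  unfolding decay_def by measurable

lemma decay_le: "ennreal (1 + norm \<eta>) * decay \<eta> \<le> 3 * ennreal (exp (- (norm \<eta>)\<^sup>2 / 8))"
proof -
  define r where "r = norm \<eta>"
  \<comment> \<open>This square compares 8 r with r^2 + 16, so that the linear factor costs only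
    half of the Gaussian.\<close>
  have "0 \<le> (r - 4)\<^sup>2" by simp
  then have "1 + r \<le> 3 + r\<^sup>2 / 8" by (simp add: power2_eq_square algebra_simps)
  also have "\<dots> \<le> 3 * (1 + r\<^sup>2 / 8)" by simp
  also have "\<dots> \<le> 3 * exp (r\<^sup>2 / 8)" by (intro mult_left_mono exp_ge_add_one_self) simp
  finally have "(1 + r) * exp (- r\<^sup>2 / 4) \<le> 3 * exp (r\<^sup>2 / 8) * exp (- r\<^sup>2 / 4)" by (rule mult_right_mono) simp
  also have "\<dots> = 3 * exp (- r\<^sup>2 / 8)" by (simp flip: exp_add)
  finally have "ennreal ((1 + r) * exp (- r\<^sup>2 / 4)) \<le> ennreal (3 * exp (- r\<^sup>2 / 8))" by (rule ennreal_leI)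
  then show ?thesis by (simp add: decay_def r_def ennreal_mult)
qed

text \<open>Within distance 1 of c the Gaussian is bounded and the pole is integrable; farther away
  the pole is bounded by 1. Translation invariance makes the first part independent of c.\<close>

lemma decay_singular_integral:
  "\<exists>K<\<infinity>. \<forall>c. (\<integral>\<^sup>+\<eta>. ennreal (1 + norm \<eta>) * decay \<eta> * (1 + inv_pow 1 (norm (\<eta> - c))) \<partial>lborel) \<le> K"
proof (intro exI conjI allI)
  let ?G = "\<integral>\<^sup>+x. ennreal (exp (- (norm (x::real^3))\<^sup>2 / 8)) \<partial>lborel"
  let ?H = "\<integral>\<^sup>+x. inv_pow 1 (norm (x::real^3)) * indicator (cball 0 1) x \<partial>lborel"
  show "3 * (2 * ?G + ?H) < \<infinity>"
    using nn_integral_gaussian_finite nn_integral_inv_norm_ball_finite by (simp add: ennreal_mult_less_top)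
  fix c :: "real^3"
  have "(\<integral>\<^sup>+\<eta>. ennreal (1 + norm \<eta>) * decay \<eta> * (1 + inv_pow 1 (norm (\<eta> - c))) \<partial>lborel)
    \<le> (\<integral>\<^sup>+\<eta>. 3 * (2 * ennreal (exp (- (norm \<eta>)\<^sup>2 / 8)) + inv_pow 1 (norm (\<eta> - c)) * indicator (cball 0 1) (\<eta> - c)) \<partial>lborel)"
  proof (intro nn_integral_mono)
    fix \<eta> :: "real^3"
    let ?e = "ennreal (exp (- (norm \<eta>)\<^sup>2 / 8))" and ?i = "inv_pow 1 (norm (\<eta> - c))"
    have "?e * (1 + ?i) \<le> 2 * ?e + ?i * indicator (cball 0 1) (\<eta> - c)"
    proof (cases "norm (\<eta> - c) \<le> 1")
      case True
      have "?e * ?i \<le> 1 * ?i" by (intro mult_right_mono) (auto intro!: ennreal_le_1)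
      moreover have "?e * (1 + ?i) = ?e + ?e * ?i" by (simp add: distrib_left)
      moreover have "?e \<le> 2 * ?e" by (simp add: mult_2 add_increasing)
      ultimately show ?thesis using True by (auto intro: add_mono)
    next
      case False
      then have "?i \<le> 1" by (intro inv_pow_le_1) auto
      then have "?e * (1 + ?i) \<le> ?e * (1 + 1)" by (intro mult_left_mono add_left_mono) auto
      then show ?thesis using False by (simp add: mult.commute)
    qed
    from mult_left_mono[OF this zero_le, of 3]
    have "3 * ?e * (1 + ?i) \<le> 3 * (2 * ?e + ?i * indicator (cball 0 1) (\<eta> - c))"
      by (simp only: mult.assoc)
    with decay_le[of \<eta>] show "ennreal (1 + norm \<eta>) * decay \<eta> * (1 + ?i) \<le> 3 * (2 * ?e + ?i * indicator (cball 0 1) (\<eta> - c))"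
      by (meson mult_right_mono order_trans zero_le)
  qed
  also have "\<dots> = 3 * (2 * ?G + (\<integral>\<^sup>+\<eta>. inv_pow 1 (norm (\<eta> - c)) * indicator (cball 0 1) (\<eta> - c) \<partial>lborel))"
  proof -
    have [measurable]: "cball 0 1 \<in> sets (borel :: (real^3) measure)" by simp
    have [measurable]: "(\<lambda>\<eta>. inv_pow 1 (norm (\<eta> - c)) * indicator (cball 0 1) (\<eta> - c)) \<in> borel_measurable borel"
      by measurable
    show ?thesis by (simp add: nn_integral_cmult nn_integral_add)
  qed
  also have "(\<integral>\<^sup>+\<eta>. inv_pow 1 (norm (\<eta> - c)) * indicator (cball 0 1) (\<eta> - c) \<partial>lborel) = ?H"
  proof -
    have [measurable]: "cball 0 1 \<in> sets (borel :: (real^3) measure)" by simp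
    have m: "(\<lambda>x::real^3. inv_pow 1 (norm x) * indicator (cball 0 1) x) \<in> borel_measurable borel" by measurable
    have "distr lborel borel ((+) (- c)) = (lborel :: (real^3) measure)" by (rule lborel_distr_plus)
    then have "?H = (\<integral>\<^sup>+x. inv_pow 1 (norm x) * indicator (cball 0 1) x \<partial>distr lborel borel ((+) (- c)))" by simp
    also have "\<dots> = (\<integral>\<^sup>+\<eta>. inv_pow 1 (norm (\<eta> - c)) * indicator (cball 0 1) (\<eta> - c) \<partial>lborel)"
      by (subst nn_integral_distr) (auto simp: m)
    finally show ?thesis ..
  qed
  finally show "(\<integral>\<^sup>+\<eta>. ennreal (1 + norm \<eta>) * decay \<eta> * (1 + inv_pow 1 (norm (\<eta> - c))) \<partial>lborel) \<le> 3 * (2 * ?G + ?H)" .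
qed

text \<open>In the variable \<eta> = \<zeta> + V the poles sit at \<zeta> and at 0. The growth in
  \<zeta> comes from |\<eta> - \<zeta>| <= (1 + |\<eta>|)(1 + |\<zeta>|), and \<gamma> <= 1 leaves
  at most a linear factor in |\<eta>| to the Gaussian.\<close>

lemma velocity_integral:
  assumes \<gamma>: "0 \<le> \<gamma>" "\<gamma> \<le> 1"
  shows "\<exists>K<\<infinity>. \<forall>\<zeta>. (\<integral>\<^sup>+V. ennreal (norm V powr \<gamma>) * decay (\<zeta> + V) * (1 + inv_pow 1 (norm V) + inv_pow 1 (norm (\<zeta> + V))) \<partial>lborel)
     \<le> K * ennreal ((1 + norm \<zeta>) powr \<gamma>)"
proof -
  obtain K where K: "K < \<infinity>" "\<And>c. (\<integral>\<^sup>+\<eta>. ennreal (1 + norm \<eta>) * decay \<eta> * (1 + inv_pow 1 (norm (\<eta> - c))) \<partial>lborel) \<le> K"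
    using decay_singular_integral by blast
  show ?thesis
  proof (intro exI conjI allI)
    show "K + K < \<infinity>" using K by simp
    fix \<zeta> :: "real^3"
    let ?p = "ennreal ((1 + norm \<zeta>) powr \<gamma>)"
    let ?F = "\<lambda>\<eta>. ennreal (norm (\<eta> - \<zeta>) powr \<gamma>) * decay \<eta> * (1 + inv_pow 1 (norm (\<eta> - \<zeta>)) + inv_pow 1 (norm \<eta>))"
    have "distr lborel borel ((+) \<zeta>) = (lborel :: (real^3) measure)" by (rule lborel_distr_plus)
    then have "(\<integral>\<^sup>+\<eta>. ?F \<eta> \<partial>lborel) = (\<integral>\<^sup>+\<eta>. ?F \<eta> \<partial>distr lborel borel ((+) \<zeta>))" by simp
    also have "\<dots> = (\<integral>\<^sup>+V. ?F (\<zeta> + V) \<partial>lborel)" by (subst nn_integral_distr) auto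
    finally have "(\<integral>\<^sup>+V. ennreal (norm V powr \<gamma>) * decay (\<zeta> + V) * (1 + inv_pow 1 (norm V) + inv_pow 1 (norm (\<zeta> + V))) \<partial>lborel)
       = (\<integral>\<^sup>+\<eta>. ?F \<eta> \<partial>lborel)" by simp
    also have "\<dots> \<le> (\<integral>\<^sup>+\<eta>. ?p * (ennreal (1 + norm \<eta>) * decay \<eta> * (1 + inv_pow 1 (norm (\<eta> - \<zeta>)))
        + ennreal (1 + norm \<eta>) * decay \<eta> * (1 + inv_pow 1 (norm (\<eta> - 0)))) \<partial>lborel)"
    proof (intro nn_integral_mono)
      fix \<eta> :: "real^3"
      have "norm (\<eta> - \<zeta>) powr \<gamma> \<le> ((1 + norm \<eta>) * (1 + norm \<zeta>)) powr \<gamma>"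
      proof (intro powr_mono2 \<gamma>)
        have "norm (\<eta> - \<zeta>) \<le> norm \<eta> + norm \<zeta>" by (rule norm_triangle_ineq4)
        also have "\<dots> \<le> (1 + norm \<eta>) * (1 + norm \<zeta>)" by (simp add: algebra_simps)
        finally show "norm (\<eta> - \<zeta>) \<le> (1 + norm \<eta>) * (1 + norm \<zeta>)" .
      qed simp
      also have "\<dots> = (1 + norm \<eta>) powr \<gamma> * (1 + norm \<zeta>) powr \<gamma>" by (simp add: powr_mult)
      also have "\<dots> \<le> (1 + norm \<eta>) powr 1 * (1 + norm \<zeta>) powr \<gamma>"
        using \<gamma> by (intro mult_right_mono powr_mono) auto
      finally have "norm (\<eta> - \<zeta>) powr \<gamma> \<le> (1 + norm \<zeta>) powr \<gamma> * (1 + norm \<eta>)" by (simp add: mult.commute)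
      from ennreal_leI[OF this] have a: "ennreal (norm (\<eta> - \<zeta>) powr \<gamma>) \<le> ?p * ennreal (1 + norm \<eta>)"
        by (simp add: ennreal_mult del: ennreal_plus)
      have "1 + inv_pow 1 (norm (\<eta> - \<zeta>)) + inv_pow 1 (norm \<eta>) \<le> (1 + inv_pow 1 (norm (\<eta> - \<zeta>))) + (1 + inv_pow 1 (norm (\<eta> - 0)))"
        by (simp add: add.assoc add_increasing add_left_mono)
      with a have "?F \<eta> \<le> ?p * ennreal (1 + norm \<eta>) * decay \<eta> * ((1 + inv_pow 1 (norm (\<eta> - \<zeta>))) + (1 + inv_pow 1 (norm (\<eta> - 0))))"
        by (intro mult_mono) auto
      then show "?F \<eta> \<le> ?p * (ennreal (1 + norm \<eta>) * decay \<eta> * (1 + inv_pow 1 (norm (\<eta> - \<zeta>)))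
        + ennreal (1 + norm \<eta>) * decay \<eta> * (1 + inv_pow 1 (norm (\<eta> - 0))))"
        by (simp only: distrib_left mult.assoc)
    qed
    also have "\<dots> = ?p * ((\<integral>\<^sup>+\<eta>. ennreal (1 + norm \<eta>) * decay \<eta> * (1 + inv_pow 1 (norm (\<eta> - \<zeta>))) \<partial>lborel)
        + (\<integral>\<^sup>+\<eta>. ennreal (1 + norm \<eta>) * decay \<eta> * (1 + inv_pow 1 (norm (\<eta> - 0))) \<partial>lborel))"
      by (subst nn_integral_cmult, measurable, subst nn_integral_add) measurable
    also have "\<dots> \<le> ?p * (K + K)" by (intro mult_left_mono add_mono K(2)) auto
    finally show "(\<integral>\<^sup>+V. ennreal (norm V powr \<gamma>) * decay (\<zeta> + V) * (1 + inv_pow 1 (norm V) + inv_pow 1 (norm (\<zeta> + V))) \<partial>lborel)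
     \<le> (K + K) * ?p" by (simp add: mult.commute)
  qed
qed

section \<open>The collision integral\<close>

lemma borel_measurable_cross3 [measurable (raw)]:
  fixes f g :: "'a \<Rightarrow> real^3"
  assumes "f \<in> borel_measurable M" "g \<in> borel_measurable M"
  shows "(\<lambda>x. cross3 (f x) (g x)) \<in> borel_measurable M"
proof -
  have bb: "bounded_bilinear cross3" using bilinear_cross bilinear_conv_bounded_bilinear by blast
  have "continuous_on UNIV (\<lambda>x :: (real^3) \<times> (real^3). cross3 (fst x) (snd x))"
    by (intro bounded_bilinear.continuous_on[OF bb] continuous_intros)
  from borel_measurable_continuous_Pair[OF assms, of cross3] this show ?thesis by simp
qed

text \<open>A measurable replacement for the arbitrary choice in \<^const>\<open>basis_completion\<close>.\<close>

definition frame2 :: "real^3 \<Rightarrow> real^3" where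
  "frame2 u = (let k = (if u $ 2 = 0 \<and> u $ 3 = 0 then axis 2 1 else axis 1 1)
     in cross3 u k /\<^sub>R norm (cross3 u k))"

definition frame3 :: "real^3 \<Rightarrow> real^3" where
  "frame3 u = cross3 u (frame2 u)"

lemma borel_measurable_fst_snd [measurable]:
  "fst \<in> borel_measurable borel" "snd \<in> borel_measurable borel"
  by (intro borel_measurable_continuous_onI continuous_intros)+

lemma borel_measurable_vec_nth3 [measurable]: "(\<lambda>u::real^3. u $ i) \<in> borel_measurable borel"
  by (intro borel_measurable_continuous_onI continuous_intros)

lemma measurable_frame [measurable]:
  "frame2 \<in> borel_measurable borel" "frame3 \<in> borel_measurable borel"
proof -
  show 1: "frame2 \<in> borel_measurable borel" unfolding frame2_def Let_def by measurable
  note [measurable] = 1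
  show "frame3 \<in> borel_measurable borel" unfolding frame3_def by measurable
qed

lemma orthonormal3_frame:
  assumes u: "norm u = 1"
  shows "orthonormal3 u (frame2 u) (frame3 u)"
proof -
  define k :: "real^3" where "k = (if u $ 2 = 0 \<and> u $ 3 = 0 then axis 2 1 else axis 1 1)"
  have nk: "norm k = 1" by (simp add: k_def norm_eq_1 inner_axis_axis)
  have uu: "(u $ 1)\<^sup>2 + (u $ 2)\<^sup>2 + (u $ 3)\<^sup>2 = 1"
    using u by (simp add: norm_eq_1 inner_vec_def sum_3 power2_eq_square)
  have "(norm (cross3 u k))\<^sup>2 = 1 - (u \<bullet> k)\<^sup>2" using u nk by (simp add: norm_cross)
  \<comment> \<open>The auxiliary axis k is chosen not parallel to u, so the cross product does not
    vanish.\<close>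
  moreover have "(u \<bullet> k)\<^sup>2 < 1"
  proof (cases "u $ 2 = 0 \<and> u $ 3 = 0")
    case True
    then show ?thesis by (simp add: k_def inner_axis)
  next
    case False
    then have "(u $ 2)\<^sup>2 + (u $ 3)\<^sup>2 > 0" by (metis sum_power2_gt_zero_iff)
    moreover have "k = axis 1 1" unfolding k_def using False by (rule if_not_P)
    then have "u \<bullet> k = u $ 1" by (simp add: inner_axis)
    ultimately show ?thesis using uu by simp
  qed
  ultimately have "norm (cross3 u k) \<noteq> 0" by auto
  then have n2: "norm (frame2 u) = 1" by (simp add: frame2_def Let_def k_def[symmetric])
  have o2: "u \<bullet> frame2 u = 0"
    by (simp add: frame2_def Let_def k_def[symmetric] dot_cross_self)
  have "(norm (frame3 u))\<^sup>2 = 1"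
    using u n2 o2 by (simp add: frame3_def norm_cross)
  then have n3: "norm (frame3 u) = 1" by (simp add: power2_eq_1_iff) (use norm_ge_zero[of "frame3 u"] in linarith)
  show ?thesis
    using u n2 n3 o2 by (auto simp: orthonormal3_def orthogonal_def frame3_def dot_cross_self)
qed

text \<open>The collision parameters \<open>(V, \<phi>, \<theta>)\<close>, where \<open>V\<close> is the relative velocity $\zeta_* - \zeta$.\<close>

type_synonym cparam = "(real^3) \<times> (real \<times> real)"

definition scatter_dir :: "cparam \<Rightarrow> real^3" where
  "scatter_dir = (\<lambda>(V, \<phi>, \<theta>). let u = V /\<^sub>R norm V in
     cos \<theta> *\<^sub>R u + (sin \<theta> * cos \<phi>) *\<^sub>R frame2 u + (sin \<theta> * sin \<phi>) *\<^sub>R frame3 u)"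

text \<open>The velocities after the collision are \<open>\<zeta> + shift1 y\<close> and
  \<open>\<zeta> + shift2 y\<close>; the partner velocity before it is
  \<open>\<zeta> + fst y\<close>.\<close>

definition shift1 :: "cparam \<Rightarrow> real^3" where
  "shift1 y = (fst y \<bullet> scatter_dir y) *\<^sub>R scatter_dir y"

definition shift2 :: "cparam \<Rightarrow> real^3" where
  "shift2 y = fst y - shift1 y"

definition kern :: "real \<Rightarrow> real \<Rightarrow> cparam \<Rightarrow> real" where
  "kern B0 \<gamma> = (\<lambda>(V, \<phi>, \<theta>). B0 * norm V powr \<gamma> * (sin \<theta> * cos \<theta>) * indicator {0..2*pi} \<phi> * indicator {0..pi/2} \<theta>)"

lemma measurable_kern [measurable]:
  "scatter_dir \<in> borel_measurable borel" "shift1 \<in> borel_measurable borel"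
  "shift2 \<in> borel_measurable borel" "kern B0 \<gamma> \<in> borel_measurable borel"
proof -
  show 1: "scatter_dir \<in> borel_measurable borel"
    unfolding scatter_dir_def Let_def borel_prod[symmetric] by measurable
  note [measurable] = 1
  show 2: "shift1 \<in> borel_measurable borel"
    unfolding shift1_def[abs_def] by measurable
  note [measurable] = 2
  show "shift2 \<in> borel_measurable borel"
    unfolding shift2_def[abs_def] by measurable
  show "kern B0 \<gamma> \<in> borel_measurable borel"
    unfolding kern_def borel_prod[symmetric] by measurable
qed

lemma kern_nonneg: "0 \<le> B0 \<Longrightarrow> 0 \<le> kern B0 \<gamma> y"
  by (cases y) (auto simp: kern_def indicator_def intro!: mult_nonneg_nonneg sin_ge_zero cos_ge_zero)

lemma ennreal_kern:
  assumes "0 \<le> B0"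
  shows "ennreal (kern B0 \<gamma> (V, z)) = ennreal (B0 * norm V powr \<gamma>) * angle_weight z"
proof (cases z)
  case (Pair \<phi> \<theta>)
  show ?thesis
  proof (cases "\<phi> \<in> {0..2*pi} \<and> \<theta> \<in> {0..pi/2}")
    case True
    then have "0 \<le> sin \<theta> * cos \<theta>" by (auto intro!: mult_nonneg_nonneg sin_ge_zero cos_ge_zero)
    then show ?thesis using assms True by (simp add: kern_def angle_weight_def Pair ennreal_mult)
  qed (auto simp: kern_def angle_weight_def Pair)
qed

lemma orthonormal3_sphere:
  assumes "orthonormal3 u e2 e3"
  shows "norm (cos \<theta> *\<^sub>R u + (sin \<theta> * cos \<phi>) *\<^sub>R e2 + (sin \<theta> * sin \<phi>) *\<^sub>R e3) = 1"
    "u \<bullet> (cos \<theta> *\<^sub>R u + (sin \<theta> * cos \<phi>) *\<^sub>R e2 + (sin \<theta> * sin \<phi>) *\<^sub>R e3) = cos \<theta>"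
proof -
  note i = orthonormal3_inner[OF assms]
  have "(C *\<^sub>R u + (S * c) *\<^sub>R e2 + (S * s) *\<^sub>R e3) \<bullet> (C *\<^sub>R u + (S * c) *\<^sub>R e2 + (S * s) *\<^sub>R e3)
     = C\<^sup>2 + S\<^sup>2 * (c\<^sup>2 + s\<^sup>2)" for C S c s
    by (simp add: inner_add_left inner_add_right i power2_eq_square algebra_simps)
  then have "(cos \<theta> *\<^sub>R u + (sin \<theta> * cos \<phi>) *\<^sub>R e2 + (sin \<theta> * sin \<phi>) *\<^sub>R e3) \<bullet>
     (cos \<theta> *\<^sub>R u + (sin \<theta> * cos \<phi>) *\<^sub>R e2 + (sin \<theta> * sin \<phi>) *\<^sub>R e3)
     = (cos \<theta>)\<^sup>2 + (sin \<theta>)\<^sup>2 * ((cos \<phi>)\<^sup>2 + (sin \<phi>)\<^sup>2)" .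
  also have "\<dots> = 1" by simp
  finally show "norm (cos \<theta> *\<^sub>R u + (sin \<theta> * cos \<phi>) *\<^sub>R e2 + (sin \<theta> * sin \<phi>) *\<^sub>R e3) = 1"
    by (simp only: norm_eq_1)
  show "u \<bullet> (cos \<theta> *\<^sub>R u + (sin \<theta> * cos \<phi>) *\<^sub>R e2 + (sin \<theta> * sin \<phi>) *\<^sub>R e3) = cos \<theta>"
    by (simp add: inner_add_right i)
qed

lemma norm_scatter_dir: "V \<noteq> 0 \<Longrightarrow> norm (scatter_dir (V, z)) = 1"
  using orthonormal3_sphere(1)[OF orthonormal3_frame[of "V /\<^sub>R norm V"]]
  by (cases z) (simp add: scatter_dir_def Let_def)

lemma shift1_eq:
  assumes "V \<noteq> 0"
  shows "shift1 (V, \<phi>, \<theta>) = (norm V * cos \<theta>) *\<^sub>R scatter_dir (V, \<phi>, \<theta>)"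
proof -
  let ?u = "V /\<^sub>R norm V"
  have "?u \<bullet> scatter_dir (V, \<phi>, \<theta>) = cos \<theta>"
    using orthonormal3_sphere(2)[OF orthonormal3_frame[of ?u]] assms by (simp add: scatter_dir_def Let_def)
  then have "V \<bullet> scatter_dir (V, \<phi>, \<theta>) = norm V * cos \<theta>" using assms by (simp add: field_simps)
  then show ?thesis by (simp add: shift1_def)
qed

lemma collision_energy:
  assumes "V \<noteq> 0"
  shows "(norm (\<zeta> + shift1 (V, z)))\<^sup>2 + (norm (\<zeta> + shift2 (V, z)))\<^sup>2 = (norm \<zeta>)\<^sup>2 + (norm (\<zeta> + V))\<^sup>2"
proof -
  let ?\<omega> = "scatter_dir (V, z)"
  have "?\<omega> \<bullet> ?\<omega> = 1" using norm_scatter_dir[OF assms, of z] by (simp add: norm_eq_1)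
  \<comment> \<open>\<open>shift1\<close> is the orthogonal projection of V to a unit vector, so its
    squared norm is its inner product with V. Conservation of energy is this identity.\<close>
  then have "shift1 (V, z) \<bullet> shift1 (V, z) = V \<bullet> shift1 (V, z)"
    by (simp add: shift1_def power2_eq_square)
  then show ?thesis
    by (simp add: power2_norm_eq_inner shift2_def inner_add_left inner_add_right inner_diff_left inner_diff_right inner_commute)
qed

lemma nn_integral_cparam:
  assumes [measurable]: "f \<in> borel_measurable borel"
  shows "(\<integral>\<^sup>+y. f y \<partial>(lborel :: cparam measure)) = (\<integral>\<^sup>+V. \<integral>\<^sup>+z. f (V, z) \<partial>lborel \<partial>lborel)"
proof -
  have "f \<in> borel_measurable (lborel \<Otimes>\<^sub>M lborel)" using assms by (simp add: lborel_prod)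
  from lborel.nn_integral_fst[OF this] show ?thesis by (simp add: lborel_prod)
qed

section \<open>Integrated kernels of gain and loss\<close>

text \<open>For fixed V the Gaussian factor does not depend on the angles, so the angular bound
  replaces both poles by multiples of 1/|V|. The integral over V is then the one of
  \<open>velocity_integral\<close>.\<close>

lemma gain_integral:
  assumes B0: "0 \<le> B0" and \<gamma>: "0 \<le> \<gamma>" "\<gamma> \<le> 1"
  shows "\<exists>K<\<infinity>. \<forall>\<zeta>. (\<integral>\<^sup>+y. ennreal (kern B0 \<gamma> y) * decay (\<zeta> + fst y) *
      (1 + inv_pow 1 (norm (\<zeta> + shift1 y)) + inv_pow 1 (norm (\<zeta> + shift2 y))) \<partial>lborel) \<le> K * ennreal ((1 + norm \<zeta>) powr \<gamma>)"
proof -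
  obtain K1 where K1: "K1 < \<infinity>" "\<And>\<zeta>. (\<integral>\<^sup>+V. ennreal (norm V powr \<gamma>) * decay (\<zeta> + V) * (1 + inv_pow 1 (norm V) + inv_pow 1 (norm (\<zeta> + V))) \<partial>lborel)
     \<le> K1 * ennreal ((1 + norm \<zeta>) powr \<gamma>)"
    using velocity_integral[OF \<gamma>] by blast
  obtain K where K: "K < \<infinity>" "\<And>u e2 e3 \<zeta> \<rho>. orthonormal3 u e2 e3 \<Longrightarrow> \<rho> > 0 \<Longrightarrow>
     (\<integral>\<^sup>+y. angle_weight y * inv_pow 1 (norm (\<zeta> + (\<rho> * cos (snd y)) *\<^sub>R
        (cos (snd y) *\<^sub>R u + (sin (snd y) * cos (fst y)) *\<^sub>R e2 + (sin (snd y) * sin (fst y)) *\<^sub>R e3))) \<partial>lborel)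
       \<le> K * inv_pow 1 \<rho>"
     "\<And>u e2 e3 \<zeta> \<rho>. orthonormal3 u e2 e3 \<Longrightarrow> \<rho> > 0 \<Longrightarrow>
     (\<integral>\<^sup>+y. angle_weight y * inv_pow 1 (norm (\<zeta> + \<rho> *\<^sub>R u - (\<rho> * cos (snd y)) *\<^sub>R
        (cos (snd y) *\<^sub>R u + (sin (snd y) * cos (fst y)) *\<^sub>R e2 + (sin (snd y) * sin (fst y)) *\<^sub>R e3))) \<partial>lborel)
       \<le> K * inv_pow 1 \<rho>"
    using sphere_singularity_vec by blast
  let ?k = "\<integral>\<^sup>+y. angle_weight y \<partial>lborel"
  define L where "L = ?k + (K + K)"
  have L: "L < \<infinity>" using K nn_integral_angle_weight_finite by (simp add: L_def)
  have aw[measurable]: "angle_weight \<in> borel_measurable borel" using measurable_angle_weight by (simp add: borel_prod)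
  show ?thesis
  proof (intro exI conjI allI)
    show "ennreal B0 * L * K1 < \<infinity>" using L K1 by (simp add: ennreal_mult_less_top)
    fix \<zeta> :: "real^3"
    let ?S = "\<lambda>y. 1 + inv_pow 1 (norm (\<zeta> + shift1 y)) + inv_pow 1 (norm (\<zeta> + shift2 y))"
    have "(\<integral>\<^sup>+y. ennreal (kern B0 \<gamma> y) * decay (\<zeta> + fst y) * ?S y \<partial>lborel)
      = (\<integral>\<^sup>+V. \<integral>\<^sup>+z. ennreal (kern B0 \<gamma> (V, z)) * decay (\<zeta> + V) * ?S (V, z) \<partial>lborel \<partial>lborel)"
      by (subst nn_integral_cparam) auto
    also have "\<dots> \<le> (\<integral>\<^sup>+V. (ennreal B0 * L) * (ennreal (norm V powr \<gamma>) * decay (\<zeta> + V) * (1 + inv_pow 1 (norm V) + inv_pow 1 (norm (\<zeta> + V)))) \<partial>lborel)"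
    proof (rule nn_integral_mono_AE)
      show "AE V in lborel. (\<integral>\<^sup>+z. ennreal (kern B0 \<gamma> (V, z)) * decay (\<zeta> + V) * ?S (V, z) \<partial>lborel)
        \<le> (ennreal B0 * L) * (ennreal (norm V powr \<gamma>) * decay (\<zeta> + V) * (1 + inv_pow 1 (norm V) + inv_pow 1 (norm (\<zeta> + V))))"
        using AE_lborel_singleton[of 0]
      proof eventually_elim
        case (elim V)
        let ?u = "V /\<^sub>R norm V"
        have o: "orthonormal3 ?u (frame2 ?u) (frame3 ?u)" using elim by (intro orthonormal3_frame) simp
        have nV: "0 < norm V" using elim by simp
        have i1: "(\<integral>\<^sup>+z. angle_weight z * inv_pow 1 (norm (\<zeta> + shift1 (V, z))) \<partial>lborel) \<le> K * inv_pow 1 (norm V)"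
        proof -
          have "\<zeta> + shift1 (V, z) = \<zeta> + (norm V * cos (snd z)) *\<^sub>R
            (cos (snd z) *\<^sub>R ?u + (sin (snd z) * cos (fst z)) *\<^sub>R frame2 ?u + (sin (snd z) * sin (fst z)) *\<^sub>R frame3 ?u)" for z
            using shift1_eq[OF elim, of "fst z" "snd z"] by (cases z) (simp add: scatter_dir_def Let_def)
          then show ?thesis using K(2)[OF o nV, of \<zeta>] by simp
        qed
        have i2: "(\<integral>\<^sup>+z. angle_weight z * inv_pow 1 (norm (\<zeta> + shift2 (V, z))) \<partial>lborel) \<le> K * inv_pow 1 (norm V)"
        proof -
          have "\<zeta> + shift2 (V, z) = \<zeta> + norm V *\<^sub>R ?u - (norm V * cos (snd z)) *\<^sub>R
            (cos (snd z) *\<^sub>R ?u + (sin (snd z) * cos (fst z)) *\<^sub>R frame2 ?u + (sin (snd z) * sin (fst z)) *\<^sub>R frame3 ?u)" for z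
            using shift1_eq[OF elim, of "fst z" "snd z"] elim by (cases z) (simp add: scatter_dir_def Let_def shift2_def)
          then show ?thesis using K(3)[OF o nV, of \<zeta>] by (simp only:)
        qed
        have "(\<integral>\<^sup>+z. ennreal (kern B0 \<gamma> (V, z)) * decay (\<zeta> + V) * ?S (V, z) \<partial>lborel)
          = (\<integral>\<^sup>+z. (ennreal (B0 * norm V powr \<gamma>) * decay (\<zeta> + V)) * (angle_weight z + angle_weight z * inv_pow 1 (norm (\<zeta> + shift1 (V, z)))
               + angle_weight z * inv_pow 1 (norm (\<zeta> + shift2 (V, z)))) \<partial>lborel)"
          by (intro nn_integral_cong) (simp add: ennreal_kern B0 distrib_left ac_simps)
        also have "\<dots> = (ennreal (B0 * norm V powr \<gamma>) * decay (\<zeta> + V)) * (?k + (\<integral>\<^sup>+z. angle_weight z * inv_pow 1 (norm (\<zeta> + shift1 (V, z))) \<partial>lborel)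
               + (\<integral>\<^sup>+z. angle_weight z * inv_pow 1 (norm (\<zeta> + shift2 (V, z))) \<partial>lborel))"
          by (simp add: nn_integral_cmult nn_integral_add)
        \<comment> \<open>All three angular terms are enlarged to multiples of the same bracket, so
          that their constants add up to L.\<close>
        also have "\<dots> \<le> (ennreal (B0 * norm V powr \<gamma>) * decay (\<zeta> + V)) * (?k * (1 + inv_pow 1 (norm V) + inv_pow 1 (norm (\<zeta> + V)))
           + K * (1 + inv_pow 1 (norm V) + inv_pow 1 (norm (\<zeta> + V))) + K * (1 + inv_pow 1 (norm V) + inv_pow 1 (norm (\<zeta> + V))))"
        proof (intro mult_left_mono add_mono)
          have "?k * 1 \<le> ?k * (1 + inv_pow 1 (norm V) + inv_pow 1 (norm (\<zeta> + V)))"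
            by (intro mult_left_mono) (auto simp: add.assoc)
          then show "?k \<le> ?k * (1 + inv_pow 1 (norm V) + inv_pow 1 (norm (\<zeta> + V)))" by simp
          have "K * inv_pow 1 (norm V) \<le> K * (1 + inv_pow 1 (norm V) + inv_pow 1 (norm (\<zeta> + V)))"
            by (intro mult_left_mono) (auto simp: add.commute[of 1] add.assoc)
          then show "(\<integral>\<^sup>+z. angle_weight z * inv_pow 1 (norm (\<zeta> + shift1 (V, z))) \<partial>lborel) \<le> K * (1 + inv_pow 1 (norm V) + inv_pow 1 (norm (\<zeta> + V)))"
            "(\<integral>\<^sup>+z. angle_weight z * inv_pow 1 (norm (\<zeta> + shift2 (V, z))) \<partial>lborel) \<le> K * (1 + inv_pow 1 (norm V) + inv_pow 1 (norm (\<zeta> + V)))"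
            using i1 i2 by (meson order_trans)+
        qed auto
        also have "\<dots> = (ennreal B0 * L) * (ennreal (norm V powr \<gamma>) * decay (\<zeta> + V) * (1 + inv_pow 1 (norm V) + inv_pow 1 (norm (\<zeta> + V))))"
          unfolding L_def by (simp only: distrib_right[symmetric] add.assoc) (simp add: ennreal_mult B0 ac_simps)
        finally show ?case .
      qed
    qed
    also have "\<dots> = (ennreal B0 * L) * (\<integral>\<^sup>+V. ennreal (norm V powr \<gamma>) * decay (\<zeta> + V) * (1 + inv_pow 1 (norm V) + inv_pow 1 (norm (\<zeta> + V))) \<partial>lborel)"
      by (rule nn_integral_cmult) measurable
    also have "\<dots> \<le> (ennreal B0 * L) * (K1 * ennreal ((1 + norm \<zeta>) powr \<gamma>))"
      by (intro mult_left_mono K1) auto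
    finally show "(\<integral>\<^sup>+y. ennreal (kern B0 \<gamma> y) * decay (\<zeta> + fst y) * ?S y \<partial>lborel) \<le> ennreal B0 * L * K1 * ennreal ((1 + norm \<zeta>) powr \<gamma>)"
      by (simp only: mult.assoc)
  qed
qed

lemma loss_integral:
  assumes B0: "0 \<le> B0" and \<gamma>: "0 \<le> \<gamma>" "\<gamma> \<le> 1"
  shows "\<exists>K<\<infinity>. \<forall>\<zeta>. (\<integral>\<^sup>+y. ennreal (kern B0 \<gamma> y) * decay (\<zeta> + fst y) *
      (1 + inv_pow 1 (norm (\<zeta> + fst y))) \<partial>lborel) \<le> K * ennreal ((1 + norm \<zeta>) powr \<gamma>)"
proof -
  obtain K1 where K1: "K1 < \<infinity>" "\<And>\<zeta>. (\<integral>\<^sup>+V. ennreal (norm V powr \<gamma>) * decay (\<zeta> + V) * (1 + inv_pow 1 (norm V) + inv_pow 1 (norm (\<zeta> + V))) \<partial>lborel)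
     \<le> K1 * ennreal ((1 + norm \<zeta>) powr \<gamma>)"
    using velocity_integral[OF \<gamma>] by blast
  let ?k = "\<integral>\<^sup>+y. angle_weight y \<partial>lborel"
  have aw[measurable]: "angle_weight \<in> borel_measurable borel" using measurable_angle_weight by (simp add: borel_prod)
  show ?thesis
  proof (intro exI conjI allI)
    show "ennreal B0 * ?k * K1 < \<infinity>" using nn_integral_angle_weight_finite K1 by (simp add: ennreal_mult_less_top)
    fix \<zeta> :: "real^3"
    have "(\<integral>\<^sup>+y. ennreal (kern B0 \<gamma> y) * decay (\<zeta> + fst y) * (1 + inv_pow 1 (norm (\<zeta> + fst y))) \<partial>lborel)
      = (\<integral>\<^sup>+V. \<integral>\<^sup>+z. ennreal (kern B0 \<gamma> (V, z)) * decay (\<zeta> + V) * (1 + inv_pow 1 (norm (\<zeta> + V))) \<partial>lborel \<partial>lborel)"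
      by (subst nn_integral_cparam) auto
    also have "\<dots> = (\<integral>\<^sup>+V. \<integral>\<^sup>+z. (ennreal B0 * (ennreal (norm V powr \<gamma>) * decay (\<zeta> + V) * (1 + inv_pow 1 (norm (\<zeta> + V))))) * angle_weight z \<partial>lborel \<partial>lborel)"
      by (intro nn_integral_cong) (simp add: ennreal_kern B0 ennreal_mult ac_simps)
    also have "\<dots> = (\<integral>\<^sup>+V. (ennreal B0 * (ennreal (norm V powr \<gamma>) * decay (\<zeta> + V) * (1 + inv_pow 1 (norm (\<zeta> + V))))) * ?k \<partial>lborel)"
      by (intro nn_integral_cong nn_integral_cmult) measurable
    also have "\<dots> \<le> (\<integral>\<^sup>+V. (ennreal B0 * ?k) * (ennreal (norm V powr \<gamma>) * decay (\<zeta> + V) * (1 + inv_pow 1 (norm V) + inv_pow 1 (norm (\<zeta> + V)))) \<partial>lborel)"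
    proof (intro nn_integral_mono)
      fix V :: "real^3"
      have "1 + inv_pow 1 (norm (\<zeta> + V)) \<le> 1 + inv_pow 1 (norm V) + inv_pow 1 (norm (\<zeta> + V))"
        by (intro add_right_mono) simp
      then have "(ennreal B0 * ?k) * (ennreal (norm V powr \<gamma>) * decay (\<zeta> + V) * (1 + inv_pow 1 (norm (\<zeta> + V))))
         \<le> (ennreal B0 * ?k) * (ennreal (norm V powr \<gamma>) * decay (\<zeta> + V) * (1 + inv_pow 1 (norm V) + inv_pow 1 (norm (\<zeta> + V))))"
        by (intro mult_left_mono) auto
      then show "(ennreal B0 * (ennreal (norm V powr \<gamma>) * decay (\<zeta> + V) * (1 + inv_pow 1 (norm (\<zeta> + V))))) * ?k
         \<le> (ennreal B0 * ?k) * (ennreal (norm V powr \<gamma>) * decay (\<zeta> + V) * (1 + inv_pow 1 (norm V) + inv_pow 1 (norm (\<zeta> + V))))"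
        by (simp only: ac_simps)
    qed
    also have "\<dots> = (ennreal B0 * ?k) * (\<integral>\<^sup>+V. ennreal (norm V powr \<gamma>) * decay (\<zeta> + V) * (1 + inv_pow 1 (norm V) + inv_pow 1 (norm (\<zeta> + V))) \<partial>lborel)"
      by (rule nn_integral_cmult) measurable
    also have "\<dots> \<le> (ennreal B0 * ?k) * (K1 * ennreal ((1 + norm \<zeta>) powr \<gamma>))"
      by (intro mult_left_mono K1) auto
    finally show "(\<integral>\<^sup>+y. ennreal (kern B0 \<gamma> y) * decay (\<zeta> + fst y) * (1 + inv_pow 1 (norm (\<zeta> + fst y))) \<partial>lborel) \<le> ennreal B0 * ?k * K1 * ennreal ((1 + norm \<zeta>) powr \<gamma>)"
      by (simp only: mult.assoc)
  qed
qed

section \<open>Independence of the orthonormal basis\<close>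

text \<open>I is arbitrary, since it will be an inner integral of a function without any regularity.
  The shifted interval is cut at 2 pi and the overhanging piece is moved back by one period. If one
  of the pieces is not integrable, both integrals are 0 by convention.\<close>

lemma integral_shift_periodic:
  fixes I :: "real \<Rightarrow> real"
  assumes per: "\<And>x. I (x + 2 * pi) = I x" and c: "0 \<le> c" "c \<le> 2 * pi"
  shows "(LINT x:{0..2*pi}|lebesgue. I (x + c)) = (LINT x:{0..2*pi}|lebesgue. I x)"
proof -
  have sh: "(LINT x:{a..b}|lebesgue. I (x + d)) = (LINT x:{a+d..b+d}|lebesgue. I x)"
    "set_integrable lebesgue {a..b} (\<lambda>x. I (x + d)) \<longleftrightarrow> set_integrable lebesgue {a+d..b+d} I" for a b d
  proof -
    have e: "indicator {a+d..b+d} (d + x) *\<^sub>R I (d + x) = indicator {a..b} x *\<^sub>R I (x + d)" for x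
      by (auto simp: indicator_def add.commute)
    show "(LINT x:{a..b}|lebesgue. I (x + d)) = (LINT x:{a+d..b+d}|lebesgue. I x)"
      unfolding set_lebesgue_integral_def
      by (subst (2) lebesgue_integral_real_affine[of 1 _ d]) (simp_all add: e del: real_scaleR_def)
    have "integrable lebesgue (\<lambda>x. indicator {a+d..b+d} x *\<^sub>R I x) \<longleftrightarrow> integrable lebesgue (\<lambda>x. indicator {a+d..b+d} (d + 1 * x) *\<^sub>R I (d + 1 * x))"
      using has_bochner_integral_lebesgue_real_affine_iff[of 1 "\<lambda>x. indicator {a+d..b+d} x *\<^sub>R I x" _ d]
      by (auto simp: integrable.simps)
    then show "set_integrable lebesgue {a..b} (\<lambda>x. I (x + d)) \<longleftrightarrow> set_integrable lebesgue {a+d..b+d} I"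
      unfolding set_integrable_def by (simp add: e del: real_scaleR_def)
  qed
  have ae: "AE x in lebesgue. x \<noteq> (a::real)" for a
    by (rule AE_completion[OF AE_lborel_singleton])
  have split: "(LINT x:{a..b}|lebesgue. I x) = (LINT x:{a..m}|lebesgue. I x) + (LINT x:{m..b}|lebesgue. I x)"
    if "a \<le> m" "m \<le> b" "set_integrable lebesgue {a..m} I" "set_integrable lebesgue {m..b} I" for a m b
  proof -
    have "{a..b} = {a..m} \<union> {m..b}" using that by auto
    moreover have "AE x in lebesgue. \<not> (x \<in> {a..m} \<and> x \<in> {m..b})" using ae[of m] by eventually_elim auto
    ultimately show ?thesis using that by (simp add: set_integral_Un_AE)
  qed
  have ints: "set_integrable lebesgue {a..b} I \<longleftrightarrow> set_integrable lebesgue {a..m} I \<and> set_integrable lebesgue {m..b} I"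
    if "a \<le> m" "m \<le> b" for a m b
  proof -
    have "{a..b} = {a..m} \<union> {m..b}" using that by auto
    then show ?thesis using that
      by (auto intro: set_integrable_Un elim: set_integrable_subset)
  qed
  have p1: "(LINT x:{2*pi..2*pi+c}|lebesgue. I x) = (LINT x:{0..c}|lebesgue. I x)"
    "set_integrable lebesgue {2*pi..2*pi+c} I \<longleftrightarrow> set_integrable lebesgue {0..c} I"
    using sh[of 0 c "2*pi"] by (simp_all add: per add.commute)
  have "(LINT x:{0..2*pi}|lebesgue. I (x + c)) = (LINT x:{c..2*pi+c}|lebesgue. I x)"
    using sh(1)[of 0 "2*pi" c] by simp
  also have "\<dots> = (LINT x:{0..2*pi}|lebesgue. I x)"
  proof (cases "set_integrable lebesgue {0..c} I \<and> set_integrable lebesgue {c..2*pi} I")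
    case True
    then show ?thesis using c split[of c "2*pi" "2*pi+c"] split[of 0 c "2*pi"] p1 by simp
  next
    case False
    then have "\<not> set_integrable lebesgue {0..2*pi} I" "\<not> set_integrable lebesgue {c..2*pi+c} I"
      using ints[of 0 c "2*pi"] ints[of c "2*pi" "2*pi+c"] p1 c by auto
    then show ?thesis by (simp add: set_integrable_def set_lebesgue_integral_def not_integrable_integral_eq)
  qed
  finally show ?thesis .
qed

lemma integral_reflect_periodic:
  fixes I :: "real \<Rightarrow> real"
  assumes per: "\<And>x. I (x + 2 * pi) = I x"
  shows "(LINT x:{0..2*pi}|lebesgue. I (- x)) = (LINT x:{0..2*pi}|lebesgue. I x)"
proof -
  have e: "indicator {0..2*pi} (2*pi + -1 * x) *\<^sub>R I (2*pi + -1 * x) = indicator {0..2*pi} x *\<^sub>R I (- x)" for x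
    using per[of "- x"] by (auto simp: indicator_def add.commute)
  show ?thesis
    unfolding set_lebesgue_integral_def
    by (subst (2) lebesgue_integral_real_affine[of "-1" _ "2*pi"]) (simp_all only: e, simp_all)
qed

text \<open>Any function is allowed here: both sides vanish together when the integrals do not exist.\<close>
lemma sphere_integral_frame_independent:
  fixes f :: "real^3 \<Rightarrow> real \<Rightarrow> real"
  assumes o: "orthonormal3 u e2 e3" and o': "orthonormal3 u e2' e3'"
  shows "(LINT \<phi>:{0..2*pi}|lebesgue. (LINT \<theta>:{0..pi/2}|lebesgue.
      f (cos \<theta> *\<^sub>R u + (sin \<theta> * cos \<phi>) *\<^sub>R e2' + (sin \<theta> * sin \<phi>) *\<^sub>R e3') \<theta>))
    = (LINT \<phi>:{0..2*pi}|lebesgue. (LINT \<theta>:{0..pi/2}|lebesgue.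
      f (cos \<theta> *\<^sub>R u + (sin \<theta> * cos \<phi>) *\<^sub>R e2 + (sin \<theta> * sin \<phi>) *\<^sub>R e3) \<theta>))"
proof -
  define I where "I \<phi> = (LINT \<theta>:{0..pi/2}|lebesgue.
      f (cos \<theta> *\<^sub>R u + (sin \<theta> * cos \<phi>) *\<^sub>R e2 + (sin \<theta> * sin \<phi>) *\<^sub>R e3) \<theta>)" for \<phi>
  have per: "I (x + 2*pi) = I x" for x by (simp add: I_def)
  note i = orthonormal3_inner[OF o] and i' = orthonormal3_inner[OF o']
  \<comment> \<open>The frames differ by an orthogonal matrix with rows (c, s) and (p, q). Its
    determinant d is 1 or -1, so changing the frame shifts \<phi> by t and, for d = -1, also
    reflects it.\<close>
  define c s p q where "c = e2' \<bullet> e2" and "s = e2' \<bullet> e3" and "p = e3' \<bullet> e2" and "q = e3' \<bullet> e3"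
  have e2': "e2' = c *\<^sub>R e2 + s *\<^sub>R e3" using orthonormal3_expand[OF o, of e2'] i' by (simp add: c_def s_def)
  have e3': "e3' = p *\<^sub>R e2 + q *\<^sub>R e3" using orthonormal3_expand[OF o, of e3'] i' by (simp add: p_def q_def)
  have cs: "c\<^sup>2 + s\<^sup>2 = 1" using i'(2) orthonormal3_inner_expand[OF o, of e2' e2'] i' by (simp add: c_def s_def power2_eq_square)
  have pq: "p\<^sup>2 + q\<^sup>2 = 1" using i'(3) orthonormal3_inner_expand[OF o, of e3' e3'] i' by (simp add: p_def q_def power2_eq_square)
  have cp: "c * p + s * q = 0" using i'(6) orthonormal3_inner_expand[OF o, of e2' e3'] i' by (simp add: c_def s_def p_def q_def)
  define d where "d = c * q - s * p"
  have pd: "p = - s * d"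
  proof -
    have "p = p * (c\<^sup>2 + s\<^sup>2)" by (simp add: cs)
    also have "\<dots> = c * (c * p + s * q) - s * (c * q - s * p)" by (simp add: power2_eq_square algebra_simps)
    finally show ?thesis by (simp add: cp d_def)
  qed
  have qd: "q = c * d"
  proof -
    have "q = q * (c\<^sup>2 + s\<^sup>2)" by (simp add: cs)
    also have "\<dots> = s * (c * p + s * q) + c * (c * q - s * p)" by (simp add: power2_eq_square algebra_simps)
    finally show ?thesis by (simp add: cp d_def)
  qed
  have "d\<^sup>2 * (c\<^sup>2 + s\<^sup>2) = 1" using pq unfolding pd qd by (simp add: power2_eq_square algebra_simps)
  then have d: "d = 1 \<or> d = - 1" by (simp add: cs power2_eq_1_iff)
  obtain t where t: "0 \<le> t" "t < 2*pi" "c = cos t" "s = sin t" using sincos_total_2pi[OF cs] by blast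
  define J where "J \<phi> = (LINT \<theta>:{0..pi/2}|lebesgue.
      f (cos \<theta> *\<^sub>R u + (sin \<theta> * cos \<phi>) *\<^sub>R e2' + (sin \<theta> * sin \<phi>) *\<^sub>R e3') \<theta>)" for \<phi>
  have rot: "(a * cos \<phi>) *\<^sub>R e2' + (a * sin \<phi>) *\<^sub>R e3' = (a * cos (t + d * \<phi>)) *\<^sub>R e2 + (a * sin (t + d * \<phi>)) *\<^sub>R e3" for a \<phi>
    using d unfolding e2' e3' pd qd t(3,4)
    by (auto simp: cos_add sin_add cos_diff sin_diff algebra_simps scaleR_add_right)
  have J: "J \<phi> = I (t + d * \<phi>)" for \<phi>
    unfolding J_def I_def by (simp only: add.assoc rot)
  have "(LINT \<phi>:{0..2*pi}|lebesgue. J \<phi>) = (LINT \<phi>:{0..2*pi}|lebesgue. I \<phi>)"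
    using d
  proof
    assume "d = 1"
    then show ?thesis unfolding J using integral_shift_periodic[of I t, OF per] t by (simp add: add.commute)
  next
    assume d: "d = - 1"
    have per'': "I (t + (x + 2*pi)) = I (t + x)" for x using per[of "t + x"] by (simp add: add.assoc)
    have "(LINT \<phi>:{0..2*pi}|lebesgue. J \<phi>) = (LINT \<phi>:{0..2*pi}|lebesgue. (\<lambda>x. I (t + x)) (- \<phi>))"
      unfolding J d by simp
    also have "\<dots> = (LINT \<phi>:{0..2*pi}|lebesgue. I (t + \<phi>))"
      by (rule integral_reflect_periodic) (rule per'')
    also have "\<dots> = (LINT \<phi>:{0..2*pi}|lebesgue. I \<phi>)"
      using integral_shift_periodic[of I t, OF per] t by (simp add: add.commute)
    finally show ?thesis .
  qed
  then show ?thesis by (simp only: J_def I_def)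
qed

section \<open>The collision operator as one Borel integral\<close>

text \<open>The collision operator and the weak derivatives are defined with the Lebesgue measure,
  while shifts, products and Fubini are handled with Borel functions. Agreement almost everywhere is
  enough to pass from one to the other.\<close>

lemma integral_lebesgue_AE_eq_borel:
  fixes f g :: "'a::euclidean_space \<Rightarrow> real"
  assumes g[measurable]: "g \<in> borel_measurable borel" and ae: "AE x in lborel. f x = g x"
  shows "integral\<^sup>L lebesgue f = integral\<^sup>L lborel g"
    and "integrable lebesgue f \<longleftrightarrow> integrable lborel g"
    and "f \<in> borel_measurable lebesgue"
proof -
  have gm: "g \<in> borel_measurable lebesgue" by (rule measurable_completion) simp
  have ae': "AE x in lebesgue. f x = g x" using ae by (rule AE_completion)
  have "AE x in lebesgue. g x = f x" using ae' by eventually_elim simp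
  from borel_measurable_AE[OF gm this] show fm: "f \<in> borel_measurable lebesgue" .
  have "integral\<^sup>L lebesgue f = integral\<^sup>L lebesgue g" by (rule integral_cong_AE[OF fm gm ae'])
  then show "integral\<^sup>L lebesgue f = integral\<^sup>L lborel g" by (simp add: integral_completion)
  have "integrable lebesgue f \<longleftrightarrow> integrable lebesgue g" by (rule integrable_cong_AE[OF fm gm ae'])
  then show "integrable lebesgue f \<longleftrightarrow> integrable lborel g" by (simp add: integrable_completion)
qed

definition mroot :: "real^3 \<Rightarrow> real" where
  "mroot \<eta> = pi powr (-3/4) * exp (- (norm \<eta>)\<^sup>2 / 2)"

lemma maxwellian_sqrt: "maxwellian \<eta> powr (1/2) = mroot \<eta>"
  by (simp add: maxwellian_def mroot_def powr_mult powr_powr exp_powr_real)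

lemma maxwellian_inv_sqrt: "maxwellian \<eta> powr (-1/2) = 1 / mroot \<eta>"
  using powr_minus[of "maxwellian \<eta>" "1/2"] by (simp add: maxwellian_sqrt inverse_eq_divide)

lemma mroot_pos: "0 < mroot \<eta>" by (simp add: mroot_def)

lemma measurable_mroot [measurable]: "mroot \<in> borel_measurable borel"
  unfolding mroot_def by measurable

lemma mroot_collision:
  assumes "V \<noteq> 0"
  shows "mroot (\<zeta> + shift1 (V, z)) * mroot (\<zeta> + shift2 (V, z)) = mroot \<zeta> * mroot (\<zeta> + V)"
proof -
  have "exp (- (norm (\<zeta> + shift1 (V, z)))\<^sup>2 / 2) * exp (- (norm (\<zeta> + shift2 (V, z)))\<^sup>2 / 2)
     = exp (- ((norm (\<zeta> + shift1 (V, z)))\<^sup>2 + (norm (\<zeta> + shift2 (V, z)))\<^sup>2) / 2)"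
    by (simp flip: exp_add add: add_divide_distrib)
  also have "\<dots> = exp (- (norm \<zeta>)\<^sup>2 / 2) * exp (- (norm (\<zeta> + V))\<^sup>2 / 2)"
    unfolding collision_energy[OF assms] by (simp flip: exp_add add: add_divide_distrib)
  finally show ?thesis by (simp add: mroot_def)
qed

text \<open>By conservation of energy the roots of the Maxwellian have the same product before and
  after the collision, so the root at \<zeta> cancels against the inverse root in front of
  \<open>Gamma_op\<close>. Only the root at the partner velocity remains.\<close>

definition coll_integrand :: "real \<Rightarrow> real \<Rightarrow> (phase \<Rightarrow> real) \<Rightarrow> (phase \<Rightarrow> real) \<Rightarrow> phase \<Rightarrow> cparam \<Rightarrow> real" where
  "coll_integrand B0 \<gamma> k1 k2 = (\<lambda>(x, \<zeta>) y. kern B0 \<gamma> y * mroot (\<zeta> + fst y) *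
     (k1 (x, \<zeta> + shift1 y) * k2 (x, \<zeta> + shift2 y) - k1 (x, \<zeta>) * k2 (x, \<zeta> + fst y)))"

lemma integral_cparam:
  fixes f :: "cparam \<Rightarrow> real"
  assumes "integrable lborel f"
  shows "AE V in lborel. integrable lborel (\<lambda>z. f (V, z))"
    "(\<integral>y. f y \<partial>lborel) = (\<integral>V. (\<integral>z. f (V, z) \<partial>lborel) \<partial>lborel)"
proof -
  have "integrable (lborel \<Otimes>\<^sub>M lborel) (case_prod (\<lambda>V z. f (V, z)))" using assms by (simp add: lborel_prod)
  from lborel_pair.AE_integrable_fst[OF this] lborel_pair.integral_fst[OF this]
  show "AE V in lborel. integrable lborel (\<lambda>z. f (V, z))"
    "(\<integral>y. f y \<partial>lborel) = (\<integral>V. (\<integral>z. f (V, z) \<partial>lborel) \<partial>lborel)"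
    by (simp_all add: lborel_prod)
qed

text \<open>For fixed V three replacements are made: the arbitrary basis by the measurable frame,
  the iterated Lebesgue integrals by one Borel integral, and F and G by Borel functions that agree
  with them at almost all angles.\<close>

lemma inner_integral_eq:
  fixes F G :: "real^3 \<Rightarrow> real"
  assumes V: "V \<noteq> 0" and B0: "0 \<le> B0"
    and B: "B = (\<lambda>r \<theta>. B0 * r powr \<gamma> * sin \<theta> * cos \<theta>)"
    and m[measurable]: "k1 \<in> borel_measurable borel" "k2 \<in> borel_measurable borel"
    and ae: "AE z in lborel. F (\<zeta> + shift1 (V, z)) = mroot (\<zeta> + shift1 (V, z)) * k1 (x, \<zeta> + shift1 (V, z)) \<and>
      G (\<zeta> + shift2 (V, z)) = mroot (\<zeta> + shift2 (V, z)) * k2 (x, \<zeta> + shift2 (V, z))"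
    and e0: "F \<zeta> = mroot \<zeta> * k1 (x, \<zeta>)" "G (\<zeta> + V) = mroot (\<zeta> + V) * k2 (x, \<zeta> + V)"
    and i: "integrable lborel (\<lambda>z. coll_integrand B0 \<gamma> k1 k2 (x, \<zeta>) (V, z))"
  shows "(LINT \<phi>:{0..2 * pi}|lebesgue. (LINT \<theta>:{0..pi / 2}|lebesgue.
        (F (post_1 \<zeta> (\<zeta> + V) \<theta> \<phi>) * G (post_2 \<zeta> (\<zeta> + V) \<theta> \<phi>) - F \<zeta> * G (\<zeta> + V)) * B (norm (\<zeta> - (\<zeta> + V))) \<theta>))
     = mroot \<zeta> * (\<integral>z. coll_integrand B0 \<gamma> k1 k2 (x, \<zeta>) (V, z) \<partial>lborel)"
proof -
  let ?u = "V /\<^sub>R norm V"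
  have u: "norm ?u = 1" using V by simp
  note o = orthonormal3_frame[OF u]
  obtain e2 e3 where e: "basis_completion ?u = (e2, e3)" by (cases "basis_completion ?u")
  have o': "orthonormal3 ?u e2 e3"
    using someI[of "\<lambda>p. case p of (e2, e3) \<Rightarrow> orthonormal3 ?u e2 e3" "(frame2 ?u, frame3 ?u)"] o e
    by (simp add: basis_completion_def)
  let ?f = "\<lambda>\<omega> \<theta>. (F (\<zeta> + (V \<bullet> \<omega>) *\<^sub>R \<omega>) * G (\<zeta> + V - (V \<bullet> \<omega>) *\<^sub>R \<omega>) - F \<zeta> * G (\<zeta> + V)) * B (norm V) \<theta>"
  let ?c = "\<lambda>z. mroot \<zeta> * coll_integrand B0 \<gamma> k1 k2 (x, \<zeta>) (V, z)"
  have cm: "?c \<in> borel_measurable borel"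
    using i by (simp add: borel_measurable_integrable)
  have "(LINT \<phi>:{0..2 * pi}|lebesgue. (LINT \<theta>:{0..pi / 2}|lebesgue.
        (F (post_1 \<zeta> (\<zeta> + V) \<theta> \<phi>) * G (post_2 \<zeta> (\<zeta> + V) \<theta> \<phi>) - F \<zeta> * G (\<zeta> + V)) * B (norm (\<zeta> - (\<zeta> + V))) \<theta>))
    = (LINT \<phi>:{0..2*pi}|lebesgue. (LINT \<theta>:{0..pi/2}|lebesgue.
        ?f (cos \<theta> *\<^sub>R ?u + (sin \<theta> * cos \<phi>) *\<^sub>R e2 + (sin \<theta> * sin \<phi>) *\<^sub>R e3) \<theta>))"
    by (simp add: post_1_def post_2_def omega_def Let_def e)
  also have "\<dots> = (LINT \<phi>:{0..2*pi}|lebesgue. (LINT \<theta>:{0..pi/2}|lebesgue.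
        ?f (cos \<theta> *\<^sub>R ?u + (sin \<theta> * cos \<phi>) *\<^sub>R frame2 ?u + (sin \<theta> * sin \<phi>) *\<^sub>R frame3 ?u) \<theta>))"
    by (rule sphere_integral_frame_independent[OF o o'])
  also have "\<dots> = (LINT \<phi>:{0..2*pi}|lebesgue. (LINT \<theta>:{0..pi/2}|lebesgue. ?f (scatter_dir (V, \<phi>, \<theta>)) \<theta>))"
    by (simp add: scatter_dir_def Let_def)
  also have "\<dots> = (\<integral>\<phi>. (\<integral>\<theta>. ?c (\<phi>, \<theta>) \<partial>lborel) \<partial>lborel)"
    unfolding set_lebesgue_integral_def
  proof (rule integral_lebesgue_AE_eq_borel(1))
    have "(\<lambda>(\<phi>, \<theta>). ?c (\<phi>, \<theta>)) \<in> borel_measurable (lborel \<Otimes>\<^sub>M lborel)" using cm by (simp add: lborel_prod case_prod_eta)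
    then show "(\<lambda>\<phi>. \<integral>\<theta>. ?c (\<phi>, \<theta>) \<partial>lborel) \<in> borel_measurable borel"
      using lborel.borel_measurable_lebesgue_integral[of "\<lambda>\<phi> \<theta>. ?c (\<phi>, \<theta>)" lborel] by simp
    have "AE \<phi> in lborel. AE \<theta> in lborel. F (\<zeta> + shift1 (V, \<phi>, \<theta>)) = mroot (\<zeta> + shift1 (V, \<phi>, \<theta>)) * k1 (x, \<zeta> + shift1 (V, \<phi>, \<theta>)) \<and>
      G (\<zeta> + shift2 (V, \<phi>, \<theta>)) = mroot (\<zeta> + shift2 (V, \<phi>, \<theta>)) * k2 (x, \<zeta> + shift2 (V, \<phi>, \<theta>))"
      using lborel_pair.AE_pair[OF ae[folded lborel_prod]] .
    then show "AE \<phi> in lborel. indicator {0..2*pi} \<phi> *\<^sub>R (\<integral>\<theta>. indicator {0..pi/2} \<theta> *\<^sub>R ?f (scatter_dir (V, \<phi>, \<theta>)) \<theta> \<partial>lebesgue)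
       = (\<integral>\<theta>. ?c (\<phi>, \<theta>) \<partial>lborel)"
    proof eventually_elim
      case (elim \<phi>)
      have "indicator {0..2*pi} \<phi> *\<^sub>R (\<integral>\<theta>. indicator {0..pi/2} \<theta> *\<^sub>R ?f (scatter_dir (V, \<phi>, \<theta>)) \<theta> \<partial>lebesgue)
         = (\<integral>\<theta>. indicator {0..2*pi} \<phi> *\<^sub>R indicator {0..pi/2} \<theta> *\<^sub>R ?f (scatter_dir (V, \<phi>, \<theta>)) \<theta> \<partial>lebesgue)"
        by simp
      also have "\<dots> = (\<integral>\<theta>. ?c (\<phi>, \<theta>) \<partial>lborel)"
      proof (rule integral_lebesgue_AE_eq_borel(1))
        have "(\<lambda>\<theta>::real. (\<phi>, \<theta>)) \<in> borel \<rightarrow>\<^sub>M (borel \<Otimes>\<^sub>M borel)" by measurable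
        then have "(\<lambda>\<theta>::real. (\<phi>, \<theta>)) \<in> borel \<rightarrow>\<^sub>M borel" by (simp only: borel_prod)
        from measurable_compose[OF this cm] show "(\<lambda>\<theta>. ?c (\<phi>, \<theta>)) \<in> borel_measurable borel" .
        show "AE \<theta> in lborel. indicator {0..2*pi} \<phi> *\<^sub>R indicator {0..pi/2} \<theta> *\<^sub>R ?f (scatter_dir (V, \<phi>, \<theta>)) \<theta> = ?c (\<phi>, \<theta>)"
          using elim
        proof eventually_elim
          case (elim \<theta>)
          let ?y = "(V, \<phi>, \<theta>)"
          have s: "\<zeta> + (V \<bullet> scatter_dir ?y) *\<^sub>R scatter_dir ?y = \<zeta> + shift1 ?y"
            "\<zeta> + V - (V \<bullet> scatter_dir ?y) *\<^sub>R scatter_dir ?y = \<zeta> + shift2 ?y"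
            by (simp_all add: shift1_def shift2_def)
          have "F (\<zeta> + shift1 ?y) * G (\<zeta> + shift2 ?y) = (mroot (\<zeta> + shift1 ?y) * mroot (\<zeta> + shift2 ?y)) * (k1 (x, \<zeta> + shift1 ?y) * k2 (x, \<zeta> + shift2 ?y))"
            using elim by (simp add: ac_simps)
          also have "\<dots> = mroot \<zeta> * mroot (\<zeta> + V) * (k1 (x, \<zeta> + shift1 ?y) * k2 (x, \<zeta> + shift2 ?y))"
            by (simp only: mroot_collision[OF V])
          finally have FG: "F (\<zeta> + shift1 ?y) * G (\<zeta> + shift2 ?y) = \<dots>" .
          show ?case unfolding s FG unfolding e0 B
            by (simp add: coll_integrand_def kern_def algebra_simps)
        qed
      qed
      finally show ?case .
    qed
  qed
  also have "\<dots> = (\<integral>z. ?c z \<partial>lborel)"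
  proof -
    have "integrable (lborel \<Otimes>\<^sub>M lborel) ?c" using i by (simp add: lborel_prod)
    from lborel_pair.integral_fst'[OF this] show ?thesis unfolding lborel_prod .
  qed
  finally show ?thesis by simp
qed

text \<open>Carries the identity for fixed V over to the integral over the partner velocity,
  translated by -\<zeta>. Agreement of h1, h2 with k1, k2 is asked for at almost all collision
  parameters and, because the loss term evaluates h1 there, at \<zeta> itself.\<close>

lemma Gamma_op_eq_integral:
  assumes B0: "0 \<le> B0" and B: "B = (\<lambda>r \<theta>. B0 * r powr \<gamma> * sin \<theta> * cos \<theta>)"
    and m[measurable]: "k1 \<in> borel_measurable borel" "k2 \<in> borel_measurable borel"
    and ae: "AE y in lborel. h1 (x, \<zeta> + shift1 y) = k1 (x, \<zeta> + shift1 y) \<and> h2 (x, \<zeta> + shift2 y) = k2 (x, \<zeta> + shift2 y)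
       \<and> h2 (x, \<zeta> + fst y) = k2 (x, \<zeta> + fst y)"
    and e0: "h1 (x, \<zeta>) = k1 (x, \<zeta>)"
    and i: "integrable lborel (coll_integrand B0 \<gamma> k1 k2 (x, \<zeta>))"
  shows "Gamma_op B h1 h2 (x, \<zeta>) = (\<integral>y. coll_integrand B0 \<gamma> k1 k2 (x, \<zeta>) y \<partial>lborel)"
proof -
  let ?F = "\<lambda>\<eta>. mroot \<eta> * h1 (x, \<eta>)" and ?G = "\<lambda>\<eta>. mroot \<eta> * h2 (x, \<eta>)"
  let ?in = "\<lambda>\<zeta>s. (LINT \<phi>:{0..2 * pi}|lebesgue. (LINT \<theta>:{0..pi / 2}|lebesgue.
        (?F (post_1 \<zeta> \<zeta>s \<theta> \<phi>) * ?G (post_2 \<zeta> \<zeta>s \<theta> \<phi>) - ?F \<zeta> * ?G \<zeta>s) * B (norm (\<zeta> - \<zeta>s)) \<theta>))"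
  let ?c = "\<lambda>V. mroot \<zeta> * (\<integral>z. coll_integrand B0 \<gamma> k1 k2 (x, \<zeta>) (V, z) \<partial>lborel)"
  have "AE V in lborel. AE z in lborel. h1 (x, \<zeta> + shift1 (V, z)) = k1 (x, \<zeta> + shift1 (V, z)) \<and> h2 (x, \<zeta> + shift2 (V, z)) = k2 (x, \<zeta> + shift2 (V, z))
       \<and> h2 (x, \<zeta> + V) = k2 (x, \<zeta> + V)"
  proof -
    have "AE y in lborel \<Otimes>\<^sub>M lborel. h1 (x, \<zeta> + shift1 y) = k1 (x, \<zeta> + shift1 y) \<and> h2 (x, \<zeta> + shift2 y) = k2 (x, \<zeta> + shift2 y)
       \<and> h2 (x, \<zeta> + fst y) = k2 (x, \<zeta> + fst y)"
      unfolding lborel_prod by (rule ae)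
    from lborel_pair.AE_pair[OF this] show ?thesis by simp
  qed
  with integral_cparam(1)[OF i] AE_lborel_singleton[of 0]
  have "AE V in lborel. ?in (\<zeta> + V) = ?c V"
  proof eventually_elim
    case (elim V)
    have "h2 (x, \<zeta> + V) = k2 (x, \<zeta> + V)"
    \<comment> \<open>The equation does not depend on z, so if it holds for almost all z then it
      holds, because the measure is not zero.\<close>
    proof (rule ccontr)
      assume "h2 (x, \<zeta> + V) \<noteq> k2 (x, \<zeta> + V)"
      then have "AE z in (lborel :: (real \<times> real) measure). False"
        using elim(3) by (auto elim: eventually_mono)
      then have "ae_filter (lborel :: (real \<times> real) measure) = bot" by (simp only: eventually_False)
      then show False by (simp add: ae_filter_eq_bot_iff)
    qed
    then show ?case using elim(3) e0
      by (intro inner_integral_eq[OF elim(2) B0 B m _ _ _ elim(1)]) (auto elim: eventually_mono)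
  qed
  from AE_lborel_add[OF this, of "- \<zeta>"] have ae2: "AE \<zeta>s in lborel. ?in \<zeta>s = ?c (\<zeta>s + (- \<zeta>))"
    by simp
  have cm: "?c \<in> borel_measurable borel"
  proof -
    have "coll_integrand B0 \<gamma> k1 k2 (x, \<zeta>) \<in> borel_measurable (lborel \<Otimes>\<^sub>M lborel)"
      using i by (simp add: lborel_prod borel_measurable_integrable)
    then have "(\<lambda>V. \<integral>z. coll_integrand B0 \<gamma> k1 k2 (x, \<zeta>) (V, z) \<partial>lborel) \<in> borel_measurable lborel"
      by (intro lborel.borel_measurable_lebesgue_integral) (simp add: case_prod_eta)
    then show ?thesis by simp
  qed
  have "collision B ?F ?G \<zeta> = (\<integral>\<zeta>s. ?c (\<zeta>s + (- \<zeta>)) \<partial>lborel)"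
    unfolding collision_def by (rule integral_lebesgue_AE_eq_borel(1)[OF _ ae2]) (use cm in measurable)
  also have "\<dots> = (\<integral>V. ?c V \<partial>lborel)" by (rule integral_lborel_add[OF cm])
  also have "\<dots> = mroot \<zeta> * (\<integral>y. coll_integrand B0 \<gamma> k1 k2 (x, \<zeta>) y \<partial>lborel)"
    using integral_cparam(2)[OF i] by simp
  finally show ?thesis
    using mroot_pos[of \<zeta>] unfolding Gamma_op_def prod.case maxwellian_sqrt maxwellian_inv_sqrt by simp
qed

section \<open>Borel representatives of weak derivatives\<close>

lemma locally_integrable_on_iff_borel:
  fixes u v :: "'a::euclidean_space \<Rightarrow> real"
  assumes U: "open U" and v[measurable]: "v \<in> borel_measurable borel"
    and ae: "AE p in lborel. p \<in> U \<longrightarrow> u p = v p"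
  shows "locally_integrable_on u U \<longleftrightarrow> locally_integrable_borel v U"
proof -
  have "set_integrable lebesgue K u \<longleftrightarrow> set_integrable lborel K v" if K: "compact K" "K \<subseteq> U" for K
    unfolding set_integrable_def
  proof (rule integral_lebesgue_AE_eq_borel(2))
    have [measurable]: "K \<in> sets borel" using K by (simp add: borel_compact)
    show "(\<lambda>x. indicator K x *\<^sub>R v x) \<in> borel_measurable borel" by measurable
    show "AE x in lborel. indicator K x *\<^sub>R u x = indicator K x *\<^sub>R v x"
      using ae by eventually_elim (use K in \<open>auto simp: indicator_def\<close>)
  qed
  then show ?thesis by (auto simp: locally_integrable_on_def locally_integrable_borel_def)
qed

lemma integral_lebesgue_on_eq_borel:
  fixes u v \<psi> :: "'a::euclidean_space \<Rightarrow> real"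
  assumes U: "open U" and [measurable]: "v \<in> borel_measurable borel" "\<psi> \<in> borel_measurable borel"
    and ae: "AE p in lborel. p \<in> U \<longrightarrow> u p = v p" and z: "\<And>p. p \<notin> U \<Longrightarrow> \<psi> p = 0"
  shows "(LINT p|lebesgue_on U. u p * \<psi> p) = (\<integral>p. v p * \<psi> p \<partial>lborel)"
proof -
  have "U \<in> sets lebesgue" using U by (simp add: borel_open)
  then have "(LINT p|lebesgue_on U. u p * \<psi> p) = (\<integral>p. indicator U p *\<^sub>R (u p * \<psi> p) \<partial>lebesgue)"
    by (intro integral_restrict_space) simp
  also have "\<dots> = (\<integral>p. v p * \<psi> p \<partial>lborel)"
  proof (rule integral_lebesgue_AE_eq_borel(1))
    show "(\<lambda>p. v p * \<psi> p) \<in> borel_measurable borel" by measurable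
    show "AE p in lborel. indicator U p *\<^sub>R (u p * \<psi> p) = v p * \<psi> p"
      using ae by eventually_elim (use z in \<open>auto simp: indicator_def\<close>)
  qed
  finally show ?thesis .
qed

text \<open>Test functions and their derivatives vanish outside U, so the values of the
  representatives there do not enter.\<close>

lemma has_weak_derivative_in_iff_borel:
  fixes u v :: "'a::euclidean_space \<Rightarrow> real"
  assumes U: "open U" and m[measurable]: "u' \<in> borel_measurable borel" "v' \<in> borel_measurable borel"
    and ae: "AE p in lborel. p \<in> U \<longrightarrow> u p = u' p" "AE p in lborel. p \<in> U \<longrightarrow> v p = v' p"
  shows "has_weak_derivative_in u v e U \<longleftrightarrow> weak_deriv_borel u' v' e U"
proof -
  have "(LINT p|lebesgue_on U. u p * frechet_derivative \<phi> (at p) e) = (\<integral>p. u' p * frechet_derivative \<phi> (at p) e \<partial>lborel)"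
    "(LINT p|lebesgue_on U. v p * \<phi> p) = (\<integral>p. v' p * \<phi> p \<partial>lborel)" if \<phi>: "test_function U \<phi>" for \<phi>
  proof -
    note F = test_function_facts[OF \<phi>] and M = test_function_measurable[OF \<phi>]
    have z: "p \<notin> U \<Longrightarrow> \<phi> p = 0" "p \<notin> U \<Longrightarrow> frechet_derivative \<phi> (at p) e = 0" for p
      using F(2) F(3)[of p] F(7)[of p e] by auto
    show "(LINT p|lebesgue_on U. u p * frechet_derivative \<phi> (at p) e) = (\<integral>p. u' p * frechet_derivative \<phi> (at p) e \<partial>lborel)"
      by (rule integral_lebesgue_on_eq_borel[OF U m(1) M(2) ae(1) z(2)])
    show "(LINT p|lebesgue_on U. v p * \<phi> p) = (\<integral>p. v' p * \<phi> p \<partial>lborel)"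
      by (rule integral_lebesgue_on_eq_borel[OF U m(2) M(1) ae(2) z(1)])
  qed
  then show ?thesis
    unfolding has_weak_derivative_in_def weak_deriv_borel_def
      locally_integrable_on_iff_borel[OF U m(1) ae(1)] locally_integrable_on_iff_borel[OF U m(2) ae(2)]
    by auto
qed

text \<open>Integrability on a closed box gives measurability there, and countably many closed boxes
  fill U.\<close>

lemma locally_integrable_on_imp_measurable:
  fixes u :: "'a::euclidean_space \<Rightarrow> real"
  assumes U: "open U" and u: "locally_integrable_on u U"
  shows "(\<lambda>p. indicator U p * u p) \<in> borel_measurable lebesgue"
proof -
  have "\<exists>D. countable D \<and> D \<subseteq> Pow U \<and> (\<forall>X\<in>D. \<exists>a b. X = cbox a b) \<and> \<Union>D = U"
  proof (rule open_countable_Union_open_cbox[OF U], rule exI, intro conjI ballI)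
    fix D X assume "\<And>X. X \<in> D \<Longrightarrow> \<exists>a b. X = cbox a b" "X \<in> D"
    then show "\<exists>a b. X = cbox a b" .
  qed assumption+
  then obtain D where D: "countable D" "D \<subseteq> Pow U" "\<forall>X\<in>D. \<exists>a b. X = cbox a b" "\<Union>D = U"
    by blast
  have Ul: "U \<in> sets lebesgue" using U by (simp add: borel_open)
  show ?thesis
  proof (rule measurable_piecewise_restrict[of "insert (- U) D"])
    show "countable (insert (- U) D)" using D by simp
    show "space lebesgue \<subseteq> \<Union>(insert (- U) D)" using D(4) by auto
    fix X assume "X \<in> insert (- U) D"
    then consider "X = - U" | "X \<in> D" by blast
    then show "X \<inter> space lebesgue \<in> sets lebesgue"
    proof cases
      case 1
      then show ?thesis using Ul by (simp add: Compl_in_sets_lebesgue)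
    next
      case 2
      with D(3) obtain a b where "X = cbox a b" by blast
      then show ?thesis by simp
    qed
    then have X: "X \<in> sets lebesgue" by simp
    have "(\<lambda>p. indicator X p *\<^sub>R (indicator U p * u p)) \<in> borel_measurable lebesgue"
      using \<open>X \<in> insert (- U) D\<close>
    proof (elim insertE)
      assume "X = - U"
      then have "(\<lambda>p. indicator X p *\<^sub>R (indicator U p * u p)) = (\<lambda>p. 0)" by (auto simp: fun_eq_iff indicator_def)
      then show ?thesis by simp
    next
      assume XD: "X \<in> D"
      from bspec[OF D(3) XD] have "compact X" by (auto intro: compact_cbox)
      moreover have XU: "X \<subseteq> U" using D(2) XD by blast
      ultimately have "set_integrable lebesgue X u" using u by (auto simp: locally_integrable_on_def)
      then have "(\<lambda>p. indicator X p *\<^sub>R u p) \<in> borel_measurable lebesgue"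
        by (simp add: set_integrable_def borel_measurable_integrable)
      also have "(\<lambda>p. indicator X p *\<^sub>R u p) = (\<lambda>p. indicator X p *\<^sub>R (indicator U p * u p))"
        using XU by (auto simp: fun_eq_iff indicator_def)
      finally show ?thesis .
    qed
    then show "(\<lambda>p. indicator U p * u p) \<in> borel_measurable (lebesgue_on X)"
      using X by (subst borel_measurable_restrict_space_iff) auto
  qed
qed

text \<open>Values above the bound b are replaced by 0, which changes the function only on a null
  set. The bound then holds at every point, so it stays valid at shifted velocities, where an
  exceptional null set could be hit.\<close>

lemma borel_representative:
  fixes u :: "'a::euclidean_space \<Rightarrow> real"
  assumes U: "open U" and u: "locally_integrable_on u U"
    and b[measurable]: "b \<in> borel_measurable borel" and b0: "\<And>p. 0 \<le> b p"
    and ae: "AE p in lborel. p \<in> U \<longrightarrow> \<bar>u p\<bar> \<le> b p"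
  obtains v where "v \<in> borel_measurable borel" "\<And>p. p \<notin> U \<Longrightarrow> v p = 0" "\<And>p. \<bar>v p\<bar> \<le> b p"
    "AE p in lborel. p \<in> U \<longrightarrow> u p = v p"
proof -
  have Ub[measurable]: "U \<in> sets borel" using U by simp
  obtain g where g[measurable]: "g \<in> borel_measurable borel" and ga: "AE p in lborel. indicator U p * u p = g p"
    using completion_ex_borel_measurable_real[OF locally_integrable_on_imp_measurable[OF U u]] by auto
  let ?v = "\<lambda>p. if p \<in> U \<and> \<bar>g p\<bar> \<le> b p then g p else 0"
  show thesis
  proof (rule that[of ?v])
    show "?v \<in> borel_measurable borel" by measurable
    show "AE p in lborel. p \<in> U \<longrightarrow> u p = ?v p"
      using ga ae by eventually_elim (auto simp: indicator_def)
  qed (use b0 in auto)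
qed

text \<open>Connects the gradient fixed by choice in \<open>weak_grad_x\<close> or
  \<open>weak_grad_\<zeta>\<close> with one that has been computed and estimated.\<close>

lemma weak_derivative_unique:
  fixes u v1 v2 :: "'a::euclidean_space \<Rightarrow> real"
  assumes U: "open U" and w: "has_weak_derivative_in u v1 e U" "has_weak_derivative_in u v2 e U"
  shows "AE p in lborel. p \<in> U \<longrightarrow> v1 p = v2 p"
proof -
  have loc: "locally_integrable_on v1 U" "locally_integrable_on v2 U"
    using w by (auto simp: has_weak_derivative_in_def)
  obtain g1 where g1: "g1 \<in> borel_measurable borel" "AE p in lborel. indicator U p * v1 p = g1 p"
    using completion_ex_borel_measurable_real[OF locally_integrable_on_imp_measurable[OF U loc(1)]] by auto
  obtain g2 where g2: "g2 \<in> borel_measurable borel" "AE p in lborel. indicator U p * v2 p = g2 p"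
    using completion_ex_borel_measurable_real[OF locally_integrable_on_imp_measurable[OF U loc(2)]] by auto
  have a1: "AE p in lborel. p \<in> U \<longrightarrow> v1 p = g1 p" using g1(2) by eventually_elim auto
  have a2: "AE p in lborel. p \<in> U \<longrightarrow> v2 p = g2 p" using g2(2) by eventually_elim auto
  have l1: "locally_integrable_borel g1 U" and l2: "locally_integrable_borel g2 U"
    using loc locally_integrable_on_iff_borel[OF U g1(1) a1] locally_integrable_on_iff_borel[OF U g2(1) a2] by auto
  have "AE p in lborel. p \<in> U \<longrightarrow> g1 p - g2 p = 0"
  proof (rule AE_eq_0_if_test_integrals_eq_0[OF U])
    show "locally_integrable_borel (\<lambda>p. g1 p - g2 p) U"
      using l1 l2 by (auto simp: locally_integrable_borel_def intro!: set_integral_diff)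
    fix \<phi> assume \<phi>: "test_function U \<phi>"
    note F = test_function_facts[OF \<phi>] and M = test_function_measurable[OF \<phi>]
    obtain B where B: "\<And>p. \<bar>\<phi> p\<bar> \<le> B" using test_function_bounds[OF \<phi>] by metis
    have z: "p \<notin> U \<Longrightarrow> \<phi> p = 0" for p using F(2) F(3)[of p] by auto
    have si: "set_integrable lborel (closure {p. \<phi> p \<noteq> 0}) g1" "set_integrable lborel (closure {p. \<phi> p \<noteq> 0}) g2"
      using l1 l2 F(1,2) by (auto simp: locally_integrable_borel_def)
    have i: "integrable lborel (\<lambda>p. g1 p * \<phi> p)" "integrable lborel (\<lambda>p. g2 p * \<phi> p)"
      by (rule integrable_mult_test[OF g1(1) M(1) si(1) F(3) B], assumption)
        (rule integrable_mult_test[OF g2(1) M(1) si(2) F(3) B], assumption)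
    have "(LINT p|lebesgue_on U. v1 p * \<phi> p) = (LINT p|lebesgue_on U. v2 p * \<phi> p)"
      using w \<phi> by (auto simp: has_weak_derivative_in_def)
    then have "(\<integral>p. g1 p * \<phi> p \<partial>lborel) = (\<integral>p. g2 p * \<phi> p \<partial>lborel)"
      using integral_lebesgue_on_eq_borel[OF U g1(1) M(1) a1 z] integral_lebesgue_on_eq_borel[OF U g2(1) M(1) a2 z] by simp
    then show "(\<integral>p. (g1 p - g2 p) * \<phi> p \<partial>lborel) = 0" using i by (simp add: left_diff_distrib)
  qed
  with a1 a2 show ?thesis by eventually_elim auto
qed

lemma weak_deriv_borel_diff:
  assumes 1: "weak_deriv_borel u1 v1 e U" and 2: "weak_deriv_borel u2 v2 e U"
  shows "weak_deriv_borel (\<lambda>p. u1 p - u2 p) (\<lambda>p. v1 p - v2 p) e U"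
  unfolding weak_deriv_borel_def
proof (intro conjI allI impI)
  have l: "locally_integrable_borel u1 U" "locally_integrable_borel v1 U" "locally_integrable_borel u2 U" "locally_integrable_borel v2 U"
    using 1 2 by (auto simp: weak_deriv_borel_def)
  then show "locally_integrable_borel (\<lambda>p. u1 p - u2 p) U" "locally_integrable_borel (\<lambda>p. v1 p - v2 p) U"
    by (auto simp: locally_integrable_borel_def intro!: set_integral_diff)
  have m: "u1 \<in> borel_measurable borel" "v1 \<in> borel_measurable borel" "u2 \<in> borel_measurable borel" "v2 \<in> borel_measurable borel"
    using l by (auto simp: locally_integrable_borel_def)
  fix \<phi> assume \<phi>: "test_function U \<phi>"
  note F = test_function_facts[OF \<phi>] and M = test_function_measurable[OF \<phi>]
  obtain B where B: "\<And>p. \<bar>\<phi> p\<bar> \<le> B" "\<And>p. \<bar>frechet_derivative \<phi> (at p) e\<bar> \<le> B"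
    using test_function_bounds[OF \<phi>] by metis
  have s: "set_integrable lborel (closure {p. \<phi> p \<noteq> 0}) f" if "locally_integrable_borel f U" for f
    using that F(1,2) by (auto simp: locally_integrable_borel_def)
  have i: "integrable lborel (\<lambda>p. f p * \<phi> p)" "integrable lborel (\<lambda>p. f p * frechet_derivative \<phi> (at p) e)"
    if f: "f \<in> borel_measurable borel" "locally_integrable_borel f U" for f
    by (rule integrable_mult_test[OF f(1) M(1) s[OF f(2)] F(3) B(1)], assumption)
      (rule integrable_mult_test[OF f(1) M(2) s[OF f(2)] F(7) B(2)], assumption)
  show "(\<integral>p. (u1 p - u2 p) * frechet_derivative \<phi> (at p) e \<partial>lborel) = - (\<integral>p. (v1 p - v2 p) * \<phi> p \<partial>lborel)"
    using 1 2 \<phi> i[OF m(1) l(1)] i[OF m(2) l(2)] i[OF m(3) l(3)] i[OF m(4) l(4)]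
    by (simp add: left_diff_distrib weak_deriv_borel_def)
qed

lemma line_deriv_cmult:
  fixes c :: real
  assumes "line_deriv u v e U"
  shows "line_deriv (\<lambda>p. c * u p) (\<lambda>p. c * v p) e U"
  unfolding line_deriv_def
proof (intro allI impI)
  fix t :: real assume "0 < t"
  with assms have "AE p in lborel. p \<in> U \<and> p + t *\<^sub>R e \<in> U \<longrightarrow> set_integrable lborel {0..t} (\<lambda>s. v (p + s *\<^sub>R e)) \<and>
     u (p + t *\<^sub>R e) - u p = (LINT s:{0..t}|lborel. v (p + s *\<^sub>R e))" by (simp add: line_deriv_def)
  then show "AE p in lborel. p \<in> U \<and> p + t *\<^sub>R e \<in> U \<longrightarrow> set_integrable lborel {0..t} (\<lambda>s. c * v (p + s *\<^sub>R e)) \<and>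
     c * u (p + t *\<^sub>R e) - c * u p = (LINT s:{0..t}|lborel. c * v (p + s *\<^sub>R e))"
  proof eventually_elim
    case (elim p)
    then show ?case
      by (auto intro!: set_integrable_mult_right simp: set_integral_mult_right simp flip: right_diff_distrib)
  qed
qed

section \<open>The square root of the Maxwellian and its derivative\<close>

definition dec :: "real^3 \<Rightarrow> real" where
  "dec \<eta> = exp (- (norm \<eta>)\<^sup>2 / 4)"

lemma decay_dec: "decay \<eta> = ennreal (dec \<eta>)" by (simp add: decay_def dec_def)

lemma dec_nonneg: "0 \<le> dec \<eta>" by (simp add: dec_def)

lemma pi_powr_le_1: "pi powr (-3/4) \<le> 1"
proof -
  have "pi powr (-3/4) \<le> pi powr 0" using pi_ge_two by (intro powr_mono) auto
  then show ?thesis by simp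
qed

lemma mroot_le_dec: "mroot \<eta> \<le> dec \<eta>"
proof -
  note pi_powr_le_1
  moreover have "exp (- (norm \<eta>)\<^sup>2 / 2) \<le> exp (- (norm \<eta>)\<^sup>2 / 4)" by simp
  ultimately have "pi powr (-3/4) * exp (- (norm \<eta>)\<^sup>2 / 2) \<le> 1 * exp (- (norm \<eta>)\<^sup>2 / 4)"
    by (intro mult_mono) auto
  then show ?thesis by (simp add: mroot_def dec_def)
qed

definition dmroot :: "real^3 \<Rightarrow> real^3 \<Rightarrow> real" where
  "dmroot v \<eta> = - mroot \<eta> * (\<eta> \<bullet> v)"

lemma mroot_has_derivative: "(mroot has_derivative (\<lambda>v. dmroot v \<eta>)) (at \<eta>)"
proof -
  have "((\<lambda>\<eta>. pi powr (-3/4) * exp (- (\<eta> \<bullet> \<eta>) / 2)) has_derivative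
     (\<lambda>v. pi powr (-3/4) * (exp (- (\<eta> \<bullet> \<eta>) / 2) * (- (\<eta> \<bullet> v + v \<bullet> \<eta>) / 2)))) (at \<eta>)"
    by (auto intro!: derivative_eq_intros simp: algebra_simps)
  also have "(\<lambda>\<eta>. pi powr (-3/4) * exp (- (\<eta> \<bullet> \<eta>) / 2)) = mroot"
    by (simp add: fun_eq_iff mroot_def power2_norm_eq_inner)
  also have "(\<lambda>v. pi powr (-3/4) * (exp (- (\<eta> \<bullet> \<eta>) / 2) * (- (\<eta> \<bullet> v + v \<bullet> \<eta>) / 2))) = (\<lambda>v. dmroot v \<eta>)"
    by (simp add: fun_eq_iff dmroot_def mroot_def power2_norm_eq_inner inner_commute)
  finally show ?thesis .
qed

lemma continuous_dmroot: "continuous_on UNIV (dmroot v)"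
  unfolding dmroot_def mroot_def by (intro continuous_intros) auto

lemma dmroot_le_dec:
  assumes "norm v \<le> 1"
  shows "\<bar>dmroot v \<eta>\<bar> \<le> dec \<eta>"
proof -
  define r where "r = norm \<eta>"
  note p1 = pi_powr_le_1
  \<comment> \<open>The linear factor of the derivative is absorbed by half of the Gaussian: r <= 1
    + r^2/4 <= exp (r^2/4).\<close>
  have "0 \<le> (r / 2 - 1)\<^sup>2" by simp
  then have "r \<le> 1 + r\<^sup>2 / 4" by (simp add: power2_eq_square algebra_simps)
  also have "\<dots> \<le> exp (r\<^sup>2 / 4)" by (rule exp_ge_add_one_self)
  finally have r: "r \<le> exp (r\<^sup>2 / 4)" .
  have "\<bar>\<eta> \<bullet> v\<bar> \<le> r * norm v" unfolding r_def by (rule Cauchy_Schwarz_ineq2)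
  also have "\<dots> \<le> r * 1" using assms by (intro mult_left_mono) (auto simp: r_def)
  finally have "\<bar>\<eta> \<bullet> v\<bar> \<le> exp (r\<^sup>2 / 4)" using r by simp
  then have "\<bar>dmroot v \<eta>\<bar> \<le> (1 * exp (- r\<^sup>2 / 2)) * exp (r\<^sup>2 / 4)"
    unfolding dmroot_def abs_mult using p1
    by (intro mult_mono) (auto simp: mroot_def r_def intro!: mult_right_le_one_le mult_left_le_one_le)
  also have "\<dots> = dec \<eta>" by (simp add: dec_def r_def flip: exp_add)
  finally show ?thesis .
qed

section \<open>Differentiation of the collision integral\<close>

text \<open>At 0 the real inverse is 0 and \<open>inv_pow\<close> is infinite, so the comparison
  holds at the pole too.\<close>

lemma ennreal_inverse_le_inv_pow: "0 \<le> r \<Longrightarrow> ennreal (inverse r) \<le> inv_pow 1 r"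
  by (cases "r = 0") (auto simp: inv_pow_def inverse_ennreal)

text \<open>The pole sits in the velocity alone, and a compact set is contained in a product of two
  balls, on which the integral factors.\<close>

lemma compact_integral_inv_pow:
  fixes K :: "phase set"
  assumes K: "compact K"
  shows "(\<integral>\<^sup>+p. (1 + inv_pow 1 (norm (snd p + s))) * indicator K p \<partial>lborel) < \<infinity>"
proof -
  obtain r where r: "\<And>p. p \<in> K \<Longrightarrow> norm p \<le> r" using compact_imp_bounded[OF K] by (auto simp: bounded_iff)
  let ?B = "cball (0::real^3) r" and ?B1 = "cball (0::real^3) 1"
  have [measurable]: "?B \<in> sets borel" "?B1 \<in> sets borel" by simp_all
  have sub: "K \<subseteq> ?B \<times> ?B"
  proof
    fix p assume "p \<in> K"
    then show "p \<in> ?B \<times> ?B" using r[of p] norm_fst_le[of "fst p" "snd p"] norm_snd_le[of "snd p" "fst p"]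
      by (auto simp: mem_Times_iff)
  qed
  have [measurable]: "K \<in> sets borel" using K by (simp add: borel_compact)
  let ?H = "\<integral>\<^sup>+x. inv_pow 1 (norm (x::real^3)) * indicator ?B1 x \<partial>lborel"
  have "(\<integral>\<^sup>+p. (1 + inv_pow 1 (norm (snd p + s))) * indicator K p \<partial>lborel)
    \<le> (\<integral>\<^sup>+p. indicator ?B (fst p) * ((2 * indicator ?B (snd p)) + inv_pow 1 (norm (snd p + s)) * indicator ?B1 (snd p + s)) \<partial>(lborel \<Otimes>\<^sub>M lborel))"
    unfolding lborel_prod
  proof (intro nn_integral_mono)
    fix p :: phase
    show "(1 + inv_pow 1 (norm (snd p + s))) * indicator K p \<le> indicator ?B (fst p) * ((2 * indicator ?B (snd p)) + inv_pow 1 (norm (snd p + s)) * indicator ?B1 (snd p + s))"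
    proof (cases "p \<in> K")
      case True
      then have b: "fst p \<in> ?B" "snd p \<in> ?B" using sub by auto
      have "1 + inv_pow 1 (norm (snd p + s)) \<le> 2 + inv_pow 1 (norm (snd p + s)) * indicator ?B1 (snd p + s)"
      proof (cases "snd p + s \<in> ?B1")
        case True
        then show ?thesis by (simp add: add_right_mono)
      next
        case False
        then have "inv_pow 1 (norm (snd p + s)) \<le> 1" by (intro inv_pow_le_1) auto
        then have "1 + inv_pow 1 (norm (snd p + s)) \<le> 1 + 1" by (rule add_left_mono)
        then show ?thesis using False by simp
      qed
      then show ?thesis using True b by simp
    qed simp
  qed
  also have "\<dots> = (\<integral>\<^sup>+x. indicator ?B x * (\<integral>\<^sup>+\<zeta>. 2 * indicator ?B \<zeta> + inv_pow 1 (norm (\<zeta> + s)) * indicator ?B1 (\<zeta> + s) \<partial>lborel) \<partial>lborel)"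
    by (subst lborel.nn_integral_fst[symmetric]) (auto simp: nn_integral_cmult)
  also have "\<dots> = (\<integral>\<^sup>+\<zeta>. 2 * indicator ?B \<zeta> + inv_pow 1 (norm (\<zeta> + s)) * indicator ?B1 (\<zeta> + s) \<partial>lborel) * emeasure lborel ?B"
    by (subst nn_integral_multc) (auto simp: mult.commute)
  also have "(\<integral>\<^sup>+\<zeta>. 2 * indicator ?B \<zeta> + inv_pow 1 (norm (\<zeta> + s)) * indicator ?B1 (\<zeta> + s) \<partial>lborel)
     = 2 * emeasure lborel ?B + (\<integral>\<^sup>+\<zeta>. inv_pow 1 (norm (\<zeta> + s)) * indicator ?B1 (\<zeta> + s) \<partial>lborel)"
    by (subst nn_integral_add) (auto simp: nn_integral_cmult)
  also have "(\<integral>\<^sup>+\<zeta>. inv_pow 1 (norm (\<zeta> + s)) * indicator ?B1 (\<zeta> + s) \<partial>lborel) = ?H"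
    by (rule nn_integral_lborel_add) measurable
  also have "(2 * emeasure lborel ?B + ?H) * emeasure lborel ?B < \<infinity>"
    using nn_integral_inv_norm_ball_finite emeasure_lborel_cball_finite[of "0::real^3" r]
    by (simp add: ennreal_mult_less_top)
  finally show ?thesis .
qed

lemma AE_lebesgue_on_iff:
  assumes "open U"
  shows "(AE p in lebesgue_on U. P p) \<longleftrightarrow> (AE p in lborel. p \<in> U \<longrightarrow> P p)"
proof -
  have "U \<in> sets lebesgue" using assms by (simp add: borel_open)
  then show ?thesis by (subst AE_restrict_space_iff) (auto simp: AE_completion_iff)
qed

text \<open>For each y the shifted null set is null again, and Fubini exchanges the two quantifiers.
  Hence for almost every phase point a function and its representative agree at almost all shifted
  velocities, which is the hypothesis of \<open>Gamma_op_eq_integral\<close>.\<close>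

lemma AE_shift_pairs:
  fixes S :: "cparam \<Rightarrow> real^3" and Q :: "phase \<Rightarrow> bool"
  assumes Q: "AE p in lborel. Q p" and S[measurable]: "S \<in> borel_measurable borel"
  shows "AE p in lborel. AE y in lborel. Q (fst p, snd p + S y)"
proof -
  from Q obtain N where N: "N \<in> null_sets lborel" "{p. \<not> Q p} \<subseteq> N"
    by (auto simp: eventually_ae_filter)
  then have [measurable]: "N \<in> sets borel" by auto
  have "AE p in lborel. (fst p, snd p + S y) \<notin> N" for y
  proof -
    have "(fst p, snd p + S y) = p + (0, S y)" for p :: phase by (simp add: prod_eq_iff)
    then show ?thesis using AE_lborel_add[OF AE_not_in[OF N(1)], of "(0, S y)"] by simp
  qed
  then have "AE y in lborel. AE p in lborel. (fst p, snd p + S y) \<notin> N" by simp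
  then have "AE p in lborel. AE y in lborel. (fst p, snd p + S y) \<notin> N"
  proof (subst lborel_pair.AE_commute)
    have [measurable]: "(\<lambda>x. (fst (fst x), snd (fst x) + S (snd x))) \<in> borel_measurable (borel \<Otimes>\<^sub>M borel :: (phase \<times> cparam) measure)"
      by measurable
    show "{x \<in> space (lborel \<Otimes>\<^sub>M lborel). (fst (fst x), snd (fst x) + S (snd x)) \<notin> N} \<in> sets (lborel \<Otimes>\<^sub>M lborel)"
      by measurable
  qed
  then show ?thesis
  proof eventually_elim
    case (elim p)
    then show ?case by eventually_elim (use N(2) in auto)
  qed
qed

lemma AE_pair_nonzero:
  "AE p in (lborel :: phase measure). snd p \<noteq> 0" "AE y in (lborel :: cparam measure). fst y \<noteq> 0"
proof -
  have "AE p in (lborel \<Otimes>\<^sub>M lborel :: phase measure). snd p \<noteq> 0"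
  proof (rule lborel_pair.AE_pair_measure)
    show "{x \<in> space (lborel \<Otimes>\<^sub>M lborel). snd x \<noteq> (0::real^3)} \<in> sets (lborel \<Otimes>\<^sub>M lborel)" by measurable
    show "AE x in lborel. AE y in lborel. snd (x :: real^3, y :: real^3) \<noteq> 0"
      using AE_lborel_singleton[of "0::real^3"] by simp
  qed
  then show "AE p in (lborel :: phase measure). snd p \<noteq> 0" by (simp only: lborel_prod)
  have "AE y in (lborel \<Otimes>\<^sub>M lborel :: cparam measure). fst y \<noteq> 0"
  proof (rule lborel_pair.AE_pair_measure)
    show "{x \<in> space (lborel \<Otimes>\<^sub>M lborel). fst x \<noteq> (0::real^3)} \<in> sets (lborel \<Otimes>\<^sub>M lborel)" by measurable
    have "AE x in lborel. x \<noteq> (0::real^3)" by (rule AE_lborel_singleton)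
    then show "AE x in lborel. AE y in lborel. fst (x :: real^3, y :: real \<times> real) \<noteq> 0" by eventually_elim simp
  qed
  then show "AE y in (lborel :: cparam measure). fst y \<noteq> 0" by (simp only: lborel_prod)
qed

lemma has_weak_grad_SOME:
  assumes "weakly_differentiable \<Omega> f"
  shows "has_weak_grad_x \<Omega> f (weak_grad_x \<Omega> f)" "has_weak_grad_\<zeta> \<Omega> f (weak_grad_\<zeta> \<Omega> f)"
proof -
  from assms have "\<exists>g. has_weak_grad_x \<Omega> f g" "\<exists>g. has_weak_grad_\<zeta> \<Omega> f g"
    by (auto simp: weakly_differentiable_def)
  from this[THEN someI_ex] show "has_weak_grad_x \<Omega> f (weak_grad_x \<Omega> f)" "has_weak_grad_\<zeta> \<Omega> f (weak_grad_\<zeta> \<Omega> f)"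
    by (simp_all only: weak_grad_x_def weak_grad_\<zeta>_def)
qed

text \<open>For f that is not integrable the left side is 0 by convention.\<close>

lemma ennreal_abs_integral_le: "ennreal \<bar>\<integral>x. f x \<partial>M\<bar> \<le> (\<integral>\<^sup>+x. ennreal \<bar>f x :: real\<bar> \<partial>M)"
proof (cases "integrable M f")
  case True
  from integral_norm_bound_ennreal[OF this] show ?thesis by simp
qed (simp add: not_integrable_integral_eq)

locale collision_setting =
  fixes \<Omega> :: "(real^3) set" and \<alpha> \<gamma> B0 :: real
  assumes op: "open \<Omega>" and ne: "\<Omega> \<noteq> {}" and bd: "bounded \<Omega>" and cv: "convex \<Omega>"
    and \<alpha>: "0 \<le> \<alpha>" and \<gamma>: "0 \<le> \<gamma>" "\<gamma> \<le> 1" and B0: "0 < B0"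
begin

definition U :: "phase set" where "U = \<Omega> \<times> UNIV"
definition D :: "real^3 \<Rightarrow> real" where "D x = infdist x (frontier \<Omega>) powr (-1/2)"
definition gauss :: "real^3 \<Rightarrow> real" where "gauss \<zeta> = exp (- \<alpha> * (norm \<zeta>)\<^sup>2)"

lemma open_U: "open U" unfolding U_def using op by (intro open_Times) auto
lemma convex_U: "convex U" unfolding U_def using cv by (intro convex_Times) auto
lemma U_iff: "p \<in> U \<longleftrightarrow> fst p \<in> \<Omega>" by (cases p) (simp add: U_def)

lemma frontier_nonempty: "frontier \<Omega> \<noteq> {}"
proof -
  have "\<Omega> \<noteq> UNIV" using bd not_bounded_UNIV by auto
  then show ?thesis using ne by (intro frontier_not_empty)
qed

lemma infdist_pos: "x \<in> \<Omega> \<Longrightarrow> 0 < infdist x (frontier \<Omega>)"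
  using op frontier_nonempty by (intro infdist_pos_not_in_closed) (auto simp: frontier_def interior_open)

lemma D_nonneg: "0 \<le> D x" by (simp add: D_def)

lemma measurable_D [measurable]: "D \<in> borel_measurable borel"
proof -
  have [measurable]: "(\<lambda>x. infdist x (frontier \<Omega>)) \<in> borel_measurable borel"
    by (intro borel_measurable_continuous_onI continuous_intros)
  show ?thesis unfolding D_def by measurable
qed

lemma measurable_gauss [measurable]: "gauss \<in> borel_measurable borel" unfolding gauss_def by measurable

lemma gauss_bounds: "0 \<le> gauss \<zeta>" "gauss \<zeta> \<le> 1" using \<alpha> by (auto simp: gauss_def)

lemma continuous_D: "continuous_on \<Omega> D"
  unfolding D_def using infdist_pos
  by (intro continuous_intros continuous_on_powr) (auto simp: less_imp_neq[THEN not_sym])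

text \<open>In a bounded set the distance to the boundary is bounded, so \<open>D\<close> stays away
  from 0. Terms without a derivative on h1 or h2 can then be absorbed into those that carry
  \<open>D\<close>.\<close>

lemma D_lower: "\<exists>c>0. \<forall>x\<in>\<Omega>. 1 \<le> c * D x"
proof -
  obtain z where z: "z \<in> frontier \<Omega>" using frontier_nonempty by blast
  obtain M where M: "\<And>y. y \<in> \<Omega> \<Longrightarrow> norm y \<le> M" using bd by (auto simp: bounded_iff)
  define R where "R = \<bar>M\<bar> + norm z + 1"
  have R: "R > 0" by (simp add: R_def add_nonneg_pos)
  show ?thesis
  proof (intro exI[of _ "R powr (1/2)"] conjI ballI)
    show "0 < R powr (1/2)" using R by simp
    fix x assume x: "x \<in> \<Omega>"
    have "infdist x (frontier \<Omega>) \<le> dist x z" using z by (rule infdist_le)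
    also have "\<dots> \<le> norm x + norm z" unfolding dist_norm by (rule norm_triangle_ineq4)
    also have "\<dots> \<le> R" using M[OF x] by (simp add: R_def)
    finally have "R powr (-1/2) \<le> D x"
      unfolding D_def using infdist_pos[OF x] powr_mono2'[of "-1/2" "infdist x (frontier \<Omega>)" R] by simp
    then have "R powr (1/2) * R powr (-1/2) \<le> R powr (1/2) * D x" by (intro mult_left_mono) auto
    then show "1 \<le> R powr (1/2) * D x" using R by (simp flip: powr_add)
  qed
qed

text \<open>
  For a fixed collision parameter \<open>y\<close> the gain term and the loss term of the integrand are products of shifts of the
  two functions; the shifts do not depend on \<open>\<zeta>\<close>. By conservation of energy only the square root of
  the Maxwellian at $\zeta_*$ remains as a factor. \<open>coll_half_deriv\<close> is the product rule in the direction \<open>e\<close>.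
\<close>

definition coll_half :: "(phase \<Rightarrow> real) \<Rightarrow> (phase \<Rightarrow> real) \<Rightarrow> (cparam \<Rightarrow> real^3) \<Rightarrow> (cparam \<Rightarrow> real^3) \<Rightarrow> phase \<Rightarrow> cparam \<Rightarrow> real" where
  "coll_half k1 k2 S1 S2 p y = kern B0 \<gamma> y * ((mroot (snd p + fst y) * k1 (fst p, snd p + S1 y)) * k2 (fst p, snd p + S2 y))"

definition coll_half_deriv :: "phase \<Rightarrow> (phase \<Rightarrow> real) \<Rightarrow> (phase \<Rightarrow> real) \<Rightarrow> (phase \<Rightarrow> real) \<Rightarrow> (phase \<Rightarrow> real) \<Rightarrow>
    (cparam \<Rightarrow> real^3) \<Rightarrow> (cparam \<Rightarrow> real^3) \<Rightarrow> phase \<Rightarrow> cparam \<Rightarrow> real" where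
  "coll_half_deriv e k1 l1 k2 l2 S1 S2 p y = kern B0 \<gamma> y *
     ((dmroot (snd e) (snd p + fst y) * k1 (fst p, snd p + S1 y) + mroot (snd p + fst y) * l1 (fst p, snd p + S1 y)) * k2 (fst p, snd p + S2 y)
      + (mroot (snd p + fst y) * k1 (fst p, snd p + S1 y)) * l2 (fst p, snd p + S2 y))"

text \<open>The bound is required at every point and not only almost everywhere, so that it may be
  used at shifted velocities.\<close>

definition dominated :: "real \<Rightarrow> (phase \<Rightarrow> real) \<Rightarrow> bool" where
  "dominated A k \<longleftrightarrow> k \<in> borel_measurable borel \<and> (\<forall>p. \<bar>k p\<bar> \<le> A * gauss (snd p))"

text \<open>The shape of a gradient of finite norm after the inverse weight has been replaced by its
  estimate through the distance to the boundary. The position and the pole in the velocity are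
  separated here, so the pole can be integrated over the collision parameters.\<close>

definition grad_dominated :: "real \<Rightarrow> (phase \<Rightarrow> real) \<Rightarrow> bool" where
  "grad_dominated W l \<longleftrightarrow> l \<in> borel_measurable borel \<and>
     (\<forall>p. \<bar>l p\<bar> \<le> W * D (fst p) * (1 + inverse (norm (snd p))) * gauss (snd p))"

text \<open>The part of conservation of energy that gain and loss share. For \<open>shift1\<close>,
  \<open>shift2\<close> the partner energy is dropped from the identity; for the pair of
  \<open>\<lambda>_. 0\<close> and \<open>fst\<close> it is trivial. One set of lemmas thus treats
  both halves of the integrand.\<close>

definition energy_shifts :: "(cparam \<Rightarrow> real^3) \<Rightarrow> (cparam \<Rightarrow> real^3) \<Rightarrow> cparam \<Rightarrow> bool" where
  "energy_shifts S1 S2 y \<longleftrightarrow> (\<forall>\<zeta>. (norm \<zeta>)\<^sup>2 \<le> (norm (\<zeta> + S1 y))\<^sup>2 + (norm (\<zeta> + S2 y))\<^sup>2)"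

lemma gauss_shifts: "energy_shifts S1 S2 y \<Longrightarrow> gauss (\<zeta> + S1 y) * gauss (\<zeta> + S2 y) \<le> gauss \<zeta>"
  using \<alpha> mult_left_mono[of "(norm \<zeta>)\<^sup>2" "(norm (\<zeta> + S1 y))\<^sup>2 + (norm (\<zeta> + S2 y))\<^sup>2" \<alpha>]
  by (simp add: gauss_def energy_shifts_def distrib_left flip: exp_add)

section \<open>Pointwise bounds for gain and loss\<close>

lemma coll_half_bound:
  assumes k: "dominated A1 k1" "dominated A2 k2" and A: "0 \<le> A1" "0 \<le> A2" and en: "energy_shifts S1 S2 y"
  shows "\<bar>coll_half k1 k2 S1 S2 (x, \<zeta>) y\<bar> \<le> A1 * A2 * gauss \<zeta> * (kern B0 \<gamma> y * dec (\<zeta> + fst y))"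
proof -
  have kn: "0 \<le> kern B0 \<gamma> y" using B0 by (intro kern_nonneg) simp
  have "\<bar>k1 (x, \<zeta> + S1 y) * k2 (x, \<zeta> + S2 y)\<bar> \<le> (A1 * gauss (\<zeta> + S1 y)) * (A2 * gauss (\<zeta> + S2 y))"
    unfolding abs_mult using k A gauss_bounds by (intro mult_mono) (auto simp: dominated_def dest: spec[of _ "(x, _)"])
  also have "\<dots> = A1 * A2 * (gauss (\<zeta> + S1 y) * gauss (\<zeta> + S2 y))" by simp
  also have "\<dots> \<le> A1 * A2 * gauss \<zeta>" using A gauss_shifts[OF en] by (intro mult_left_mono) auto
  finally have kk: "\<bar>k1 (x, \<zeta> + S1 y) * k2 (x, \<zeta> + S2 y)\<bar> \<le> A1 * A2 * gauss \<zeta>" .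
  have "\<bar>coll_half k1 k2 S1 S2 (x, \<zeta>) y\<bar> = kern B0 \<gamma> y * (mroot (\<zeta> + fst y) * \<bar>k1 (x, \<zeta> + S1 y) * k2 (x, \<zeta> + S2 y)\<bar>)"
    using kn mroot_pos[of "\<zeta> + fst y"] by (simp add: coll_half_def abs_mult)
  also have "\<dots> \<le> kern B0 \<gamma> y * (dec (\<zeta> + fst y) * (A1 * A2 * gauss \<zeta>))"
    using kn kk mroot_le_dec dec_nonneg by (intro mult_left_mono mult_mono) auto
  finally show ?thesis by (simp add: ac_simps)
qed

text \<open>The product rule gives three terms. Those with a derivative on k1 or k2 carry
  \<open>D x\<close> once; the one with the derivative on the root of the Maxwellian does not and is
  raised to the same level by \<open>1 \<le> c * D x\<close>. This explains the factor c +
  2.\<close>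

lemma coll_half_deriv_bound:
  assumes k: "dominated A1 k1" "dominated A2 k2" and l: "grad_dominated W1 l1" "grad_dominated W2 l2"
    and A: "0 \<le> A1" "0 \<le> A2" "A1 \<le> W1" "A2 \<le> W2" and e: "norm (snd e) \<le> 1"
    and en: "energy_shifts S1 S2 y" and c: "1 \<le> c * D x"
  shows "\<bar>coll_half_deriv e k1 l1 k2 l2 S1 S2 (x, \<zeta>) y\<bar> \<le> (c + 2) * W1 * W2 * D x * gauss \<zeta> *
    (kern B0 \<gamma> y * dec (\<zeta> + fst y) * (1 + inverse (norm (\<zeta> + S1 y)) + inverse (norm (\<zeta> + S2 y))))"
proof -
  let ?z1 = "\<zeta> + S1 y" and ?z2 = "\<zeta> + S2 y"
  define i1 where "i1 = inverse (norm ?z1)"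
  define i2 where "i2 = inverse (norm ?z2)"
  have i: "0 \<le> i1" "0 \<le> i2" by (auto simp: i1_def i2_def)
  have kn: "0 \<le> kern B0 \<gamma> y" using B0 by (intro kern_nonneg) simp
  have W: "0 \<le> W1" "0 \<le> W2" using A by auto
  note Dn = D_nonneg[of x] and e0 = gauss_bounds(1)
  have ka: "\<bar>k1 (x, ?z1)\<bar> \<le> A1 * gauss ?z1" "\<bar>k2 (x, ?z2)\<bar> \<le> A2 * gauss ?z2"
    using k by (auto simp: dominated_def dest: spec[of _ "(x, _)"])
  have la: "\<bar>l1 (x, ?z1)\<bar> \<le> W1 * D x * (1 + i1) * gauss ?z1" "\<bar>l2 (x, ?z2)\<bar> \<le> W2 * D x * (1 + i2) * gauss ?z2"
    using l unfolding grad_dominated_def i1_def i2_def by (metis fst_conv snd_conv)+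
  have ka': "\<bar>k1 (x, ?z1)\<bar> \<le> W1 * gauss ?z1" "\<bar>k2 (x, ?z2)\<bar> \<le> W2 * gauss ?z2"
    using ka A e0 by (meson mult_right_mono order_trans)+
  let ?E = "gauss ?z1 * gauss ?z2"
  have E: "0 \<le> ?E" "?E \<le> gauss \<zeta>" using e0 gauss_shifts[OF en, of \<zeta>] by auto
  have t1: "\<bar>dmroot (snd e) (\<zeta> + fst y)\<bar> * (\<bar>k1 (x, ?z1)\<bar> * \<bar>k2 (x, ?z2)\<bar>) \<le> dec (\<zeta> + fst y) * (W1 * W2 * ?E)"
  proof (rule mult_mono[OF dmroot_le_dec[OF e] _ dec_nonneg])
    have "\<bar>k1 (x, ?z1)\<bar> * \<bar>k2 (x, ?z2)\<bar> \<le> (W1 * gauss ?z1) * (W2 * gauss ?z2)"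
      using ka' W e0 by (intro mult_mono) auto
    then show "\<bar>k1 (x, ?z1)\<bar> * \<bar>k2 (x, ?z2)\<bar> \<le> W1 * W2 * ?E" by (simp add: ac_simps)
  qed auto
  have t2: "mroot (\<zeta> + fst y) * (\<bar>l1 (x, ?z1)\<bar> * \<bar>k2 (x, ?z2)\<bar>) \<le> dec (\<zeta> + fst y) * (W1 * W2 * D x * (1 + i1) * ?E)"
  proof (rule mult_mono[OF mroot_le_dec _ dec_nonneg])
    have "\<bar>l1 (x, ?z1)\<bar> * \<bar>k2 (x, ?z2)\<bar> \<le> (W1 * D x * (1 + i1) * gauss ?z1) * (W2 * gauss ?z2)"
      using la ka' W e0 Dn i by (intro mult_mono) auto
    then show "\<bar>l1 (x, ?z1)\<bar> * \<bar>k2 (x, ?z2)\<bar> \<le> W1 * W2 * D x * (1 + i1) * ?E" by (simp add: ac_simps)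
  qed auto
  have t3: "mroot (\<zeta> + fst y) * (\<bar>k1 (x, ?z1)\<bar> * \<bar>l2 (x, ?z2)\<bar>) \<le> dec (\<zeta> + fst y) * (W1 * W2 * D x * (1 + i2) * ?E)"
  proof (rule mult_mono[OF mroot_le_dec _ dec_nonneg])
    have "\<bar>k1 (x, ?z1)\<bar> * \<bar>l2 (x, ?z2)\<bar> \<le> (W1 * gauss ?z1) * (W2 * D x * (1 + i2) * gauss ?z2)"
      using la ka' W e0 Dn i by (intro mult_mono) auto
    then show "\<bar>k1 (x, ?z1)\<bar> * \<bar>l2 (x, ?z2)\<bar> \<le> W1 * W2 * D x * (1 + i2) * ?E" by (simp add: ac_simps)
  qed auto
  have "\<bar>(dmroot (snd e) (\<zeta> + fst y) * k1 (x, ?z1) + mroot (\<zeta> + fst y) * l1 (x, ?z1)) * k2 (x, ?z2)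
      + (mroot (\<zeta> + fst y) * k1 (x, ?z1)) * l2 (x, ?z2)\<bar>
    \<le> \<bar>dmroot (snd e) (\<zeta> + fst y)\<bar> * (\<bar>k1 (x, ?z1)\<bar> * \<bar>k2 (x, ?z2)\<bar>) + mroot (\<zeta> + fst y) * (\<bar>l1 (x, ?z1)\<bar> * \<bar>k2 (x, ?z2)\<bar>)
      + mroot (\<zeta> + fst y) * (\<bar>k1 (x, ?z1)\<bar> * \<bar>l2 (x, ?z2)\<bar>)"
  proof -
    have "\<bar>(a * b + m * c) * d + (m * b) * f\<bar> \<le> \<bar>a\<bar> * (\<bar>b\<bar> * \<bar>d\<bar>) + m * (\<bar>c\<bar> * \<bar>d\<bar>) + m * (\<bar>b\<bar> * \<bar>f\<bar>)" if "0 \<le> m" for a b c d f m :: real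
    proof -
      have "(a * b + m * c) * d + (m * b) * f = a * (b * d) + m * (c * d) + m * (b * f)" by (simp add: algebra_simps)
      also have "\<bar>\<dots>\<bar> \<le> \<bar>a * (b * d)\<bar> + \<bar>m * (c * d)\<bar> + \<bar>m * (b * f)\<bar>" by linarith
      finally show ?thesis using that by (simp add: abs_mult)
    qed
    then show ?thesis using mroot_pos[of "\<zeta> + fst y"] by (simp add: less_imp_le)
  qed
  also have "\<dots> \<le> dec (\<zeta> + fst y) * (W1 * W2 * ?E) + dec (\<zeta> + fst y) * (W1 * W2 * D x * (1 + i1) * ?E) + dec (\<zeta> + fst y) * (W1 * W2 * D x * (1 + i2) * ?E)"
    by (intro add_mono t1 t2 t3)
  also have "\<dots> = dec (\<zeta> + fst y) * (W1 * W2) * ?E * (1 + D x * (1 + i1) + D x * (1 + i2))" by (simp add: algebra_simps)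
  also have "\<dots> \<le> dec (\<zeta> + fst y) * (W1 * W2) * gauss \<zeta> * ((c + 2) * D x * (1 + i1 + i2))"
  proof (intro mult_mono)
    have c0: "0 \<le> c * D x" using c by linarith
    have "c * D x * 1 \<le> c * D x * (1 + i1 + i2)" using c0 i by (intro mult_left_mono) auto
    moreover have "D x * (1 + i1) \<le> D x * (1 + i1 + i2)" "D x * (1 + i2) \<le> D x * (1 + i1 + i2)"
      using Dn i by (auto intro!: mult_left_mono)
    ultimately have "1 + D x * (1 + i1) + D x * (1 + i2) \<le> c * D x * (1 + i1 + i2) + D x * (1 + i1 + i2) + D x * (1 + i1 + i2)"
      using c by linarith
    then show "1 + D x * (1 + i1) + D x * (1 + i2) \<le> (c + 2) * D x * (1 + i1 + i2)" by (simp add: algebra_simps)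
  qed (use W E dec_nonneg e0 Dn i in auto)
  finally have main: "\<bar>(dmroot (snd e) (\<zeta> + fst y) * k1 (x, ?z1) + mroot (\<zeta> + fst y) * l1 (x, ?z1)) * k2 (x, ?z2)
      + (mroot (\<zeta> + fst y) * k1 (x, ?z1)) * l2 (x, ?z2)\<bar> \<le> dec (\<zeta> + fst y) * (W1 * W2) * gauss \<zeta> * ((c + 2) * D x * (1 + i1 + i2))" .
  have "\<bar>coll_half_deriv e k1 l1 k2 l2 S1 S2 (x, \<zeta>) y\<bar> = kern B0 \<gamma> y * \<bar>(dmroot (snd e) (\<zeta> + fst y) * k1 (x, ?z1) + mroot (\<zeta> + fst y) * l1 (x, ?z1)) * k2 (x, ?z2)
      + (mroot (\<zeta> + fst y) * k1 (x, ?z1)) * l2 (x, ?z2)\<bar>"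
    using kn by (simp add: coll_half_deriv_def abs_mult)
  also have "\<dots> \<le> kern B0 \<gamma> y * (dec (\<zeta> + fst y) * (W1 * W2) * gauss \<zeta> * ((c + 2) * D x * (1 + i1 + i2)))"
    by (rule mult_left_mono[OF main kn])
  finally show ?thesis by (simp add: i1_def i2_def ac_simps)
qed

lemma measurable_coll_half [measurable]:
  assumes [measurable]: "k1 \<in> borel_measurable borel" "k2 \<in> borel_measurable borel"
    "S1 \<in> borel_measurable borel" "S2 \<in> borel_measurable borel"
  shows "(\<lambda>(p, y). coll_half k1 k2 S1 S2 p y) \<in> borel_measurable (borel \<Otimes>\<^sub>M borel)"
  unfolding coll_half_def case_prod_beta by measurable

lemma measurable_dmroot [measurable]: "dmroot v \<in> borel_measurable borel"
  by (intro borel_measurable_continuous_onI continuous_dmroot)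

lemma measurable_coll_half_deriv [measurable]:
  assumes [measurable]: "k1 \<in> borel_measurable borel" "k2 \<in> borel_measurable borel"
    "l1 \<in> borel_measurable borel" "l2 \<in> borel_measurable borel"
    "S1 \<in> borel_measurable borel" "S2 \<in> borel_measurable borel"
  shows "(\<lambda>(p, y). coll_half_deriv e k1 l1 k2 l2 S1 S2 p y) \<in> borel_measurable (borel \<Otimes>\<^sub>M borel)"
  unfolding coll_half_deriv_def case_prod_beta by measurable

section \<open>Integrability and weak derivatives of gain and loss\<close>

lemma integral_dominated_inv_pow_finite:
  fixes f :: "phase \<Rightarrow> ennreal"
  assumes K: "compact K" and M: "M < \<infinity>"
    and f: "\<And>p. p \<in> K \<Longrightarrow> f p \<le> M * ((1 + inv_pow 1 (norm (snd p + s1))) + (1 + inv_pow 1 (norm (snd p + s2))))"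
  shows "(\<integral>\<^sup>+p. f p * indicator K p \<partial>lborel) < \<infinity>"
proof -
  have [measurable]: "K \<in> sets borel" using K by (simp add: borel_compact)
  have "(\<integral>\<^sup>+p. f p * indicator K p \<partial>lborel) \<le> (\<integral>\<^sup>+p. M * ((1 + inv_pow 1 (norm (snd p + s1))) * indicator K p + (1 + inv_pow 1 (norm (snd p + s2))) * indicator K p) \<partial>lborel)"
  proof (intro nn_integral_mono)
    fix p show "f p * indicator K p \<le> M * ((1 + inv_pow 1 (norm (snd p + s1))) * indicator K p + (1 + inv_pow 1 (norm (snd p + s2))) * indicator K p)"
      using f[of p] by (cases "p \<in> K") auto
  qed
  also have "\<dots> = M * ((\<integral>\<^sup>+p. (1 + inv_pow 1 (norm (snd p + s1))) * indicator K p \<partial>lborel) + (\<integral>\<^sup>+p. (1 + inv_pow 1 (norm (snd p + s2))) * indicator K p \<partial>lborel))"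
    by (subst nn_integral_cmult, measurable, subst nn_integral_add) measurable
  also have "\<dots> < \<infinity>" using M compact_integral_inv_pow[OF K] by (simp add: ennreal_mult_less_top)
  finally show ?thesis .
qed

text \<open>\<open>D\<close> blows up at the boundary of the domain, but compact subsets of U stay
  away from it.\<close>

lemma D_bounded_on_compact:
  assumes "compact K" "K \<subseteq> U"
  obtains M where "0 \<le> M" "\<And>p. p \<in> K \<Longrightarrow> D (fst p) \<le> M" "\<And>p. p \<in> K \<Longrightarrow> (1 + norm (snd p)) powr \<gamma> \<le> M"
proof -
  have "continuous_on K (\<lambda>p. D (fst p))"
    using assms(2) by (intro continuous_on_compose2[OF continuous_D] continuous_intros) (auto simp: U_iff)
  then have "bounded ((\<lambda>p. D (fst p)) ` K)" using assms by (intro compact_imp_bounded compact_continuous_image)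
  then obtain M1 where "\<forall>d\<in>(\<lambda>p. D (fst p)) ` K. norm d \<le> M1" unfolding bounded_iff by blast
  then have M1: "\<And>p. p \<in> K \<Longrightarrow> D (fst p) \<le> M1" by force
  have "continuous_on K (\<lambda>p. (1 + norm (snd p)) powr \<gamma>)"
    by (intro continuous_intros continuous_on_powr) (auto simp: add_nonneg_eq_0_iff)
  then have "bounded ((\<lambda>p. (1 + norm (snd p)) powr \<gamma>) ` K)" using assms by (intro compact_imp_bounded compact_continuous_image)
  then obtain M2 where "\<forall>d\<in>(\<lambda>p. (1 + norm (snd p)) powr \<gamma>) ` K. norm d \<le> M2" unfolding bounded_iff by blast
  then have M2: "\<And>p. p \<in> K \<Longrightarrow> (1 + norm (snd p)) powr \<gamma> \<le> M2" by force
  show thesis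
  proof (rule that[of "\<bar>M1\<bar> + \<bar>M2\<bar>"])
    show "D (fst p) \<le> \<bar>M1\<bar> + \<bar>M2\<bar>" if "p \<in> K" for p using M1[OF that] by linarith
    show "(1 + norm (snd p)) powr \<gamma> \<le> \<bar>M1\<bar> + \<bar>M2\<bar>" if "p \<in> K" for p using M2[OF that] by linarith
  qed simp
qed

text \<open>The product rule along lines is used twice, for the root of the Maxwellian times the
  first function and then times the second. The shifts act on the velocity only, and U contains all
  velocities, so U is mapped into itself.\<close>

lemma line_deriv_coll_half:
  assumes k: "dominated A1 k1" "dominated A2 k2" and l: "grad_dominated W1 l1" "grad_dominated W2 l2"
    and w: "weak_deriv_borel k1 l1 e U" "weak_deriv_borel k2 l2 e U"
  shows "line_deriv (\<lambda>p. coll_half k1 k2 S1 S2 p y) (\<lambda>p. coll_half_deriv e k1 l1 k2 l2 S1 S2 p y) e U"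
proof -
  have [measurable]: "k1 \<in> borel_measurable borel" "k2 \<in> borel_measurable borel"
    "l1 \<in> borel_measurable borel" "l2 \<in> borel_measurable borel"
    using k l by (auto simp: dominated_def grad_dominated_def)
  have sh: "line_deriv (\<lambda>p. k (fst p, snd p + s)) (\<lambda>p. l (fst p, snd p + s)) e U" if "weak_deriv_borel k l e U" for k l s
  proof -
    have "p + (0, s) \<in> U" if "p \<in> U" for p using that by (simp add: U_iff)
    from line_deriv_translate[OF weak_deriv_imp_line_deriv[OF open_U convex_U that(1)] this]
    have "line_deriv (\<lambda>p. k (p + (0, s))) (\<lambda>p. l (p + (0, s))) e U" .
    moreover have "p + (0, s) = (fst p, snd p + s)" for p :: phase by (simp add: prod_eq_iff)
    ultimately show ?thesis by simp
  qed
  have m: "line_deriv (\<lambda>p. mroot (snd p + fst y)) (\<lambda>p. dmroot (snd e) (snd p + fst y)) e U"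
  proof (rule line_deriv_classical)
    fix p :: phase
    have "((\<lambda>p. snd p + fst y) has_derivative snd) (at p)"
      by (auto intro!: derivative_eq_intros)
    from has_derivative_compose[OF this mroot_has_derivative]
    show "((\<lambda>p. mroot (snd p + fst y)) has_derivative (\<lambda>h. dmroot (snd h) (snd p + fst y))) (at p)" .
  next
    show "continuous_on UNIV (\<lambda>p. dmroot (snd e) (snd p + fst y))"
      by (rule continuous_on_compose2[OF continuous_dmroot]) (auto intro!: continuous_intros)
  qed simp
  have 1: "line_deriv (\<lambda>p. mroot (snd p + fst y) * k1 (fst p, snd p + S1 y))
      (\<lambda>p. dmroot (snd e) (snd p + fst y) * k1 (fst p, snd p + S1 y) + mroot (snd p + fst y) * l1 (fst p, snd p + S1 y)) e U"
    by (rule line_deriv_mult[OF _ _ _ _ open_U convex_U m sh[OF w(1)]]) measurable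
  have 2: "line_deriv (\<lambda>p. (mroot (snd p + fst y) * k1 (fst p, snd p + S1 y)) * k2 (fst p, snd p + S2 y))
      (\<lambda>p. (dmroot (snd e) (snd p + fst y) * k1 (fst p, snd p + S1 y) + mroot (snd p + fst y) * l1 (fst p, snd p + S1 y)) * k2 (fst p, snd p + S2 y)
        + (mroot (snd p + fst y) * k1 (fst p, snd p + S1 y)) * l2 (fst p, snd p + S2 y)) e U"
    by (rule line_deriv_mult[OF _ _ _ _ open_U convex_U 1 sh[OF w(2)]]) measurable
  show ?thesis unfolding coll_half_def coll_half_deriv_def by (rule line_deriv_cmult[OF 2])
qed

lemma nn_integral_coll_half:
  assumes k: "dominated A1 k1" "dominated A2 k2" and A: "0 \<le> A1" "0 \<le> A2"
    and en: "AE y in lborel. energy_shifts S1 S2 y"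
    and I: "(\<integral>\<^sup>+y. ennreal (kern B0 \<gamma> y) * decay (\<zeta> + fst y) \<partial>lborel) \<le> R"
  shows "(\<integral>\<^sup>+y. ennreal \<bar>coll_half k1 k2 S1 S2 (x, \<zeta>) y\<bar> \<partial>lborel) \<le> ennreal (A1 * A2 * gauss \<zeta>) * R"
proof -
  have kn: "0 \<le> kern B0 \<gamma> y" for y using B0 by (intro kern_nonneg) simp
  have "(\<integral>\<^sup>+y. ennreal \<bar>coll_half k1 k2 S1 S2 (x, \<zeta>) y\<bar> \<partial>lborel) \<le> (\<integral>\<^sup>+y. ennreal (A1 * A2 * gauss \<zeta>) * (ennreal (kern B0 \<gamma> y) * decay (\<zeta> + fst y)) \<partial>lborel)"
  proof (rule nn_integral_mono_AE)
    show "AE y in lborel. ennreal \<bar>coll_half k1 k2 S1 S2 (x, \<zeta>) y\<bar> \<le> ennreal (A1 * A2 * gauss \<zeta>) * (ennreal (kern B0 \<gamma> y) * decay (\<zeta> + fst y))"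
      using en
    proof eventually_elim
      case (elim y)
      from coll_half_bound[OF k A elim, of x \<zeta>]
      have "ennreal \<bar>coll_half k1 k2 S1 S2 (x, \<zeta>) y\<bar> \<le> ennreal (A1 * A2 * gauss \<zeta> * (kern B0 \<gamma> y * dec (\<zeta> + fst y)))" by (rule ennreal_leI)
      also have "\<dots> = ennreal (A1 * A2 * gauss \<zeta>) * (ennreal (kern B0 \<gamma> y) * decay (\<zeta> + fst y))"
        using A gauss_bounds kn dec_nonneg by (simp add: ennreal_mult decay_dec)
      finally show ?case .
    qed
  qed
  also have "\<dots> = ennreal (A1 * A2 * gauss \<zeta>) * (\<integral>\<^sup>+y. ennreal (kern B0 \<gamma> y) * decay (\<zeta> + fst y) \<partial>lborel)"
    by (rule nn_integral_cmult) measurable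
  also have "\<dots> \<le> ennreal (A1 * A2 * gauss \<zeta>) * R" by (intro mult_left_mono I) auto
  finally show ?thesis .
qed

lemma nn_integral_coll_half_deriv:
  assumes k: "dominated A1 k1" "dominated A2 k2" and l: "grad_dominated W1 l1" "grad_dominated W2 l2"
    and A: "0 \<le> A1" "0 \<le> A2" "A1 \<le> W1" "A2 \<le> W2" and e: "norm (snd e) \<le> 1"
    and [measurable]: "S1 \<in> borel_measurable borel" "S2 \<in> borel_measurable borel"
    and en: "AE y in lborel. energy_shifts S1 S2 y" and c: "0 < c" "1 \<le> c * D x"
    and I: "(\<integral>\<^sup>+y. ennreal (kern B0 \<gamma> y) * decay (\<zeta> + fst y) * (1 + inv_pow 1 (norm (\<zeta> + S1 y)) + inv_pow 1 (norm (\<zeta> + S2 y))) \<partial>lborel) \<le> R"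
  shows "(\<integral>\<^sup>+y. ennreal \<bar>coll_half_deriv e k1 l1 k2 l2 S1 S2 (x, \<zeta>) y\<bar> \<partial>lborel) \<le> ennreal ((c + 2) * W1 * W2 * D x * gauss \<zeta>) * R"
proof -
  have kn: "0 \<le> kern B0 \<gamma> y" for y using B0 by (intro kern_nonneg) simp
  let ?C = "(c + 2) * W1 * W2 * D x * gauss \<zeta>"
  have C: "0 \<le> ?C" using A c D_nonneg gauss_bounds by (intro mult_nonneg_nonneg) auto
  have "(\<integral>\<^sup>+y. ennreal \<bar>coll_half_deriv e k1 l1 k2 l2 S1 S2 (x, \<zeta>) y\<bar> \<partial>lborel)
     \<le> (\<integral>\<^sup>+y. ennreal ?C * (ennreal (kern B0 \<gamma> y) * decay (\<zeta> + fst y) * (1 + inv_pow 1 (norm (\<zeta> + S1 y)) + inv_pow 1 (norm (\<zeta> + S2 y)))) \<partial>lborel)"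
  proof (rule nn_integral_mono_AE)
    show "AE y in lborel. ennreal \<bar>coll_half_deriv e k1 l1 k2 l2 S1 S2 (x, \<zeta>) y\<bar>
       \<le> ennreal ?C * (ennreal (kern B0 \<gamma> y) * decay (\<zeta> + fst y) * (1 + inv_pow 1 (norm (\<zeta> + S1 y)) + inv_pow 1 (norm (\<zeta> + S2 y))))"
      using en
    proof eventually_elim
      case (elim y)
      let ?s = "1 + inverse (norm (\<zeta> + S1 y)) + inverse (norm (\<zeta> + S2 y))"
      from coll_half_deriv_bound[OF k l A e elim c(2), of \<zeta>]
      have "ennreal \<bar>coll_half_deriv e k1 l1 k2 l2 S1 S2 (x, \<zeta>) y\<bar> \<le> ennreal (?C * (kern B0 \<gamma> y * dec (\<zeta> + fst y) * ?s))"
        by (rule ennreal_leI)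
      also have "\<dots> = ennreal ?C * (ennreal (kern B0 \<gamma> y) * decay (\<zeta> + fst y) * ennreal ?s)"
        using C kn dec_nonneg by (subst ennreal_mult, simp, simp add: add_nonneg_nonneg, subst ennreal_mult, simp, simp add: add_nonneg_nonneg,
            subst ennreal_mult) (auto simp: decay_dec)
      also have "\<dots> \<le> ennreal ?C * (ennreal (kern B0 \<gamma> y) * decay (\<zeta> + fst y) * (1 + inv_pow 1 (norm (\<zeta> + S1 y)) + inv_pow 1 (norm (\<zeta> + S2 y))))"
      proof (intro mult_left_mono)
        show "ennreal ?s \<le> 1 + inv_pow 1 (norm (\<zeta> + S1 y)) + inv_pow 1 (norm (\<zeta> + S2 y))"
          using ennreal_inverse_le_inv_pow[of "norm (\<zeta> + S1 y)"] ennreal_inverse_le_inv_pow[of "norm (\<zeta> + S2 y)"]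
          by (simp add: add_mono)
      qed auto
      finally show ?case .
    qed
  qed
  also have "\<dots> = ennreal ?C * (\<integral>\<^sup>+y. ennreal (kern B0 \<gamma> y) * decay (\<zeta> + fst y) * (1 + inv_pow 1 (norm (\<zeta> + S1 y)) + inv_pow 1 (norm (\<zeta> + S2 y))) \<partial>lborel)"
    by (rule nn_integral_cmult) measurable
  also have "\<dots> \<le> ennreal ?C * R" by (intro mult_left_mono I) auto
  finally show ?thesis .
qed

text \<open>For a fixed collision parameter the poles in the velocity are at \<open>- S1 y\<close>
  and \<open>- S2 y\<close>. They are integrable in three dimensions, and \<open>D\<close> is
  bounded on compact subsets of U.\<close>

lemma locally_integrable_coll_half_coll_half_deriv:
  assumes k: "dominated A1 k1" "dominated A2 k2" and l: "grad_dominated W1 l1" "grad_dominated W2 l2"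
    and A: "0 \<le> A1" "0 \<le> A2" "A1 \<le> W1" "A2 \<le> W2" and e: "norm (snd e) \<le> 1"
    and en: "energy_shifts S1 S2 y"
  shows "locally_integrable_borel (\<lambda>p. coll_half k1 k2 S1 S2 p y) U" "locally_integrable_borel (\<lambda>p. coll_half_deriv e k1 l1 k2 l2 S1 S2 p y) U"
proof -
  have [measurable]: "k1 \<in> borel_measurable borel" "k2 \<in> borel_measurable borel"
    "l1 \<in> borel_measurable borel" "l2 \<in> borel_measurable borel"
    using k l by (auto simp: dominated_def grad_dominated_def)
  have mu[measurable]: "(\<lambda>p. coll_half k1 k2 S1 S2 p y) \<in> borel_measurable borel"
    unfolding coll_half_def by measurable
  have mv[measurable]: "(\<lambda>p. coll_half_deriv e k1 l1 k2 l2 S1 S2 p y) \<in> borel_measurable borel"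
    unfolding coll_half_deriv_def by measurable
  obtain c where c: "c > 0" "\<And>x. x \<in> \<Omega> \<Longrightarrow> 1 \<le> c * D x" using D_lower by blast
  have kn: "0 \<le> kern B0 \<gamma> y" using B0 by (intro kern_nonneg) simp
  have int: "set_integrable lborel K f" if K: "compact K" and f[measurable]: "f \<in> borel_measurable borel"
    and M: "0 \<le> M" "\<And>p. p \<in> K \<Longrightarrow> \<bar>f p\<bar> \<le> M * (1 + inverse (norm (snd p + S1 y)) + inverse (norm (snd p + S2 y)))" for K :: "phase set" and f M
    unfolding set_integrable_def
  proof (rule integrableI_bounded)
    have [measurable]: "K \<in> sets borel" using K by (simp add: borel_compact)
    show "(\<lambda>x. indicator K x *\<^sub>R f x) \<in> borel_measurable lborel" by measurable
    have "(\<integral>\<^sup>+p. ennreal (norm (indicator K p *\<^sub>R f p)) \<partial>lborel) = (\<integral>\<^sup>+p. ennreal \<bar>f p\<bar> * indicator K p \<partial>lborel)"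
      by (intro nn_integral_cong) (auto simp: indicator_def)
    also have "\<dots> < \<infinity>"
    proof (rule integral_dominated_inv_pow_finite[OF K, of "ennreal M" _ "S1 y" "S2 y"])
      fix p assume "p \<in> K"
      from M(2)[OF this] have "ennreal \<bar>f p\<bar> \<le> ennreal (M * (1 + inverse (norm (snd p + S1 y)) + inverse (norm (snd p + S2 y))))" by (rule ennreal_leI)
      also have "\<dots> = ennreal M * (1 + ennreal (inverse (norm (snd p + S1 y))) + ennreal (inverse (norm (snd p + S2 y))))"
        using M(1) by (subst ennreal_mult) (auto intro: add_nonneg_nonneg)
      also have "\<dots> \<le> ennreal M * ((1 + inv_pow 1 (norm (snd p + S1 y))) + (1 + inv_pow 1 (norm (snd p + S2 y))))"
        using ennreal_inverse_le_inv_pow[of "norm (snd p + S1 y)"] ennreal_inverse_le_inv_pow[of "norm (snd p + S2 y)"]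
        by (intro mult_left_mono add_mono) (auto simp: add_increasing)
      finally show "ennreal \<bar>f p\<bar> \<le> ennreal M * ((1 + inv_pow 1 (norm (snd p + S1 y))) + (1 + inv_pow 1 (norm (snd p + S2 y))))" .
    qed simp
    finally show "(\<integral>\<^sup>+p. ennreal (norm (indicator K p *\<^sub>R f p)) \<partial>lborel) < \<infinity>" .
  qed
  have dec1: "dec \<eta> \<le> 1" for \<eta> by (simp add: dec_def)
  have "set_integrable lborel K (\<lambda>p. coll_half k1 k2 S1 S2 p y)" if K: "compact K" "K \<subseteq> U" for K
  proof (rule int[OF K(1) mu, of "A1 * A2 * kern B0 \<gamma> y"])
    fix p assume "p \<in> K"
    have "\<bar>coll_half k1 k2 S1 S2 p y\<bar> \<le> A1 * A2 * gauss (snd p) * (kern B0 \<gamma> y * dec (snd p + fst y))"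
      using coll_half_bound[OF k A(1,2) en, of "fst p" "snd p"] by simp
    also have "\<dots> \<le> A1 * A2 * 1 * (kern B0 \<gamma> y * 1)"
      using A kn gauss_bounds dec1 dec_nonneg by (intro mult_mono) auto
    also have "\<dots> = A1 * A2 * kern B0 \<gamma> y * 1" by simp
    also have "\<dots> \<le> A1 * A2 * kern B0 \<gamma> y * (1 + inverse (norm (snd p + S1 y)) + inverse (norm (snd p + S2 y)))"
      using A kn by (intro mult_left_mono) auto
    finally show "\<bar>coll_half k1 k2 S1 S2 p y\<bar> \<le> \<dots>" .
  qed (use A kn in auto)
  then show "locally_integrable_borel (\<lambda>p. coll_half k1 k2 S1 S2 p y) U" by (auto simp: locally_integrable_borel_def)
  have "set_integrable lborel K (\<lambda>p. coll_half_deriv e k1 l1 k2 l2 S1 S2 p y)" if K: "compact K" "K \<subseteq> U" for K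
  proof -
    obtain M where M: "0 \<le> M" "\<And>p. p \<in> K \<Longrightarrow> D (fst p) \<le> M" using D_bounded_on_compact[OF K] by metis
    show ?thesis
    proof (rule int[OF K(1) mv, of "(c + 2) * W1 * W2 * M * kern B0 \<gamma> y"])
      fix p assume p: "p \<in> K"
      then have "fst p \<in> \<Omega>" using K by (auto simp: U_iff)
      let ?s = "1 + inverse (norm (snd p + S1 y)) + inverse (norm (snd p + S2 y))"
      have s: "0 \<le> ?s" by (intro add_nonneg_nonneg) auto
      have "\<bar>coll_half_deriv e k1 l1 k2 l2 S1 S2 p y\<bar> \<le> (c + 2) * W1 * W2 * D (fst p) * gauss (snd p) * (kern B0 \<gamma> y * dec (snd p + fst y) * ?s)"
        using coll_half_deriv_bound[OF k l A e en c(2)[OF \<open>fst p \<in> \<Omega>\<close>], of "snd p"] by simp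
      also have "\<dots> \<le> (c + 2) * W1 * W2 * M * 1 * (kern B0 \<gamma> y * 1 * ?s)"
        using A kn gauss_bounds dec1 dec_nonneg M(1) M(2)[OF p] c D_nonneg s
        by (intro mult_mono mult_nonneg_nonneg) auto
      finally show "\<bar>coll_half_deriv e k1 l1 k2 l2 S1 S2 p y\<bar> \<le> (c + 2) * W1 * W2 * M * kern B0 \<gamma> y * ?s" by (simp add: ac_simps)
    qed (use A kn c M in auto)
  qed
  then show "locally_integrable_borel (\<lambda>p. coll_half_deriv e k1 l1 k2 l2 S1 S2 p y) U" by (auto simp: locally_integrable_borel_def)
qed

text \<open>For almost every y the line criterion gives a weak derivative, and superposition
  integrates over y. The factor \<open>1 + inv_pow 1 (norm \<zeta>)\<close> in the hypothesis is
  there for the loss term: its first shift is 0, so a pole at \<zeta> = 0 comes out of the integral,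
  and this pole is locally integrable.\<close>

lemma weak_deriv_coll_half:
  assumes k: "dominated A1 k1" "dominated A2 k2" and l: "grad_dominated W1 l1" "grad_dominated W2 l2"
    and w: "weak_deriv_borel k1 l1 e U" "weak_deriv_borel k2 l2 e U"
    and A: "0 \<le> A1" "0 \<le> A2" "A1 \<le> W1" "A2 \<le> W2" and e: "norm (snd e) \<le> 1"
    and S[measurable]: "S1 \<in> borel_measurable borel" "S2 \<in> borel_measurable borel"
    and en: "AE y in lborel. energy_shifts S1 S2 y"
    and Kst: "Kst < \<infinity>" and I: "\<And>\<zeta>. (\<integral>\<^sup>+y. ennreal (kern B0 \<gamma> y) * decay (\<zeta> + fst y) * (1 + inv_pow 1 (norm (\<zeta> + S1 y)) + inv_pow 1 (norm (\<zeta> + S2 y))) \<partial>lborel)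
       \<le> Kst * (1 + inv_pow 1 (norm \<zeta>)) * ennreal ((1 + norm \<zeta>) powr \<gamma>)"
  shows "weak_deriv_borel (\<lambda>p. \<integral>y. coll_half k1 k2 S1 S2 p y \<partial>lborel) (\<lambda>p. \<integral>y. coll_half_deriv e k1 l1 k2 l2 S1 S2 p y \<partial>lborel) e U"
proof -
  have [measurable]: "k1 \<in> borel_measurable borel" "k2 \<in> borel_measurable borel"
    "l1 \<in> borel_measurable borel" "l2 \<in> borel_measurable borel"
    using k l by (auto simp: dominated_def grad_dominated_def)
  obtain c where c: "c > 0" "\<And>x. x \<in> \<Omega> \<Longrightarrow> 1 \<le> c * D x" using D_lower by blast
  let ?u = "\<lambda>(p, y). coll_half k1 k2 S1 S2 p y" and ?v = "\<lambda>(p, y). coll_half_deriv e k1 l1 k2 l2 S1 S2 p y"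
  have I0: "(\<integral>\<^sup>+y. ennreal (kern B0 \<gamma> y) * decay (\<zeta> + fst y) \<partial>lborel) \<le> Kst * (1 + inv_pow 1 (norm \<zeta>)) * ennreal ((1 + norm \<zeta>) powr \<gamma>)" for \<zeta>
  proof (rule order_trans[OF nn_integral_mono I])
    fix y
    have "ennreal (kern B0 \<gamma> y) * decay (\<zeta> + fst y) * 1 \<le> ennreal (kern B0 \<gamma> y) * decay (\<zeta> + fst y) * (1 + inv_pow 1 (norm (\<zeta> + S1 y)) + inv_pow 1 (norm (\<zeta> + S2 y)))"
      by (intro mult_left_mono) (auto simp: add.assoc)
    then show "ennreal (kern B0 \<gamma> y) * decay (\<zeta> + fst y) \<le> ennreal (kern B0 \<gamma> y) * decay (\<zeta> + fst y) * (1 + inv_pow 1 (norm (\<zeta> + S1 y)) + inv_pow 1 (norm (\<zeta> + S2 y)))" by simp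
  qed
  have fin: "(\<integral>\<^sup>+p. F p * indicator K p \<partial>lborel) < \<infinity>"
    if K: "compact K" "K \<subseteq> U" and C: "0 \<le> C" "\<And>p. p \<in> K \<Longrightarrow> F p \<le> ennreal (C * D (fst p)) * (Kst * (1 + inv_pow 1 (norm (snd p))) * ennreal ((1 + norm (snd p)) powr \<gamma>))"
    for K F C
  proof -
    obtain M where M: "0 \<le> M" "\<And>p. p \<in> K \<Longrightarrow> D (fst p) \<le> M" "\<And>p. p \<in> K \<Longrightarrow> (1 + norm (snd p)) powr \<gamma> \<le> M"
      using D_bounded_on_compact[OF K] by metis
    show ?thesis
    proof (rule integral_dominated_inv_pow_finite[OF K(1), of "ennreal (C * M) * Kst * ennreal M" _ 0 0])
      show "ennreal (C * M) * Kst * ennreal M < \<infinity>" using Kst by (simp add: ennreal_mult_less_top)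
      fix p assume p: "p \<in> K"
      have "F p \<le> ennreal (C * D (fst p)) * (Kst * (1 + inv_pow 1 (norm (snd p))) * ennreal ((1 + norm (snd p)) powr \<gamma>))" by (rule C(2)[OF p])
      also have "\<dots> \<le> ennreal (C * M) * (Kst * (1 + inv_pow 1 (norm (snd p))) * ennreal M)"
        using M(2,3)[OF p] C(1) by (intro mult_mono mult_left_mono ennreal_leI) auto
      also have "\<dots> = ennreal (C * M) * Kst * ennreal M * (1 + inv_pow 1 (norm (snd p)))" by (simp add: ac_simps)
      also have "\<dots> \<le> ennreal (C * M) * Kst * ennreal M * ((1 + inv_pow 1 (norm (snd p + 0))) + (1 + inv_pow 1 (norm (snd p + 0))))"
        by (intro mult_left_mono) (auto simp: add_increasing2)
      finally show "F p \<le> \<dots>" .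
    qed
  qed
  have "weak_deriv_borel (\<lambda>p. \<integral>y. ?u (p, y) \<partial>lborel) (\<lambda>p. \<integral>y. ?v (p, y) \<partial>lborel) e U"
  proof (rule weak_deriv_superposition[OF sigma_finite_lborel])
    have "?u \<in> borel_measurable (borel \<Otimes>\<^sub>M borel)" by (rule measurable_coll_half) measurable
    then show "?u \<in> borel_measurable (borel \<Otimes>\<^sub>M lborel)" by (subst measurable_cong_sets[OF sets_pair_measure_cong refl]) auto
    have "?v \<in> borel_measurable (borel \<Otimes>\<^sub>M borel)" by (rule measurable_coll_half_deriv) measurable
    then show "?v \<in> borel_measurable (borel \<Otimes>\<^sub>M lborel)" by (subst measurable_cong_sets[OF sets_pair_measure_cong refl]) auto
    show "AE y in lborel. weak_deriv_borel (\<lambda>p. ?u (p, y)) (\<lambda>p. ?v (p, y)) e U"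
      using en
    proof eventually_elim
      case (elim y)
      show ?case unfolding prod.case
        by (rule line_deriv_imp_weak_deriv[OF open_U line_deriv_coll_half[OF k l w] locally_integrable_coll_half_coll_half_deriv[OF k l A e elim]])
    qed
    fix K :: "phase set" assume K: "compact K" "K \<subseteq> U"
    show "(\<integral>\<^sup>+p. (\<integral>\<^sup>+y. ennreal \<bar>?u (p, y)\<bar> \<partial>lborel) * indicator K p \<partial>lborel) < \<infinity>"
    proof (rule fin[OF K, of "A1 * A2 * c"])
      fix p assume "p \<in> K"
      then have x: "1 \<le> c * D (fst p)" using K c by (auto simp: U_iff)
      have "(\<integral>\<^sup>+y. ennreal \<bar>?u (p, y)\<bar> \<partial>lborel) \<le> ennreal (A1 * A2 * gauss (snd p)) * (Kst * (1 + inv_pow 1 (norm (snd p))) * ennreal ((1 + norm (snd p)) powr \<gamma>))"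
        using nn_integral_coll_half[OF k A(1,2) en I0, where x="fst p" and \<zeta>="snd p"] by simp
      also have "\<dots> \<le> ennreal (A1 * A2 * c * D (fst p)) * (Kst * (1 + inv_pow 1 (norm (snd p))) * ennreal ((1 + norm (snd p)) powr \<gamma>))"
      proof (intro mult_right_mono ennreal_leI)
        have "A1 * A2 * gauss (snd p) \<le> A1 * A2 * (c * D (fst p))"
          using A x gauss_bounds(2)[of "snd p"] by (intro mult_left_mono) auto
        then show "A1 * A2 * gauss (snd p) \<le> A1 * A2 * c * D (fst p)" by (simp add: ac_simps)
      qed auto
      finally show "(\<integral>\<^sup>+y. ennreal \<bar>?u (p, y)\<bar> \<partial>lborel) \<le> \<dots>" .
    qed (use A c in auto)
    show "(\<integral>\<^sup>+p. (\<integral>\<^sup>+y. ennreal \<bar>?v (p, y)\<bar> \<partial>lborel) * indicator K p \<partial>lborel) < \<infinity>"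
    proof (rule fin[OF K, of "(c + 2) * W1 * W2"])
      fix p assume "p \<in> K"
      then have x: "1 \<le> c * D (fst p)" using K c by (auto simp: U_iff)
      have "(\<integral>\<^sup>+y. ennreal \<bar>?v (p, y)\<bar> \<partial>lborel) \<le> ennreal ((c + 2) * W1 * W2 * D (fst p) * gauss (snd p)) * (Kst * (1 + inv_pow 1 (norm (snd p))) * ennreal ((1 + norm (snd p)) powr \<gamma>))"
        using nn_integral_coll_half_deriv[OF k l A e S en c(1) x I, where \<zeta>="snd p"] by simp
      also have "\<dots> \<le> ennreal ((c + 2) * W1 * W2 * D (fst p)) * (Kst * (1 + inv_pow 1 (norm (snd p))) * ennreal ((1 + norm (snd p)) powr \<gamma>))"
        using A c D_nonneg gauss_bounds by (intro mult_right_mono ennreal_leI mult_right_le_one_le mult_nonneg_nonneg) auto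
      finally show "(\<integral>\<^sup>+y. ennreal \<bar>?v (p, y)\<bar> \<partial>lborel) \<le> \<dots>" .
    qed (use A c in auto)
  qed
  then show ?thesis by simp
qed

lemma energy_shifts_gain: "AE y in lborel. energy_shifts shift1 shift2 y"
  using AE_pair_nonzero(2)
proof eventually_elim
  case (elim y)
  then show ?case using collision_energy[of "fst y" _ "snd y"] by (simp add: energy_shifts_def)
qed

lemma energy_shifts_loss: "energy_shifts (\<lambda>_. 0) fst y"
  by (simp add: energy_shifts_def)

text \<open>
  In the loss term the first function is evaluated at \<open>\<zeta>\<close> itself, so the singularity of its gradient is not
  smoothed by the integration. This is where the inverse weight (here \<open>I\<close>) enters the estimate.
\<close>

lemma coll_half_deriv_loss_bound:
  assumes k: "dominated A1 k1" "dominated A2 k2" and l: "grad_dominated W2 l2" "\<bar>l1 (x, \<zeta>)\<bar> \<le> W1 * I * gauss \<zeta>"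
    and A: "0 \<le> A1" "0 \<le> A2" "A1 \<le> W1" "A2 \<le> W2" and e: "norm (snd e) \<le> 1"
    and c: "1 \<le> c * D x" and I: "0 \<le> I"
  shows "\<bar>coll_half_deriv e k1 l1 k2 l2 (\<lambda>_. 0) fst (x, \<zeta>) y\<bar> \<le> W1 * W2 * gauss \<zeta> * ((c + 1) * D x + I) *
    (kern B0 \<gamma> y * dec (\<zeta> + fst y) * (1 + inverse (norm (\<zeta> + fst y))))"
proof -
  let ?z = "\<zeta> + fst y"
  define i where "i = inverse (norm ?z)"
  have i: "0 \<le> i" by (simp add: i_def)
  have kn: "0 \<le> kern B0 \<gamma> y" using B0 by (intro kern_nonneg) simp
  have W: "0 \<le> W1" "0 \<le> W2" using A by auto
  note Dn = D_nonneg[of x] and e0 = gauss_bounds(1)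
  have k1: "\<bar>k1 (x, \<zeta>)\<bar> \<le> W1 * gauss \<zeta>"
  proof -
    have "\<bar>k1 (x, \<zeta>)\<bar> \<le> A1 * gauss \<zeta>" using k(1) by (auto simp: dominated_def dest!: spec[of _ "(x, \<zeta>)"])
    also have "\<dots> \<le> W1 * gauss \<zeta>" using A(3) e0 by (rule mult_right_mono)
    finally show ?thesis .
  qed
  have k2: "\<bar>k2 (x, ?z)\<bar> \<le> W2"
  proof -
    have "\<bar>k2 (x, ?z)\<bar> \<le> A2 * gauss ?z" using k(2) by (auto simp: dominated_def dest!: spec[of _ "(x, ?z)"])
    also have "\<dots> \<le> W2 * 1" using A gauss_bounds by (intro mult_mono) auto
    finally show ?thesis by simp
  qed
  have l2: "\<bar>l2 (x, ?z)\<bar> \<le> W2 * D x * (1 + i)"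
  proof -
    have "\<bar>l2 (x, ?z)\<bar> \<le> W2 * D x * (1 + i) * gauss ?z" using l(1) unfolding grad_dominated_def i_def by (metis fst_conv snd_conv)
    also have "\<dots> \<le> W2 * D x * (1 + i) * 1" using gauss_bounds W Dn i by (intro mult_left_mono mult_nonneg_nonneg) auto
    finally show ?thesis by simp
  qed
  have t1: "\<bar>dmroot (snd e) ?z\<bar> * (\<bar>k1 (x, \<zeta>)\<bar> * \<bar>k2 (x, ?z)\<bar>) \<le> dec ?z * ((W1 * gauss \<zeta>) * W2)"
  proof (rule mult_mono[OF dmroot_le_dec[OF e] _ dec_nonneg])
    show "\<bar>k1 (x, \<zeta>)\<bar> * \<bar>k2 (x, ?z)\<bar> \<le> (W1 * gauss \<zeta>) * W2" using k1 k2 W e0 by (intro mult_mono) auto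
  qed auto
  have t2: "mroot ?z * (\<bar>l1 (x, \<zeta>)\<bar> * \<bar>k2 (x, ?z)\<bar>) \<le> dec ?z * ((W1 * I * gauss \<zeta>) * W2)"
  proof (rule mult_mono[OF mroot_le_dec _ dec_nonneg])
    show "\<bar>l1 (x, \<zeta>)\<bar> * \<bar>k2 (x, ?z)\<bar> \<le> (W1 * I * gauss \<zeta>) * W2" using l(2) k2 W e0 I by (intro mult_mono) auto
  qed auto
  have t3: "mroot ?z * (\<bar>k1 (x, \<zeta>)\<bar> * \<bar>l2 (x, ?z)\<bar>) \<le> dec ?z * ((W1 * gauss \<zeta>) * (W2 * D x * (1 + i)))"
  proof (rule mult_mono[OF mroot_le_dec _ dec_nonneg])
    show "\<bar>k1 (x, \<zeta>)\<bar> * \<bar>l2 (x, ?z)\<bar> \<le> (W1 * gauss \<zeta>) * (W2 * D x * (1 + i))" using k1 l2 W e0 by (intro mult_mono) auto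
  qed auto
  have "\<bar>(dmroot (snd e) ?z * k1 (x, \<zeta>) + mroot ?z * l1 (x, \<zeta>)) * k2 (x, ?z) + (mroot ?z * k1 (x, \<zeta>)) * l2 (x, ?z)\<bar>
    \<le> \<bar>dmroot (snd e) ?z\<bar> * (\<bar>k1 (x, \<zeta>)\<bar> * \<bar>k2 (x, ?z)\<bar>) + mroot ?z * (\<bar>l1 (x, \<zeta>)\<bar> * \<bar>k2 (x, ?z)\<bar>)
      + mroot ?z * (\<bar>k1 (x, \<zeta>)\<bar> * \<bar>l2 (x, ?z)\<bar>)"
  proof -
    have "\<bar>(a * b + m * c) * d + (m * b) * f\<bar> \<le> \<bar>a\<bar> * (\<bar>b\<bar> * \<bar>d\<bar>) + m * (\<bar>c\<bar> * \<bar>d\<bar>) + m * (\<bar>b\<bar> * \<bar>f\<bar>)" if "0 \<le> m" for a b c d f m :: real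
    proof -
      have "(a * b + m * c) * d + (m * b) * f = a * (b * d) + m * (c * d) + m * (b * f)" by (simp add: algebra_simps)
      also have "\<bar>\<dots>\<bar> \<le> \<bar>a * (b * d)\<bar> + \<bar>m * (c * d)\<bar> + \<bar>m * (b * f)\<bar>" by linarith
      finally show ?thesis using that by (simp add: abs_mult)
    qed
    then show ?thesis using mroot_pos[of ?z] by (simp add: less_imp_le)
  qed
  also have "\<dots> \<le> dec ?z * ((W1 * gauss \<zeta>) * W2) + dec ?z * ((W1 * I * gauss \<zeta>) * W2) + dec ?z * ((W1 * gauss \<zeta>) * (W2 * D x * (1 + i)))"
    by (intro add_mono t1 t2 t3)
  also have "\<dots> = dec ?z * (W1 * W2 * gauss \<zeta>) * (1 + I + D x * (1 + i))" by (simp add: algebra_simps)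
  also have "\<dots> \<le> dec ?z * (W1 * W2 * gauss \<zeta>) * (((c + 1) * D x + I) * (1 + i))"
  proof (intro mult_left_mono)
    have c0: "0 \<le> c * D x" using c by linarith
    have "c * D x * 1 \<le> c * D x * (1 + i)" using c0 i by (intro mult_left_mono) auto
    moreover have "I * 1 \<le> I * (1 + i)" using I i by (intro mult_left_mono) auto
    ultimately have "1 + I + D x * (1 + i) \<le> c * D x * (1 + i) + I * (1 + i) + D x * (1 + i)" using c by linarith
    then show "1 + I + D x * (1 + i) \<le> ((c + 1) * D x + I) * (1 + i)" by (simp add: algebra_simps)
  qed (use W dec_nonneg e0 in auto)
  finally have main: "\<bar>(dmroot (snd e) ?z * k1 (x, \<zeta>) + mroot ?z * l1 (x, \<zeta>)) * k2 (x, ?z) + (mroot ?z * k1 (x, \<zeta>)) * l2 (x, ?z)\<bar>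
     \<le> dec ?z * (W1 * W2 * gauss \<zeta>) * (((c + 1) * D x + I) * (1 + i))" .
  have "\<bar>coll_half_deriv e k1 l1 k2 l2 (\<lambda>_. 0) fst (x, \<zeta>) y\<bar> = kern B0 \<gamma> y * \<bar>(dmroot (snd e) ?z * k1 (x, \<zeta>) + mroot ?z * l1 (x, \<zeta>)) * k2 (x, ?z) + (mroot ?z * k1 (x, \<zeta>)) * l2 (x, ?z)\<bar>"
    using kn by (simp add: coll_half_deriv_def abs_mult)
  also have "\<dots> \<le> kern B0 \<gamma> y * (dec ?z * (W1 * W2 * gauss \<zeta>) * (((c + 1) * D x + I) * (1 + i)))"
    by (rule mult_left_mono[OF main kn])
  finally show ?thesis by (simp add: i_def ac_simps)
qed

lemma nn_integral_coll_half_deriv_loss: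
  assumes k: "dominated A1 k1" "dominated A2 k2" and l: "grad_dominated W2 l2" "\<bar>l1 (x, \<zeta>)\<bar> \<le> W1 * I * gauss \<zeta>"
    and A: "0 \<le> A1" "0 \<le> A2" "A1 \<le> W1" "A2 \<le> W2" and e: "norm (snd e) \<le> 1"
    and c: "0 < c" "1 \<le> c * D x" and I: "0 \<le> I"
    and R: "(\<integral>\<^sup>+y. ennreal (kern B0 \<gamma> y) * decay (\<zeta> + fst y) * (1 + inv_pow 1 (norm (\<zeta> + fst y))) \<partial>lborel) \<le> R"
  shows "(\<integral>\<^sup>+y. ennreal \<bar>coll_half_deriv e k1 l1 k2 l2 (\<lambda>_. 0) fst (x, \<zeta>) y\<bar> \<partial>lborel) \<le> ennreal (W1 * W2 * gauss \<zeta> * ((c + 1) * D x + I)) * R"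
proof -
  have kn: "0 \<le> kern B0 \<gamma> y" for y using B0 by (intro kern_nonneg) simp
  let ?C = "W1 * W2 * gauss \<zeta> * ((c + 1) * D x + I)"
  have C: "0 \<le> ?C" using A c D_nonneg[of x] gauss_bounds I by (intro mult_nonneg_nonneg add_nonneg_nonneg) auto
  have "(\<integral>\<^sup>+y. ennreal \<bar>coll_half_deriv e k1 l1 k2 l2 (\<lambda>_. 0) fst (x, \<zeta>) y\<bar> \<partial>lborel)
     \<le> (\<integral>\<^sup>+y. ennreal ?C * (ennreal (kern B0 \<gamma> y) * decay (\<zeta> + fst y) * (1 + inv_pow 1 (norm (\<zeta> + fst y)))) \<partial>lborel)"
  proof (rule nn_integral_mono)
    fix y :: cparam
    let ?s = "1 + inverse (norm (\<zeta> + fst y))"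
    from coll_half_deriv_loss_bound[where y=y and ?k1.0=k1 and ?k2.0=k2 and ?l1.0=l1 and ?l2.0=l2 and x=x and \<zeta>=\<zeta>, OF k l A e c(2) I]
    have "ennreal \<bar>coll_half_deriv e k1 l1 k2 l2 (\<lambda>_. 0) fst (x, \<zeta>) y\<bar> \<le> ennreal (?C * (kern B0 \<gamma> y * dec (\<zeta> + fst y) * ?s))"
      by (rule ennreal_leI)
    also have "\<dots> = ennreal ?C * (ennreal (kern B0 \<gamma> y) * decay (\<zeta> + fst y) * ennreal ?s)"
      using C kn dec_nonneg by (subst ennreal_mult, simp, simp add: add_nonneg_nonneg, subst ennreal_mult, simp, simp add: add_nonneg_nonneg,
          subst ennreal_mult) (auto simp: decay_dec)
    also have "\<dots> \<le> ennreal ?C * (ennreal (kern B0 \<gamma> y) * decay (\<zeta> + fst y) * (1 + inv_pow 1 (norm (\<zeta> + fst y))))"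
      using ennreal_inverse_le_inv_pow[of "norm (\<zeta> + fst y)"] by (intro mult_left_mono) (auto simp: add_left_mono)
    finally show "ennreal \<bar>coll_half_deriv e k1 l1 k2 l2 (\<lambda>_. 0) fst (x, \<zeta>) y\<bar> \<le> \<dots>" .
  qed
  also have "\<dots> = ennreal ?C * (\<integral>\<^sup>+y. ennreal (kern B0 \<gamma> y) * decay (\<zeta> + fst y) * (1 + inv_pow 1 (norm (\<zeta> + fst y))) \<partial>lborel)"
    by (rule nn_integral_cmult) measurable
  also have "\<dots> \<le> ennreal ?C * R" by (intro mult_left_mono R) auto
  finally show ?thesis .
qed

section \<open>Representatives of functions of finite norm\<close>

text \<open>One representative l has two bounds. The bound with \<open>D\<close> and an explicit
  pole holds everywhere and is used under the integral; the bound with the inverse weight holds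
  almost everywhere and is used at \<zeta> itself in the loss term.\<close>

lemma grad_representative:
  assumes C0: "0 < C0" and w: "\<And>x \<zeta>. x \<in> \<Omega> \<Longrightarrow> \<zeta> \<noteq> 0 \<Longrightarrow> 0 < weight \<Omega> x \<zeta>"
    "\<And>x \<zeta>. x \<in> \<Omega> \<Longrightarrow> \<zeta> \<noteq> 0 \<Longrightarrow> inverse (weight \<Omega> x \<zeta>) \<le> C0 * D x * (1 + inverse (norm \<zeta>))"
    and k: "k \<in> borel_measurable borel" "AE p in lborel. p \<in> U \<longrightarrow> h p = k p"
    and hw: "has_weak_derivative_in h v e U" and W: "0 \<le> W"
    and G: "AE p in lborel. p \<in> U \<longrightarrow> norm (g p) * weight \<Omega> (fst p) (snd p) * exp (\<alpha> * (norm (snd p))\<^sup>2) \<le> W"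
    and vg: "\<And>p. \<bar>v p\<bar> \<le> norm (g p :: real^3)"
  shows "\<exists>l. grad_dominated ((C0 + 1) * W) l \<and> weak_deriv_borel k l e U \<and>
     (AE p in lborel. p \<in> U \<longrightarrow> \<bar>l p\<bar> \<le> W * inverse (weight \<Omega> (fst p) (snd p)) * gauss (snd p))"
proof -
  have b: "AE p in lborel. p \<in> U \<longrightarrow> \<bar>v p\<bar> \<le> W * inverse (weight \<Omega> (fst p) (snd p)) * gauss (snd p) \<and>
     \<bar>v p\<bar> \<le> C0 * W * D (fst p) * (1 + inverse (norm (snd p))) * gauss (snd p)"
    using G AE_pair_nonzero(1)
  proof eventually_elim
    case (elim p)
    show ?case
    proof
      assume p: "p \<in> U"
      then have x: "fst p \<in> \<Omega>" by (simp add: U_iff)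
      let ?w = "weight \<Omega> (fst p) (snd p)"
      have w0: "0 < ?w" using w(1)[OF x] elim(2) by simp
      have "?w * inverse ?w = 1" "exp (\<alpha> * (norm (snd p))\<^sup>2) * gauss (snd p) = 1"
        using w0 by (simp_all add: gauss_def flip: exp_add)
      then have "norm (g p) = norm (g p) * (?w * inverse ?w) * (exp (\<alpha> * (norm (snd p))\<^sup>2) * gauss (snd p))"
        by simp
      also have "\<dots> = (norm (g p) * ?w * exp (\<alpha> * (norm (snd p))\<^sup>2)) * (inverse ?w * gauss (snd p))"
        by (simp only: ac_simps)
      also have "\<dots> \<le> W * (inverse ?w * gauss (snd p))"
        using elim p w0 gauss_bounds by (intro mult_right_mono) auto
      finally have 1: "\<bar>v p\<bar> \<le> W * inverse ?w * gauss (snd p)" using vg[of p] by (simp add: mult.assoc)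
      also have "\<dots> \<le> W * (C0 * D (fst p) * (1 + inverse (norm (snd p)))) * gauss (snd p)"
        using w(2)[OF x] elim(2) W gauss_bounds by (intro mult_right_mono mult_left_mono) auto
      finally have "\<bar>v p\<bar> \<le> C0 * W * D (fst p) * (1 + inverse (norm (snd p))) * gauss (snd p)" by (simp add: ac_simps)
      with 1 show "\<bar>v p\<bar> \<le> W * inverse ?w * gauss (snd p) \<and> \<bar>v p\<bar> \<le> C0 * W * D (fst p) * (1 + inverse (norm (snd p))) * gauss (snd p)" by blast
    qed
  qed
  have lv: "locally_integrable_on v U" using hw by (simp add: has_weak_derivative_in_def)
  let ?b = "\<lambda>p. C0 * W * D (fst p) * (1 + inverse (norm (snd p))) * gauss (snd p)"
  obtain l where l: "l \<in> borel_measurable borel" "\<And>p. \<bar>l p\<bar> \<le> ?b p" "AE p in lborel. p \<in> U \<longrightarrow> v p = l p"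
  proof (rule borel_representative[OF open_U lv])
    show "?b \<in> borel_measurable borel" by measurable
    show "0 \<le> ?b p" for p using C0 W D_nonneg gauss_bounds by (intro mult_nonneg_nonneg add_nonneg_nonneg) auto
    show "AE p in lborel. p \<in> U \<longrightarrow> \<bar>v p\<bar> \<le> ?b p" using b by eventually_elim blast
  qed blast
  show ?thesis
  proof (intro exI conjI)
    have "?b p \<le> (C0 + 1) * W * D (fst p) * (1 + inverse (norm (snd p))) * gauss (snd p)" for p
      using C0 W D_nonneg[of "fst p"] gauss_bounds(1)[of "snd p"]
      by (intro mult_right_mono) (auto intro: add_nonneg_nonneg)
    then show "grad_dominated ((C0 + 1) * W) l" using l(1,2) unfolding grad_dominated_def by (meson order_trans)
    show "weak_deriv_borel k l e U"
      using has_weak_derivative_in_iff_borel[OF open_U k(1) l(1) k(2) l(3)] hw by blast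
    show "AE p in lborel. p \<in> U \<longrightarrow> \<bar>l p\<bar> \<le> W * inverse (weight \<Omega> (fst p) (snd p)) * gauss (snd p)"
      using b l(3) by eventually_elim auto
  qed
qed

definition coordinate_directions :: "phase set" where "coordinate_directions = range (\<lambda>i. (axis i 1, 0)) \<union> range (\<lambda>i. (0, axis i 1))"

text \<open>The constant is \<open>C0 + 1\<close> instead of \<open>C0\<close> so that it also dominates \<open>A\<close>.\<close>

definition admissible :: "real \<Rightarrow> real \<Rightarrow> real \<Rightarrow> (phase \<Rightarrow> real) \<Rightarrow> (phase \<Rightarrow> real) \<Rightarrow> bool" where
  "admissible C0 A W h k \<longleftrightarrow> 0 \<le> A \<and> A \<le> W \<and> dominated A k \<and> (AE p in lborel. p \<in> U \<longrightarrow> h p = k p) \<and>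
     (\<forall>e\<in>coordinate_directions. \<exists>l. grad_dominated ((C0 + 1) * W) l \<and> weak_deriv_borel k l e U \<and>
       (AE p in lborel. p \<in> U \<longrightarrow> \<bar>l p\<bar> \<le> W * inverse (weight \<Omega> (fst p) (snd p)) * gauss (snd p)))"

text \<open>The same Borel function k serves all six coordinate directions; only its derivative l
  depends on the direction.\<close>

lemma Wt_space_representative:
  assumes C0: "0 < C0" and w: "\<And>x \<zeta>. x \<in> \<Omega> \<Longrightarrow> \<zeta> \<noteq> 0 \<Longrightarrow> 0 < weight \<Omega> x \<zeta>"
    "\<And>x \<zeta>. x \<in> \<Omega> \<Longrightarrow> \<zeta> \<noteq> 0 \<Longrightarrow> inverse (weight \<Omega> x \<zeta>) \<le> C0 * D x * (1 + inverse (norm \<zeta>))"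
    and h: "h \<in> Wt_space \<alpha> \<Omega>"
  shows "\<exists>k. admissible C0 (enn2real (Linf_norm \<alpha> \<Omega> h)) (enn2real (Wt_norm \<alpha> \<Omega> h)) h k"
proof -
  define A W where "A = enn2real (Linf_norm \<alpha> \<Omega> h)" and "W = enn2real (Wt_norm \<alpha> \<Omega> h)"
  have wd: "weakly_differentiable \<Omega> h" and fin: "Wt_norm \<alpha> \<Omega> h < \<infinity>" using h by (auto simp: Wt_space_def)
  have LW: "Linf_norm \<alpha> \<Omega> h \<le> Wt_norm \<alpha> \<Omega> h" unfolding Wt_norm_def by (simp add: add.assoc)
  have eA: "Linf_norm \<alpha> \<Omega> h = ennreal A" and eW: "Wt_norm \<alpha> \<Omega> h = ennreal W"
    using fin LW by (auto simp: A_def W_def ennreal_enn2real_if top_unique)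
  have AW: "0 \<le> A" "A \<le> W" "0 \<le> W" using LW fin by (auto simp: A_def W_def intro: enn2real_mono)
  have gx: "has_weak_grad_x \<Omega> h (weak_grad_x \<Omega> h)" and gz: "has_weak_grad_\<zeta> \<Omega> h (weak_grad_\<zeta> \<Omega> h)"
    by (rule has_weak_grad_SOME[OF wd])+
  have U: "\<Omega> \<times> UNIV = U" by (simp add: U_def)
  have lh: "locally_integrable_on h U"
    using gx by (auto simp: has_weak_grad_x_def has_weak_derivative_in_def U)
  have aeh: "AE p in lborel. p \<in> U \<longrightarrow> \<bar>h p\<bar> \<le> A * gauss (snd p)"
  proof -
    have "AE p in lebesgue_on U. (case p of (x, \<zeta>) \<Rightarrow> ennreal (\<bar>h (x, \<zeta>)\<bar> * exp (\<alpha> * (norm \<zeta>)\<^sup>2))) \<le> ennreal A"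
      unfolding eA[symmetric] Linf_norm_def U by (rule esssup_AE)
    then have "AE p in lborel. p \<in> U \<longrightarrow> (case p of (x, \<zeta>) \<Rightarrow> ennreal (\<bar>h (x, \<zeta>)\<bar> * exp (\<alpha> * (norm \<zeta>)\<^sup>2))) \<le> ennreal A"
      by (simp only: AE_lebesgue_on_iff[OF open_U])
    then show ?thesis
    proof eventually_elim
      case (elim p)
      show ?case
      proof
        assume "p \<in> U"
        with elim have "\<bar>h p\<bar> * exp (\<alpha> * (norm (snd p))\<^sup>2) \<le> A" using AW by (cases p) (simp add: ennreal_le_iff)
        then have "(\<bar>h p\<bar> * exp (\<alpha> * (norm (snd p))\<^sup>2)) * gauss (snd p) \<le> A * gauss (snd p)"
          using gauss_bounds by (intro mult_right_mono)
        then show "\<bar>h p\<bar> \<le> A * gauss (snd p)" by (simp add: gauss_def mult.assoc flip: exp_add)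
      qed
    qed
  qed
  have bm: "(\<lambda>p. A * gauss (snd p)) \<in> borel_measurable borel" by measurable
  obtain k where k: "k \<in> borel_measurable borel" "\<And>p. \<bar>k p\<bar> \<le> A * gauss (snd p)" "AE p in lborel. p \<in> U \<longrightarrow> h p = k p"
    by (rule borel_representative[OF open_U lh bm _ aeh]) (use AW gauss_bounds in auto)
  have Gbound: "AE p in lborel. p \<in> U \<longrightarrow> norm (g p) * weight \<Omega> (fst p) (snd p) * exp (\<alpha> * (norm (snd p))\<^sup>2) \<le> W"
    if "esssup (lebesgue_on (\<Omega> \<times> UNIV)) (\<lambda>(x, \<zeta>). ennreal (norm (g (x, \<zeta>)) * weight \<Omega> x \<zeta> * exp (\<alpha> * (norm \<zeta>)\<^sup>2))) \<le> ennreal W"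
    for g :: "phase \<Rightarrow> real^3"
  proof -
    have "AE p in lebesgue_on U. (case p of (x, \<zeta>) \<Rightarrow> ennreal (norm (g (x, \<zeta>)) * weight \<Omega> x \<zeta> * exp (\<alpha> * (norm \<zeta>)\<^sup>2))) \<le> ennreal W"
      using esssup_AE[where M="lebesgue_on U" and f="\<lambda>(x, \<zeta>). ennreal (norm (g (x, \<zeta>)) * weight \<Omega> x \<zeta> * exp (\<alpha> * (norm \<zeta>)\<^sup>2))"] that
      unfolding U by (auto elim!: eventually_mono intro: order_trans)
    then have "AE p in lborel. p \<in> U \<longrightarrow> (case p of (x, \<zeta>) \<Rightarrow> ennreal (norm (g (x, \<zeta>)) * weight \<Omega> x \<zeta> * exp (\<alpha> * (norm \<zeta>)\<^sup>2))) \<le> ennreal W"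
      by (simp only: AE_lebesgue_on_iff[OF open_U])
    then show ?thesis by eventually_elim (use AW in \<open>auto simp: ennreal_le_iff\<close>)
  qed
  have Gx: "AE p in lborel. p \<in> U \<longrightarrow> norm (weak_grad_x \<Omega> h p) * weight \<Omega> (fst p) (snd p) * exp (\<alpha> * (norm (snd p))\<^sup>2) \<le> W"
    by (rule Gbound) (simp add: eW[symmetric] Wt_norm_def add_increasing add_increasing2)
  have Gz: "AE p in lborel. p \<in> U \<longrightarrow> norm (weak_grad_\<zeta> \<Omega> h p) * weight \<Omega> (fst p) (snd p) * exp (\<alpha> * (norm (snd p))\<^sup>2) \<le> W"
    by (rule Gbound) (simp add: eW[symmetric] Wt_norm_def add_increasing add_increasing2)
  have "\<exists>l. grad_dominated ((C0 + 1) * W) l \<and> weak_deriv_borel k l e U \<and>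
       (AE p in lborel. p \<in> U \<longrightarrow> \<bar>l p\<bar> \<le> W * inverse (weight \<Omega> (fst p) (snd p)) * gauss (snd p))" if e: "e \<in> coordinate_directions" for e
  proof -
    from e consider i where "e = (axis i 1, 0)" | i where "e = (0, axis i 1)" by (auto simp: coordinate_directions_def)
    then show ?thesis
    proof cases
      case 1
      have "has_weak_derivative_in h (\<lambda>p. weak_grad_x \<Omega> h p $ i) e U" using gx 1 by (simp add: has_weak_grad_x_def U)
      from grad_representative[OF C0 w k(1,3) this AW(3) Gx component_le_norm_cart] show ?thesis .
    next
      case 2
      have "has_weak_derivative_in h (\<lambda>p. weak_grad_\<zeta> \<Omega> h p $ i) e U" using gz 2 by (simp add: has_weak_grad_\<zeta>_def U)
      from grad_representative[OF C0 w k(1,3) this AW(3) Gz component_le_norm_cart] show ?thesis .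
    qed
  qed
  then have "admissible C0 A W h k" unfolding admissible_def dominated_def
    using AW(1,2) k by blast
  then show ?thesis unfolding A_def W_def by blast
qed

section \<open>The collision operator and its weak gradient\<close>

lemma gain_bound: "\<exists>K\<ge>0. \<forall>\<zeta>. (\<integral>\<^sup>+y. ennreal (kern B0 \<gamma> y) * decay (\<zeta> + fst y) *
    (1 + inv_pow 1 (norm (\<zeta> + shift1 y)) + inv_pow 1 (norm (\<zeta> + shift2 y))) \<partial>lborel) \<le> ennreal (K * (1 + norm \<zeta>) powr \<gamma>)"
proof -
  obtain K where K: "K < \<infinity>" "\<And>\<zeta>. (\<integral>\<^sup>+y. ennreal (kern B0 \<gamma> y) * decay (\<zeta> + fst y) *
    (1 + inv_pow 1 (norm (\<zeta> + shift1 y)) + inv_pow 1 (norm (\<zeta> + shift2 y))) \<partial>lborel) \<le> K * ennreal ((1 + norm \<zeta>) powr \<gamma>)"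
    using gain_integral[OF less_imp_le[OF B0] \<gamma>] by blast
  have "K = ennreal (enn2real K)" using K(1) by (simp add: ennreal_enn2real_if)
  then show ?thesis using K(2) by (intro exI[of _ "enn2real K"]) (simp add: ennreal_mult)
qed

lemma loss_bound: "\<exists>K\<ge>0. \<forall>\<zeta>. (\<integral>\<^sup>+y. ennreal (kern B0 \<gamma> y) * decay (\<zeta> + fst y) *
    (1 + inv_pow 1 (norm (\<zeta> + fst y))) \<partial>lborel) \<le> ennreal (K * (1 + norm \<zeta>) powr \<gamma>)"
proof -
  obtain K where K: "K < \<infinity>" "\<And>\<zeta>. (\<integral>\<^sup>+y. ennreal (kern B0 \<gamma> y) * decay (\<zeta> + fst y) *
    (1 + inv_pow 1 (norm (\<zeta> + fst y))) \<partial>lborel) \<le> K * ennreal ((1 + norm \<zeta>) powr \<gamma>)"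
    using loss_integral[OF less_imp_le[OF B0] \<gamma>] by blast
  have "K = ennreal (enn2real K)" using K(1) by (simp add: ennreal_enn2real_if)
  then show ?thesis using K(2) by (intro exI[of _ "enn2real K"]) (simp add: ennreal_mult)
qed

lemma coll_integrand_eq_coll_half:
  "coll_integrand B0 \<gamma> k1 k2 p y = coll_half k1 k2 shift1 shift2 p y - coll_half k1 k2 (\<lambda>_. 0) fst p y"
  by (cases p) (simp add: coll_integrand_def coll_half_def algebra_simps)

lemma coll_half_integral:
  assumes k: "dominated A1 k1" "dominated A2 k2" and A: "0 \<le> A1" "0 \<le> A2"
    and S: "S1 \<in> borel_measurable borel" "S2 \<in> borel_measurable borel"
    and en: "AE y in lborel. energy_shifts S1 S2 y" and K: "0 \<le> K"
    and J: "\<And>\<zeta>. (\<integral>\<^sup>+y. ennreal (kern B0 \<gamma> y) * decay (\<zeta> + fst y) \<partial>lborel) \<le> ennreal (K * (1 + norm \<zeta>) powr \<gamma>)"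
  shows "integrable lborel (coll_half k1 k2 S1 S2 p)"
    "\<bar>\<integral>y. coll_half k1 k2 S1 S2 p y \<partial>lborel\<bar> \<le> A1 * A2 * gauss (snd p) * (K * (1 + norm (snd p)) powr \<gamma>)"
proof -
  have [measurable]: "k1 \<in> borel_measurable borel" "k2 \<in> borel_measurable borel" "S1 \<in> borel_measurable borel" "S2 \<in> borel_measurable borel"
    using k S by (auto simp: dominated_def)
  have A0: "0 \<le> A1 * A2 * gauss (snd p)" using A gauss_bounds by auto
  have "(\<integral>\<^sup>+y. ennreal \<bar>coll_half k1 k2 S1 S2 p y\<bar> \<partial>lborel) \<le> ennreal (A1 * A2 * gauss (snd p)) * ennreal (K * (1 + norm (snd p)) powr \<gamma>)"
    using nn_integral_coll_half[OF k A en J, where x="fst p" and \<zeta>="snd p"] by simp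
  also have "\<dots> = ennreal (A1 * A2 * gauss (snd p) * (K * (1 + norm (snd p)) powr \<gamma>))" (is "_ = ennreal ?b")
    using A gauss_bounds K by (intro ennreal_mult[symmetric] mult_nonneg_nonneg) auto
  finally have b: "(\<integral>\<^sup>+y. ennreal \<bar>coll_half k1 k2 S1 S2 p y\<bar> \<partial>lborel) \<le> ennreal ?b" .
  have b0: "0 \<le> ?b" using A0 K by (intro mult_nonneg_nonneg[OF A0]) auto
  show "integrable lborel (coll_half k1 k2 S1 S2 p)"
  proof (rule integrableI_bounded)
    show "coll_half k1 k2 S1 S2 p \<in> borel_measurable lborel" unfolding coll_half_def by measurable
    show "(\<integral>\<^sup>+y. ennreal (norm (coll_half k1 k2 S1 S2 p y)) \<partial>lborel) < \<infinity>"
      using b by (auto intro: le_less_trans)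
  qed
  show "\<bar>\<integral>y. coll_half k1 k2 S1 S2 p y \<partial>lborel\<bar> \<le> ?b"
    using order_trans[OF ennreal_abs_integral_le b] b0 by (simp add: ennreal_le_iff)
qed

text \<open>\<open>AE_shift_pairs\<close> is used for the three shifted velocities at which h1 and
  h2 occur. Gain and loss are integrable separately, so the integral of their difference
  splits.\<close>

lemma Gamma_op_representation:
  assumes B: "B = (\<lambda>r \<theta>. B0 * r powr \<gamma> * sin \<theta> * cos \<theta>)"
    and k: "dominated A1 k1" "dominated A2 k2" and A: "0 \<le> A1" "0 \<le> A2"
    and hk: "AE p in lborel. p \<in> U \<longrightarrow> h1 p = k1 p" "AE p in lborel. p \<in> U \<longrightarrow> h2 p = k2 p" and K: "0 \<le> K"
    and J: "\<And>\<zeta>. (\<integral>\<^sup>+y. ennreal (kern B0 \<gamma> y) * decay (\<zeta> + fst y) \<partial>lborel) \<le> ennreal (K * (1 + norm \<zeta>) powr \<gamma>)"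
  shows "AE p in lborel. p \<in> U \<longrightarrow> Gamma_op B h1 h2 p =
    (\<integral>y. coll_half k1 k2 shift1 shift2 p y \<partial>lborel) - (\<integral>y. coll_half k1 k2 (\<lambda>_. 0) fst p y \<partial>lborel)"
proof -
  have km: "k1 \<in> borel_measurable borel" "k2 \<in> borel_measurable borel" using k by (auto simp: dominated_def)
  have S0: "(\<lambda>_. 0) \<in> borel_measurable (borel :: cparam measure)" "fst \<in> borel_measurable (borel :: cparam measure)"
    by (simp, intro borel_measurable_continuous_onI continuous_intros)
  have AE_loss: "AE y in lborel. energy_shifts (\<lambda>_. 0) fst y" using energy_shifts_loss by simp
  have i: "integrable lborel (coll_half k1 k2 shift1 shift2 p)" "integrable lborel (coll_half k1 k2 (\<lambda>_. 0) fst p)" for p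
    using coll_half_integral(1)[OF k A measurable_kern(2,3) energy_shifts_gain K J]
      coll_half_integral(1)[OF k A S0 AE_loss K J] by auto
  show ?thesis
    using AE_shift_pairs[OF hk(1) measurable_kern(2)] AE_shift_pairs[OF hk(2) measurable_kern(3)]
      AE_shift_pairs[OF hk(2) S0(2)] hk(1)
  proof eventually_elim
    case (elim p)
    show ?case
    proof
      assume p: "p \<in> U"
      obtain x \<zeta> where px: "p = (x, \<zeta>)" by (cases p)
      have "Gamma_op B h1 h2 (x, \<zeta>) = (\<integral>y. coll_integrand B0 \<gamma> k1 k2 (x, \<zeta>) y \<partial>lborel)"
      proof (rule Gamma_op_eq_integral[OF less_imp_le[OF B0] B km])
        show "AE y in lborel. h1 (x, \<zeta> + shift1 y) = k1 (x, \<zeta> + shift1 y) \<and> h2 (x, \<zeta> + shift2 y) = k2 (x, \<zeta> + shift2 y)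
           \<and> h2 (x, \<zeta> + fst y) = k2 (x, \<zeta> + fst y)"
          using elim(1,2,3) by eventually_elim (use p in \<open>auto simp: U_iff px\<close>)
        show "h1 (x, \<zeta>) = k1 (x, \<zeta>)" using elim(4) p px by simp
        show "integrable lborel (coll_integrand B0 \<gamma> k1 k2 (x, \<zeta>))"
          unfolding ext[OF coll_integrand_eq_coll_half] by (rule Bochner_Integration.integrable_diff[OF i])
      qed
      also have "\<dots> = (\<integral>y. coll_half k1 k2 shift1 shift2 p y \<partial>lborel) - (\<integral>y. coll_half k1 k2 (\<lambda>_. 0) fst p y \<partial>lborel)"
        unfolding coll_integrand_eq_coll_half px by (rule Bochner_Integration.integral_diff[OF i])
      finally show "Gamma_op B h1 h2 p = (\<integral>y. coll_half k1 k2 shift1 shift2 p y \<partial>lborel) - (\<integral>y. coll_half k1 k2 (\<lambda>_. 0) fst p y \<partial>lborel)"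
        by (simp add: px)
    qed
  qed
qed

lemma norm_coordinate_directions: "e \<in> coordinate_directions \<Longrightarrow> norm (snd e) \<le> 1"
  by (auto simp: coordinate_directions_def)

text \<open>The constant collects (C0 + 1)^2 from the derivative bounds of the two functions, c + 2
  from the product rule, and Kg + Kl from the integrated kernels.\<close>

lemma weak_derivative_Gamma_op:
  assumes B: "B = (\<lambda>r \<theta>. B0 * r powr \<gamma> * sin \<theta> * cos \<theta>)"
    and C0: "0 < C0" and w: "\<And>x \<zeta>. x \<in> \<Omega> \<Longrightarrow> \<zeta> \<noteq> 0 \<Longrightarrow> 0 < weight \<Omega> x \<zeta>"
    and adm: "admissible C0 A1 W1 h1 k1" "admissible C0 A2 W2 h2 k2" and e: "e \<in> coordinate_directions"
    and c: "0 < c" "\<And>x. x \<in> \<Omega> \<Longrightarrow> 1 \<le> c * D x" and K: "0 \<le> Kg" "0 \<le> Kl"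
    and Kg: "\<And>\<zeta>. (\<integral>\<^sup>+y. ennreal (kern B0 \<gamma> y) * decay (\<zeta> + fst y) *
      (1 + inv_pow 1 (norm (\<zeta> + shift1 y)) + inv_pow 1 (norm (\<zeta> + shift2 y))) \<partial>lborel) \<le> ennreal (Kg * (1 + norm \<zeta>) powr \<gamma>)"
    and Kl: "\<And>\<zeta>. (\<integral>\<^sup>+y. ennreal (kern B0 \<gamma> y) * decay (\<zeta> + fst y) *
      (1 + inv_pow 1 (norm (\<zeta> + fst y))) \<partial>lborel) \<le> ennreal (Kl * (1 + norm \<zeta>) powr \<gamma>)"
    and \<Gamma>: "AE p in lborel. p \<in> U \<longrightarrow> Gamma_op B h1 h2 p =
      (\<integral>y. coll_half k1 k2 shift1 shift2 p y \<partial>lborel) - (\<integral>y. coll_half k1 k2 (\<lambda>_. 0) fst p y \<partial>lborel)"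
  shows "\<exists>T. has_weak_derivative_in (Gamma_op B h1 h2) T e U \<and>
    (AE p in lborel. p \<in> U \<longrightarrow> \<bar>T p\<bar> \<le> (C0 + 1)\<^sup>2 * (c + 2) * (Kg + Kl) * (D (fst p) + inverse (weight \<Omega> (fst p) (snd p)))
      * W1 * W2 * gauss (snd p) * (1 + norm (snd p)) powr \<gamma>)"
proof -
  define V1 V2 where "V1 = (C0 + 1) * W1" and "V2 = (C0 + 1) * W2"
  have k: "dominated A1 k1" "dominated A2 k2" and A: "0 \<le> A1" "0 \<le> A2" and AW: "A1 \<le> W1" "A2 \<le> W2"
    using adm by (auto simp: admissible_def)
  have "0 \<le> C0 * W1" "0 \<le> C0 * W2" using C0 A AW by auto
  then have WV: "W1 \<le> V1" "W2 \<le> V2" by (auto simp: V1_def V2_def distrib_right)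
  then have AV: "A1 \<le> V1" "A2 \<le> V2" using AW by auto
  have V: "0 \<le> V1" "0 \<le> V2" using A AV by auto
  obtain l1 where l1: "grad_dominated V1 l1" "weak_deriv_borel k1 l1 e U"
    "AE p in lborel. p \<in> U \<longrightarrow> \<bar>l1 p\<bar> \<le> W1 * inverse (weight \<Omega> (fst p) (snd p)) * gauss (snd p)"
    using adm(1) e unfolding admissible_def V1_def by blast
  obtain l2 where l2: "grad_dominated V2 l2" "weak_deriv_borel k2 l2 e U"
    using adm(2) e unfolding admissible_def V2_def by blast
  have [measurable]: "k1 \<in> borel_measurable borel" "k2 \<in> borel_measurable borel"
    "l1 \<in> borel_measurable borel" "l2 \<in> borel_measurable borel"
    using k l1 l2 by (auto simp: dominated_def grad_dominated_def)
  have S0[measurable]: "(\<lambda>_. 0) \<in> borel_measurable (borel :: cparam measure)" "fst \<in> borel_measurable (borel :: cparam measure)"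
    by (simp, intro borel_measurable_continuous_onI continuous_intros)
  have AE_loss: "AE y in lborel. energy_shifts (\<lambda>_. 0) fst y" using energy_shifts_loss by simp
  note ne = norm_coordinate_directions[OF e]
  let ?ug = "\<lambda>p. \<integral>y. coll_half k1 k2 shift1 shift2 p y \<partial>lborel" and ?ul = "\<lambda>p. \<integral>y. coll_half k1 k2 (\<lambda>_. 0) fst p y \<partial>lborel"
  let ?vg = "\<lambda>p. \<integral>y. coll_half_deriv e k1 l1 k2 l2 shift1 shift2 p y \<partial>lborel" and ?vl = "\<lambda>p. \<integral>y. coll_half_deriv e k1 l1 k2 l2 (\<lambda>_. 0) fst p y \<partial>lborel"
  have "weak_deriv_borel ?ug ?vg e U"
  proof (rule weak_deriv_coll_half[OF k l1(1) l2(1) l1(2) l2(2) A AV ne measurable_kern(2,3) energy_shifts_gain])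
    show "ennreal Kg < \<infinity>" by simp
    show "(\<integral>\<^sup>+y. ennreal (kern B0 \<gamma> y) * decay (\<zeta> + fst y) *
      (1 + inv_pow 1 (norm (\<zeta> + shift1 y)) + inv_pow 1 (norm (\<zeta> + shift2 y))) \<partial>lborel)
      \<le> ennreal Kg * (1 + inv_pow 1 (norm \<zeta>)) * ennreal ((1 + norm \<zeta>) powr \<gamma>)" for \<zeta>
    proof -
      note Kg[of \<zeta>]
      also have "ennreal (Kg * (1 + norm \<zeta>) powr \<gamma>) = ennreal Kg * 1 * ennreal ((1 + norm \<zeta>) powr \<gamma>)"
        using K by (simp add: ennreal_mult)
      also have "\<dots> \<le> ennreal Kg * (1 + inv_pow 1 (norm \<zeta>)) * ennreal ((1 + norm \<zeta>) powr \<gamma>)"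
        by (intro mult_right_mono mult_left_mono) auto
      finally show ?thesis .
    qed
  qed
  moreover have "weak_deriv_borel ?ul ?vl e U"
  proof (rule weak_deriv_coll_half[OF k l1(1) l2(1) l1(2) l2(2) A AV ne S0 AE_loss])
    show "ennreal Kl < \<infinity>" by simp
    show "(\<integral>\<^sup>+y. ennreal (kern B0 \<gamma> y) * decay (\<zeta> + fst y) *
      (1 + inv_pow 1 (norm (\<zeta> + 0)) + inv_pow 1 (norm (\<zeta> + fst y))) \<partial>lborel)
      \<le> ennreal Kl * (1 + inv_pow 1 (norm \<zeta>)) * ennreal ((1 + norm \<zeta>) powr \<gamma>)" for \<zeta>
    proof -
      let ?f = "\<lambda>y. ennreal (kern B0 \<gamma> y) * decay (\<zeta> + fst y) * (1 + inv_pow 1 (norm (\<zeta> + fst y)))"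
      have "(\<integral>\<^sup>+y. ennreal (kern B0 \<gamma> y) * decay (\<zeta> + fst y) * (1 + inv_pow 1 (norm (\<zeta> + 0)) + inv_pow 1 (norm (\<zeta> + fst y))) \<partial>lborel)
        \<le> (\<integral>\<^sup>+y. (1 + inv_pow 1 (norm \<zeta>)) * ?f y \<partial>lborel)"
      proof (rule nn_integral_mono)
        fix y :: cparam
        \<comment> \<open>Separates the pole at \<zeta>, which does not depend on y, from the pole
          at the partner velocity, which is integrated.\<close>
        have "1 + a + b \<le> (1 + a) * (1 + b)" for a b :: ennreal by (simp add: distrib_left distrib_right add.assoc)
        then have "ennreal (kern B0 \<gamma> y) * decay (\<zeta> + fst y) * (1 + inv_pow 1 (norm \<zeta>) + inv_pow 1 (norm (\<zeta> + fst y)))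
          \<le> ennreal (kern B0 \<gamma> y) * decay (\<zeta> + fst y) * ((1 + inv_pow 1 (norm \<zeta>)) * (1 + inv_pow 1 (norm (\<zeta> + fst y))))"
          by (intro mult_left_mono) auto
        also have "\<dots> = (1 + inv_pow 1 (norm \<zeta>)) * ?f y" by (simp only: ac_simps)
        finally show "ennreal (kern B0 \<gamma> y) * decay (\<zeta> + fst y) * (1 + inv_pow 1 (norm (\<zeta> + 0)) + inv_pow 1 (norm (\<zeta> + fst y))) \<le> \<dots>"
          by simp
      qed
      also have "\<dots> = (1 + inv_pow 1 (norm \<zeta>)) * (\<integral>\<^sup>+y. ?f y \<partial>lborel)" by (rule nn_integral_cmult) measurable
      also have "\<dots> \<le> (1 + inv_pow 1 (norm \<zeta>)) * ennreal (Kl * (1 + norm \<zeta>) powr \<gamma>)" by (intro mult_left_mono Kl) auto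
      also have "\<dots> = ennreal Kl * (1 + inv_pow 1 (norm \<zeta>)) * ennreal ((1 + norm \<zeta>) powr \<gamma>)"
        using K by (simp add: ennreal_mult ac_simps)
      finally show ?thesis .
    qed
  qed
  ultimately have wd: "weak_deriv_borel (\<lambda>p. ?ug p - ?ul p) (\<lambda>p. ?vg p - ?vl p) e U" by (rule weak_deriv_borel_diff)
  then have m: "(\<lambda>p. ?ug p - ?ul p) \<in> borel_measurable borel" "(\<lambda>p. ?vg p - ?vl p) \<in> borel_measurable borel"
    by (auto simp: weak_deriv_borel_def locally_integrable_borel_def)
  have hw: "has_weak_derivative_in (Gamma_op B h1 h2) (\<lambda>p. ?vg p - ?vl p) e U"
    using has_weak_derivative_in_iff_borel[OF open_U m \<Gamma>, of "\<lambda>p. ?vg p - ?vl p"] wd by simp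
  have "AE p in lborel. p \<in> U \<longrightarrow> \<bar>?vg p - ?vl p\<bar> \<le> (C0 + 1)\<^sup>2 * (c + 2) * (Kg + Kl) * (D (fst p) + inverse (weight \<Omega> (fst p) (snd p)))
      * W1 * W2 * gauss (snd p) * (1 + norm (snd p)) powr \<gamma>"
    using l1(3) AE_pair_nonzero(1)
  proof eventually_elim
    case (elim p)
    show ?case
    proof
      assume p: "p \<in> U"
      then have x: "fst p \<in> \<Omega>" by (simp add: U_iff)
      define I P d E where "I = inverse (weight \<Omega> (fst p) (snd p))" and "P = (1 + norm (snd p)) powr \<gamma>"
        and "d = D (fst p)" and "E = gauss (snd p)"
      have nn: "0 \<le> I" "0 \<le> P" "0 \<le> d" "0 \<le> E"
        using w[OF x elim(2)] D_nonneg gauss_bounds by (auto simp: I_def P_def d_def E_def)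
      have cd: "1 \<le> c * D (fst p)" by (rule c(2)[OF x])
      \<comment> \<open>At \<zeta> itself the bound of l1 through the weight is used: the other one
        has the factor 1 + 1/|\<zeta>|, which the claim does not contain.\<close>
      have "\<bar>l1 p\<bar> \<le> W1 * (I * E)" using elim(1) p by (simp add: I_def E_def mult.assoc)
      also have "\<dots> \<le> V1 * (I * E)" using WV nn by (intro mult_right_mono) auto
      finally have l1p: "\<bar>l1 (fst p, snd p)\<bar> \<le> V1 * I * gauss (snd p)" by (simp add: E_def mult.assoc)
      have vg: "\<bar>?vg p\<bar> \<le> (c + 2) * V1 * V2 * d * E * (Kg * P)"
      proof -
        have "ennreal \<bar>?vg p\<bar> \<le> ennreal ((c + 2) * V1 * V2 * d * E) * ennreal (Kg * P)"
          using order_trans[OF ennreal_abs_integral_le nn_integral_coll_half_deriv[OF k l1(1) l2(1) A AV ne measurable_kern(2,3) energy_shifts_gain c(1) cd Kg, where \<zeta>="snd p"]]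
          by (simp add: d_def E_def P_def)
        also have "\<dots> = ennreal ((c + 2) * V1 * V2 * d * E * (Kg * P))"
          using nn V c(1) K by (intro ennreal_mult[symmetric] mult_nonneg_nonneg add_nonneg_nonneg) auto
        finally show ?thesis using nn V c(1) K by (subst (asm) ennreal_le_iff) auto
      qed
      have vl: "\<bar>?vl p\<bar> \<le> V1 * V2 * E * ((c + 1) * d + I) * (Kl * P)"
      proof -
        have "ennreal \<bar>?vl p\<bar> \<le> ennreal (V1 * V2 * E * ((c + 1) * d + I)) * ennreal (Kl * P)"
          using order_trans[OF ennreal_abs_integral_le nn_integral_coll_half_deriv_loss[where ?k1.0=k1 and ?k2.0=k2 and ?l1.0=l1 and ?l2.0=l2 and x="fst p" and \<zeta>="snd p", OF k l2(1) l1p A AV ne c(1) cd nn(1) Kl]]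
          by (simp add: d_def E_def P_def)
        also have "\<dots> = ennreal (V1 * V2 * E * ((c + 1) * d + I) * (Kl * P))"
          using nn V c(1) K by (intro ennreal_mult[symmetric] mult_nonneg_nonneg add_nonneg_nonneg) auto
        finally show ?thesis using nn V c(1) K by (subst (asm) ennreal_le_iff) auto
      qed
      have "\<bar>?vg p - ?vl p\<bar> \<le> (c + 2) * V1 * V2 * d * E * (Kg * P) + V1 * V2 * E * ((c + 1) * d + I) * (Kl * P)"
        using vg vl by linarith
      also have "\<dots> = V1 * V2 * E * P * ((c + 2) * d * Kg + ((c + 1) * d + I) * Kl)" by (simp add: algebra_simps)
      also have "\<dots> \<le> V1 * V2 * E * P * ((c + 2) * (d + I) * (Kg + Kl))"
      proof (intro mult_left_mono)
        have "0 \<le> (c + 2) * I * Kg + (d + (c + 1) * I) * Kl" using nn c(1) K by auto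
        then show "(c + 2) * d * Kg + ((c + 1) * d + I) * Kl \<le> (c + 2) * (d + I) * (Kg + Kl)" by (simp add: algebra_simps)
      qed (use nn V in auto)
      also have "\<dots> = (C0 + 1)\<^sup>2 * (c + 2) * (Kg + Kl) * (d + I) * W1 * W2 * E * P"
        by (simp add: V1_def V2_def power2_eq_square)
      finally show "\<bar>?vg p - ?vl p\<bar> \<le> (C0 + 1)\<^sup>2 * (c + 2) * (Kg + Kl) * (D (fst p) + inverse (weight \<Omega> (fst p) (snd p)))
        * W1 * W2 * gauss (snd p) * (1 + norm (snd p)) powr \<gamma>"
        by (simp only: d_def I_def E_def P_def)
    qed
  qed
  with hw have "has_weak_derivative_in (Gamma_op B h1 h2) (\<lambda>p. ?vg p - ?vl p) e U \<and> (AE p in lborel. p \<in> U \<longrightarrow> \<bar>?vg p - ?vl p\<bar>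
    \<le> (C0 + 1)\<^sup>2 * (c + 2) * (Kg + Kl) * (D (fst p) + inverse (weight \<Omega> (fst p) (snd p)))
      * W1 * W2 * gauss (snd p) * (1 + norm (snd p)) powr \<gamma>)" by (rule conjI)
  then show ?thesis by (rule exI[where x="\<lambda>p. ?vg p - ?vl p"])
qed

text \<open>Uniqueness of weak derivatives carries the bounds for T over to the components of g; the
  factor 3 counts the components.\<close>

lemma norm_weak_grad_le:
  fixes G g :: "phase \<Rightarrow> real^3" and d :: "3 \<Rightarrow> phase"
  assumes T: "\<And>i. has_weak_derivative_in f (T i) (d i) U" and g: "\<And>i. has_weak_derivative_in f (\<lambda>p. g p $ i) (d i) U"
    and b: "\<And>i. AE p in lborel. p \<in> U \<longrightarrow> \<bar>T i p\<bar> \<le> b p"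
  shows "AE p in lborel. p \<in> U \<longrightarrow> norm (g p) \<le> 3 * b p"
proof -
  have "AE p in lborel. p \<in> U \<longrightarrow> \<bar>g p $ i\<bar> \<le> b p" for i
    using weak_derivative_unique[OF open_U g[of i] T[of i]] b[of i] by eventually_elim auto
  then have "AE p in lborel. \<forall>i. p \<in> U \<longrightarrow> \<bar>g p $ i\<bar> \<le> b p" by (subst AE_all_countable) auto
  then show ?thesis
  proof eventually_elim
    case (elim p)
    show ?case
    proof
      assume p: "p \<in> U"
      have "norm (g p) \<le> (\<Sum>i\<in>UNIV. \<bar>g p $ i\<bar>)" by (rule norm_le_l1_cart)
      also have "\<dots> \<le> (\<Sum>i\<in>(UNIV::3 set). b p)" using elim p by (intro sum_mono) auto
      finally show "norm (g p) \<le> 3 * b p" by simp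
    qed
  qed
qed

end

theorem lemma1p9:
  fixes \<Omega> :: "(real^3) set" and \<alpha> \<gamma> B0 :: real and B :: "real \<Rightarrow> real \<Rightarrow> real"
  assumes "open \<Omega>" and "\<Omega> \<noteq> {}" and "bounded \<Omega>" and "convex \<Omega>"
    and "C2_boundary \<Omega>" and "positive_boundary_curvature \<Omega>"
    and "0 \<le> \<alpha>" and "\<alpha> < 1/2"
    and "0 < B0" and "0 \<le> \<gamma>" and "\<gamma> \<le> 1"
    and "B = (\<lambda>r \<theta>. B0 * r powr \<gamma> * sin \<theta> * cos \<theta>)"
  shows "\<exists>C>0. \<forall>h1\<in>Wt_space \<alpha> \<Omega>. \<forall>h2\<in>Wt_space \<alpha> \<Omega>.
      weakly_differentiable \<Omega> (Gamma_op B h1 h2) \<and>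
      (AE (x, \<zeta>) in lebesgue_on (\<Omega> \<times> UNIV).
         \<bar>Gamma_op B h1 h2 (x, \<zeta>)\<bar>
           \<le> C * enn2real (Linf_norm \<alpha> \<Omega> h1) * enn2real (Linf_norm \<alpha> \<Omega> h2)
               * exp (- \<alpha> * (norm \<zeta>)\<^sup>2) * (1 + norm \<zeta>) powr \<gamma> \<and>
         norm (weak_grad_x \<Omega> (Gamma_op B h1 h2) (x, \<zeta>))
           \<le> C * (infdist x (frontier \<Omega>) powr (-1/2) + inverse (weight \<Omega> x \<zeta>))
               * enn2real (Wt_norm \<alpha> \<Omega> h1) * enn2real (Wt_norm \<alpha> \<Omega> h2)
               * exp (- \<alpha> * (norm \<zeta>)\<^sup>2) * (1 + norm \<zeta>) powr \<gamma> \<and>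
         norm (weak_grad_\<zeta> \<Omega> (Gamma_op B h1 h2) (x, \<zeta>))
           \<le> C * (infdist x (frontier \<Omega>) powr (-1/2) + inverse (weight \<Omega> x \<zeta>))
               * enn2real (Wt_norm \<alpha> \<Omega> h1) * enn2real (Wt_norm \<alpha> \<Omega> h2)
               * exp (- \<alpha> * (norm \<zeta>)\<^sup>2) * (1 + norm \<zeta>) powr \<gamma>)"
proof -
  interpret collision_setting \<Omega> \<alpha> \<gamma> B0 using assms by unfold_locales
  obtain C0 where C0: "0 < C0" "\<And>x \<zeta>. x \<in> \<Omega> \<Longrightarrow> \<zeta> \<noteq> 0 \<Longrightarrow> 0 < weight \<Omega> x \<zeta>"
    "\<And>x \<zeta>. x \<in> \<Omega> \<Longrightarrow> \<zeta> \<noteq> 0 \<Longrightarrow> inverse (weight \<Omega> x \<zeta>) \<le> C0 * D x * (1 + inverse (norm \<zeta>))"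
    unfolding D_def using inverse_weight_bound[OF assms(1-6)] by metis
  obtain c where c: "0 < c" "\<And>x. x \<in> \<Omega> \<Longrightarrow> 1 \<le> c * D x" using D_lower by blast
  obtain Kg where Kg: "0 \<le> Kg" "\<And>\<zeta>. (\<integral>\<^sup>+y. ennreal (kern B0 \<gamma> y) * decay (\<zeta> + fst y) *
      (1 + inv_pow 1 (norm (\<zeta> + shift1 y)) + inv_pow 1 (norm (\<zeta> + shift2 y))) \<partial>lborel) \<le> ennreal (Kg * (1 + norm \<zeta>) powr \<gamma>)"
    using gain_bound by blast
  obtain Kl where Kl: "0 \<le> Kl" "\<And>\<zeta>. (\<integral>\<^sup>+y. ennreal (kern B0 \<gamma> y) * decay (\<zeta> + fst y) *
      (1 + inv_pow 1 (norm (\<zeta> + fst y))) \<partial>lborel) \<le> ennreal (Kl * (1 + norm \<zeta>) powr \<gamma>)"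
    using loss_bound by blast
  \<comment> \<open>Without derivatives there is no pole, and by conservation of energy this one
    integral bounds both gain and loss.\<close>
  have J: "(\<integral>\<^sup>+y. ennreal (kern B0 \<gamma> y) * decay (\<zeta> + fst y) \<partial>lborel) \<le> ennreal (Kl * (1 + norm \<zeta>) powr \<gamma>)" for \<zeta>
  proof (rule order_trans[OF nn_integral_mono Kl(2)])
    fix y :: cparam
    have "ennreal (kern B0 \<gamma> y) * decay (\<zeta> + fst y) * 1 \<le> ennreal (kern B0 \<gamma> y) * decay (\<zeta> + fst y) * (1 + inv_pow 1 (norm (\<zeta> + fst y)))"
      by (intro mult_left_mono) auto
    then show "ennreal (kern B0 \<gamma> y) * decay (\<zeta> + fst y) \<le> ennreal (kern B0 \<gamma> y) * decay (\<zeta> + fst y) * (1 + inv_pow 1 (norm (\<zeta> + fst y)))"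
      by simp
  qed
  define C1 where "C1 = (C0 + 1)\<^sup>2 * (c + 2) * (Kg + Kl)"
  \<comment> \<open>3 C1 serves the gradients, one C1 for each component; 2 Kl serves the bound
    without derivatives, once for gain and once for loss; the summand 1 makes C positive.\<close>
  define C where "C = 3 * C1 + 2 * Kl + 1"
  have C1: "0 \<le> C1" using C0(1) c Kg(1) Kl(1) by (simp add: C1_def)
  then have C: "0 < C" "3 * C1 \<le> C" "2 * Kl \<le> C" using Kl(1) by (auto simp: C_def)
  have UU: "\<Omega> \<times> UNIV = U" by (simp add: U_def)
  have S0: "(\<lambda>_. 0) \<in> borel_measurable (borel :: cparam measure)" "fst \<in> borel_measurable (borel :: cparam measure)"
    by (simp, intro borel_measurable_continuous_onI continuous_intros)
  have AE_loss: "AE y in lborel. energy_shifts (\<lambda>_. 0) fst y" using energy_shifts_loss by simp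
  show ?thesis
  proof (intro exI[of _ C] conjI ballI C(1))
    fix h1 h2 assume h: "h1 \<in> Wt_space \<alpha> \<Omega>" "h2 \<in> Wt_space \<alpha> \<Omega>"
    define A1 A2 W1 W2 where "A1 = enn2real (Linf_norm \<alpha> \<Omega> h1)" and "A2 = enn2real (Linf_norm \<alpha> \<Omega> h2)"
      and "W1 = enn2real (Wt_norm \<alpha> \<Omega> h1)" and "W2 = enn2real (Wt_norm \<alpha> \<Omega> h2)"
    have AW0: "0 \<le> A1" "0 \<le> A2" "0 \<le> W1" "0 \<le> W2" by (auto simp: A1_def A2_def W1_def W2_def)
    obtain k1 where a1: "admissible C0 A1 W1 h1 k1"
      using Wt_space_representative[OF C0 h(1)] unfolding A1_def W1_def by blast
    obtain k2 where a2: "admissible C0 A2 W2 h2 k2"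
      using Wt_space_representative[OF C0 h(2)] unfolding A2_def W2_def by blast
    have k: "dominated A1 k1" "dominated A2 k2" and hk: "AE p in lborel. p \<in> U \<longrightarrow> h1 p = k1 p" "AE p in lborel. p \<in> U \<longrightarrow> h2 p = k2 p"
      using a1 a2 by (auto simp: admissible_def)
    let ?G = "Gamma_op B h1 h2"
    let ?b = "\<lambda>p. C1 * (D (fst p) + inverse (weight \<Omega> (fst p) (snd p))) * W1 * W2 * gauss (snd p) * (1 + norm (snd p)) powr \<gamma>"
    note rep = Gamma_op_representation[OF assms(12) k AW0(1,2) hk Kl(1) J]
    have "\<forall>e\<in>coordinate_directions. \<exists>T. has_weak_derivative_in ?G T e U \<and> (AE p in lborel. p \<in> U \<longrightarrow> \<bar>T p\<bar> \<le> ?b p)"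
    proof
      fix e assume e: "e \<in> coordinate_directions"
      show "\<exists>T. has_weak_derivative_in ?G T e U \<and> (AE p in lborel. p \<in> U \<longrightarrow> \<bar>T p\<bar> \<le> ?b p)"
        unfolding C1_def
        by (rule weak_derivative_Gamma_op[OF assms(12) C0(1,2) a1 a2 e c Kg(1) Kl(1) Kg(2) Kl(2) rep])
    qed
    from bchoice[OF this] obtain T
      where "\<forall>e\<in>coordinate_directions. has_weak_derivative_in ?G (T e) e U \<and> (AE p in lborel. p \<in> U \<longrightarrow> \<bar>T e p\<bar> \<le> ?b p)" ..
    then have T: "\<And>e. e \<in> coordinate_directions \<Longrightarrow> has_weak_derivative_in ?G (T e) e U"
      "\<And>e. e \<in> coordinate_directions \<Longrightarrow> AE p in lborel. p \<in> U \<longrightarrow> \<bar>T e p\<bar> \<le> ?b p" by simp_all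
    have dirs: "(axis i 1, 0) \<in> coordinate_directions" "(0, axis i 1) \<in> coordinate_directions" for i by (auto simp: coordinate_directions_def)
    have "has_weak_grad_x \<Omega> ?G (\<lambda>p. \<chi> i. T (axis i 1, 0) p)" "has_weak_grad_\<zeta> \<Omega> ?G (\<lambda>p. \<chi> i. T (0, axis i 1) p)"
      using T(1) dirs by (auto simp: has_weak_grad_x_def has_weak_grad_\<zeta>_def UU)
    then show wd: "weakly_differentiable \<Omega> ?G" unfolding weakly_differentiable_def by blast
    \<comment> \<open>The chosen gradients satisfy the weak identity only now that weak
      differentiability is known; the bounds for T are transferred to them.\<close>
    note g = has_weak_grad_SOME[OF wd, unfolded has_weak_grad_x_def has_weak_grad_\<zeta>_def UU, rule_format]
    have gx: "AE p in lborel. p \<in> U \<longrightarrow> norm (weak_grad_x \<Omega> ?G p) \<le> 3 * ?b p"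
      by (rule norm_weak_grad_le[OF T(1)[OF dirs(1)] g(1) T(2)[OF dirs(1)]])
    have gz: "AE p in lborel. p \<in> U \<longrightarrow> norm (weak_grad_\<zeta> \<Omega> ?G p) \<le> 3 * ?b p"
      by (rule norm_weak_grad_le[OF T(1)[OF dirs(2)] g(2) T(2)[OF dirs(2)]])
    show "AE (x, \<zeta>) in lebesgue_on (\<Omega> \<times> UNIV).
         \<bar>Gamma_op B h1 h2 (x, \<zeta>)\<bar>
           \<le> C * enn2real (Linf_norm \<alpha> \<Omega> h1) * enn2real (Linf_norm \<alpha> \<Omega> h2)
               * exp (- \<alpha> * (norm \<zeta>)\<^sup>2) * (1 + norm \<zeta>) powr \<gamma> \<and>
         norm (weak_grad_x \<Omega> (Gamma_op B h1 h2) (x, \<zeta>))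
           \<le> C * (infdist x (frontier \<Omega>) powr (-1/2) + inverse (weight \<Omega> x \<zeta>))
               * enn2real (Wt_norm \<alpha> \<Omega> h1) * enn2real (Wt_norm \<alpha> \<Omega> h2)
               * exp (- \<alpha> * (norm \<zeta>)\<^sup>2) * (1 + norm \<zeta>) powr \<gamma> \<and>
         norm (weak_grad_\<zeta> \<Omega> (Gamma_op B h1 h2) (x, \<zeta>))
           \<le> C * (infdist x (frontier \<Omega>) powr (-1/2) + inverse (weight \<Omega> x \<zeta>))
               * enn2real (Wt_norm \<alpha> \<Omega> h1) * enn2real (Wt_norm \<alpha> \<Omega> h2)
               * exp (- \<alpha> * (norm \<zeta>)\<^sup>2) * (1 + norm \<zeta>) powr \<gamma>"
      unfolding UU AE_lebesgue_on_iff[OF open_U]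
      using rep gx gz AE_pair_nonzero(1)
    proof eventually_elim
      case (elim p)
      obtain x \<zeta> where p: "p = (x, \<zeta>)" by (cases p)
      show ?case unfolding p prod.case
      proof (intro impI)
        assume "(x, \<zeta>) \<in> U"
        then have x: "x \<in> \<Omega>" and pU: "p \<in> U" by (auto simp: U_iff p)
        have P: "0 \<le> (1 + norm \<zeta>) powr \<gamma>" by simp
        \<comment> \<open>The weight is positive off the null set of vanishing velocities.\<close>
        have I: "0 \<le> inverse (weight \<Omega> x \<zeta>)" using C0(2)[OF x, of \<zeta>] elim(4) p by simp
        let ?t = "(D x + inverse (weight \<Omega> x \<zeta>)) * W1 * W2 * gauss \<zeta> * (1 + norm \<zeta>) powr \<gamma>"
        have t: "0 \<le> ?t" using I D_nonneg AW0 gauss_bounds by (intro mult_nonneg_nonneg add_nonneg_nonneg) auto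
        have b: "3 * ?b p \<le> C * ?t" using mult_right_mono[OF C(2) t] by (simp add: p mult.assoc)
        have "\<bar>?G p\<bar> \<le> A1 * A2 * gauss \<zeta> * (Kl * (1 + norm \<zeta>) powr \<gamma>) + A1 * A2 * gauss \<zeta> * (Kl * (1 + norm \<zeta>) powr \<gamma>)"
          unfolding elim(1)[rule_format, OF pU]
          using order_trans[OF abs_triangle_ineq4 add_mono[OF coll_half_integral(2)[OF k AW0(1,2) measurable_kern(2,3) energy_shifts_gain Kl(1) J]
            coll_half_integral(2)[OF k AW0(1,2) S0 AE_loss Kl(1) J]], of p p] by (simp only: p snd_conv)
        also have "\<dots> = 2 * Kl * (A1 * A2 * gauss \<zeta> * (1 + norm \<zeta>) powr \<gamma>)" by simp
        also have "\<dots> \<le> C * (A1 * A2 * gauss \<zeta> * (1 + norm \<zeta>) powr \<gamma>)"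
          using AW0 gauss_bounds by (intro mult_right_mono C(3) mult_nonneg_nonneg) auto
        finally have 1: "\<bar>?G (x, \<zeta>)\<bar> \<le> C * (A1 * A2 * gauss \<zeta> * (1 + norm \<zeta>) powr \<gamma>)" by (simp add: p)
        have 2: "norm (weak_grad_x \<Omega> ?G (x, \<zeta>)) \<le> C * ?t" "norm (weak_grad_\<zeta> \<Omega> ?G (x, \<zeta>)) \<le> C * ?t"
          using elim(2,3) pU b unfolding p by (auto intro: order_trans)
        show "\<bar>Gamma_op B h1 h2 (x, \<zeta>)\<bar>
           \<le> C * enn2real (Linf_norm \<alpha> \<Omega> h1) * enn2real (Linf_norm \<alpha> \<Omega> h2)
               * exp (- \<alpha> * (norm \<zeta>)\<^sup>2) * (1 + norm \<zeta>) powr \<gamma> \<and>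
         norm (weak_grad_x \<Omega> (Gamma_op B h1 h2) (x, \<zeta>))
           \<le> C * (infdist x (frontier \<Omega>) powr (-1/2) + inverse (weight \<Omega> x \<zeta>))
               * enn2real (Wt_norm \<alpha> \<Omega> h1) * enn2real (Wt_norm \<alpha> \<Omega> h2)
               * exp (- \<alpha> * (norm \<zeta>)\<^sup>2) * (1 + norm \<zeta>) powr \<gamma> \<and>
         norm (weak_grad_\<zeta> \<Omega> (Gamma_op B h1 h2) (x, \<zeta>))
           \<le> C * (infdist x (frontier \<Omega>) powr (-1/2) + inverse (weight \<Omega> x \<zeta>))
               * enn2real (Wt_norm \<alpha> \<Omega> h1) * enn2real (Wt_norm \<alpha> \<Omega> h2)
               * exp (- \<alpha> * (norm \<zeta>)\<^sup>2) * (1 + norm \<zeta>) powr \<gamma>"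
          using 1 2 by (simp only: D_def gauss_def A1_def A2_def W1_def W2_def mult.assoc simp_thms)
      qed
    qed
  qed
qed

end
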